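(* Let $0<s<s'<1/2$. The mollified interpolator (smoothed projector) $\Pi_h$ is stable $\mathrm H^{s'}(S)\to\mathrm H^{s}(S)$, uniformly in $h$: there is a constant $M$ such that for all $h$ and all $u\in\mathrm H^{s'}\mathrm{Alt}^\bullet(S)$, $$\|\Pi_hu\|_{\mathrm H^s(S)}\le M\,\|u\|_{\mathrm H^{s'}(S)} .$$
   Context: Domain: $S=\mathbb R^n/\mathbb L$, $\mathbb L=\sum_{i=1}^n\mathbb Z e_i$ for a basis $(e_i)$ of $\mathbb R^n$, with the flat Euclidean metric. $O=\mathrm L^2\mathrm{Alt}^\bullet(S)$ is the space of $\mathrm L^2$ differential forms of all degrees, with norm $|\cdot|$; $\mathrm d$ is the exterior derivative; $X=\{u\in O:\mathrm d u\in O\}$. Meshes: $(\mathcal T_h)$ is a sequence of cellular complexes on $S$, indexed by $h>0$ with $h\to0$, where $h$ is the largest diameter of a cell of $\mathcal T_h$. It is quasi-uniform: each $\mathcal T_h$ has a simplicial refinement, these refinements being quasi-uniform in the usual sense (uniformly shape-regular simplices with diameters uniformly comparable to $h$), and each cell of $\mathcal T_h$ is composed of a uniformly bounded number of simplices. Finite element spaces: for each $h$, $X_h=\bigoplus_{k=0}^n X_h^k\subset X$ is the space of a finite element system on $\mathcal T_h$: to each cell $T$ (of any dimension) and each $k$ is attached a finite dimensional space $X^k(T)$ of $k$-forms on $T$, smooth up to the boundary, such that $\mathrm d X^k(T)\subset X^{k+1}(T)$ and pullback to a subcell $T'\subset T$ maps $X^k(T)$ into $X^k(T')$; $X_h^k$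 consists of the $k$-forms on $S$ having, on every cell $T$, a single-valued pullback belonging to $X^k(T)$. The system is compatible: for each $T$ the sequence $0\to\mathbb R\to X^0(T)\to\cdots\to X^{\dim T}(T)\to0$ (with maps $\mathrm d$) is exact, and any family of elements of the $X^k(T')$, $T'$ ranging over proper subcells of $T$, compatible under pullback, extends to an element of $X^k(T)$. In the $h$-setting: after scaling by $h^{-1}$, the macro-elements (unions of cells touching a given cell) with their local spaces range in a compact family (finitely many combinatorial types, uniformly bounded dimensions). The local spaces contain the polynomial forms of degree up to a fixed integer $p\ge0$. Mollified interpolator: $\phi$ is a smooth function on $\mathbb R^n$ supported in the unit ball, with integral $1$, such that $\int\phi(-x)q(x)\,\mathrm dx=q(0)$ for all polynomials $q$ of degree up to $p$; $\phi_\epsilon(x)=\epsilon^{-n}\phi(\epsilon^{-1}x)$. $I_h$ is an interpolator onto $X_h$ deduced from degrees of freedom, defined on smooth forms: a projection commuting with $\mathrm d$, local to cells, and uniformly bounded after scaling with respect to some $C^m$ norm. Let $Q_h:O\to X_h$, $Q_hu=I_h(\phi_{\epsilon h}\ast u)$. For $\epsilon>0$ fixed small enough (depending only on the family of meshes and spaces, $I_h$ and $\phi$), $Q_h$ restricts to an isomorphism $X_h\to X_h$ and $\Pi_h=(Q_h|_{X_h})^{-1}Q_h:O\to X_h$, a projector that is uniformly bounded $O\to O$ and commutes with $\mathrm d$ on $X$. Such a sufficiently small $\epsilon$ is fixed. *)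

theory Defs
  imports "HOL-Analysis.Analysis"
begin

section \<open>Alternating forms and smooth differential forms\<close>

text \<open>
  The exterior algebra of \<open>\<real>\<^sup>n\<close> is \<open>(real, 'n set) vec\<close>: the component at \<open>I\<close> is the coefficient of
  \<open>dx\<^sub>I = dx\<^bsub>i1\<^esub> \<and> \<dots> \<and> dx\<^bsub>ik\<^esub>\<close>, \<open>I = {i1 < \<dots> < ik}\<close>, so that the Euclidean norm of this type is the
  usual norm of alternating forms.  The order on \<open>'n\<close> only serves to fix these signs.  A
  differential form on the torus is a periodic map on \<open>\<real>\<^sup>n\<close>.
\<close>

type_synonym 'n point = "(real, 'n) vec"
type_synonym 'n form = "'n point \<Rightarrow> (real, 'n set) vec"

definition insert_sign :: "'n::{finite,linorder} \<Rightarrow> 'n set \<Rightarrow> real" where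
  "insert_sign i I = (- 1) ^ card {j \<in> I. j < i}"

text \<open>\<open>(\<Sum>\<^sub>i v\<^sub>i dx\<^sub>i) \<and> a\<close> and the interior product of \<open>a\<close> with \<open>v\<close>.\<close>

definition wedge1 :: "'n point \<Rightarrow> (real, 'n set) vec \<Rightarrow> (real, 'n::{finite,linorder} set) vec" where
  "wedge1 v a = (\<chi> J. \<Sum>i\<in>J. insert_sign i J * v $ i * a $ (J - {i}))"

definition contract :: "'n point \<Rightarrow> (real, 'n set) vec \<Rightarrow> (real, 'n::{finite,linorder} set) vec" where
  "contract v a = (\<chi> I. \<Sum>i\<in>- I. insert_sign i I * v $ i * a $ (insert i I))"

text \<open>\<open>eval_alt a [v1, \<dots>, vk]\<close> is the value at \<open>(v1, \<dots>, vk)\<close> of the degree \<open>k\<close> part of \<open>a\<close>.\<close>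

fun eval_alt :: "(real, 'n::{finite,linorder} set) vec \<Rightarrow> 'n point list \<Rightarrow> real" where
  "eval_alt a [] = a $ {}"
| "eval_alt a (v # vs) = eval_alt (contract v a) vs"

definition partial :: "'n \<Rightarrow> ('n::finite point \<Rightarrow> 'b::real_normed_vector) \<Rightarrow> 'n point \<Rightarrow> 'b" where
  "partial i f x = frechet_derivative f (at x) (axis i 1)"

definition partials :: "'n list \<Rightarrow> ('n::finite point \<Rightarrow> 'b::real_normed_vector) \<Rightarrow> 'n point \<Rightarrow> 'b" where
  "partials is f = foldr partial is f"

definition smooth :: "('n::finite point \<Rightarrow> 'b::real_normed_vector) \<Rightarrow> bool" where
  "smooth f \<longleftrightarrow> (\<forall>is x. partials is f differentiable (at x))"

definition ext_d :: "'n::{finite,linorder} form \<Rightarrow> 'n form" where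
  "ext_d U x = (\<Sum>i\<in>UNIV. wedge1 (axis i 1) (partial i U x))"

definition degree_part :: "nat \<Rightarrow> 'n::finite form \<Rightarrow> 'n form" where
  "degree_part k U x = (\<chi> I. if card I = k then U x $ I else 0)"

definition k_form :: "nat \<Rightarrow> 'n::finite form \<Rightarrow> bool" where
  "k_form k U \<longleftrightarrow> degree_part k U = U"

definition poly_map :: "nat \<Rightarrow> ('n::finite point \<Rightarrow> 'b::real_vector) \<Rightarrow> bool" where
  "poly_map p q \<longleftrightarrow>
     (\<exists>c. q = (\<lambda>x. \<Sum>\<alpha> | (\<Sum>i\<in>UNIV. \<alpha> i) \<le> p. (\<Prod>i\<in>UNIV. (x $ i) ^ \<alpha> i) *\<^sub>R c (\<alpha> :: 'n \<Rightarrow> nat)))"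


section \<open>The flat torus and its function spaces\<close>

definition lattice_points :: "('n::finite \<Rightarrow> 'n point) \<Rightarrow> 'n point set" where
  "lattice_points e = {\<Sum>i\<in>UNIV. of_int (z i) *\<^sub>R e i | z :: 'n \<Rightarrow> int. True}"

definition fundamental_domain :: "('n::finite \<Rightarrow> 'n point) \<Rightarrow> 'n point set" where
  "fundamental_domain e = {\<Sum>i\<in>UNIV. t i *\<^sub>R e i | t. \<forall>i. 0 \<le> t i \<and> t i < 1}"

definition torus_dist :: "('n::finite \<Rightarrow> 'n point) \<Rightarrow> 'n point \<Rightarrow> 'n point \<Rightarrow> real" where
  "torus_dist e x y = (INF l\<in>lattice_points e. dist x (y + l))"

definition periodic :: "('n::finite \<Rightarrow> 'n point) \<Rightarrow> ('n point \<Rightarrow> 'b) \<Rightarrow> bool" where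
  "periodic e f \<longleftrightarrow> (\<forall>l\<in>lattice_points e. \<forall>x. f (x + l) = f x)"

definition L2_forms :: "('n::finite \<Rightarrow> 'n point) \<Rightarrow> 'n form set" where
  "L2_forms e = {u. periodic e u \<and> u \<in> borel_measurable borel \<and>
     set_integrable lborel (fundamental_domain e) (\<lambda>x. (norm (u x))\<^sup>2)}"

definition L2_form_norm :: "('n::finite \<Rightarrow> 'n point) \<Rightarrow> 'n form \<Rightarrow> real" where
  "L2_form_norm e u = sqrt (LINT x:fundamental_domain e|lborel. (norm (u x))\<^sup>2)"

text \<open>
  \<open>w = d u\<close> in the sense of distributions, both being square integrable: for test functions
  \<open>\<eta>\<close> on the torus, \<open>\<integral> \<eta> w = - \<integral> d\<eta> \<and> u\<close>, in each component.
\<close>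

definition weak_d :: "('n::{finite,linorder} \<Rightarrow> 'n point) \<Rightarrow> 'n form \<Rightarrow> 'n form \<Rightarrow> bool" where
  "weak_d e u w \<longleftrightarrow> u \<in> L2_forms e \<and> w \<in> L2_forms e \<and>
     (\<forall>\<eta> :: 'n point \<Rightarrow> real. smooth \<eta> \<longrightarrow> periodic e \<eta> \<longrightarrow>
        (LINT x:fundamental_domain e|lborel. \<eta> x *\<^sub>R w x) =
        - (LINT x:fundamental_domain e|lborel. wedge1 (\<chi> i. partial i \<eta> x) (u x)))"

definition X_space :: "('n::{finite,linorder} \<Rightarrow> 'n point) \<Rightarrow> 'n form set" where
  "X_space e = {u. \<exists>w. weak_d e u w}"

text \<open>\<open>H\<^sup>s\<close> for \<open>0 < s < 1\<close>, with the Sobolev--Slobodetskii norm for the distance of the torus.\<close>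

definition Hs_seminorm_sq :: "('n::finite \<Rightarrow> 'n point) \<Rightarrow> real \<Rightarrow> 'n form \<Rightarrow> ennreal" where
  "Hs_seminorm_sq e s u =
     (\<integral>\<^sup>+x\<in>fundamental_domain e. (\<integral>\<^sup>+y\<in>fundamental_domain e.
        ennreal ((norm (u x - u y))\<^sup>2 / torus_dist e x y powr (real CARD('n) + 2 * s)) \<partial>lborel) \<partial>lborel)"

definition Hs_forms :: "('n::finite \<Rightarrow> 'n point) \<Rightarrow> real \<Rightarrow> 'n form set" where
  "Hs_forms e s = {u \<in> L2_forms e. Hs_seminorm_sq e s u < \<infinity>}"

definition Hs_norm :: "('n::finite \<Rightarrow> 'n point) \<Rightarrow> real \<Rightarrow> 'n form \<Rightarrow> real" where
  "Hs_norm e s u = sqrt ((L2_form_norm e u)\<^sup>2 + enn2real (Hs_seminorm_sq e s u))"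


section \<open>Cellular complexes\<close>

text \<open>
  A \<open>k\<close>-cell with boundary \<open>B\<close> is a bi-Lipschitz image of the closed unit ball of dimension \<open>k\<close>,
  \<open>B\<close> being the image of the unit sphere.  By invariance of domain \<open>k\<close> and \<open>B\<close> are determined by \<open>T\<close>.
\<close>

definition is_cell :: "nat \<Rightarrow> 'n::finite point set \<Rightarrow> 'n point set \<Rightarrow> bool" where
  "is_cell k T B \<longleftrightarrow> (\<exists>(V :: 'n point set) f C. subspace V \<and> dim V = k \<and>
     bij_betw f (V \<inter> cball 0 1) T \<and>
     C-lipschitz_on (V \<inter> cball 0 1) f \<and>
     C-lipschitz_on T (inv_into (V \<inter> cball 0 1) f) \<and>
     B = f ` (V \<inter> sphere 0 1))"

definition cell_dim :: "'n::finite point set \<Rightarrow> nat" where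
  "cell_dim T = (THE k. \<exists>B. is_cell k T B)"

definition cell_boundary :: "'n::finite point set \<Rightarrow> 'n point set" where
  "cell_boundary T = (THE B. \<exists>k. is_cell k T B)"

definition cell_interior :: "'n::finite point set \<Rightarrow> 'n point set" where
  "cell_interior T = T - cell_boundary T"

definition cell_family :: "'n::finite point set set \<Rightarrow> bool" where
  "cell_family \<T> \<longleftrightarrow>
     (\<forall>T\<in>\<T>. \<exists>k B. is_cell k T B) \<and>
     (\<forall>T\<in>\<T>. \<forall>T'\<in>\<T>. T \<noteq> T' \<longrightarrow> cell_interior T \<inter> cell_interior T' = {}) \<and>
     (\<forall>T\<in>\<T>. \<exists>\<C>\<subseteq>\<T>. cell_boundary T = \<Union>\<C>)"

definition finite_mod_lattice :: "('n::finite \<Rightarrow> 'n point) \<Rightarrow> 'n point set set \<Rightarrow> bool" where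
  "finite_mod_lattice e \<C> \<longleftrightarrow>
     (\<forall>C\<in>\<C>. \<forall>l\<in>lattice_points e. (+) l ` C \<in> \<C>) \<and>
     (\<exists>F\<subseteq>\<C>. finite F \<and> (\<forall>C\<in>\<C>. \<exists>C'\<in>F. \<exists>l\<in>lattice_points e. C = (+) l ` C'))"

text \<open>
  A cellular complex on the torus, described by all the lifts of its cells to \<open>\<real>\<^sup>n\<close> (cells are simply
  connected).  The disjointness from nontrivial translates says that a lift is mapped bijectively
  onto the cell of the torus.
\<close>

definition torus_complex :: "('n::finite \<Rightarrow> 'n point) \<Rightarrow> 'n point set set \<Rightarrow> bool" where
  "torus_complex e \<T> \<longleftrightarrow> cell_family \<T> \<and> finite_mod_lattice e \<T> \<and> \<Union>\<T> = UNIV \<and>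
     (\<forall>T\<in>\<T>. \<forall>l\<in>lattice_points e. l \<noteq> 0 \<longrightarrow> T \<inter> (+) l ` T = {})"

definition mesh_size :: "('n::finite \<Rightarrow> 'n point) \<Rightarrow> 'n point set set \<Rightarrow> real" where
  "mesh_size e \<T> = (SUP T\<in>\<T>. SUP (x, y)\<in>T \<times> T. torus_dist e x y)"

definition simplicial_refinement ::
    "('n::finite \<Rightarrow> 'n point) \<Rightarrow> 'n point set set \<Rightarrow> 'n point set set \<Rightarrow> bool" where
  "simplicial_refinement e \<T> \<S> \<longleftrightarrow>
     finite_mod_lattice e \<S> \<and> \<Union>\<S> = UNIV \<and>
     (\<forall>\<sigma>\<in>\<S>. \<exists>d. d simplex \<sigma>) \<and>
     (\<forall>\<sigma>\<in>\<S>. \<forall>F. F face_of \<sigma> \<longrightarrow> F \<in> \<S>) \<and>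
     (\<forall>\<sigma>\<in>\<S>. \<forall>\<tau>\<in>\<S>. (\<sigma> \<inter> \<tau>) face_of \<sigma>) \<and>
     (\<forall>T\<in>\<T>. T = \<Union>{\<sigma>\<in>\<S>. \<sigma> \<subseteq> T})"

definition quasi_uniform ::
    "('n::finite \<Rightarrow> 'n point) \<Rightarrow> (nat \<Rightarrow> real) \<Rightarrow> (nat \<Rightarrow> 'n point set set) \<Rightarrow> bool" where
  "quasi_uniform e h \<T> \<longleftrightarrow> (\<exists>\<S> \<kappa> N. \<kappa> > 0 \<and> (\<forall>j.
     simplicial_refinement e (\<T> j) (\<S> j) \<and>
     (\<forall>\<sigma>\<in>\<S> j. int CARD('n) simplex \<sigma> \<longrightarrow>
        h j / \<kappa> \<le> diameter \<sigma> \<and> diameter \<sigma> \<le> \<kappa> * h j \<and>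
        (\<exists>x. cball x (diameter \<sigma> / \<kappa>) \<subseteq> \<sigma>)) \<and>
     (\<forall>T\<in>\<T> j. finite {\<sigma>\<in>\<S> j. \<sigma> \<subseteq> T} \<and> card {\<sigma>\<in>\<S> j. \<sigma> \<subseteq> T} \<le> N)))"


section \<open>Finite element systems\<close>

text \<open>
  The cells considered are polyhedral.  \<open>flat_at T x V\<close>: near \<open>x\<close>, the cell \<open>T\<close> is a piece of
  \<open>x + V\<close>, so \<open>V\<close> is its tangent space.  Such points are dense in \<open>T\<close>.
\<close>

definition flat_at :: "'n::finite point set \<Rightarrow> 'n point \<Rightarrow> 'n point set \<Rightarrow> bool" where
  "flat_at T x V \<longleftrightarrow> subspace V \<and> (\<exists>r>0. T \<inter> ball x r = (+) x ` V \<inter> ball x r)"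

definition same_pullback :: "'n point set \<Rightarrow> 'n::{finite,linorder} form \<Rightarrow> 'n form \<Rightarrow> bool" where
  "same_pullback T U W \<longleftrightarrow>
     (\<forall>x V vs. flat_at T x V \<longrightarrow> set vs \<subseteq> V \<longrightarrow> eval_alt (U x) vs = eval_alt (W x) vs)"

text \<open>
  A form on \<open>T\<close>, smooth up to the boundary, is the pullback to \<open>T\<close> of a smooth form on \<open>\<real>\<^sup>n\<close>.  The
  space \<open>X\<^sup>k(T)\<close> is given by the set \<open>X T k\<close> of \<^emph>\<open>all\<close> smooth \<open>k\<close>-forms on \<open>\<real>\<^sup>n\<close> whose pullback to
  \<open>T\<close> belongs to it; algebraic statements about \<open>X\<^sup>k(T)\<close> are statements about \<open>X T k\<close> modulo
  \<open>same_pullback T\<close>.  Pullback to a subcell is then the identity on representatives, and the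
  condition that it maps \<open>X\<^sup>k(T)\<close> into \<open>X\<^sup>k(T')\<close> reads \<open>X T k \<subseteq> X T' k\<close>.
\<close>

type_synonym 'n element_system = "'n point set \<Rightarrow> nat \<Rightarrow> 'n form set"

definition finite_element_system ::
    "'n point set set \<Rightarrow> 'n::{finite,linorder} element_system \<Rightarrow> bool" where
  "finite_element_system \<T> X \<longleftrightarrow> (\<forall>T\<in>\<T>. \<forall>k\<le>CARD('n).
     (\<forall>U\<in>X T k. smooth U \<and> k_form k U) \<and>
     (\<forall>U\<in>X T k. \<forall>W. smooth W \<longrightarrow> k_form k W \<longrightarrow> same_pullback T U W \<longrightarrow> W \<in> X T k) \<and>
     (\<lambda>x. 0) \<in> X T k \<and>
     (\<forall>U\<in>X T k. \<forall>W\<in>X T k. \<forall>a b. (\<lambda>x. a *\<^sub>R U x + b *\<^sub>R W x) \<in> X T k) \<and>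
     (\<exists>B\<subseteq>X T k. finite B \<and>
        (\<forall>U\<in>X T k. \<exists>c. same_pullback T U (\<lambda>x. \<Sum>b\<in>B. c b *\<^sub>R b x))) \<and>
     (k < CARD('n) \<longrightarrow> (\<forall>U\<in>X T k. ext_d U \<in> X T (Suc k))) \<and>
     (\<forall>T'\<in>\<T>. T' \<subseteq> T \<longrightarrow> X T k \<subseteq> X T' k))"

definition exact_on_cell :: "'n point set \<Rightarrow> 'n::{finite,linorder} element_system \<Rightarrow> bool" where
  "exact_on_cell T X \<longleftrightarrow>
     (\<forall>c. (\<lambda>x. \<chi> I. if I = {} then c else 0) \<in> X T 0) \<and>
     (\<forall>U\<in>X T 0. same_pullback T (ext_d U) (\<lambda>x. 0) \<longrightarrow>
        (\<exists>c. same_pullback T U (\<lambda>x. \<chi> I. if I = {} then c else 0))) \<and>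
     (\<forall>k<cell_dim T. \<forall>U\<in>X T (Suc k). same_pullback T (ext_d U) (\<lambda>x. 0) \<longrightarrow>
        (\<exists>W\<in>X T k. same_pullback T (ext_d W) U))"

definition admits_extensions ::
    "'n point set set \<Rightarrow> 'n point set \<Rightarrow> 'n::{finite,linorder} element_system \<Rightarrow> bool" where
  "admits_extensions \<T> T X \<longleftrightarrow> (\<forall>k\<le>CARD('n). \<forall>W.
     (\<forall>T'\<in>\<T>. T' \<subset> T \<longrightarrow> W T' \<in> X T' k) \<longrightarrow>
     (\<forall>T'\<in>\<T>. \<forall>T''\<in>\<T>. T' \<subset> T \<longrightarrow> T'' \<subseteq> T' \<longrightarrow> same_pullback T'' (W T') (W T'')) \<longrightarrow>
     (\<exists>U\<in>X T k. \<forall>T'\<in>\<T>. T' \<subset> T \<longrightarrow> same_pullback T' U (W T')))"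

definition compatible_system ::
    "'n point set set \<Rightarrow> 'n::{finite,linorder} element_system \<Rightarrow> bool" where
  "compatible_system \<T> X \<longleftrightarrow> finite_element_system \<T> X \<and>
     (\<forall>T\<in>\<T>. exact_on_cell T X \<and> admits_extensions \<T> T X)"

definition periodic_system ::
    "('n \<Rightarrow> 'n point) \<Rightarrow> 'n point set set \<Rightarrow> 'n::{finite,linorder} element_system \<Rightarrow> bool" where
  "periodic_system e \<T> X \<longleftrightarrow> (\<forall>T\<in>\<T>. \<forall>k\<le>CARD('n). \<forall>l\<in>lattice_points e. \<forall>U\<in>X T k.
     (\<lambda>x. U (x - l)) \<in> X ((+) l ` T) k)"

definition contains_polynomials ::
    "nat \<Rightarrow> 'n point set set \<Rightarrow> 'n::{finite,linorder} element_system \<Rightarrow> bool" where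
  "contains_polynomials p \<T> X \<longleftrightarrow>
     (\<forall>T\<in>\<T>. \<forall>k\<le>CARD('n). \<forall>U. poly_map p U \<longrightarrow> k_form k U \<longrightarrow> U \<in> X T k)"

text \<open>\<open>u\<close> is smooth on each cell, with single-valued pullbacks, represented by \<open>W\<close>.\<close>

definition has_traces ::
    "'n point set set \<Rightarrow> nat \<Rightarrow> 'n::{finite,linorder} form \<Rightarrow> ('n point set \<Rightarrow> 'n form) \<Rightarrow> bool" where
  "has_traces \<T> k u W \<longleftrightarrow>
     (\<forall>T\<in>\<T>. smooth (W T) \<and> k_form k (W T)) \<and>
     (\<forall>T\<in>\<T>. \<forall>T'\<in>\<T>. T' \<subseteq> T \<longrightarrow> same_pullback T' (W T) (W T')) \<and>
     (\<forall>T\<in>\<T>. cell_dim T = CARD('n) \<longrightarrow> (\<forall>x\<in>cell_interior T. u x = W T x))"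

text \<open>
  Each element of \<open>X\<^sub>h\<close>, which is an almost everywhere class, is represented by its unique member
  that is smooth inside the \<open>n\<close>-cells and vanishes on the negligible union of the other cells.
\<close>

definition fe_space_deg ::
    "('n \<Rightarrow> 'n point) \<Rightarrow> 'n point set set \<Rightarrow> 'n::{finite,linorder} element_system \<Rightarrow> nat \<Rightarrow> 'n form set" where
  "fe_space_deg e \<T> X k = {u. periodic e u \<and>
     (\<forall>x. (\<forall>T\<in>\<T>. cell_dim T = CARD('n) \<longrightarrow> x \<notin> cell_interior T) \<longrightarrow> u x = 0) \<and>
     (\<exists>W. has_traces \<T> k u W \<and> (\<forall>T\<in>\<T>. W T \<in> X T k))}"

definition fe_space ::
    "('n \<Rightarrow> 'n point) \<Rightarrow> 'n point set set \<Rightarrow> 'n::{finite,linorder} element_system \<Rightarrow> 'n form set" where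
  "fe_space e \<T> X = {u. \<forall>k\<le>CARD('n). degree_part k u \<in> fe_space_deg e \<T> X k}"


section \<open>Compactness of the scaled macro-elements\<close>

text \<open>A macro-element: the cells touching \<open>T\<close>, with all their subcells, and the local spaces.\<close>

type_synonym 'n macro_element = "'n point set set \<times> 'n element_system"

definition macro_cells :: "'n::finite point set set \<Rightarrow> 'n point set \<Rightarrow> 'n point set set" where
  "macro_cells \<T> T = {C\<in>\<T>. \<exists>C'\<in>\<T>. C' \<inter> T \<noteq> {} \<and> C \<subseteq> C'}"

text \<open>
  Image of a macro-element under \<open>x \<mapsto> (x - a) / h\<close>.  The factor \<open>h ^ k\<close> in the pullback of
  \<open>k\<close>-forms does not change the spaces and is left out.
\<close>

definition scaled_macro ::
    "'n point \<Rightarrow> real \<Rightarrow> 'n::{finite,linorder} macro_element \<Rightarrow> 'n macro_element" where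
  "scaled_macro a h D =
     ((\<lambda>C. (\<lambda>x. (x - a) /\<^sub>R h) ` C) ` fst D,
      \<lambda>C k. (\<lambda>U x. U (a + h *\<^sub>R x)) ` snd D ((\<lambda>x. a + h *\<^sub>R x) ` C) k)"

definition basis_on_cell ::
    "'n point set \<Rightarrow> 'n::{finite,linorder} form set \<Rightarrow> nat \<Rightarrow> (nat \<Rightarrow> 'n form) \<Rightarrow> bool" where
  "basis_on_cell T A r b \<longleftrightarrow> (\<forall>l<r. b l \<in> A) \<and>
     (\<forall>U\<in>A. \<exists>c. same_pullback T U (\<lambda>x. \<Sum>l<r. c l *\<^sub>R b l x)) \<and>
     (\<forall>c. same_pullback T (\<lambda>x. \<Sum>l<r. c l *\<^sub>R b l x) (\<lambda>x. 0) \<longrightarrow> (\<forall>l<r. c l = 0))"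

text \<open>
  Convergence of macro-elements: they are eventually of the same combinatorial type as the limit,
  through piecewise affine homeomorphisms tending to the identity, and the local spaces have bases
  that converge with all derivatives.  In a family that is sequentially compact for this
  convergence, there are finitely many combinatorial types, and the dimensions are bounded.
\<close>

definition macro_converges ::
    "(nat \<Rightarrow> 'n::{finite,linorder} macro_element) \<Rightarrow> 'n macro_element \<Rightarrow> bool" where
  "macro_converges D E \<longleftrightarrow> (\<exists>\<S> \<Psi> N.
     simplicial_complex \<S> \<and> \<Union>\<S> = \<Union>(fst E) \<and> (\<forall>T\<in>fst E. T = \<Union>{\<sigma>\<in>\<S>. \<sigma> \<subseteq> T}) \<and>
     (\<forall>i\<ge>N. inj_on (\<Psi> i) (\<Union>(fst E)) \<and>
        (\<forall>\<sigma>\<in>\<S>. \<exists>A c. linear A \<and> (\<forall>x\<in>\<sigma>. \<Psi> i x = A x + c)) \<and>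
        bij_betw ((`) (\<Psi> i)) (fst E) (fst (D i))) \<and>
     (\<forall>x\<in>\<Union>(fst E). (\<lambda>i. \<Psi> i x) \<longlonglongrightarrow> x) \<and>
     (\<forall>T\<in>fst E. \<forall>k\<le>CARD('n). \<exists>r b b'.
        basis_on_cell T (snd E T k) r b \<and>
        (\<forall>i\<ge>N. basis_on_cell (\<Psi> i ` T) (snd (D i) (\<Psi> i ` T) k) r (b' i)) \<and>
        (\<forall>l<r. \<forall>is R. uniform_limit (cball 0 R)
           (\<lambda>i. partials is (b' i l)) (partials is (b l)) sequentially)))"

definition macro_compact :: "'n::{finite,linorder} macro_element set \<Rightarrow> bool" where
  "macro_compact \<F> \<longleftrightarrow>
     (\<forall>D :: nat \<Rightarrow> 'n macro_element.
        (\<forall>i. D i \<in> \<F>) \<longrightarrow> (\<exists>E\<in>\<F>. \<exists>r. strict_mono r \<and> macro_converges (D \<circ> r) E))"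

definition h_setting ::
    "(nat \<Rightarrow> real) \<Rightarrow> (nat \<Rightarrow> 'n point set set) \<Rightarrow> (nat \<Rightarrow> 'n::{finite,linorder} element_system) \<Rightarrow> bool" where
  "h_setting h \<T> X \<longleftrightarrow> (\<exists>\<F>. macro_compact \<F> \<and>
     (\<forall>E\<in>\<F>. finite (fst E) \<and> cell_family (fst E) \<and> compatible_system (fst E) (snd E)) \<and>
     (\<forall>j. \<forall>T\<in>\<T> j. \<forall>a\<in>T. scaled_macro a (h j) (macro_cells (\<T> j) T, X j) \<in> \<F>))"


section \<open>Interpolator, mollification and smoothed projector\<close>

text \<open>
  \<open>F T k\<close> is the set of degrees of freedom attached to \<open>T\<close>: linear functionals on the \<open>k\<close>-forms on
  \<open>T\<close>, smooth up to the boundary.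
\<close>

type_synonym 'n dofs = "'n point set \<Rightarrow> nat \<Rightarrow> ('n form \<Rightarrow> real) set"

definition unisolvent_dofs ::
    "('n \<Rightarrow> 'n point) \<Rightarrow> 'n point set set \<Rightarrow> 'n::{finite,linorder} element_system \<Rightarrow> 'n dofs \<Rightarrow> bool" where
  "unisolvent_dofs e \<T> X F \<longleftrightarrow> (\<forall>T\<in>\<T>. \<forall>k\<le>CARD('n).
     (\<forall>m\<in>F T k. \<forall>U W. smooth U \<longrightarrow> k_form k U \<longrightarrow> smooth W \<longrightarrow> k_form k W \<longrightarrow>
        (\<forall>a b. m (\<lambda>x. a *\<^sub>R U x + b *\<^sub>R W x) = a * m U + b * m W) \<and>
        (same_pullback T U W \<longrightarrow> m U = m W)) \<and>
     (\<forall>m\<in>F T k. \<forall>l\<in>lattice_points e. (\<lambda>U. m (\<lambda>x. U (x + l))) \<in> F ((+) l ` T) k) \<and>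
     (\<forall>U. smooth U \<longrightarrow> k_form k U \<longrightarrow>
        (\<exists>W\<in>X T k. \<forall>T'\<in>\<T>. T' \<subseteq> T \<longrightarrow> (\<forall>m\<in>F T' k. m W = m U))) \<and>
     (\<forall>W\<in>X T k. (\<forall>T'\<in>\<T>. T' \<subseteq> T \<longrightarrow> (\<forall>m\<in>F T' k. m W = 0)) \<longrightarrow> same_pullback T W (\<lambda>x. 0)))"

text \<open>
  The interpolator deduced from the degrees of freedom: the element of \<open>X\<^sub>h\<close> with the same degrees of
  freedom as \<open>u\<close>.  It is meaningful for smooth forms on the torus and more generally for cellwise smooth
  forms with single-valued pullbacks.  By unisolvence it is the identity on \<open>X\<^sub>h\<close>, and the
  restriction of \<open>I\<^sub>h u\<close> to a cell depends only on the pullback of \<open>u\<close> to this cell.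
\<close>

definition interpolator ::
    "('n \<Rightarrow> 'n point) \<Rightarrow> 'n point set set \<Rightarrow> 'n::{finite,linorder} element_system \<Rightarrow> 'n dofs \<Rightarrow>
     'n form \<Rightarrow> 'n form" where
  "interpolator e \<T> X F u = (THE v. v \<in> fe_space e \<T> X \<and> (\<forall>k\<le>CARD('n). \<exists>U W.
     has_traces \<T> k (degree_part k u) U \<and>
     has_traces \<T> k (degree_part k v) W \<and> (\<forall>T\<in>\<T>. W T \<in> X T k) \<and>
     (\<forall>T\<in>\<T>. \<forall>m\<in>F T k. m (W T) = m (U T))))"

definition commutes_with_d :: "('n::{finite,linorder} \<Rightarrow> 'n point) \<Rightarrow> ('n form \<Rightarrow> 'n form) \<Rightarrow> bool" where
  "commutes_with_d e I \<longleftrightarrow>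
     (\<forall>u. smooth u \<longrightarrow> periodic e u \<longrightarrow> weak_d e (I u) (I (ext_d u)))"

definition scaled_Cm_bounded ::
    "('n \<Rightarrow> 'n point) \<Rightarrow> (nat \<Rightarrow> real) \<Rightarrow> (nat \<Rightarrow> 'n point set set) \<Rightarrow>
     (nat \<Rightarrow> 'n::{finite,linorder} form \<Rightarrow> 'n form) \<Rightarrow> bool" where
  "scaled_Cm_bounded e h \<T> I \<longleftrightarrow> (\<exists>m C. \<forall>j. \<forall>T\<in>\<T> j. cell_dim T = CARD('n) \<longrightarrow>
     (\<forall>u. smooth u \<longrightarrow> periodic e u \<longrightarrow> (\<forall>x\<in>cell_interior T.
        norm (I j u x) \<le>
          C * (\<Sum>is | length is \<le> m. h j ^ length is * (SUP y\<in>T. norm (partials is u y))))))"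

definition mollifier :: "nat \<Rightarrow> ('n::finite point \<Rightarrow> real) \<Rightarrow> bool" where
  "mollifier p \<phi> \<longleftrightarrow> smooth \<phi> \<and> (\<forall>x. norm x > 1 \<longrightarrow> \<phi> x = 0) \<and> (LINT x|lborel. \<phi> x) = 1 \<and>
     (\<forall>q :: 'n point \<Rightarrow> real. poly_map p q \<longrightarrow> (LINT x|lborel. \<phi> (- x) * q x) = q 0)"

definition rescaled :: "real \<Rightarrow> ('n::finite point \<Rightarrow> real) \<Rightarrow> 'n point \<Rightarrow> real" where
  "rescaled \<delta> \<phi> x = \<phi> (x /\<^sub>R \<delta>) / \<delta> ^ CARD('n)"

definition convolve :: "('n::finite point \<Rightarrow> real) \<Rightarrow> 'n form \<Rightarrow> 'n form" where
  "convolve \<phi> u x = (LINT y|lborel. \<phi> (x - y) *\<^sub>R u y)"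

definition mollified_interpolation ::
    "('n \<Rightarrow> 'n point) \<Rightarrow> 'n point set set \<Rightarrow> 'n::{finite,linorder} element_system \<Rightarrow> 'n dofs \<Rightarrow>
     ('n point \<Rightarrow> real) \<Rightarrow> real \<Rightarrow> 'n form \<Rightarrow> 'n form" where
  "mollified_interpolation e \<T> X F \<phi> \<delta> u = interpolator e \<T> X F (convolve (rescaled \<delta> \<phi>) u)"

definition smoothed_projector ::
    "('n \<Rightarrow> 'n point) \<Rightarrow> 'n point set set \<Rightarrow> 'n::{finite,linorder} element_system \<Rightarrow> 'n dofs \<Rightarrow>
     ('n point \<Rightarrow> real) \<Rightarrow> real \<Rightarrow> 'n form \<Rightarrow> 'n form" where
  "smoothed_projector e \<T> X F \<phi> \<delta> u =
     inv_into (fe_space e \<T> X) (mollified_interpolation e \<T> X F \<phi> \<delta>)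
       (mollified_interpolation e \<T> X F \<phi> \<delta> u)"

text \<open>The properties that a sufficiently small \<open>\<epsilon>\<close> is chosen to ensure.\<close>

definition admissible_eps ::
    "('n \<Rightarrow> 'n point) \<Rightarrow> (nat \<Rightarrow> real) \<Rightarrow> (nat \<Rightarrow> 'n point set set) \<Rightarrow>
     (nat \<Rightarrow> 'n::{finite,linorder} element_system) \<Rightarrow> (nat \<Rightarrow> 'n dofs) \<Rightarrow> ('n point \<Rightarrow> real) \<Rightarrow> real \<Rightarrow> bool" where
  "admissible_eps e h \<T> X F \<phi> \<epsilon> \<longleftrightarrow> \<epsilon> > 0 \<and>
     (\<forall>j. bij_betw (mollified_interpolation e (\<T> j) (X j) (F j) \<phi> (\<epsilon> * h j))
            (fe_space e (\<T> j) (X j)) (fe_space e (\<T> j) (X j))) \<and>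
     (\<exists>C. \<forall>j. \<forall>u\<in>L2_forms e.
        L2_form_norm e (smoothed_projector e (\<T> j) (X j) (F j) \<phi> (\<epsilon> * h j) u) \<le> C * L2_form_norm e u) \<and>
     (\<forall>j u w. weak_d e u w \<longrightarrow>
        weak_d e (smoothed_projector e (\<T> j) (X j) (F j) \<phi> (\<epsilon> * h j) u)
          (smoothed_projector e (\<T> j) (X j) (F j) \<phi> (\<epsilon> * h j) w))"

end

theory Submission
  imports Defs
begin

text \<open>
  The double integral over the torus is replaced by the integral of
  \<open>\<parallel>u(\<cdot> + z) - u\<parallel>\<^sup>2 |z| powr (- n - 2 * s)\<close> over all translations \<open>z\<close>.  As \<open>I\<^sub>h\<close> and the mollification
  preserve constants and are local, \<open>\<parallel>\<Pi>\<^sub>h u - u\<parallel>\<^sup>2\<close> is at most the mean of \<open>\<parallel>u(\<cdot> + q) - u\<parallel>\<^sup>2\<close> over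
  \<open>|q| \<le> R h\<close>, up to a constant; this takes care of \<open>|z| > h\<close>.  For \<open>|z| \<le> h\<close>, compactness of the scaled
  macro-elements gives an inverse estimate for \<open>v = \<Pi>\<^sub>h u\<close>, so that \<open>v(x + z) - v(x)\<close> is controlled by
  \<open>|z| / h\<close> times the local oscillation of \<open>v\<close> as long as \<open>x\<close> and \<open>x + z\<close> lie in a common simplex.  The
  other \<open>x\<close> fill a proportion \<open>O(|z| / h)\<close> of each ball of radius comparable to \<open>h\<close>, and the jumps across
  faces are harmless since \<open>|z| powr (1 - n - 2 * s)\<close> is integrable at \<open>0\<close> for \<open>s < 1/2\<close>.  The oscillation
  of \<open>v\<close> at scale \<open>h\<close> is in turn bounded by that of \<open>u\<close>, with a gain \<open>h powr s'\<close>.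
\<close>

section \<open>The lattice\<close>

text \<open>The obstacle is that \<open>v\<close> jumps across faces and that \<open>u\<close> has
  no derivative to compare with. What helps is a free constant: the local spaces contain the
  constants, so every local bound on \<open>v\<close> holds for \<open>v - c\<close> with arbitrary
  \<open>c\<close>, and averaging over \<open>c = u (x + q)\<close>, \<open>norm q \<le> h\<close>,
  turns an oscillation of \<open>v\<close> into \<open>v - u\<close> and an oscillation of
  \<open>u\<close>. The difference is reached through \<Pi>_h u - u = \<Pi>_h (u - Q_h u) - (u - Q_h
  u), where only the L2 stability of \<Pi>_h enters, and u - Q_h u is estimated pointwise with
  \<open>c = u x\<close>. Cells need not be convex, so segments and translations are handled in the
  simplices of the refinement. Integrals take values in \<open>ennreal\<close>, so that Fubini needs
  measurability only. Uniformity in \<open>h\<close> means that every constant is fixed before the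
  mesh is; hence the locale for a single mesh receives its constants as parameters.\<close>

locale lattice_basis =
  fixes e :: "'n::finite \<Rightarrow> 'n point"
  assumes inj_e: "inj e" and indep_e: "independent (range e)"
begin

abbreviation L where "L \<equiv> lattice_points e"
abbreviation FD where "FD \<equiv> fundamental_domain e"

definition comb :: "'n point \<Rightarrow> 'n point" where
  "comb t = (\<Sum>i\<in>UNIV. t $ i *\<^sub>R e i)"

lemma linear_comb: "linear comb"
  unfolding comb_def by (intro linearI) (simp_all add: sum.distrib scaleR_left_distrib scaleR_sum_right)

lemma inj_comb: "inj comb"
proof -
  have "t = 0" if "comb t = 0" for t
  proof -
    have "(\<Sum>v\<in>range e. (t $ inv e v) *\<^sub>R v) = comb t"
      unfolding comb_def by (subst sum.reindex[OF inj_e]) (simp add: inj_e)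
    then have "(\<Sum>v\<in>range e. (t $ inv e v) *\<^sub>R v) = 0" using that by simp
    with indep_e have "\<forall>v\<in>range e. t $ inv e v = 0"
      by (subst (asm) dependent_finite) auto
    then show "t = 0" by (simp add: vec_eq_iff inj_e)
  qed
  then show ?thesis using linear_injective_0[OF linear_comb] by blast
qed

lemma surj_comb: "surj comb"
  using linear_injective_imp_surjective[OF linear_comb inj_comb] by simp

lemma bij_comb: "bij comb" using inj_comb surj_comb by (simp add: bij_def)

lemma comb_bounded_below: obtains c where "c > 0" "\<And>t. c * norm t \<le> norm (comb t)"
proof -
  obtain B where "B > 0" "\<And>x. B * norm x \<le> norm (comb x)"
    using linear_inj_bounded_below_pos[OF linear_comb inj_comb] by (metis mult.commute)
  then show ?thesis using that by blast
qed

definition coords :: "'n point \<Rightarrow> 'n point" where "coords = inv comb"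

lemma coords_comb [simp]: "coords (comb t) = t" and comb_coords [simp]: "comb (coords x) = x"
  by (simp_all add: coords_def inj_comb surj_comb surj_f_inv_f)

lemma linear_coords: "linear coords"
  unfolding coords_def using linear_comb bij_comb
  by (metis inj_comb inj_linear_imp_inv_linear coords_def)

lemma coords_measurable [measurable]: "coords \<in> borel_measurable borel"
  using linear_coords by (intro borel_measurable_continuous_onI linear_continuous_on)
    (simp add: linear_conv_bounded_linear)

lemma lattice_iff: "x \<in> L \<longleftrightarrow> (\<forall>i. coords x $ i \<in> \<int>)"
proof
  assume "x \<in> L"
  then obtain z :: "'n \<Rightarrow> int" where "x = (\<Sum>i\<in>UNIV. of_int (z i) *\<^sub>R e i)"
    by (auto simp: lattice_points_def)
  then have "x = comb (\<chi> i. of_int (z i))" by (simp add: comb_def)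
  then have "coords x = (\<chi> i. of_int (z i))" by (simp only: coords_comb)
  then show "\<forall>i. coords x $ i \<in> \<int>" by simp
next
  assume "\<forall>i. coords x $ i \<in> \<int>"
  then have "\<forall>i. \<exists>z. coords x $ i = of_int z" by (auto elim: Ints_cases)
  then obtain z :: "'n \<Rightarrow> int" where z: "\<And>i. coords x $ i = of_int (z i)" by metis
  moreover have "x = comb (coords x)" by simp
  ultimately have "x = (\<Sum>i\<in>UNIV. of_int (z i) *\<^sub>R e i)" by (simp add: comb_def)
  then show "x \<in> L" by (auto simp: lattice_points_def)
qed

lemma FD_iff: "x \<in> FD \<longleftrightarrow> (\<forall>i. 0 \<le> coords x $ i \<and> coords x $ i < 1)"
proof
  assume "x \<in> FD"
  then obtain t where t: "x = (\<Sum>i\<in>UNIV. t i *\<^sub>R e i)" "\<forall>i. 0 \<le> t i \<and> t i < 1"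
    by (auto simp: fundamental_domain_def)
  then have "x = comb (\<chi> i. t i)" by (simp add: comb_def)
  then show "\<forall>i. 0 \<le> coords x $ i \<and> coords x $ i < 1" using t by simp
next
  assume "\<forall>i. 0 \<le> coords x $ i \<and> coords x $ i < 1"
  moreover have "x = (\<Sum>i\<in>UNIV. (coords x $ i) *\<^sub>R e i)" using comb_coords[of x] by (simp only: comb_def)
  ultimately show "x \<in> FD" unfolding fundamental_domain_def by blast
qed

lemma lattice_0 [simp]: "0 \<in> L"
  by (simp add: lattice_iff linear_0[OF linear_coords])
lemma lattice_diff: "x \<in> L \<Longrightarrow> y \<in> L \<Longrightarrow> x - y \<in> L"
  by (simp add: lattice_iff linear_diff[OF linear_coords])
lemma lattice_minus: "x \<in> L \<Longrightarrow> - x \<in> L"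
  by (simp add: lattice_iff linear_neg[OF linear_coords])
lemma lattice_minus_iff [simp]: "- x \<in> L \<longleftrightarrow> x \<in> L"
  using lattice_minus[of x] lattice_minus[of "-x"] by auto

lemma countable_lattice: "countable L"
proof -
  have "L \<subseteq> range (\<lambda>z :: 'n \<Rightarrow> int. \<Sum>i\<in>UNIV. of_int (z i) *\<^sub>R e i)"
    by (auto simp: lattice_points_def)
  moreover have "countable (UNIV :: ('n \<Rightarrow> int) set)" by simp
  ultimately show ?thesis by (meson countable_image countable_subset)
qed

lemma FD_measurable [measurable]: "FD \<in> sets borel"
proof -
  have "FD = {x \<in> space borel. \<forall>i. 0 \<le> coords x $ i \<and> coords x $ i < 1}" by (auto simp: FD_iff)
  also have "\<dots> \<in> sets borel" by measurable
  finally show ?thesis .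
qed

text \<open>Removing the integer parts of the coordinates is the only way into the half-open box.
  Uniqueness holds at every point, boundary included, so the unfolding of integrals below has no
  exceptional sets.\<close>

lemma FD_shift: "\<exists>!l. l \<in> L \<and> x + l \<in> FD"
proof
  let ?l = "comb (\<chi> i. - of_int \<lfloor>coords x $ i\<rfloor>)"
  show "?l \<in> L \<and> x + ?l \<in> FD"
    by (auto simp: lattice_iff FD_iff linear_add[OF linear_coords]) linarith
next
  fix l assume l: "l \<in> L \<and> x + l \<in> FD"
  let ?l = "comb (\<chi> i. - of_int \<lfloor>coords x $ i\<rfloor>)"
  have "coords l = (\<chi> i. - of_int \<lfloor>coords x $ i\<rfloor>)"
  proof (subst vec_eq_iff, safe)
    fix i
    obtain z where z: "coords l $ i = of_int z" using l by (auto simp: lattice_iff elim: Ints_cases)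
    have "0 \<le> coords x $ i + of_int z \<and> coords x $ i + of_int z < 1"
      using l z by (metis FD_iff linear_add[OF linear_coords] vector_add_component)
    then have "\<lfloor>coords x $ i\<rfloor> = - z" by linarith
    then show "coords l $ i = (\<chi> i. - of_int \<lfloor>coords x $ i\<rfloor>) $ i" using z by simp
  qed
  then show "l = ?l" using comb_coords[of l] by simp
qed

lemma finite_lattice_bounded:
  assumes "bounded S" shows "finite (L \<inter> S)"
proof -
  obtain c where c: "c > 0" "\<And>t. c * norm t \<le> norm (comb t)" using comb_bounded_below by blast
  obtain B where B: "\<And>x. x \<in> S \<Longrightarrow> norm x \<le> B" using assms unfolding bounded_iff by blast
  define Z where "Z = {z :: 'n \<Rightarrow> int. \<forall>i. z i \<in> {-\<lceil>B/c\<rceil>..\<lceil>B/c\<rceil>}}"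
  have "Z = Pi\<^sub>E UNIV (\<lambda>_. {-\<lceil>B/c\<rceil>..\<lceil>B/c\<rceil>})" by (auto simp: Z_def PiE_def Pi_def)
  then have fin: "finite Z" by (simp add: finite_PiE)
  have sub: "L \<inter> S \<subseteq> (\<lambda>z. comb (\<chi> i. of_int (z i))) ` Z"
  proof
    fix x assume x: "x \<in> L \<inter> S"
    then have "\<forall>i. \<exists>z. coords x $ i = of_int z" by (auto simp: lattice_iff elim: Ints_cases)
    then obtain z :: "'n \<Rightarrow> int" where z: "\<And>i. coords x $ i = of_int (z i)" by metis
    have "c * norm (coords x) \<le> B" using c(2)[of "coords x"] B[of x] x by simp
    then have n: "norm (coords x) \<le> B / c" using c(1) by (simp add: field_simps)
    have "z i \<in> {-\<lceil>B/c\<rceil>..\<lceil>B/c\<rceil>}" for i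
    proof -
      have "\<bar>of_int (z i)\<bar> \<le> B / c" using n component_le_norm_cart[of "coords x" i] z by simp
      then show ?thesis by (simp; linarith)
    qed
    then have "z \<in> Z" by (simp add: Z_def)
    moreover have "coords x = (\<chi> i. of_int (z i))" by (simp add: vec_eq_iff z)
    then have "x = comb (\<chi> i. of_int (z i))" using comb_coords[of x] by simp
    ultimately show "x \<in> (\<lambda>z. comb (\<chi> i. of_int (z i))) ` Z" by blast
  qed
  show ?thesis by (rule finite_subset[OF sub]) (rule finite_imageI[OF fin])
qed

text \<open>Two admissible lattice vectors differ by one of norm at most \<open>2 * r\<close>, so
  subtracting a fixed one injects the set into a ball about \<open>0\<close>. The bound is
  independent of \<open>x\<close>; it serves as the multiplicity with which a ball folds into the
  torus.\<close>

lemma card_lattice_ball: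
  "finite {l\<in>L. norm (x + l) \<le> r}" (is "finite ?A")
  "card {l\<in>L. norm (x + l) \<le> r} \<le> card (L \<inter> cball 0 (2 * r))"
proof -
  have fin: "finite (L \<inter> cball 0 (2 * r))" by (rule finite_lattice_bounded) simp
  define A where "A = ?A"
  have "finite A \<and> card A \<le> card (L \<inter> cball 0 (2 * r))"
  proof (cases "A = {}")
    case True
    then show ?thesis by simp
  next
    case False
    then obtain l0 where l0: "l0 \<in> L" "norm (x + l0) \<le> r" by (auto simp: A_def)
    have sub: "(\<lambda>l. l - l0) ` A \<subseteq> L \<inter> cball 0 (2 * r)"
    proof
      fix m assume "m \<in> (\<lambda>l. l - l0) ` A"
      then obtain l where l: "l \<in> L" "norm (x + l) \<le> r" "m = l - l0" by (auto simp: A_def)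
      have "norm (l - l0) \<le> norm (x + l) + norm (x + l0)"
        using norm_triangle_ineq4[of "x+l" "x+l0"] by simp
      then have "norm m \<le> 2 * r" using l l0 by simp
      then show "m \<in> L \<inter> cball 0 (2*r)" using l l0 lattice_diff by simp
    qed
    have inj: "inj_on (\<lambda>l. l - l0) A" by (simp add: inj_on_def)
    show ?thesis using card_inj_on_le[OF inj sub fin] inj_on_finite[OF inj sub fin] by simp
  qed
  then show "finite ?A" "card ?A \<le> card (L \<inter> cball 0 (2 * r))" by (simp_all add: A_def)
qed

text \<open>Only lattice vectors at least as good as \<open>0\<close> compete, and these are
  finitely many, so the infimum is a minimum.\<close>

lemma torus_dist_attained: "\<exists>l\<in>L. torus_dist e x y = norm (x - y - l)"
proof -
  define A where "A = {l\<in>L. norm ((y - x) + l) \<le> norm (x - y)}"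
  define f where "f = (\<lambda>l. dist x (y + l))"
  have fin: "finite A" unfolding A_def by (rule card_lattice_ball)
  have f: "f l = norm ((y - x) + l)" for l
    using norm_minus_commute[of x "y + l"] by (simp add: f_def dist_norm algebra_simps)
  have "0 \<in> A" by (simp add: A_def norm_minus_commute)
  then have ne: "A \<noteq> {}" by blast
  define m where "m = arg_min_on f A"
  have m: "m \<in> A" unfolding m_def by (rule arg_min_if_finite(1)[OF fin ne])
  have min: "f m \<le> f l" if "l \<in> L" for l
  proof (cases "l \<in> A")
    case True then show ?thesis unfolding m_def by (intro arg_min_least[OF fin ne])
  next
    case False then show ?thesis using m that by (simp add: A_def f)
  qed
  have "m \<in> L" using m by (simp add: A_def)
  have "(INF l\<in>L. f l) = f m"
    by (rule cInf_eq_minimum) (use \<open>m \<in> L\<close> min in auto)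
  then have "torus_dist e x y = norm (x - y - m)"
    by (simp add: torus_dist_def f_def dist_norm diff_diff_eq)
  then show ?thesis using \<open>m \<in> L\<close> by blast
qed

lemma torus_dist_le:
  assumes "l \<in> L" shows "torus_dist e x y \<le> norm (x - y - l)"
proof -
  have "bdd_below ((\<lambda>l. dist x (y + l)) ` L)" by (rule bdd_belowI2[where m=0]) simp
  from cINF_lower[OF this assms] show ?thesis by (simp add: torus_dist_def dist_norm diff_diff_eq)
qed

lemma torus_dist_nonneg: "0 \<le> torus_dist e x y"
  using torus_dist_attained[of x y] by auto

end

section \<open>Translation differences and the Gagliardo seminorm\<close>

lemma nn_integral_lborel_shift:
  fixes f :: "'a::euclidean_space \<Rightarrow> ennreal"
  assumes [measurable]: "f \<in> borel_measurable borel"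
  shows "(\<integral>\<^sup>+x. f (x + a) \<partial>lborel) = (\<integral>\<^sup>+x. f x \<partial>lborel)"
proof -
  have "(\<integral>\<^sup>+x. f x \<partial>lborel) = (\<integral>\<^sup>+x. f x \<partial>distr lborel borel ((+) a))"
    by (simp only: lborel_distr_plus)
  also have "\<dots> = (\<integral>\<^sup>+x. f (x + a) \<partial>lborel)" by (simp add: nn_integral_distr add.commute)
  finally show ?thesis by simp
qed

lemma nn_integral_lborel_minus:
  fixes f :: "'a::euclidean_space \<Rightarrow> ennreal"
  assumes [measurable]: "f \<in> borel_measurable borel"
  shows "(\<integral>\<^sup>+x. f (a - x) \<partial>lborel) = (\<integral>\<^sup>+x. f x \<partial>lborel)"
proof -
  have "lborel = distr lborel borel (\<lambda>x::'a. a - x)"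
    using lborel_affine[of "-1::real" a] by (simp add: density_1)
  then have "(\<integral>\<^sup>+x. f x \<partial>lborel) = (\<integral>\<^sup>+x. f x \<partial>distr lborel borel (\<lambda>x. a - x))" by simp
  also have "\<dots> = (\<integral>\<^sup>+x. f (a - x) \<partial>lborel)" by (simp add: nn_integral_distr)
  finally show ?thesis by simp
qed

lemma shell_cover:
  fixes r x :: real assumes "0 < r" "r \<le> x"
  shows "\<exists>k::nat. r * 2 ^ k \<le> x \<and> x \<le> r * 2 ^ Suc k"
proof -
  define m where "m = \<lfloor>log 2 (x / r)\<rfloor>"
  have "0 \<le> log 2 (x / r)" using assms by (simp add: field_simps)
  then have m0: "0 \<le> m" by (simp add: m_def)
  have x: "x / r = 2 powr log 2 (x / r)" using assms by simp
  have "2 powr of_int m \<le> 2 powr log 2 (x / r)" "2 powr log 2 (x / r) \<le> 2 powr (of_int m + 1)"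
    by (rule powr_mono; simp add: m_def; linarith)+
  then have "2 powr of_int m \<le> x / r" "x / r \<le> 2 powr (of_int m + 1)" by (simp_all only: x[symmetric])
  moreover have "2 powr of_int m = (2::real) ^ nat m" "2 powr (of_int m + 1) = (2::real) ^ Suc (nat m)"
    using m0 by (simp_all add: powr_realpow[symmetric] powr_add)
  ultimately show ?thesis using assms by (intro exI[of _ "nat m"]) (simp add: field_simps)
qed

text \<open>On the dyadic shell between \<open>t k\<close> and \<open>2 * t k\<close> the integrand
  is at most \<open>t k powr - \<beta>\<close> and the volume at most that of the ball of radius
  \<open>2 * t k\<close>; the products form a geometric series with ratio \<open>q\<close>. One
  statement covers shells growing from \<open>r\<close> (tail) and shells shrinking to
  \<open>0\<close> (singularity).\<close>

lemma nn_integral_shells: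
  fixes f :: "'a::euclidean_space \<Rightarrow> real" and t :: "nat \<Rightarrow> real" and \<beta> c q :: real
  assumes t: "\<And>k. t k > 0" and A: "\<And>z. z \<in> A \<Longrightarrow> z \<noteq> 0 \<Longrightarrow> \<exists>k. t k \<le> norm z \<and> norm z \<le> 2 * t k"
    and \<beta>: "\<beta> > 0" and t_eq: "\<And>k. t k powr (DIM('a) - \<beta>) = c * q ^ k" and q: "0 \<le> q" "q < 1"
    and [measurable]: "A \<in> sets borel" and c: "c \<ge> 0"
  shows "(\<integral>\<^sup>+z\<in>A. ennreal (norm (z::'a) powr - \<beta>) \<partial>lborel)
    \<le> ennreal (unit_ball_vol DIM('a) * 2 ^ DIM('a) / (1 - q) * c)"
proof -
  let ?n = "DIM('a)"
  define \<omega> where "\<omega> = unit_ball_vol (real ?n)"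
  have w: "\<omega> \<ge> 0" by (simp add: \<omega>_def)
  define S where "S k = {z::'a. t k \<le> norm z \<and> norm z \<le> 2 * t k}" for k
  have [measurable]: "S k \<in> sets borel" for k unfolding S_def by measurable
  have "(\<integral>\<^sup>+z\<in>A. ennreal (norm z powr - \<beta>) \<partial>lborel)
      \<le> (\<integral>\<^sup>+z. (\<Sum>k. ennreal (norm z powr - \<beta>) * indicator (S k) z) \<partial>lborel)"
  proof (rule nn_integral_mono)
    fix z :: 'a
    show "ennreal (norm z powr - \<beta>) * indicator A z \<le> (\<Sum>k. ennreal (norm z powr - \<beta>) * indicator (S k) z)"
    proof (cases "z \<in> A \<and> z \<noteq> 0")
      case True
      then obtain k where "z \<in> S k" using A[of z] by (auto simp: S_def)
      then have "ennreal (norm z powr - \<beta>) * indicator A z \<le> (\<Sum>k\<in>{k}. ennreal (norm z powr - \<beta>) * indicator (S k) z)"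
        using True by simp
      also have "\<dots> \<le> (\<Sum>k. ennreal (norm z powr - \<beta>) * indicator (S k) z)"
        by (intro sum_le_suminf) auto
      finally show ?thesis .
    next
      case False then show ?thesis by (auto simp: indicator_def)
    qed
  qed
  also have "\<dots> = (\<Sum>k. \<integral>\<^sup>+z. ennreal (norm z powr - \<beta>) * indicator (S k) z \<partial>lborel)"
    by (rule nn_integral_suminf) simp
  also have "\<dots> \<le> (\<Sum>k. ennreal (\<omega> * 2 ^ ?n * c * q ^ k))"
  proof (intro suminf_le summableI)
    fix k
    have "(\<integral>\<^sup>+z. ennreal (norm z powr - \<beta>) * indicator (S k) z \<partial>lborel)
        \<le> (\<integral>\<^sup>+z. ennreal (t k powr - \<beta>) * indicator (cball 0 (2 * t k)) z \<partial>(lborel :: 'a measure))"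
    proof (rule nn_integral_mono)
      fix z :: 'a
      show "ennreal (norm z powr - \<beta>) * indicator (S k) z \<le> ennreal (t k powr - \<beta>) * indicator (cball 0 (2 * t k)) z"
      proof (cases "z \<in> S k")
        case True
        then have "norm z powr - \<beta> \<le> t k powr - \<beta>" using t[of k] \<beta> by (intro powr_mono2') (auto simp: S_def)
        then show ?thesis using True by (simp add: S_def ennreal_leI)
      qed simp
    qed
    also have "\<dots> = ennreal (t k powr - \<beta>) * ennreal (\<omega> * (2 * t k) ^ ?n)"
      using t[of k] by (subst nn_integral_cmult_indicator) (auto simp: emeasure_cball \<omega>_def)
    also have "\<dots> = ennreal (\<omega> * 2 ^ ?n * (t k powr (?n - \<beta>)))"
      using t[of k] w
      by (simp add: ennreal_mult[symmetric] powr_diff powr_minus_divide powr_realpow power_mult_distrib field_simps)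
    finally show "(\<integral>\<^sup>+z. ennreal (norm z powr - \<beta>) * indicator (S k) z \<partial>lborel) \<le> ennreal (\<omega> * 2 ^ ?n * c * q ^ k)"
      by (simp add: t_eq mult.assoc)
  qed
  also have "\<dots> = ennreal (\<Sum>k. \<omega> * 2 ^ ?n * c * q ^ k)"
    using q w c by (intro suminf_ennreal2) (auto intro!: mult_nonneg_nonneg summable_mult summable_geometric)
  also have "(\<Sum>k. \<omega> * 2 ^ ?n * c * q ^ k) = \<omega> * 2 ^ ?n / (1 - q) * c"
    using q by (subst suminf_mult) (auto simp: suminf_geometric summable_geometric)
  finally show ?thesis by (simp add: \<omega>_def)
qed

lemma nn_integral_powr_outside_ball:
  fixes \<gamma> r :: real
  assumes "\<gamma> > 0" "r > 0"
  shows "(\<integral>\<^sup>+z\<in>{z. r \<le> norm z}. ennreal (norm (z::'a::euclidean_space) powr - (DIM('a) + \<gamma>)) \<partial>lborel)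
    \<le> ennreal (unit_ball_vol DIM('a) * 2 ^ DIM('a) / (1 - 2 powr - \<gamma>) * r powr - \<gamma>)"
proof (rule nn_integral_shells[where t = "\<lambda>k. r * 2 ^ k"])
  show "\<exists>k. r * 2 ^ k \<le> norm z \<and> norm z \<le> 2 * (r * 2 ^ k)" if "z \<in> {z. r \<le> norm z}" for z :: 'a
    using shell_cover[OF assms(2), of "norm z"] that by (simp add: mult.left_commute)
  show "(r * 2 ^ k) powr (DIM('a) - (DIM('a) + \<gamma>)) = r powr - \<gamma> * (2 powr - \<gamma>) ^ k" for k
    using assms by (simp add: powr_mult powr_realpow[symmetric] powr_powr mult.commute)
  show "2 powr - \<gamma> < (1::real)" using assms by (simp add: powr_less_one)
qed (use assms in auto)

text \<open>The outermost shell starts at \<open>r / 2\<close>, hence the power of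
  \<open>r / 2\<close>; each further shell contributes \<open>2 powr - \<gamma>\<close> times the
  previous one.\<close>

lemma nn_integral_powr_inside_ball:
  fixes \<gamma> r :: real
  assumes "\<gamma> > 0" "r > 0" "\<gamma> < DIM('a)"
  shows "(\<integral>\<^sup>+z\<in>cball 0 r. ennreal (norm (z::'a::euclidean_space) powr - (DIM('a) - \<gamma>)) \<partial>lborel)
    \<le> ennreal (unit_ball_vol DIM('a) * 2 ^ DIM('a) / (1 - 2 powr - \<gamma>) * (r / 2) powr \<gamma>)"
proof (rule nn_integral_shells[where t = "\<lambda>k. r / 2 / 2 ^ k"])
  show "\<exists>k. r / 2 / 2 ^ k \<le> norm z \<and> norm z \<le> 2 * (r / 2 / 2 ^ k)" if "z \<in> cball 0 r" "z \<noteq> 0" for z :: 'a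
  proof -
    have "norm z \<le> r" "0 < norm z" using that by auto
    then show ?thesis using shell_cover[of "norm z" r] assms by (auto simp: field_simps)
  qed
  show "(r / 2 / 2 ^ k) powr (DIM('a) - (DIM('a) - \<gamma>)) = (r / 2) powr \<gamma> * (2 powr - \<gamma>) ^ k" for k
    using assms by (simp add: powr_divide powr_realpow[symmetric] powr_powr powr_minus_divide powr_mult mult.commute field_simps)
  show "2 powr - \<gamma> < (1::real)" using assms by (simp add: powr_less_one)
qed (use assms in auto)

context lattice_basis begin

lemma nn_integral_lattice_single:
  assumes "l0 \<in> L" "\<And>l. l \<in> L \<Longrightarrow> f l = c * indicator {l0} l"
  shows "(\<integral>\<^sup>+l. f l \<partial>count_space L) = (c::ennreal)"
proof -
  have "(\<integral>\<^sup>+l. f l \<partial>count_space L) = (\<integral>\<^sup>+l. c * indicator {l0} l \<partial>count_space L)"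
    by (rule nn_integral_cong) (simp add: assms)
  also have "\<dots> = c" using assms(1) by (subst nn_integral_cmult_indicator) auto
  finally show ?thesis .
qed

text \<open>By \<open>FD_shift\<close> exactly one summand survives: the indicators of the
  translates of the fundamental domain form a partition of unity.\<close>

lemma nn_integral_count_FD:
  "(\<integral>\<^sup>+l. c * indicator FD (x + l) \<partial>count_space L) = c"
  "(\<integral>\<^sup>+l. c * indicator FD (x - l) \<partial>count_space L) = c"
proof -
  define l0 where "l0 = (THE l. l \<in> L \<and> x + l \<in> FD)"
  have l0: "l0 \<in> L" "x + l0 \<in> FD"
    unfolding l0_def using theI'[OF FD_shift[of x]] by simp_all
  have l0_unique: "l = l0" if "l \<in> L" "x + l \<in> FD" for l
    unfolding l0_def by (rule sym, rule the1_equality[OF FD_shift[of x]]) (rule conjI[OF that])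
  show "(\<integral>\<^sup>+l. c * indicator FD (x + l) \<partial>count_space L) = c"
  proof (rule nn_integral_lattice_single[OF l0(1)])
    fix l assume "l \<in> L"
    then have "x + l \<in> FD \<longleftrightarrow> l = l0" using l0(2) l0_unique[of l] by blast
    then show "c * indicator FD (x + l) = c * indicator {l0} l" by (simp add: indicator_def)
  qed
  show "(\<integral>\<^sup>+l. c * indicator FD (x - l) \<partial>count_space L) = c"
  proof (rule nn_integral_lattice_single[of "- l0"])
    fix l assume l: "l \<in> L"
    have "x - l \<in> FD \<longleftrightarrow> l = - l0"
    proof
      assume "x - l \<in> FD"
      then have "x + (- l) \<in> FD" by simp
      then have "- l = l0" using l by (intro l0_unique) simp_all
      then show "l = - l0" by auto
    next
      assume "l = - l0" then show "x - l \<in> FD" using l0(2) by simp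
    qed
    then show "c * indicator FD (x - l) = c * indicator {- l0} l" by (simp add: indicator_def)
  qed (simp add: l0)
qed

text \<open>Insert the partition of unity by translates of \<open>FD\<close>, exchange sum and
  integral, and shift each piece back to \<open>FD\<close>.\<close>

lemma nn_integral_unfold:
  assumes [measurable]: "g \<in> borel_measurable borel"
  shows "(\<integral>\<^sup>+x. g x \<partial>lborel) = (\<integral>\<^sup>+x\<in>FD. (\<integral>\<^sup>+l. g (x + l) \<partial>count_space L) \<partial>lborel)"
proof -
  have "(\<integral>\<^sup>+x. g x \<partial>lborel) = (\<integral>\<^sup>+x. \<integral>\<^sup>+l. g x * indicator FD (x - l) \<partial>count_space L \<partial>lborel)"
    by (simp add: nn_integral_count_FD)
  also have "\<dots> = (\<integral>\<^sup>+l. \<integral>\<^sup>+x. g x * indicator FD (x - l) \<partial>lborel \<partial>count_space L)"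
    by (rule nn_integral_count_space_nn_integral) (auto simp: countable_lattice)
  also have "\<dots> = (\<integral>\<^sup>+l. \<integral>\<^sup>+x. g (x + l) * indicator FD x \<partial>lborel \<partial>count_space L)"
  proof (rule nn_integral_cong)
    fix l
    show "(\<integral>\<^sup>+x. g x * indicator FD (x - l) \<partial>lborel) = (\<integral>\<^sup>+x. g (x + l) * indicator FD x \<partial>lborel)"
      using nn_integral_lborel_shift[of "\<lambda>x. g x * indicator FD (x - l)" l] by simp
  qed
  also have "\<dots> = (\<integral>\<^sup>+x. \<integral>\<^sup>+l. g (x + l) * indicator FD x \<partial>count_space L \<partial>lborel)"
    by (rule nn_integral_count_space_nn_integral[symmetric]) (auto simp: countable_lattice)
  also have "\<dots> = (\<integral>\<^sup>+x\<in>FD. (\<integral>\<^sup>+l. g (x + l) \<partial>count_space L) \<partial>lborel)"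
    by (simp add: nn_integral_multc)
  finally show ?thesis .
qed

lemma periodicD: "periodic e f \<Longrightarrow> l \<in> L \<Longrightarrow> f (x + l) = f x"
  by (simp add: periodic_def)

text \<open>A translate of \<open>FD\<close> is again a fundamental domain: unfolding
  \<open>g\<close> times its indicator leaves, by periodicity, \<open>g x\<close> times a sum of
  indicators equal to \<open>1\<close>.\<close>

lemma nn_integral_FD_shift:
  assumes [measurable]: "g \<in> borel_measurable borel" and per: "periodic e g"
  shows "(\<integral>\<^sup>+x\<in>FD. g (x + w) \<partial>lborel) = (\<integral>\<^sup>+x\<in>FD. g x \<partial>lborel)"
proof -
  have "(\<integral>\<^sup>+x\<in>FD. g (x + w) \<partial>lborel) = (\<integral>\<^sup>+x. g x * indicator FD (x - w) \<partial>lborel)"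
    using nn_integral_lborel_shift[of "\<lambda>x. g x * indicator FD (x - w)" w] by simp
  also have "\<dots> = (\<integral>\<^sup>+x\<in>FD. (\<integral>\<^sup>+l. g (x + l) * indicator FD (x + l - w) \<partial>count_space L) \<partial>lborel)"
    by (rule nn_integral_unfold) measurable
  also have "\<dots> = (\<integral>\<^sup>+x\<in>FD. (\<integral>\<^sup>+l. g x * indicator FD (x - w + l) \<partial>count_space L) \<partial>lborel)"
    by (intro nn_integral_cong arg_cong2[where f=times]) (auto simp: periodicD[OF per] algebra_simps)
  also have "\<dots> = (\<integral>\<^sup>+x\<in>FD. g x \<partial>lborel)"
    by (simp add: nn_integral_count_FD)
  finally show ?thesis .
qed

definition transl_diff :: "'n form \<Rightarrow> 'n point \<Rightarrow> ennreal" where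
  "transl_diff u z = (\<integral>\<^sup>+x\<in>FD. ennreal ((norm (u (x + z) - u x))\<^sup>2) \<partial>lborel)"

lemma L2_formsD:
  assumes "u \<in> L2_forms e"
  shows "periodic e u" "u \<in> borel_measurable borel"
    "(\<integral>\<^sup>+x\<in>FD. ennreal ((norm (u x))\<^sup>2) \<partial>lborel) = ennreal ((L2_form_norm e u)\<^sup>2)"
proof -
  show "periodic e u" and m [measurable]: "u \<in> borel_measurable borel" using assms by (auto simp: L2_forms_def)
  have i: "set_integrable lborel FD (\<lambda>x. (norm (u x))\<^sup>2)" using assms by (auto simp: L2_forms_def)
  have "(\<integral>\<^sup>+x\<in>FD. ennreal ((norm (u x))\<^sup>2) \<partial>lborel) = (\<integral>\<^sup>+x. ennreal (indicator FD x *\<^sub>R (norm (u x))\<^sup>2) \<partial>lborel)"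
    by (intro nn_integral_cong) (auto simp: indicator_def)
  also have "\<dots> = ennreal (LINT x:FD|lborel. (norm (u x))\<^sup>2)"
    unfolding set_lebesgue_integral_def using i unfolding set_integrable_def
    by (intro nn_integral_eq_integral) auto
  also have "(LINT x:FD|lborel. (norm (u x))\<^sup>2) = (L2_form_norm e u)\<^sup>2"
    unfolding L2_form_norm_def set_lebesgue_integral_def
    by (subst real_sqrt_pow2) (auto intro!: integral_nonneg)
  finally show "(\<integral>\<^sup>+x\<in>FD. ennreal ((norm (u x))\<^sup>2) \<partial>lborel) = ennreal ((L2_form_norm e u)\<^sup>2)" .
qed

lemma L2_formsI:
  assumes "periodic e u" "u \<in> borel_measurable borel" "(\<integral>\<^sup>+x\<in>FD. ennreal ((norm (u x))\<^sup>2) \<partial>lborel) < \<infinity>"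
  shows "u \<in> L2_forms e"
proof -
  have [measurable]: "u \<in> borel_measurable borel" by fact
  have "(\<integral>\<^sup>+x. ennreal (norm (indicator FD x *\<^sub>R (norm (u x))\<^sup>2)) \<partial>lborel) = (\<integral>\<^sup>+x\<in>FD. ennreal ((norm (u x))\<^sup>2) \<partial>lborel)"
    by (intro nn_integral_cong) (auto simp: indicator_def)
  then have "set_integrable lborel FD (\<lambda>x. (norm (u x))\<^sup>2)"
    unfolding set_integrable_def using assms(3) by (intro integrableI_bounded) (simp_all only: , measurable)
  then show ?thesis using assms by (simp add: L2_forms_def)
qed

lemma norm_diff_sq_le: "(norm (a - b :: 'a::real_normed_vector))\<^sup>2 \<le> 2 * (norm a)\<^sup>2 + 2 * (norm b)\<^sup>2"
proof -
  have "(norm (a - b))\<^sup>2 \<le> (norm a + norm b)\<^sup>2" by (intro power_mono norm_triangle_ineq4) simp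
  also have "\<dots> \<le> 2 * (norm a)\<^sup>2 + 2 * (norm b)\<^sup>2"
    using zero_le_power2[of "norm a - norm b"] by (simp add: power2_eq_square algebra_simps)
  finally show ?thesis .
qed

lemma transl_diff_measurable [measurable]:
  assumes [measurable]: "u \<in> borel_measurable borel"
  shows "transl_diff u \<in> borel_measurable borel"
  unfolding transl_diff_def by measurable

lemma transl_diff_le_nn:
  assumes [measurable]: "u \<in> borel_measurable borel" and per: "periodic e u"
  shows "transl_diff u z \<le> 4 * (\<integral>\<^sup>+x\<in>FD. ennreal ((norm (u x))\<^sup>2) \<partial>lborel)"
proof -
  have "transl_diff u z \<le> (\<integral>\<^sup>+x\<in>FD. 2 * ennreal ((norm (u (x + z)))\<^sup>2) + 2 * ennreal ((norm (u x))\<^sup>2) \<partial>lborel)"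
    unfolding transl_diff_def
  proof (intro nn_integral_mono mult_right_mono)
    fix x
    have "ennreal ((norm (u (x + z) - u x))\<^sup>2) \<le> ennreal (2 * (norm (u (x + z)))\<^sup>2 + 2 * (norm (u x))\<^sup>2)"
      by (intro ennreal_leI norm_diff_sq_le)
    then show "ennreal ((norm (u (x + z) - u x))\<^sup>2) \<le> 2 * ennreal ((norm (u (x + z)))\<^sup>2) + 2 * ennreal ((norm (u x))\<^sup>2)"
      by (simp add: ennreal_plus ennreal_mult)
  qed simp
  also have "\<dots> = 2 * (\<integral>\<^sup>+x\<in>FD. ennreal ((norm (u (x + z)))\<^sup>2) \<partial>lborel) + 2 * (\<integral>\<^sup>+x\<in>FD. ennreal ((norm (u x))\<^sup>2) \<partial>lborel)"
    by (simp add: distrib_right nn_integral_add mult.assoc nn_integral_cmult)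
  also have "(\<integral>\<^sup>+x\<in>FD. ennreal ((norm (u (x + z)))\<^sup>2) \<partial>lborel) = (\<integral>\<^sup>+x\<in>FD. ennreal ((norm (u x))\<^sup>2) \<partial>lborel)"
    by (rule nn_integral_FD_shift[where g="\<lambda>x. ennreal ((norm (u x))\<^sup>2)"])
      (use per in \<open>auto simp: periodic_def\<close>)
  finally show ?thesis by (simp flip: distrib_right)
qed

lemma transl_diff_le:
  assumes u: "u \<in> L2_forms e"
  shows "transl_diff u z \<le> ennreal (4 * (L2_form_norm e u)\<^sup>2)"
  using transl_diff_le_nn[OF L2_formsD(2,1)[OF u], of z] by (simp add: L2_formsD(3)[OF u] ennreal_mult)

text \<open>Here \<open>z\<close> ranges over the whole space, not over a period, which makes shifts
  of \<open>x\<close> free. Folding \<open>z\<close> back gives the torus kernel summed over the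
  lattice; \<open>Hs_seminorm_le_gagliardo\<close> and \<open>gagliardo_le\<close> compare this
  quantity with the seminorm from above and with the full norm from below.\<close>

definition gagliardo :: "real \<Rightarrow> 'n form \<Rightarrow> ennreal" where
  "gagliardo s u = (\<integral>\<^sup>+z. transl_diff u z * ennreal (norm z powr - (real CARD('n) + 2 * s)) \<partial>lborel)"

lemma gagliardo_swap:
  assumes [measurable]: "u \<in> borel_measurable borel" "A \<in> sets borel"
  shows "(\<integral>\<^sup>+z\<in>A. transl_diff u z * ennreal (norm z powr a) \<partial>lborel) =
    (\<integral>\<^sup>+x\<in>FD. (\<integral>\<^sup>+z\<in>A. ennreal ((norm (u (x + z) - u x))\<^sup>2 * norm z powr a) \<partial>lborel) \<partial>lborel)"
proof -
  have "(\<integral>\<^sup>+z\<in>A. transl_diff u z * ennreal (norm z powr a) \<partial>lborel) =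
    (\<integral>\<^sup>+z. (\<integral>\<^sup>+x. ennreal ((norm (u (x + z) - u x))\<^sup>2 * norm z powr a) * indicator A z * indicator FD x \<partial>lborel) \<partial>lborel)"
  proof (rule nn_integral_cong)
    fix z
    have "transl_diff u z * ennreal (norm z powr a) * indicator A z
      = (\<integral>\<^sup>+x. ennreal ((norm (u (x + z) - u x))\<^sup>2) * indicator FD x * ennreal (norm z powr a) * indicator A z \<partial>lborel)"
      unfolding transl_diff_def by (simp add: nn_integral_multc)
    then show "transl_diff u z * ennreal (norm z powr a) * indicator A z
      = (\<integral>\<^sup>+x. ennreal ((norm (u (x + z) - u x))\<^sup>2 * norm z powr a) * indicator A z * indicator FD x \<partial>lborel)"
      by (simp add: ennreal_mult mult_ac)
  qed
  also have "\<dots> = (\<integral>\<^sup>+x. (\<integral>\<^sup>+z. ennreal ((norm (u (x + z) - u x))\<^sup>2 * norm z powr a) * indicator A z * indicator FD x \<partial>lborel) \<partial>lborel)"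
    by (rule lborel_pair.Fubini'[symmetric]) measurable
  finally show ?thesis by (simp add: nn_integral_multc)
qed

lemma divide_powr_eq: "a / (b::real) powr c = a * b powr - c"
  by (simp add: powr_minus_divide)

text \<open>After unfolding the integral over \<open>z\<close>, the torus kernel is the single term
  of the lattice sum at which the torus distance is attained.\<close>

lemma Hs_seminorm_le_gagliardo:
  assumes [measurable]: "u \<in> borel_measurable borel" and per: "periodic e u" and s: "0 \<le> s"
  shows "Hs_seminorm_sq e s u \<le> gagliardo s u"
proof -
  define \<alpha> where "\<alpha> = real CARD('n) + 2 * s"
  have \<alpha>: "\<alpha> > 0" using s by (simp add: \<alpha>_def add_pos_nonneg)
  have "(\<integral>\<^sup>+y\<in>FD. ennreal ((norm (u x - u y))\<^sup>2 / torus_dist e x y powr \<alpha>) \<partial>lborel)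
      \<le> (\<integral>\<^sup>+z. ennreal ((norm (u (x + z) - u x))\<^sup>2 * norm z powr - \<alpha>) \<partial>lborel)" (is "?l \<le> ?r") for x
  proof -
    have "?r = (\<integral>\<^sup>+y. ennreal ((norm (u y - u x))\<^sup>2 * norm (y - x) powr - \<alpha>) \<partial>lborel)"
      using nn_integral_lborel_shift[of "\<lambda>y. ennreal ((norm (u y - u x))\<^sup>2 * norm (y - x) powr - \<alpha>)" x]
      by (simp add: add.commute)
    also have "\<dots> = (\<integral>\<^sup>+y\<in>FD. (\<integral>\<^sup>+l. ennreal ((norm (u (y + l) - u x))\<^sup>2 * norm (y + l - x) powr - \<alpha>) \<partial>count_space L) \<partial>lborel)"
      by (rule nn_integral_unfold) measurable
    also have "\<dots> \<ge> ?l"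
    proof (intro nn_integral_mono mult_right_mono)
      fix y
      obtain l where l: "l \<in> L" "torus_dist e x y = norm (x - y - l)" using torus_dist_attained by blast
      have "ennreal ((norm (u x - u y))\<^sup>2 / torus_dist e x y powr \<alpha>) = ennreal ((norm (u (y + l) - u x))\<^sup>2 * norm (y + l - x) powr - \<alpha>)"
        unfolding divide_powr_eq l(2) periodicD[OF per l(1)]
        by (simp only: norm_minus_commute[of "u y"] norm_minus_commute[of "y + l"] diff_diff_eq)
      also have "\<dots> \<le> (\<integral>\<^sup>+l. ennreal ((norm (u (y + l) - u x))\<^sup>2 * norm (y + l - x) powr - \<alpha>) \<partial>count_space L)"
        using l(1) by (rule nn_integral_ge_point)
      finally show "ennreal ((norm (u x - u y))\<^sup>2 / torus_dist e x y powr \<alpha>) \<le> \<dots>" .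
    qed simp
    finally show ?thesis .
  qed
  then have "Hs_seminorm_sq e s u \<le> (\<integral>\<^sup>+x\<in>FD. (\<integral>\<^sup>+z. ennreal ((norm (u (x + z) - u x))\<^sup>2 * norm z powr - \<alpha>) \<partial>lborel) \<partial>lborel)"
    unfolding Hs_seminorm_sq_def \<alpha>_def by - (rule nn_integral_mono, rule mult_right_mono, simp_all)
  also have "\<dots> = gagliardo s u"
    using gagliardo_swap[of u UNIV "- \<alpha>"] by (simp add: gagliardo_def \<alpha>_def)
  finally show ?thesis .
qed

lemma torus_dist_measurable [measurable]:
  assumes [measurable]: "f \<in> borel_measurable M" "g \<in> borel_measurable M"
  shows "(\<lambda>x. torus_dist e (f x) (g x)) \<in> borel_measurable M"
  unfolding torus_dist_def
  by (rule borel_measurable_cINF) (auto simp: countable_lattice intro!: bdd_belowI2[where m=0])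

text \<open>At most \<open>card (L \<inter> cball 0 2)\<close> lattice translates come within
  distance 1, and each of their kernels is bounded by the torus kernel because the torus distance is
  the least of all. The restriction to the unit ball is what keeps this count finite.\<close>

lemma gagliardo_unit_ball_le:
  assumes [measurable]: "u \<in> borel_measurable borel" and per: "periodic e u" and s: "0 \<le> s"
  shows "(\<integral>\<^sup>+z\<in>cball 0 1. transl_diff u z * ennreal (norm z powr - (real CARD('n) + 2 * s)) \<partial>lborel)
    \<le> of_nat (card (L \<inter> cball 0 2)) * Hs_seminorm_sq e s u"
proof -
  define \<alpha> where "\<alpha> = real CARD('n) + 2 * s"
  have \<alpha>: "\<alpha> > 0" using s by (simp add: \<alpha>_def add_pos_nonneg)
  let ?K = "of_nat (card (L \<inter> cball 0 2)) :: ennreal"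
  have [measurable]: "cball (0::'n point) 1 \<in> sets borel" by simp
  define T where "T x y = ennreal ((norm (u x - u y))\<^sup>2 / torus_dist e x y powr \<alpha>)" for x y
  have [measurable]: "(\<lambda>y. T x y) \<in> borel_measurable borel" for x unfolding T_def by measurable
  have "(\<integral>\<^sup>+z\<in>cball 0 1. ennreal ((norm (u (x + z) - u x))\<^sup>2 * norm z powr - \<alpha>) \<partial>lborel)
      \<le> ?K * (\<integral>\<^sup>+y\<in>FD. T x y \<partial>lborel)" (is "?l \<le> _") for x
  proof -
    have "?l = (\<integral>\<^sup>+y. ennreal ((norm (u y - u x))\<^sup>2 * norm (y - x) powr - \<alpha>) * indicator (cball 0 1) (y - x) \<partial>lborel)"
      using nn_integral_lborel_shift[of "\<lambda>y. ennreal ((norm (u y - u x))\<^sup>2 * norm (y - x) powr - \<alpha>) * indicator (cball 0 1) (y - x)" x]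
      by (simp add: add.commute)
    also have "\<dots> = (\<integral>\<^sup>+y\<in>FD. (\<integral>\<^sup>+l. ennreal ((norm (u (y + l) - u x))\<^sup>2 * norm (y + l - x) powr - \<alpha>) * indicator (cball 0 1) (y + l - x) \<partial>count_space L) \<partial>lborel)"
      by (rule nn_integral_unfold) measurable
    also have "\<dots> \<le> (\<integral>\<^sup>+y\<in>FD. ?K * T x y \<partial>lborel)"
    proof (intro nn_integral_mono mult_right_mono)
      fix y
      define A where "A = {l\<in>L. norm ((y - x) + l) \<le> 1}"
      have A: "finite A" "card A \<le> card (L \<inter> cball 0 2)" using card_lattice_ball[of "y - x" 1] by (simp_all add: A_def)
      have "(\<integral>\<^sup>+l. ennreal ((norm (u (y + l) - u x))\<^sup>2 * norm (y + l - x) powr - \<alpha>) * indicator (cball 0 1) (y + l - x) \<partial>count_space L)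
        \<le> (\<integral>\<^sup>+l. T x y * indicator A l \<partial>count_space L)"
      proof (intro nn_integral_mono)
        fix l assume "l \<in> space (count_space L)"
        then have l: "l \<in> L" by simp
        have n: "norm (y + l - x) = norm (x - y - l)" by (simp only: norm_minus_commute[of "y + l"] diff_diff_eq)
        have p: "(norm (u (y + l) - u x))\<^sup>2 = (norm (u x - u y))\<^sup>2" unfolding periodicD[OF per l] by (simp only: norm_minus_commute[of "u y"])
        have "(norm (u x - u y))\<^sup>2 * norm (x - y - l) powr - \<alpha> \<le> (norm (u x - u y))\<^sup>2 / torus_dist e x y powr \<alpha>"
        proof (cases "torus_dist e x y = 0")
          \<comment> \<open>Division by zero gives \<open>0\<close> here, which would spoil the
            bound; but then \<open>x - y\<close> is a lattice vector and the numerator vanishes by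
            periodicity.\<close>
          case True
          then obtain m where "m \<in> L" "x - y - m = 0" using torus_dist_attained[of x y] by auto
          then have "u x = u y" using periodicD[OF per, of m y] by (simp add: algebra_simps)
          then show ?thesis by simp
        next
          case False
          then have pos: "0 < torus_dist e x y" using torus_dist_nonneg[of x y] by simp
          then have "norm (x - y - l) powr - \<alpha> \<le> torus_dist e x y powr - \<alpha>"
            using \<alpha> torus_dist_le[OF l, of x y] by (intro powr_mono2') auto
          then show ?thesis unfolding divide_powr_eq by (intro mult_left_mono) auto
        qed
        then have "ennreal ((norm (u (y + l) - u x))\<^sup>2 * norm (y + l - x) powr - \<alpha>) \<le> T x y"
          unfolding T_def n p by (rule ennreal_leI)
        then show "ennreal ((norm (u (y + l) - u x))\<^sup>2 * norm (y + l - x) powr - \<alpha>) * indicator (cball 0 1) (y + l - x) \<le> T x y * indicator A l"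
          using l by (auto simp: indicator_def A_def algebra_simps)
      qed
      also have "\<dots> = T x y * of_nat (card A)"
        using A(1) by (subst nn_integral_cmult_indicator) (auto simp: A_def)
      also have "\<dots> \<le> ?K * T x y"
        using A(2) by (subst mult.commute) (intro mult_right_mono, simp_all)
      finally show "(\<integral>\<^sup>+l. ennreal ((norm (u (y + l) - u x))\<^sup>2 * norm (y + l - x) powr - \<alpha>) * indicator (cball 0 1) (y + l - x) \<partial>count_space L) \<le> ?K * T x y" .
    qed simp
    also have "\<dots> \<le> ?K * (\<integral>\<^sup>+y\<in>FD. T x y \<partial>lborel)"
      by (simp add: mult.assoc nn_integral_cmult)
    finally show ?thesis .
  qed
  then have "(\<integral>\<^sup>+x\<in>FD. (\<integral>\<^sup>+z\<in>cball 0 1. ennreal ((norm (u (x + z) - u x))\<^sup>2 * norm z powr - \<alpha>) \<partial>lborel) \<partial>lborel)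
    \<le> (\<integral>\<^sup>+x\<in>FD. ?K * (\<integral>\<^sup>+y\<in>FD. T x y \<partial>lborel) \<partial>lborel)"
    by - (rule nn_integral_mono, rule mult_right_mono, simp_all)
  also have "\<dots> \<le> ?K * Hs_seminorm_sq e s u"
    unfolding Hs_seminorm_sq_def T_def \<alpha>_def by (simp add: mult.assoc nn_integral_cmult)
  finally show ?thesis
    using gagliardo_swap[of u "cball 0 1" "- \<alpha>"] by (simp add: \<alpha>_def)
qed

text \<open>Outside the unit ball the kernel is integrable and the translation difference is at most
  four times the squared L2 norm, so the seminorm is needed only inside.\<close>

lemma gagliardo_le:
  assumes s: "0 < s"
  obtains K where "K \<ge> 0" "\<And>u. u \<in> Hs_forms e s \<Longrightarrow> gagliardo s u \<le> ennreal (K * (Hs_norm e s u)\<^sup>2)"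
proof -
  define \<alpha> where "\<alpha> = real CARD('n) + 2 * s"
  define K0 where "K0 = unit_ball_vol CARD('n) * 2 ^ CARD('n) / (1 - 2 powr - (2 * s))"
  define K1 where "K1 = real (card (L \<inter> cball 0 2))"
  have K0: "K0 \<ge> 0" using s unfolding K0_def by (intro divide_nonneg_nonneg mult_nonneg_nonneg) (auto simp: powr_less_one less_imp_le)
  have K1: "K1 \<ge> 0" by (simp add: K1_def)
  show thesis
  proof (rule that[of "K1 + 4 * K0"])
    show "K1 + 4 * K0 \<ge> 0" using K0 K1 by simp
    fix u assume uu: "u \<in> Hs_forms e s"
    then have u: "u \<in> L2_forms e" and fin: "Hs_seminorm_sq e s u < \<infinity>" by (auto simp: Hs_forms_def)
    note [measurable] = L2_formsD(2)[OF u]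
    have [measurable]: "cball (0::'n point) 1 \<in> sets borel" by simp
    define N where "N = enn2real (Hs_seminorm_sq e s u)"
    have N: "Hs_seminorm_sq e s u = ennreal N" "N \<ge> 0" using fin by (simp_all add: N_def less_top)
    let ?f = "\<lambda>z. transl_diff u z * ennreal (norm z powr - \<alpha>)"
    have "gagliardo s u \<le> (\<integral>\<^sup>+z. ?f z * indicator (cball 0 1) z + ennreal (4 * (L2_form_norm e u)\<^sup>2) * (ennreal (norm z powr - \<alpha>) * indicator {z. 1 \<le> norm z} z) \<partial>lborel)"
      unfolding gagliardo_def \<alpha>_def[symmetric]
    proof (rule nn_integral_mono)
      fix z :: "'n point"
      have "?f z \<le> ennreal (4 * (L2_form_norm e u)\<^sup>2) * ennreal (norm z powr - \<alpha>)"
        by (intro mult_right_mono transl_diff_le u) simp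
      then show "?f z \<le> ?f z * indicator (cball 0 1) z + ennreal (4 * (L2_form_norm e u)\<^sup>2) * (ennreal (norm z powr - \<alpha>) * indicator {z. 1 \<le> norm z} z)"
        by (cases "norm z \<le> 1") (auto simp: indicator_def)
    qed
    also have "\<dots> = (\<integral>\<^sup>+z\<in>cball 0 1. ?f z \<partial>lborel) + ennreal (4 * (L2_form_norm e u)\<^sup>2) * (\<integral>\<^sup>+z\<in>{z. 1 \<le> norm z}. ennreal (norm z powr - \<alpha>) \<partial>(lborel :: 'n point measure))"
      by (subst nn_integral_add) (auto simp: nn_integral_cmult)
    also have "\<dots> \<le> ennreal K1 * ennreal N + ennreal (4 * (L2_form_norm e u)\<^sup>2) * ennreal K0"
    proof (intro add_mono mult_left_mono)
      show "(\<integral>\<^sup>+z\<in>cball 0 1. ?f z \<partial>lborel) \<le> ennreal K1 * ennreal N"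
        using gagliardo_unit_ball_le[OF _ L2_formsD(1)[OF u], of s] s N by (simp add: \<alpha>_def K1_def ennreal_of_nat_eq_real_of_nat)
      show "(\<integral>\<^sup>+z\<in>{z. 1 \<le> norm z}. ennreal (norm z powr - \<alpha>) \<partial>(lborel :: 'n point measure)) \<le> ennreal K0"
      proof -
        have "(\<integral>\<^sup>+z\<in>{z. 1 \<le> norm z}. ennreal (norm (z :: 'n point) powr - (DIM('n point) + 2 * s)) \<partial>lborel)
          \<le> ennreal (unit_ball_vol DIM('n point) * 2 ^ DIM('n point) / (1 - 2 powr - (2 * s)) * 1 powr - (2 * s))"
          using s by (intro nn_integral_powr_outside_ball) auto
        then show ?thesis by (simp add: \<alpha>_def K0_def)
      qed
    qed simp
    also have "\<dots> = ennreal (K1 * N + 4 * (L2_form_norm e u)\<^sup>2 * K0)"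
      using K0 K1 N by (simp add: ennreal_mult ennreal_plus)
    also have "\<dots> \<le> ennreal ((K1 + 4 * K0) * (Hs_norm e s u)\<^sup>2)"
    proof (intro ennreal_leI)
      have "(Hs_norm e s u)\<^sup>2 = (L2_form_norm e u)\<^sup>2 + N"
        using N by (simp add: Hs_norm_def N_def)
      then show "K1 * N + 4 * (L2_form_norm e u)\<^sup>2 * K0 \<le> (K1 + 4 * K0) * (Hs_norm e s u)\<^sup>2"
        using K0 K1 N by (simp add: algebra_simps)
    qed
    finally show "gagliardo s u \<le> ennreal ((K1 + 4 * K0) * (Hs_norm e s u)\<^sup>2)" .
  qed
qed

end

section \<open>Stability of the seminorm from local estimates\<close>

lemma AE_lborel_shift:
  fixes a :: "'a::euclidean_space"
  assumes "AE x in lborel. P x"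
  shows "AE x in lborel. P (x + a)"
proof -
  obtain N where N: "\<And>x. x \<in> space lborel - N \<Longrightarrow> P x" "N \<in> null_sets lborel"
    using AE_E3[OF assms] by metis
  then have [measurable]: "N \<in> sets borel" and e: "emeasure lborel N = 0" by auto
  let ?M = "{x. x + a \<in> N}"
  have [measurable]: "?M \<in> sets borel" by measurable
  have "emeasure lborel ?M = (\<integral>\<^sup>+x. indicator N (x + a) \<partial>lborel)"
  proof -
    have "emeasure lborel ?M = (\<integral>\<^sup>+x. indicator ?M x \<partial>lborel)" by simp
    also have "\<dots> = (\<integral>\<^sup>+x. indicator N (x + a) \<partial>lborel)"
      by (intro nn_integral_cong) (simp add: indicator_def)
    finally show ?thesis .
  qed
  also have "\<dots> = emeasure lborel N" by (subst nn_integral_lborel_shift) auto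
  finally have "?M \<in> null_sets lborel" using e by auto
  then show ?thesis by (rule AE_I') (use N in auto)
qed

lemma ennreal_sq_diff_le:
  "ennreal ((norm (a - b :: 'a::real_normed_vector))\<^sup>2)
    \<le> 2 * ennreal ((norm (a - c))\<^sup>2) + 2 * ennreal ((norm (b - c))\<^sup>2)"
proof -
  have "(norm (a - b))\<^sup>2 \<le> 2 * (norm (a - c))\<^sup>2 + 2 * (norm (b - c))\<^sup>2"
  proof -
    have "(norm (a - b))\<^sup>2 \<le> (norm (a - c) + norm (b - c))\<^sup>2"
      using norm_triangle_ineq4[of "a - c" "b - c"] by (intro power_mono) simp_all
    also have "\<dots> \<le> 2 * (norm (a - c))\<^sup>2 + 2 * (norm (b - c))\<^sup>2"
      using zero_le_power2[of "norm (a - c) - norm (b - c)"] by (simp add: power2_eq_square algebra_simps)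
    finally show ?thesis .
  qed
  then have "ennreal ((norm (a - b))\<^sup>2) \<le> ennreal (2 * (norm (a - c))\<^sup>2 + 2 * (norm (b - c))\<^sup>2)"
    by (rule ennreal_leI)
  then show ?thesis by (simp add: ennreal_plus ennreal_mult)
qed

context lattice_basis begin

text \<open>Not divided by the volume of the ball: the factors \<open>1 / h ^ CARD('n)\<close> in
  the estimates below supply this normalisation, up to constants.\<close>

definition ball_osc :: "real \<Rightarrow> 'n form \<Rightarrow> 'n point \<Rightarrow> ennreal" where
  "ball_osc r u y = (\<integral>\<^sup>+q\<in>cball 0 r. ennreal ((norm (u (y + q) - u y))\<^sup>2) \<partial>lborel)"

lemma ball_osc_measurable [measurable]:
  assumes [measurable]: "u \<in> borel_measurable borel"
  shows "ball_osc r u \<in> borel_measurable borel"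
proof -
  have [measurable]: "cball (0::'n point) r \<in> sets borel" by simp
  show ?thesis unfolding ball_osc_def by measurable
qed

lemma nn_integral_FD_ball_osc:
  assumes [measurable]: "u \<in> borel_measurable borel"
  shows "(\<integral>\<^sup>+y\<in>FD. ball_osc r u y \<partial>lborel) = (\<integral>\<^sup>+q\<in>cball 0 r. transl_diff u q \<partial>lborel)"
proof -
  have [measurable]: "cball (0::'n point) r \<in> sets borel" by simp
  have "(\<integral>\<^sup>+y\<in>FD. ball_osc r u y \<partial>lborel)
    = (\<integral>\<^sup>+y. (\<integral>\<^sup>+q. ennreal ((norm (u (y + q) - u y))\<^sup>2) * indicator (cball 0 r) q * indicator FD y \<partial>lborel) \<partial>lborel)"
    by (simp add: ball_osc_def nn_integral_multc)
  also have "\<dots> = (\<integral>\<^sup>+q. (\<integral>\<^sup>+y. ennreal ((norm (u (y + q) - u y))\<^sup>2) * indicator (cball 0 r) q * indicator FD y \<partial>lborel) \<partial>lborel)"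
    by (rule lborel_pair.Fubini') measurable
  also have "\<dots> = (\<integral>\<^sup>+q. (\<integral>\<^sup>+y. ennreal ((norm (u (y + q) - u y))\<^sup>2) * indicator FD y * indicator (cball 0 r) q \<partial>lborel) \<partial>lborel)"
    by (simp add: mult_ac)
  also have "\<dots> = (\<integral>\<^sup>+q\<in>cball 0 r. transl_diff u q \<partial>lborel)"
    by (simp add: transl_diff_def nn_integral_multc)
  finally show ?thesis .
qed

text \<open>On the ball the kernel is at least its value at radius \<open>r\<close>. For
  \<open>r\<close> proportional to \<open>h\<close>, the volume accounts for
  \<open>h ^ CARD('n)\<close> and the remaining \<open>h powr (2 * s)\<close> is the gain from
  regularity.\<close>

lemma ball_transl_diff_le:
  assumes [measurable]: "u \<in> borel_measurable borel" and r: "r > 0" and s: "s \<ge> 0"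
  shows "(\<integral>\<^sup>+q\<in>cball 0 r. transl_diff u q \<partial>lborel) \<le> ennreal (r powr (real CARD('n) + 2 * s)) * gagliardo s u"
proof -
  let ?\<alpha> = "real CARD('n) + 2 * s"
  have "(\<integral>\<^sup>+q\<in>cball 0 r. transl_diff u q \<partial>lborel)
    \<le> (\<integral>\<^sup>+q. ennreal (r powr ?\<alpha>) * (transl_diff u q * ennreal (norm q powr - ?\<alpha>)) \<partial>lborel)"
  proof (rule nn_integral_mono)
    fix q :: "'n point"
    show "transl_diff u q * indicator (cball 0 r) q \<le> ennreal (r powr ?\<alpha>) * (transl_diff u q * ennreal (norm q powr - ?\<alpha>))"
    proof (cases "q = 0 \<or> norm q > r")
      \<comment> \<open>At \<open>q = 0\<close> the kernel evaluates to \<open>0\<close>, not to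
        infinity, but the translation difference is \<open>0\<close> there as well.\<close>
      case True
      then show ?thesis by (auto simp: transl_diff_def indicator_def)
    next
      case False
      then have q: "0 < norm q" "norm q \<le> r" by auto
      have "1 = norm q powr ?\<alpha> * norm q powr - ?\<alpha>" using q by (simp flip: powr_add)
      also have "\<dots> \<le> r powr ?\<alpha> * norm q powr - ?\<alpha>"
        using q s by (intro mult_right_mono powr_mono2) auto
      finally have "ennreal 1 \<le> ennreal (r powr ?\<alpha> * norm q powr - ?\<alpha>)" by (rule ennreal_leI)
      then have "transl_diff u q * 1 \<le> transl_diff u q * (ennreal (r powr ?\<alpha>) * ennreal (norm q powr - ?\<alpha>))"
        by (intro mult_left_mono) (simp_all add: ennreal_mult)
      then show ?thesis using q by (simp add: mult_ac)
    qed
  qed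
  also have "\<dots> = ennreal (r powr ?\<alpha>) * gagliardo s u"
    unfolding gagliardo_def by (rule nn_integral_cmult) measurable
  finally show ?thesis .
qed

text \<open>The hypothesis allows every \<open>c\<close>, so \<open>c = u (x + q)\<close> may be
  averaged over \<open>norm q \<le> h\<close>. Splitting \<open>v (x + w) - u (x + q)\<close> at
  \<open>u (x + w)\<close> leaves \<open>v - u\<close> and an oscillation of \<open>u\<close>; its
  radius is \<open>(R + 1) * h\<close> because \<open>norm (q - w)\<close> can reach that.\<close>

lemma transl_diff_mono_const:
  fixes u v :: "'n form" and K :: "'n point \<Rightarrow> ennreal"
  assumes [measurable]: "u \<in> borel_measurable borel" "v \<in> borel_measurable borel" "K \<in> borel_measurable borel"
    and h: "h > 0" "R \<ge> 0"
    and D: "AE x in lborel. \<forall>c. ennreal ((norm (v (x + z) - v x))\<^sup>2)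
      \<le> K x * (\<integral>\<^sup>+w\<in>cball 0 (R * h). ennreal ((norm (v (x + w) - c))\<^sup>2) \<partial>lborel)"
    and g_def: "g = (\<lambda>y. 2 * ennreal ((norm (v y - u y))\<^sup>2)
      + 2 * ennreal (1 / (unit_ball_vol CARD('n) * h ^ CARD('n))) * ball_osc ((R + 1) * h) u y)"
  shows "AE x in lborel. ennreal ((norm (v (x + z) - v x))\<^sup>2)
    \<le> K x * (\<integral>\<^sup>+w\<in>cball 0 (R * h). g (x + w) \<partial>lborel)"
  using D
proof eventually_elim
  case (elim x)
  have [measurable]: "cball (0::'n point) r \<in> sets borel" for r by simp
  define V where "V = unit_ball_vol CARD('n) * h ^ CARD('n)"
  have V: "V > 0" using h by (simp add: V_def)
  have [measurable]: "g \<in> borel_measurable borel" unfolding g_def by measurable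
  let ?d = "ennreal ((norm (v (x + z) - v x))\<^sup>2)"
  have emV: "emeasure lborel (cball (0::'n point) h) = ennreal V"
    using h by (simp add: emeasure_cball V_def)
  have "?d * ennreal V = (\<integral>\<^sup>+q\<in>cball 0 h. ?d \<partial>(lborel :: 'n point measure))"
    by (subst nn_integral_cmult_indicator) (simp_all add: emV)
  also have "\<dots> \<le> (\<integral>\<^sup>+q\<in>cball 0 h. K x * (\<integral>\<^sup>+w\<in>cball 0 (R * h). ennreal ((norm (v (x + w) - u (x + q)))\<^sup>2) \<partial>lborel) \<partial>lborel)"
    by (rule nn_integral_mono, rule mult_right_mono) (use elim in auto)
  also have "\<dots> = K x * (\<integral>\<^sup>+q. (\<integral>\<^sup>+w. ennreal ((norm (v (x + w) - u (x + q)))\<^sup>2) * indicator (cball 0 (R * h)) w * indicator (cball 0 h) q \<partial>lborel) \<partial>lborel)"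
  proof -
    have "(\<integral>\<^sup>+w. ennreal ((norm (v (x + w) - u (x + q)))\<^sup>2) * indicator (cball 0 (R * h)) w * indicator (cball 0 h) q \<partial>lborel)
      = (\<integral>\<^sup>+w\<in>cball 0 (R * h). ennreal ((norm (v (x + w) - u (x + q)))\<^sup>2) \<partial>lborel) * indicator (cball 0 h) q" for q
      by (rule nn_integral_multc) measurable
    then show ?thesis by (simp add: mult.assoc nn_integral_cmult)
  qed
  also have "(\<integral>\<^sup>+q. (\<integral>\<^sup>+w. ennreal ((norm (v (x + w) - u (x + q)))\<^sup>2) * indicator (cball 0 (R * h)) w * indicator (cball 0 h) q \<partial>lborel) \<partial>lborel)
    = (\<integral>\<^sup>+w. (\<integral>\<^sup>+q. ennreal ((norm (v (x + w) - u (x + q)))\<^sup>2) * indicator (cball 0 (R * h)) w * indicator (cball 0 h) q \<partial>lborel) \<partial>lborel)"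
    by (rule lborel_pair.Fubini') measurable
  also have "\<dots> \<le> (\<integral>\<^sup>+w\<in>cball 0 (R * h). ennreal V * g (x + w) \<partial>lborel)"
  proof (rule nn_integral_mono)
    fix w :: "'n point"
    show "(\<integral>\<^sup>+q. ennreal ((norm (v (x + w) - u (x + q)))\<^sup>2) * indicator (cball 0 (R * h)) w * indicator (cball 0 h) q \<partial>lborel)
      \<le> ennreal V * g (x + w) * indicator (cball 0 (R * h)) w"
    proof (cases "norm w \<le> R * h")
      case False then show ?thesis by (simp add: indicator_def)
    next
      case True
      let ?a = "ennreal ((norm (v (x + w) - u (x + w)))\<^sup>2)"
      have "(\<integral>\<^sup>+q. ennreal ((norm (v (x + w) - u (x + q)))\<^sup>2) * indicator (cball 0 h) q \<partial>lborel)
        \<le> (\<integral>\<^sup>+q. 2 * ?a * indicator (cball 0 h) q + 2 * (ennreal ((norm (u (x + q) - u (x + w)))\<^sup>2) * indicator (cball 0 h) q) \<partial>lborel)"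
      proof (rule nn_integral_mono)
        fix q
        show "ennreal ((norm (v (x + w) - u (x + q)))\<^sup>2) * indicator (cball 0 h) q
          \<le> 2 * ?a * indicator (cball 0 h) q + 2 * (ennreal ((norm (u (x + q) - u (x + w)))\<^sup>2) * indicator (cball 0 h) q)"
          using ennreal_sq_diff_le[of "v (x + w)" "u (x + q)" "u (x + w)"] by (simp add: indicator_def)
      qed
      also have "\<dots> = 2 * ?a * ennreal V + 2 * (\<integral>\<^sup>+q. ennreal ((norm (u (x + q) - u (x + w)))\<^sup>2) * indicator (cball 0 h) q \<partial>lborel)"
        by (subst nn_integral_add) (auto simp: nn_integral_cmult nn_integral_cmult_indicator emV)
      also have "(\<integral>\<^sup>+q. ennreal ((norm (u (x + q) - u (x + w)))\<^sup>2) * indicator (cball 0 h) q \<partial>lborel)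
        = (\<integral>\<^sup>+q. ennreal ((norm (u (x + (q + w)) - u (x + w)))\<^sup>2) * indicator (cball 0 h) (q + w) \<partial>lborel)"
        by (subst nn_integral_lborel_shift[of "\<lambda>q. ennreal ((norm (u (x + q) - u (x + w)))\<^sup>2) * indicator (cball 0 h) q" w]) simp_all
      also have "\<dots> \<le> ball_osc ((R + 1) * h) u (x + w)"
        unfolding ball_osc_def
      proof (rule nn_integral_mono)
        fix q
        have "norm q \<le> (R + 1) * h" if "norm (q + w) \<le> h"
          using that True norm_triangle_ineq4[of "q + w" w] by (simp add: algebra_simps)
        then show "ennreal ((norm (u (x + (q + w)) - u (x + w)))\<^sup>2) * indicator (cball 0 h) (q + w)
          \<le> ennreal ((norm (u (x + w + q) - u (x + w)))\<^sup>2) * indicator (cball 0 ((R + 1) * h)) q"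
          by (auto simp: indicator_def add_ac)
      qed
      finally have *: "(\<integral>\<^sup>+q. ennreal ((norm (v (x + w) - u (x + q)))\<^sup>2) * indicator (cball 0 h) q \<partial>lborel)
        \<le> 2 * ?a * ennreal V + 2 * ball_osc ((R + 1) * h) u (x + w)" by (simp add: mult_left_mono)
      have "ennreal V * ennreal (1 / V) = 1" using V by (simp add: ennreal_mult[symmetric])
      moreover have "ennreal V * g (x + w) = 2 * ?a * ennreal V + ennreal V * ennreal (1 / V) * (2 * ball_osc ((R + 1) * h) u (x + w))"
        unfolding g_def V_def[symmetric] by (simp only: distrib_left mult_ac)
      ultimately have "ennreal V * g (x + w) = 2 * ?a * ennreal V + 2 * ball_osc ((R + 1) * h) u (x + w)"
        by simp
      then show ?thesis using * True by simp
    qed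
  qed
  also have "\<dots> = ennreal V * (\<integral>\<^sup>+w\<in>cball 0 (R * h). g (x + w) \<partial>lborel)"
    by (simp add: mult.assoc nn_integral_cmult)
  finally have "?d * ennreal V \<le> K x * (ennreal V * (\<integral>\<^sup>+w\<in>cball 0 (R * h). g (x + w) \<partial>lborel))"
    by (simp add: mult_left_mono)
  then have "?d * ennreal V * ennreal (1 / V) \<le> K x * (ennreal V * (\<integral>\<^sup>+w\<in>cball 0 (R * h). g (x + w) \<partial>lborel)) * ennreal (1 / V)"
    by (rule mult_right_mono) simp
  moreover have "ennreal V * ennreal (1 / V) = 1" using V by (simp add: ennreal_mult[symmetric])
  moreover have "?d * ennreal V * ennreal (1 / V) = ?d * (ennreal V * ennreal (1 / V))"
    "K x * (ennreal V * (\<integral>\<^sup>+w\<in>cball 0 (R * h). g (x + w) \<partial>lborel)) * ennreal (1 / V)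
      = K x * (\<integral>\<^sup>+w\<in>cball 0 (R * h). g (x + w) \<partial>lborel) * (ennreal V * ennreal (1 / V))"
    by (simp_all only: mult_ac)
  ultimately show ?case by simp
qed

text \<open>Exchanging the integrals moves the indicator to \<open>x - w\<close> while
  \<open>g\<close> sits at \<open>x\<close>; the vectors \<open>w\<close> that qualify have the
  measure of \<open>B\<close> in the ball about \<open>x\<close>. A small density of
  \<open>B\<close> at scale \<open>r\<close> thus passes to the integral, although \<open>g\<close>
  need not be small on \<open>B\<close>.\<close>

lemma nn_integral_FD_bad:
  fixes g :: "'n point \<Rightarrow> ennreal"
  assumes [measurable]: "g \<in> borel_measurable borel" "B \<in> sets borel"
    and per: "periodic e g" "periodic e (\<lambda>x. x \<in> B)"
    and B: "\<And>y. emeasure lborel (B \<inter> cball y r) \<le> b"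
  shows "(\<integral>\<^sup>+x\<in>FD. indicator B x * (\<integral>\<^sup>+w\<in>cball 0 r. g (x + w) \<partial>lborel) \<partial>lborel) \<le> b * (\<integral>\<^sup>+x\<in>FD. g x \<partial>lborel)"
proof -
  have [measurable]: "cball (0::'n point) r \<in> sets borel" by simp
  have "(\<integral>\<^sup>+x\<in>FD. indicator B x * (\<integral>\<^sup>+w\<in>cball 0 r. g (x + w) \<partial>lborel) \<partial>lborel)
    = (\<integral>\<^sup>+x. (\<integral>\<^sup>+w. indicator B x * (g (x + w) * indicator (cball 0 r) w) * indicator FD x \<partial>lborel) \<partial>lborel)"
    by (simp add: nn_integral_cmult nn_integral_multc)
  also have "\<dots> = (\<integral>\<^sup>+w. (\<integral>\<^sup>+x. indicator B x * (g (x + w) * indicator (cball 0 r) w) * indicator FD x \<partial>lborel) \<partial>lborel)"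
    by (rule lborel_pair.Fubini') measurable
  also have "\<dots> = (\<integral>\<^sup>+w. (\<integral>\<^sup>+x. indicator B (x - w) * (g x * indicator (cball 0 r) w) * indicator FD x \<partial>lborel) \<partial>lborel)"
  proof (rule nn_integral_cong)
    fix w
    have "(\<integral>\<^sup>+x\<in>FD. (indicator B (x + w - w) * g (x + w)) * indicator (cball 0 r) w \<partial>lborel)
      = (\<integral>\<^sup>+x\<in>FD. (indicator B (x - w) * g x) * indicator (cball 0 r) w \<partial>lborel)"
    proof (rule nn_integral_FD_shift)
      show "periodic e (\<lambda>x. indicator B (x - w) * g x * indicator (cball 0 r) w)"
        unfolding periodic_def
      proof safe
        fix l x assume l: "l \<in> L"
        have "x - w + l \<in> B \<longleftrightarrow> x - w \<in> B" using periodicD[OF per(2) l] by simp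
        then have "indicator B (x + l - w) = (indicator B (x - w) :: ennreal)" by (simp add: indicator_def algebra_simps)
        then show "indicator B (x + l - w) * g (x + l) * indicator (cball 0 r) w = indicator B (x - w) * g x * indicator (cball 0 r) w"
          using periodicD[OF per(1) l] by simp
      qed
    qed measurable
    then show "(\<integral>\<^sup>+x. indicator B x * (g (x + w) * indicator (cball 0 r) w) * indicator FD x \<partial>lborel)
      = (\<integral>\<^sup>+x. indicator B (x - w) * (g x * indicator (cball 0 r) w) * indicator FD x \<partial>lborel)"
      by (simp add: mult.assoc)
  qed
  also have "\<dots> = (\<integral>\<^sup>+x. (\<integral>\<^sup>+w. indicator B (x - w) * (g x * indicator (cball 0 r) w) * indicator FD x \<partial>lborel) \<partial>lborel)"
    by (rule lborel_pair.Fubini') measurable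
  also have "\<dots> \<le> (\<integral>\<^sup>+x. b * (g x * indicator FD x) \<partial>lborel)"
  proof (rule nn_integral_mono)
    fix x
    have "(\<integral>\<^sup>+w. indicator B (x - w) * (g x * indicator (cball 0 r) w) * indicator FD x \<partial>lborel)
      = (\<integral>\<^sup>+w. indicator B (x - w) * indicator (cball 0 r) w * (g x * indicator FD x) \<partial>lborel)"
      by (simp add: mult_ac)
    also have "\<dots> = (\<integral>\<^sup>+w. indicator B (x - w) * indicator (cball 0 r) w \<partial>lborel) * (g x * indicator FD x)"
      by (rule nn_integral_multc) measurable
    also have "(\<integral>\<^sup>+w. indicator B (x - w) * indicator (cball 0 r) w \<partial>lborel)
      = (\<integral>\<^sup>+w. indicator B (x - w) * indicator (cball 0 r) (x - (x - w)) \<partial>lborel)" by simp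
    also have "\<dots> = (\<integral>\<^sup>+w. indicator B w * indicator (cball 0 r) (x - w) \<partial>lborel)"
      by (rule nn_integral_lborel_minus[of "\<lambda>w. indicator B w * indicator (cball 0 r) (x - w)" x]) measurable
    also have "\<dots> = (\<integral>\<^sup>+w. indicator (B \<inter> cball x r) w \<partial>lborel)"
      by (intro nn_integral_cong) (auto simp: indicator_def dist_norm norm_minus_commute)
    also have "\<dots> = emeasure lborel (B \<inter> cball x r)" by (rule nn_integral_indicator) auto
    finally show "(\<integral>\<^sup>+w. indicator B (x - w) * (g x * indicator (cball 0 r) w) * indicator FD x \<partial>lborel) \<le> b * (g x * indicator FD x)"
      using B[of x] by (simp add: mult_right_mono)
  qed
  also have "\<dots> = b * (\<integral>\<^sup>+x\<in>FD. g x \<partial>lborel)" by (rule nn_integral_cmult) measurable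
  finally show ?thesis .
qed

end

context lattice_basis begin

lemma nn_integral_ball_shift_le:
  fixes F :: "'n point \<Rightarrow> ennreal"
  assumes [measurable]: "F \<in> borel_measurable borel" and z: "norm z \<le> h"
  shows "(\<integral>\<^sup>+w\<in>cball 0 (R * h). F (x + z + w) \<partial>lborel) \<le> (\<integral>\<^sup>+w\<in>cball 0 ((R + 1) * h). F (x + w) \<partial>lborel)"
proof -
  have [measurable]: "cball (0::'n point) r \<in> sets borel" for r by simp
  have "(\<integral>\<^sup>+w\<in>cball 0 (R * h). F (x + z + w) \<partial>lborel)
    = (\<integral>\<^sup>+w. F (x + (w + z)) * indicator (cball 0 (R * h)) ((w + z) - z) \<partial>lborel)"
    by (simp add: add_ac)
  also have "\<dots> = (\<integral>\<^sup>+w. F (x + w) * indicator (cball 0 (R * h)) (w - z) \<partial>lborel)"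
    by (rule nn_integral_lborel_shift) measurable
  also have "\<dots> \<le> (\<integral>\<^sup>+w\<in>cball 0 ((R + 1) * h). F (x + w) \<partial>lborel)"
  proof (rule nn_integral_mono)
    fix w
    have "norm w \<le> (R + 1) * h" if "norm (w - z) \<le> R * h"
      using that z norm_triangle_ineq[of "w - z" z] by (simp add: algebra_simps)
    then show "F (x + w) * indicator (cball 0 (R * h)) (w - z) \<le> F (x + w) * indicator (cball 0 ((R + 1) * h)) w"
      by (auto simp: indicator_def)
  qed
  finally show ?thesis .
qed

text \<open>The kernel with the smaller exponent is dominated by the other one only for
  \<open>norm z \<le> 1\<close>; beyond, the L2 norm takes over.\<close>

lemma gagliardo_mono_exponent:
  assumes s: "0 < s" "s < s'" and u: "u \<in> L2_forms e"
  shows "gagliardo s u \<le> gagliardo s' u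
    + ennreal (4 * (unit_ball_vol CARD('n) * 2 ^ CARD('n) / (1 - 2 powr - (2 * s)))) * ennreal ((L2_form_norm e u)\<^sup>2)"
proof -
  define K where "K = unit_ball_vol CARD('n) * 2 ^ CARD('n) / (1 - 2 powr - (2 * s))"
  have K: "K \<ge> 0" using s unfolding K_def by (intro divide_nonneg_nonneg mult_nonneg_nonneg) (auto simp: powr_less_one less_imp_le)
  note [measurable] = L2_formsD(2)[OF u]
  let ?\<alpha> = "real CARD('n) + 2 * s"
  have "gagliardo s u \<le> (\<integral>\<^sup>+z. transl_diff u z * ennreal (norm z powr - (real CARD('n) + 2 * s'))
      + ennreal (4 * (L2_form_norm e u)\<^sup>2) * (ennreal (norm z powr - ?\<alpha>) * indicator {z. 1 \<le> norm z} z) \<partial>lborel)"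
    unfolding gagliardo_def
  proof (rule nn_integral_mono)
    fix z :: "'n point"
    let ?A = "transl_diff u z * ennreal (norm z powr - ?\<alpha>)"
    let ?B = "transl_diff u z * ennreal (norm z powr - (real CARD('n) + 2 * s'))"
    let ?C = "ennreal (4 * (L2_form_norm e u)\<^sup>2) * (ennreal (norm z powr - ?\<alpha>) * indicator {z. 1 \<le> norm z} z)"
    consider "norm z \<ge> 1" | "z \<noteq> 0" "norm z \<le> 1" | "z = 0" by fastforce
    then show "?A \<le> ?B + ?C"
    proof cases
      case 1
      then have "?A \<le> ?C" using mult_right_mono[OF transl_diff_le[OF u, of z], of "ennreal (norm z powr - ?\<alpha>)"] by simp
      then show ?thesis by (rule order_trans) simp
    next
      case 2
      then have "norm z powr - ?\<alpha> \<le> norm z powr - (real CARD('n) + 2 * s')"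
        using s by (intro powr_mono') auto
      then have "?A \<le> ?B" by (intro mult_left_mono ennreal_leI) auto
      then show ?thesis by (rule order_trans) simp
    qed simp
  qed
  also have "\<dots> = gagliardo s' u + ennreal (4 * (L2_form_norm e u)\<^sup>2) * (\<integral>\<^sup>+z\<in>{z. 1 \<le> norm z}. ennreal (norm z powr - ?\<alpha>) \<partial>(lborel :: 'n point measure))"
    unfolding gagliardo_def by (subst nn_integral_add) (auto simp: nn_integral_cmult)
  also have "\<dots> \<le> gagliardo s' u + ennreal (4 * (L2_form_norm e u)\<^sup>2) * ennreal K"
  proof (intro add_mono mult_left_mono order_refl)
    have "(\<integral>\<^sup>+z\<in>{z. 1 \<le> norm z}. ennreal (norm (z :: 'n point) powr - (DIM('n point) + 2 * s)) \<partial>lborel)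
        \<le> ennreal (unit_ball_vol DIM('n point) * 2 ^ DIM('n point) / (1 - 2 powr - (2 * s)) * 1 powr - (2 * s))"
      using s by (intro nn_integral_powr_outside_ball) auto
    then show "(\<integral>\<^sup>+z\<in>{z. 1 \<le> norm z}. ennreal (norm z powr - ?\<alpha>) \<partial>(lborel :: 'n point measure)) \<le> ennreal K"
      by (simp add: K_def)
  qed simp
  also have "ennreal (4 * (L2_form_norm e u)\<^sup>2) * ennreal K = ennreal (4 * K) * ennreal ((L2_form_norm e u)\<^sup>2)"
    using K by (simp add: ennreal_mult[symmetric] mult_ac)
  finally show ?thesis unfolding K_def .
qed

text \<open>At good points \<open>diff\<close> gives decay in \<open>norm z / h\<close>; at bad ones
  \<open>v (x + z)\<close> and \<open>v x\<close> are bounded separately by \<open>val\<close>.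
  After integration with \<open>nn_integral_FD_bad\<close> both contributions are linear in
  \<open>norm z / h\<close>.\<close>

lemma transl_diff_near:
  assumes u: "u \<in> L2_forms e" and v: "v \<in> L2_forms e" and h: "0 < h" and C: "C \<ge> 0" "R \<ge> 1" and s': "s' \<ge> 0"
    and approx: "(\<integral>\<^sup>+x\<in>FD. ennreal ((norm (v x - u x))\<^sup>2) \<partial>lborel)
      \<le> ennreal (C / h ^ CARD('n)) * (\<integral>\<^sup>+q\<in>cball 0 (R * h). transl_diff u q \<partial>lborel)"
    and val: "AE x in lborel. \<forall>c. ennreal ((norm (v x - c))\<^sup>2)
      \<le> ennreal (C / h ^ CARD('n)) * (\<integral>\<^sup>+w\<in>cball 0 (R * h). ennreal ((norm (v (x + w) - c))\<^sup>2) \<partial>lborel)"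
    and z: "norm z \<le> h"
    and diff: "AE x in lborel. x \<notin> bad \<longrightarrow> (\<forall>c. ennreal ((norm (v (x + z) - v x))\<^sup>2)
      \<le> ennreal (C * (norm z / h)\<^sup>2 / h ^ CARD('n)) * (\<integral>\<^sup>+w\<in>cball 0 (R * h). ennreal ((norm (v (x + w) - c))\<^sup>2) \<partial>lborel))"
    and bad [measurable]: "bad \<in> sets borel" and bad_per: "periodic e (\<lambda>x. x \<in> bad)"
    and bad_meas: "\<And>y. emeasure lborel (bad \<inter> cball y ((R + 1) * h)) \<le> ennreal (C * (norm z / h) * h ^ CARD('n))"
  defines "\<omega> \<equiv> unit_ball_vol CARD('n)"
  defines "C\<Gamma> \<equiv> (2 * C + 2 / \<omega>) * (R + 2) powr (real CARD('n) + 2 * s')"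
  shows "transl_diff v z \<le> ennreal (4 * C * (\<omega> * (R + 1) ^ CARD('n) + C) * C\<Gamma> * h powr (2 * s') * (norm z / h)) * gagliardo s' u"
    and "(\<integral>\<^sup>+x\<in>FD. ennreal ((norm (v x - u x))\<^sup>2) \<partial>lborel) \<le> ennreal (C\<Gamma> * h powr (2 * s')) * gagliardo s' u"
proof -
  note [measurable] = L2_formsD(2)[OF u] L2_formsD(2)[OF v]
  have [measurable]: "cball (0::'n point) r \<in> sets borel" for r by simp
  let ?n = "CARD('n)"
  have w: "\<omega> > 0" by (simp add: \<omega>_def)
  define t where "t = norm z / h"
  have t: "0 \<le> t" "t \<le> 1" using z h by (simp_all add: t_def)
  \<comment> \<open>Up to the common factor, weight \<open>t\<close> at good points and at least
    \<open>1\<close> at bad ones; the \<open>4\<close> comes from the two-term splitting at bad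
    points.\<close>
  define K where "K x = ennreal (4 * C / h ^ ?n) * (ennreal t + indicator bad x)" for x
  \<comment> \<open>The radius is \<open>R + 2\<close> in units of \<open>h\<close>: the shift by
    \<open>z\<close> costs one unit, the averaging over constants another.\<close>
  define g where "g = (\<lambda>y. 2 * ennreal ((norm (v y - u y))\<^sup>2)
      + 2 * ennreal (1 / (\<omega> * h ^ ?n)) * ball_osc ((R + 1 + 1) * h) u y)"
  define G where "G x = (\<integral>\<^sup>+w\<in>cball 0 ((R + 1) * h). g (x + w) \<partial>lborel)" for x
  have [measurable]: "g \<in> borel_measurable borel" unfolding g_def by measurable
  have [measurable]: "G \<in> borel_measurable borel" unfolding G_def by measurable
  have per_g: "periodic e g"
    unfolding periodic_def
  proof safe
    fix l x assume l: "l \<in> L"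
    have "u (x + l + q) = u (x + q)" for q
      using periodicD[OF L2_formsD(1)[OF u] l, of "x + q"] by (simp add: add_ac)
    moreover have "u (x + l) = u x" "v (x + l) = v x"
      using periodicD[OF _ l] L2_formsD(1)[OF u] L2_formsD(1)[OF v] by auto
    ultimately show "g (x + l) = g x" by (simp add: g_def ball_osc_def)
  qed
  have pt: "AE x in lborel. ennreal ((norm (v (x + z) - v x))\<^sup>2) \<le> K x * G x"
    unfolding G_def
  proof (rule transl_diff_mono_const[where R="R + 1" and h=h and u=u])
    show "AE x in lborel. \<forall>c. ennreal ((norm (v (x + z) - v x))\<^sup>2)
      \<le> K x * (\<integral>\<^sup>+w\<in>cball 0 ((R + 1) * h). ennreal ((norm (v (x + w) - c))\<^sup>2) \<partial>lborel)"
      using val AE_lborel_shift[OF val, of z] diff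
    proof eventually_elim
      case (elim x)
      show ?case
      proof
        fix c
        define I where "I = (\<integral>\<^sup>+w\<in>cball 0 ((R + 1) * h). ennreal ((norm (v (x + w) - c))\<^sup>2) \<partial>lborel)"
        have I0: "(\<integral>\<^sup>+w\<in>cball 0 (R * h). ennreal ((norm (v (x + w) - c))\<^sup>2) \<partial>lborel) \<le> I"
          using nn_integral_ball_shift_le[of "\<lambda>y. ennreal ((norm (v y - c))\<^sup>2)" 0 h x R] h by (simp add: I_def)
        have Iz: "(\<integral>\<^sup>+w\<in>cball 0 (R * h). ennreal ((norm (v (x + z + w) - c))\<^sup>2) \<partial>lborel) \<le> I"
          using nn_integral_ball_shift_le[of "\<lambda>y. ennreal ((norm (v y - c))\<^sup>2)" z h x R] z by (simp add: I_def)
        show "ennreal ((norm (v (x + z) - v x))\<^sup>2) \<le> K x * I"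
        proof (cases "x \<in> bad")
          case False
          then have "ennreal ((norm (v (x + z) - v x))\<^sup>2) \<le> ennreal (C * t\<^sup>2 / h ^ ?n) * I"
            using elim(3) I0 unfolding t_def by (meson mult_left_mono order_trans zero_le)
          \<comment> \<open>The square of \<open>t\<close> is given away, since the bad points allow
            no more than its first power.\<close>
          also have "\<dots> \<le> ennreal (4 * C / h ^ ?n * t) * I"
          proof (intro mult_right_mono ennreal_leI)
            have "t\<^sup>2 \<le> 4 * t" using t by (simp add: power2_eq_square mult_right_mono)
            then have "C / h ^ ?n * t\<^sup>2 \<le> C / h ^ ?n * (4 * t)" using C h by (intro mult_left_mono) auto
            then show "C * t\<^sup>2 / h ^ ?n \<le> 4 * C / h ^ ?n * t" by (simp add: mult_ac)
          qed simp
          also have "ennreal (4 * C / h ^ ?n * t) = ennreal (4 * C / h ^ ?n) * ennreal t"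
            by (rule ennreal_mult) (use C h t in auto)
          also have "ennreal (4 * C / h ^ ?n) * ennreal t * I = K x * I" using False by (simp add: K_def)
          finally show ?thesis .
        next
          case True
          have "ennreal ((norm (v (x + z) - v x))\<^sup>2) \<le> 2 * ennreal ((norm (v (x + z) - c))\<^sup>2) + 2 * ennreal ((norm (v x - c))\<^sup>2)"
            by (rule ennreal_sq_diff_le)
          also have "\<dots> \<le> 2 * (ennreal (C / h ^ ?n) * I) + 2 * (ennreal (C / h ^ ?n) * I)"
            by (intro add_mono mult_left_mono order_trans[OF elim(1)[rule_format, of c]] order_trans[OF elim(2)[rule_format, of c]] I0 Iz) auto
          also have "\<dots> = (2 + 2) * (ennreal (C / h ^ ?n) * I)" by (simp only: distrib_right)
          also have "\<dots> = 4 * ennreal (C / h ^ ?n) * I" by (simp add: mult.assoc)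
          also have "4 * ennreal (C / h ^ ?n) = ennreal (4 * (C / h ^ ?n))"
            using C h by (subst ennreal_mult) auto
          also have "4 * (C / h ^ ?n) = 4 * C / h ^ ?n" by simp
          also have "ennreal (4 * C / h ^ ?n) * I \<le> K x * I" using True unfolding K_def by (intro mult_right_mono) (auto simp: distrib_left)
          finally show ?thesis .
        qed
      qed
    qed
  qed (use C h in \<open>auto simp: g_def \<omega>_def K_def[abs_def]\<close>)
  define \<Gamma> where "\<Gamma> = (\<integral>\<^sup>+x\<in>FD. g x \<partial>lborel)"
  \<comment> \<open>The density lemma with the whole space as exceptional set gives the total mass;
    the factor \<open>t\<close> then comes from the weight \<open>K\<close>, whereas in
    \<open>G2\<close> it comes from the measure of \<open>bad\<close>.\<close>
  have G1: "(\<integral>\<^sup>+x\<in>FD. indicator UNIV x * G x \<partial>lborel) \<le> ennreal (\<omega> * ((R + 1) * h) ^ ?n) * \<Gamma>"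
    unfolding G_def \<Gamma>_def
    by (rule nn_integral_FD_bad) (use per_g C h in \<open>auto simp: periodic_def emeasure_cball \<omega>_def\<close>)
  have G2: "(\<integral>\<^sup>+x\<in>FD. indicator bad x * G x \<partial>lborel) \<le> ennreal (C * t * h ^ ?n) * \<Gamma>"
    unfolding G_def \<Gamma>_def
    by (rule nn_integral_FD_bad) (use per_g bad_per bad_meas in \<open>auto simp: t_def\<close>)
  have "transl_diff v z \<le> (\<integral>\<^sup>+x\<in>FD. K x * G x \<partial>lborel)"
    unfolding transl_diff_def by (rule nn_integral_mono_AE) (use pt in \<open>eventually_elim, simp add: mult_right_mono\<close>)
  also have "\<dots> = (\<integral>\<^sup>+x. ennreal (4 * C / h ^ ?n) * (ennreal t * (indicator UNIV x * G x * indicator FD x) + indicator bad x * G x * indicator FD x) \<partial>lborel)"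
    by (intro nn_integral_cong) (simp add: K_def distrib_left distrib_right mult_ac)
  also have "\<dots> = ennreal (4 * C / h ^ ?n) * (ennreal t * (\<integral>\<^sup>+x\<in>FD. indicator UNIV x * G x \<partial>lborel) + (\<integral>\<^sup>+x\<in>FD. indicator bad x * G x \<partial>lborel))"
    by (simp add: nn_integral_cmult nn_integral_add)
  also have "\<dots> \<le> ennreal (4 * C / h ^ ?n) * (ennreal t * (ennreal (\<omega> * ((R + 1) * h) ^ ?n) * \<Gamma>) + ennreal (C * t * h ^ ?n) * \<Gamma>)"
    by (intro mult_left_mono add_mono G1 G2) auto
  also have "\<dots> = ennreal (4 * C / h ^ ?n) * (ennreal t * ennreal (\<omega> * ((R + 1) * h) ^ ?n) + ennreal (C * t * h ^ ?n)) * \<Gamma>"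
    by (simp only: distrib_right mult.assoc)
  also have "ennreal (4 * C / h ^ ?n) * (ennreal t * ennreal (\<omega> * ((R + 1) * h) ^ ?n) + ennreal (C * t * h ^ ?n))
    = ennreal (4 * C / h ^ ?n * (t * (\<omega> * ((R + 1) * h) ^ ?n) + C * t * h ^ ?n))"
  proof -
    have "0 \<le> 4 * C / h ^ ?n" "0 \<le> \<omega> * ((R + 1) * h) ^ ?n" "0 \<le> C * t * h ^ ?n" using C h t w by auto
    then show ?thesis using t by (simp only: ennreal_mult ennreal_plus mult_nonneg_nonneg add_nonneg_nonneg)
  qed
  also have "4 * C / h ^ ?n * (t * (\<omega> * ((R + 1) * h) ^ ?n) + C * t * h ^ ?n) = 4 * C * (\<omega> * (R + 1) ^ ?n + C) * t"
    using h unfolding power_mult_distrib by (simp add: field_simps)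
  finally have main: "transl_diff v z \<le> ennreal (4 * C * (\<omega> * (R + 1) ^ ?n + C) * t) * \<Gamma>" .
  let ?T = "\<integral>\<^sup>+q\<in>cball 0 ((R + 2) * h). transl_diff u q \<partial>lborel"
  have "\<Gamma> = 2 * (\<integral>\<^sup>+x\<in>FD. ennreal ((norm (v x - u x))\<^sup>2) \<partial>lborel) + 2 * ennreal (1 / (\<omega> * h ^ ?n)) * (\<integral>\<^sup>+x\<in>FD. ball_osc ((R + 1 + 1) * h) u x \<partial>lborel)"
    unfolding \<Gamma>_def g_def by (simp add: distrib_right nn_integral_add mult.assoc nn_integral_cmult)
  also have "\<dots> = 2 * (\<integral>\<^sup>+x\<in>FD. ennreal ((norm (v x - u x))\<^sup>2) \<partial>lborel) + 2 * ennreal (1 / (\<omega> * h ^ ?n)) * ?T"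
    by (subst nn_integral_FD_ball_osc) (simp_all add: add.assoc)
  finally have \<Gamma>: "\<Gamma> = \<dots>" .
  have "(\<integral>\<^sup>+q\<in>cball 0 (R * h). transl_diff u q \<partial>lborel) \<le> ?T"
    using h by (intro nn_integral_mono mult_left_mono indicator_leI) (auto intro: order_trans)
  then have "(\<integral>\<^sup>+x\<in>FD. ennreal ((norm (v x - u x))\<^sup>2) \<partial>lborel) \<le> ennreal (C / h ^ ?n) * ?T"
    using approx by (meson mult_left_mono order_trans zero_le)
  then have "\<Gamma> \<le> 2 * (ennreal (C / h ^ ?n) * ?T) + 2 * ennreal (1 / (\<omega> * h ^ ?n)) * ?T"
    unfolding \<Gamma> by (intro add_mono mult_left_mono) auto
  also have "\<dots> = (2 * ennreal (C / h ^ ?n) + 2 * ennreal (1 / (\<omega> * h ^ ?n))) * ?T"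
    by (simp add: distrib_right mult.assoc)
  also have "2 * ennreal (C / h ^ ?n) + 2 * ennreal (1 / (\<omega> * h ^ ?n)) = ennreal (2 * (C / h ^ ?n) + 2 * (1 / (\<omega> * h ^ ?n)))"
  proof -
    have "0 \<le> C / h ^ ?n" "0 \<le> 1 / (\<omega> * h ^ ?n)" using C h w by auto
    then show ?thesis by (simp only: ennreal_plus ennreal_mult ennreal_numeral mult_nonneg_nonneg zero_le_numeral)
  qed
  also have "2 * (C / h ^ ?n) + 2 * (1 / (\<omega> * h ^ ?n)) = (2 * C + 2 / \<omega>) / h ^ ?n"
    using h w by (simp add: field_simps)
  also have "ennreal ((2 * C + 2 / \<omega>) / h ^ ?n) * ?T
    \<le> ennreal ((2 * C + 2 / \<omega>) / h ^ ?n) * (ennreal (((R + 2) * h) powr (real ?n + 2 * s')) * gagliardo s' u)"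
    using C h s' by (intro mult_left_mono ball_transl_diff_le) auto
  also have "\<dots> = ennreal ((2 * C + 2 / \<omega>) / h ^ ?n * ((R + 2) * h) powr (real ?n + 2 * s')) * gagliardo s' u"
    by (subst ennreal_mult) (use C h w in \<open>auto simp: mult.assoc\<close>)
  also have "(2 * C + 2 / \<omega>) / h ^ ?n * ((R + 2) * h) powr (real ?n + 2 * s') = C\<Gamma> * h powr (2 * s')"
    using h C by (simp add: C\<Gamma>_def powr_mult powr_add powr_realpow)
  finally have \<Gamma>_le: "\<Gamma> \<le> ennreal (C\<Gamma> * h powr (2 * s')) * gagliardo s' u" .
  have "(\<integral>\<^sup>+x\<in>FD. ennreal ((norm (v x - u x))\<^sup>2) \<partial>lborel) \<le> 1 * \<Gamma>"
  proof -
    have "(\<integral>\<^sup>+x\<in>FD. ennreal ((norm (v x - u x))\<^sup>2) \<partial>lborel) \<le> 2 * (\<integral>\<^sup>+x\<in>FD. ennreal ((norm (v x - u x))\<^sup>2) \<partial>lborel)"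
      by (simp flip: one_add_one add: distrib_right)
    then show ?thesis unfolding \<Gamma> by (simp add: add_increasing2)
  qed
  then show "(\<integral>\<^sup>+x\<in>FD. ennreal ((norm (v x - u x))\<^sup>2) \<partial>lborel) \<le> ennreal (C\<Gamma> * h powr (2 * s')) * gagliardo s' u"
    using \<Gamma>_le by simp
  have C\<Gamma>: "C\<Gamma> \<ge> 0" using C w by (simp add: C\<Gamma>_def)
  have "transl_diff v z \<le> ennreal (4 * C * (\<omega> * (R + 1) ^ ?n + C) * t) * (ennreal (C\<Gamma> * h powr (2 * s')) * gagliardo s' u)"
    using main \<Gamma>_le by (meson mult_left_mono order_trans zero_le)
  also have "\<dots> = ennreal (4 * C * (\<omega> * (R + 1) ^ ?n + C) * t * (C\<Gamma> * h powr (2 * s'))) * gagliardo s' u"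
    by (subst (2) ennreal_mult) (use C t w C\<Gamma> in \<open>auto simp: mult.assoc\<close>)
  finally show "transl_diff v z \<le> ennreal (4 * C * (\<omega> * (R + 1) ^ ?n + C) * C\<Gamma> * h powr (2 * s') * (norm z / h)) * gagliardo s' u"
    by (simp add: t_def mult_ac)
qed

end

context lattice_basis begin

text \<open>
  For \<open>|z| \<le> h\<close> the translation difference of \<open>v\<close> is quadratic in \<open>|z| / h\<close> off \<open>bad z\<close>; on \<open>bad z\<close> it is
  only bounded, but the measure of this set gives one factor \<open>|z| / h\<close>, which is integrable against
  \<open>|z| powr (- n - 2 * s)\<close> because \<open>s < 1/2\<close>.  For \<open>|z| > h\<close>, \<open>v\<close> is compared with \<open>u\<close>.
\<close>

lemma gagliardo_stability:
  fixes C R H s s' :: real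
  assumes s: "0 < s" "s < s'" "s' < 1/2" and C: "C \<ge> 0" "R \<ge> 1" and H: "H > 0"
  obtains M where "M \<ge> 0" "\<And>u v h bad. \<lbrakk>u \<in> L2_forms e; v \<in> L2_forms e; 0 < h; h \<le> H;
    (\<integral>\<^sup>+x\<in>FD. ennreal ((norm (v x - u x))\<^sup>2) \<partial>lborel)
      \<le> ennreal (C / h ^ CARD('n)) * (\<integral>\<^sup>+q\<in>cball 0 (R * h). transl_diff u q \<partial>lborel);
    AE x in lborel. \<forall>c. ennreal ((norm (v x - c))\<^sup>2)
      \<le> ennreal (C / h ^ CARD('n)) * (\<integral>\<^sup>+w\<in>cball 0 (R * h). ennreal ((norm (v (x + w) - c))\<^sup>2) \<partial>lborel);
    \<And>z. norm z \<le> h \<Longrightarrow> AE x in lborel. x \<notin> bad z \<longrightarrow> (\<forall>c. ennreal ((norm (v (x + z) - v x))\<^sup>2)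
      \<le> ennreal (C * (norm z / h)\<^sup>2 / h ^ CARD('n)) * (\<integral>\<^sup>+w\<in>cball 0 (R * h). ennreal ((norm (v (x + w) - c))\<^sup>2) \<partial>lborel));
    \<And>z. bad z \<in> sets borel; \<And>z. periodic e (\<lambda>x. x \<in> bad z);
    \<And>z y. norm z \<le> h \<Longrightarrow> emeasure lborel (bad z \<inter> cball y ((R + 1) * h)) \<le> ennreal (C * (norm z / h) * h ^ CARD('n))\<rbrakk>
    \<Longrightarrow> gagliardo s v \<le> ennreal M * (gagliardo s' u + ennreal ((L2_form_norm e u)\<^sup>2))"
proof -
  let ?n = "CARD('n)"
  define \<omega> where "\<omega> = unit_ball_vol (real ?n)"
  define C\<Gamma> where "C\<Gamma> = (2 * C + 2 / \<omega>) * (R + 2) powr (real ?n + 2 * s')"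
  define K5 where "K5 = 4 * C * (\<omega> * (R + 1) ^ ?n + C) * C\<Gamma>"
  \<comment> \<open>The factor \<open>norm z\<close> of the near estimate turns the kernel exponent
    \<open>CARD('n) + 2 * s\<close> into \<open>CARD('n) - \<gamma>\<close>; integrability at
    \<open>0\<close> means \<open>\<gamma> > 0\<close>, that is \<open>s < 1/2\<close>.\<close>
  define \<gamma> where "\<gamma> = 1 - 2 * s"
  define K6 where "K6 = \<omega> * 2 ^ ?n / (1 - 2 powr - \<gamma>)"
  define K7 where "K7 = \<omega> * 2 ^ ?n / (1 - 2 powr - (2 * s))"
  \<comment> \<open>Both ranges of \<open>z\<close> leave the power
    \<open>h powr (2 * s' - 2 * s)\<close>, whose exponent is positive; \<open>h \<le> H\<close>
    bounds it.\<close>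
  define P where "P = H powr (2 * s' - 2 * s)"
  define M where "M = K5 * K6 * P + 8 * C\<Gamma> * K7 * P + 2 + 8 * K7"
  have w: "\<omega> > 0" by (simp add: \<omega>_def)
  have \<gamma>: "0 < \<gamma>" "\<gamma> < real ?n" using s by (simp_all add: \<gamma>_def add_strict_increasing less_le_trans[of _ 1])
  have C\<Gamma>: "C\<Gamma> \<ge> 0" using C w by (simp add: C\<Gamma>_def)
  have K5: "K5 \<ge> 0" using C w C\<Gamma> by (simp add: K5_def)
  have K6: "K6 \<ge> 0" and K7: "K7 \<ge> 0" using s \<gamma> w unfolding K6_def K7_def
    by (auto intro!: divide_nonneg_nonneg mult_nonneg_nonneg simp: powr_less_one less_imp_le)
  have P: "P \<ge> 0" by (simp add: P_def)
  show thesis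
  proof (rule that[of M])
    show "M \<ge> 0" using K5 K6 K7 C\<Gamma> P by (simp add: M_def)
    fix u v h bad
    assume u: "u \<in> L2_forms e" and v: "v \<in> L2_forms e" and h: "0 < h" "h \<le> H"
      and hyps: "(\<integral>\<^sup>+x\<in>FD. ennreal ((norm (v x - u x))\<^sup>2) \<partial>lborel)
          \<le> ennreal (C / h ^ CARD('n)) * (\<integral>\<^sup>+q\<in>cball 0 (R * h). transl_diff u q \<partial>lborel)"
        "AE x in lborel. \<forall>c. ennreal ((norm (v x - c))\<^sup>2)
          \<le> ennreal (C / h ^ CARD('n)) * (\<integral>\<^sup>+w\<in>cball 0 (R * h). ennreal ((norm (v (x + w) - c))\<^sup>2) \<partial>lborel)"
        "\<And>z. norm z \<le> h \<Longrightarrow> AE x in lborel. x \<notin> bad z \<longrightarrow> (\<forall>c. ennreal ((norm (v (x + z) - v x))\<^sup>2)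
          \<le> ennreal (C * (norm z / h)\<^sup>2 / h ^ CARD('n)) * (\<integral>\<^sup>+w\<in>cball 0 (R * h). ennreal ((norm (v (x + w) - c))\<^sup>2) \<partial>lborel))"
        "\<And>z. bad z \<in> sets borel" "\<And>z. periodic e (\<lambda>x. x \<in> bad z)"
        "\<And>z y. norm z \<le> h \<Longrightarrow> emeasure lborel (bad z \<inter> cball y ((R + 1) * h)) \<le> ennreal (C * (norm z / h) * h ^ CARD('n))"
    define N where "N = gagliardo s' u"
    define U where "U = ennreal ((L2_form_norm e u)\<^sup>2)"
    define W where "W = (\<integral>\<^sup>+x\<in>FD. ennreal ((norm (v x - u x))\<^sup>2) \<partial>lborel)"
    note [measurable] = L2_formsD(2)[OF u] L2_formsD(2)[OF v]
    have [measurable]: "cball (0::'n point) r \<in> sets borel" for r by simp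
    have near: "transl_diff v z \<le> ennreal (K5 * h powr (2 * s') * (norm z / h)) * N"
      and W: "W \<le> ennreal (C\<Gamma> * h powr (2 * s')) * N" if z: "norm z \<le> h" for z
      unfolding K5_def C\<Gamma>_def \<omega>_def N_def W_def
      by (rule transl_diff_near[OF u v h(1) C _ hyps(1,2) z hyps(3)[OF z] hyps(4,5) hyps(6)[OF z]], use s in simp)+
    have W: "W \<le> ennreal (C\<Gamma> * h powr (2 * s')) * N" using W[of 0] h by simp
    let ?p = "\<lambda>z::'n point. ennreal (norm z powr - (real ?n + 2 * s))"
    have hp: "h powr (2 * s' - 2 * s) \<le> P" using h s by (simp add: P_def powr_mono2)
    have in_ball: "(\<integral>\<^sup>+z\<in>cball 0 h. ennreal (norm (z :: 'n point) powr - (real ?n - \<gamma>)) \<partial>lborel) \<le> ennreal (K6 * (h / 2) powr \<gamma>)"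
    proof -
      have "(\<integral>\<^sup>+z\<in>cball 0 h. ennreal (norm (z :: 'n point) powr - (DIM('n point) - \<gamma>)) \<partial>lborel)
        \<le> ennreal (unit_ball_vol DIM('n point) * 2 ^ DIM('n point) / (1 - 2 powr - \<gamma>) * (h / 2) powr \<gamma>)"
        by (rule nn_integral_powr_inside_ball) (use \<gamma> h in auto)
      then show ?thesis by (simp add: K6_def \<omega>_def)
    qed
    have out_ball: "(\<integral>\<^sup>+z\<in>{z. h \<le> norm z}. ?p z \<partial>lborel) \<le> ennreal (K7 * h powr - (2 * s))"
    proof -
      have "(\<integral>\<^sup>+z\<in>{z. h \<le> norm z}. ennreal (norm (z :: 'n point) powr - (DIM('n point) + 2 * s)) \<partial>lborel)
        \<le> ennreal (unit_ball_vol DIM('n point) * 2 ^ DIM('n point) / (1 - 2 powr - (2 * s)) * h powr - (2 * s))"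
        by (rule nn_integral_powr_outside_ball) (use s h in auto)
      then show ?thesis by (simp add: K7_def \<omega>_def)
    qed
    define A where "A = ennreal (K5 * h powr (2 * s') / h) * N"
    have "gagliardo s v \<le> (\<integral>\<^sup>+z. A * (ennreal (norm z powr - (real ?n - \<gamma>)) * indicator (cball 0 h) z)
        + (8 * W * (?p z * indicator {z. h \<le> norm z} z) + 2 * (transl_diff u z * ?p z)) \<partial>lborel)"
      unfolding gagliardo_def
    proof (rule nn_integral_mono)
      fix z :: "'n point"
      let ?B = "8 * W * (?p z * indicator {z. h \<le> norm z} z) + 2 * (transl_diff u z * ?p z)"
      show "transl_diff v z * ?p z \<le> A * (ennreal (norm z powr - (real ?n - \<gamma>)) * indicator (cball 0 h) z) + ?B"
      proof (cases "norm z \<le> h")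
        case True
        have "norm z * norm z powr - (real ?n + 2 * s) = norm z powr - (real ?n - \<gamma>)"
          using powr_mult_base[of "norm z" "- (real ?n + 2 * s)"] by (simp add: \<gamma>_def algebra_simps)
        then have "ennreal (norm z) * ?p z = ennreal (norm z powr - (real ?n - \<gamma>))" by (subst ennreal_mult[symmetric]) simp_all
        moreover have "ennreal (K5 * h powr (2 * s') * (norm z / h)) = ennreal (K5 * h powr (2 * s') / h) * ennreal (norm z)"
          by (subst ennreal_mult[symmetric]) (use K5 h in auto)
        moreover have "ennreal (K5 * h powr (2 * s') / h) * ennreal (norm z) * N * ?p z = A * (ennreal (norm z) * ?p z)"
          unfolding A_def by (simp only: mult_ac)
        ultimately have "ennreal (K5 * h powr (2 * s') * (norm z / h)) * N * ?p z = A * ennreal (norm z powr - (real ?n - \<gamma>))"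
          by simp
        then have "transl_diff v z * ?p z \<le> A * (ennreal (norm z powr - (real ?n - \<gamma>)) * indicator (cball 0 h) z)"
          using mult_right_mono[OF near[OF True], of "?p z"] True by simp
        then show ?thesis by (simp add: add_increasing2)
      next
        case False
        \<comment> \<open>For \<open>norm z > h\<close> write \<open>v\<close> as
          \<open>u + (v - u)\<close>: the second part costs the squared L2 norm \<open>W\<close>, of
          order \<open>h powr (2 * s')\<close>, against a kernel tail of order
          \<open>h powr - (2 * s)\<close>.\<close>
        have "transl_diff v z \<le> (\<integral>\<^sup>+x\<in>FD. 2 * ennreal ((norm ((v (x + z) - u (x + z)) - (v x - u x)))\<^sup>2) + 2 * ennreal ((norm (u (x + z) - u x))\<^sup>2) \<partial>lborel)"
          unfolding transl_diff_def
        proof (rule nn_integral_mono, rule mult_right_mono)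
          fix x
          show "ennreal ((norm (v (x + z) - v x))\<^sup>2) \<le> 2 * ennreal ((norm ((v (x + z) - u (x + z)) - (v x - u x)))\<^sup>2) + 2 * ennreal ((norm (u (x + z) - u x))\<^sup>2)"
            using ennreal_sq_diff_le[of "(v (x + z) - u (x + z)) - (v x - u x)" "- (u (x + z) - u x)" 0]
            by (simp add: algebra_simps norm_minus_commute)
        qed simp
        also have "\<dots> = 2 * transl_diff (\<lambda>x. v x - u x) z + 2 * transl_diff u z"
          unfolding transl_diff_def by (simp add: distrib_right nn_integral_add mult.assoc nn_integral_cmult)
        also have "\<dots> \<le> 2 * (4 * W) + 2 * transl_diff u z"
          unfolding W_def
          by (intro add_mono mult_left_mono transl_diff_le_nn order_refl)
            (use L2_formsD(1)[OF u] L2_formsD(1)[OF v] in \<open>auto simp: periodic_def\<close>)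
        finally have "transl_diff v z * ?p z \<le> (8 * W + 2 * transl_diff u z) * ?p z"
          by (intro mult_right_mono) (simp_all add: mult.assoc[symmetric])
        also have "\<dots> = ?B" using False by (simp add: distrib_right mult.assoc)
        finally show ?thesis by (simp add: add_increasing)
      qed
    qed
    also have "\<dots> = A * (\<integral>\<^sup>+z\<in>cball 0 h. ennreal (norm (z :: 'n point) powr - (real ?n - \<gamma>)) \<partial>lborel)
      + (8 * W * (\<integral>\<^sup>+z\<in>{z. h \<le> norm z}. ?p z \<partial>lborel) + 2 * gagliardo s u)"
      by (simp add: nn_integral_add nn_integral_cmult gagliardo_def)
    also have "\<dots> \<le> A * ennreal (K6 * (h / 2) powr \<gamma>) + (8 * (ennreal (C\<Gamma> * h powr (2 * s')) * N) * ennreal (K7 * h powr - (2 * s)) + 2 * (N + ennreal (4 * K7) * U))"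
    proof -
      have "gagliardo s u \<le> N + ennreal (4 * K7) * U"
        using gagliardo_mono_exponent[OF s(1,2) u] by (simp add: N_def U_def K7_def \<omega>_def)
      then show ?thesis
        by (intro add_mono mult_left_mono mult_mono in_ball out_ball W) auto
    qed
    also have "A * ennreal (K6 * (h / 2) powr \<gamma>) \<le> ennreal (K5 * K6 * P) * N"
    proof -
      have "K5 * h powr (2 * s') / h * (K6 * (h / 2) powr \<gamma>) \<le> K5 * h powr (2 * s') / h * (K6 * h powr \<gamma>)"
        using K5 K6 h \<gamma> by (intro mult_left_mono powr_mono2) auto
      also have "\<dots> = K5 * K6 * h powr (2 * s' - 2 * s)"
        using h by (simp add: \<gamma>_def powr_diff field_simps)
      also have "\<dots> \<le> K5 * K6 * P" using hp K5 K6 by (intro mult_left_mono) auto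
      finally have "ennreal (K5 * h powr (2 * s') / h * (K6 * (h / 2) powr \<gamma>)) * N \<le> ennreal (K5 * K6 * P) * N"
        by (intro mult_right_mono ennreal_leI) auto
      moreover have "ennreal (K5 * h powr (2 * s') / h * (K6 * (h / 2) powr \<gamma>)) = ennreal (K5 * h powr (2 * s') / h) * ennreal (K6 * (h / 2) powr \<gamma>)"
        using K5 K6 h by (intro ennreal_mult) auto
      ultimately show ?thesis unfolding A_def by (simp add: mult_ac)
    qed
    also have "8 * (ennreal (C\<Gamma> * h powr (2 * s')) * N) * ennreal (K7 * h powr - (2 * s)) \<le> ennreal (8 * C\<Gamma> * K7 * P) * N"
    proof -
      have "8 * (C\<Gamma> * h powr (2 * s')) * (K7 * h powr - (2 * s)) = 8 * C\<Gamma> * K7 * h powr (2 * s' - 2 * s)"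
        by (simp add: powr_diff powr_minus_divide)
      also have "\<dots> \<le> 8 * C\<Gamma> * K7 * P" using hp C\<Gamma> K7 by (intro mult_left_mono) auto
      finally have "ennreal (8 * (C\<Gamma> * h powr (2 * s')) * (K7 * h powr - (2 * s))) * N \<le> ennreal (8 * C\<Gamma> * K7 * P) * N"
        by (intro mult_right_mono ennreal_leI) auto
      moreover have "ennreal (8 * (C\<Gamma> * h powr (2 * s')) * (K7 * h powr - (2 * s))) = 8 * ennreal (C\<Gamma> * h powr (2 * s')) * ennreal (K7 * h powr - (2 * s))"
        using C\<Gamma> K7 by (simp add: ennreal_mult)
      ultimately show ?thesis by (simp add: mult_ac)
    qed
    also have "ennreal (K5 * K6 * P) * N + (ennreal (8 * C\<Gamma> * K7 * P) * N + 2 * (N + ennreal (4 * K7) * U)) \<le> ennreal M * (N + U)"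
    proof -
      have "2 * (N + ennreal (4 * K7) * U) = ennreal 2 * N + ennreal (8 * K7) * U"
        using K7 by (simp add: distrib_left ennreal_mult mult.assoc[symmetric])
      then have "ennreal (K5 * K6 * P) * N + (ennreal (8 * C\<Gamma> * K7 * P) * N + 2 * (N + ennreal (4 * K7) * U))
        = ennreal (K5 * K6 * P + 8 * C\<Gamma> * K7 * P + 2) * N + ennreal (8 * K7) * U"
        using K5 K6 K7 C\<Gamma> P by (simp add: ennreal_plus distrib_right add.assoc)
      also have "\<dots> \<le> ennreal M * N + ennreal M * U"
        using K5 K6 K7 C\<Gamma> P by (intro add_mono mult_right_mono ennreal_leI) (auto simp: M_def)
      finally show ?thesis by (simp add: distrib_left)
    qed
    finally show "gagliardo s v \<le> ennreal M * (gagliardo s' u + ennreal ((L2_form_norm e u)\<^sup>2))"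
      by (simp add: N_def U_def add_mono)
  qed
qed

end

section \<open>Cells\<close>

lemma is_cell_lipschitzD:
  fixes B :: "'n::finite point set"
  assumes "is_cell k T B"
  obtains V :: "'n point set" and f C where "subspace V" "dim V = k" "bij_betw f (V \<inter> cball 0 1) T"
    "C-lipschitz_on (V \<inter> cball 0 1) f" "C-lipschitz_on T (inv_into (V \<inter> cball 0 1) f)"
    "B = f ` (V \<inter> sphere 0 1)"
    "continuous_on (V \<inter> cball 0 1) f" "continuous_on T (inv_into (V \<inter> cball 0 1) f)"
proof -
  obtain V :: "'n point set" and f C where "subspace V" "dim V = k" "bij_betw f (V \<inter> cball 0 1) T"
    "C-lipschitz_on (V \<inter> cball 0 1) f" "C-lipschitz_on T (inv_into (V \<inter> cball 0 1) f)" "B = f ` (V \<inter> sphere 0 1)"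
    using assms unfolding is_cell_def by blast
  then show thesis using that lipschitz_on_continuous_on by blast
qed

lemma compact_subspace_cball: "subspace (V :: 'n::finite point set) \<Longrightarrow> compact (V \<inter> cball 0 1)"
  by (metis Int_commute closed_subspace compact_Int_closed compact_cball)

lemma is_cell_compact:
  assumes "is_cell k T (B :: 'n::finite point set)" shows "compact T"
proof -
  obtain V :: "'n point set" and f C where V: "subspace V" "bij_betw f (V \<inter> cball 0 1) T"
    "continuous_on (V \<inter> cball 0 1) f"
    by (rule is_cell_lipschitzD[OF assms])
  have "T = f ` (V \<inter> cball 0 1)" using V(2) by (simp add: bij_betw_def)
  then show ?thesis using compact_continuous_image[OF V(3)] compact_subspace_cball[OF V(1)] by simp
qed

text \<open>The image of the open ball is open in \<open>V'\<close> by invariance of domain. A point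
  of it on the unit sphere could be pushed outwards within the image, which lies in the closed
  ball.\<close>

lemma is_cell_chart_ball:
  assumes V: "subspace (V :: 'n::finite point set)" and V': "subspace (V' :: 'n point set)" and d: "dim V' \<le> dim V"
    and bij: "bij_betw \<phi> (V \<inter> cball 0 1) (V' \<inter> cball 0 1)" and cont: "continuous_on (V \<inter> cball 0 1) \<phi>"
  shows "\<phi> ` (V \<inter> ball 0 1) \<subseteq> V' \<inter> ball 0 1"
proof
  have sub: "V \<inter> ball 0 1 \<subseteq> V \<inter> cball 0 1" by auto
  have "openin (top_of_set V') (\<phi> ` (V \<inter> ball 0 1))"
  proof (rule invariance_of_domain_subspaces[OF _ V V' d])
    show "openin (top_of_set V) (V \<inter> ball 0 1)" by (simp add: openin_open_Int)
    show "continuous_on (V \<inter> ball 0 1) \<phi>" using cont sub continuous_on_subset by blast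
    show "\<phi> \<in> V \<inter> ball 0 1 \<rightarrow> V'" using bij sub by (auto simp: bij_betw_def)
    show "inj_on \<phi> (V \<inter> ball 0 1)" using bij sub by (meson bij_betw_def inj_on_subset)
  qed
  then obtain U where U: "open U" "\<phi> ` (V \<inter> ball 0 1) = V' \<inter> U" by (auto simp: openin_open)
  fix y assume y: "y \<in> \<phi> ` (V \<inter> ball 0 1)"
  have y': "y \<in> V' \<inter> cball 0 1" using y bij sub by (auto simp: bij_betw_def)
  have "norm y < 1"
  proof (rule ccontr)
    assume "\<not> norm y < 1"
    then have n: "norm y = 1" using y' by auto
    obtain r where r: "r > 0" "ball y r \<subseteq> U" using U y open_contains_ball by blast
    have "(1 + r / 2) *\<^sub>R y \<in> ball y r" using n r(1) by (simp add: dist_norm scaleR_left_distrib)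
    moreover have "(1 + r / 2) *\<^sub>R y \<in> V'" using V' y' by (simp add: subspace_scale)
    ultimately have "(1 + r / 2) *\<^sub>R y \<in> \<phi> ` (V \<inter> ball 0 1)" using U r by blast
    then have "(1 + r / 2) *\<^sub>R y \<in> V' \<inter> cball 0 1" using bij_betw_imp_surj_on[OF bij] sub by blast
    then show False using n r(1) by simp
  qed
  then show "y \<in> V' \<inter> ball 0 1" using y' by auto
qed

text \<open>The two charts are compared by \<open>?g \<circ> f\<close>. Dimension is invariant; and
  a boundary point cannot come from the open ball of the other chart, since the inverse change of
  charts maps open ball into open ball.\<close>

lemma is_cell_unique_aux:
  assumes "is_cell k T (B :: 'n::finite point set)" "is_cell k' T B'"
  shows "k \<le> k' \<and> (k = k' \<longrightarrow> B \<subseteq> B')"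
proof -
  obtain V :: "'n point set" and f C where V: "subspace V" "dim V = k" "bij_betw f (V \<inter> cball 0 1) T" "B = f ` (V \<inter> sphere 0 1)"
    "continuous_on (V \<inter> cball 0 1) f" "continuous_on T (inv_into (V \<inter> cball 0 1) f)"
    by (rule is_cell_lipschitzD[OF assms(1)])
  obtain V' :: "'n point set" and f' C' where V': "subspace V'" "dim V' = k'" "bij_betw f' (V' \<inter> cball 0 1) T" "B' = f' ` (V' \<inter> sphere 0 1)"
    "continuous_on (V' \<inter> cball 0 1) f'" "continuous_on T (inv_into (V' \<inter> cball 0 1) f')"
    by (rule is_cell_lipschitzD[OF assms(2)])
  let ?g = "inv_into (V' \<inter> cball 0 1) f'"
  let ?g' = "inv_into (V \<inter> cball 0 1) f"
  have b: "bij_betw (?g \<circ> f) (V \<inter> cball 0 1) (V' \<inter> cball 0 1)"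
    using V(3) V'(3) by (intro bij_betw_trans bij_betw_inv_into)
  have b': "bij_betw (?g' \<circ> f') (V' \<inter> cball 0 1) (V \<inter> cball 0 1)"
    using V(3) V'(3) by (intro bij_betw_trans bij_betw_inv_into)
  have c: "continuous_on (V \<inter> cball 0 1) (?g \<circ> f)"
    using V(3,5) V'(6) by (intro continuous_on_compose) (simp_all add: bij_betw_imp_surj_on)
  have c': "continuous_on (V' \<inter> cball 0 1) (?g' \<circ> f')"
    using V'(3,5) V(6) by (intro continuous_on_compose) (simp_all add: bij_betw_imp_surj_on)
  have "dim V \<le> dim V'"
  proof (rule invariance_of_dimension_subspaces[of V "V \<inter> ball 0 1" V' "?g \<circ> f"])
    have sub: "V \<inter> ball 0 1 \<subseteq> V \<inter> cball 0 1" by auto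
    show "openin (top_of_set V) (V \<inter> ball 0 1)" by (simp add: openin_open_Int)
    show "continuous_on (V \<inter> ball 0 1) (?g \<circ> f)" using c sub continuous_on_subset by blast
    show "?g \<circ> f \<in> V \<inter> ball 0 1 \<rightarrow> V'" using bij_betw_imp_surj_on[OF b] sub by blast
    show "inj_on (?g \<circ> f) (V \<inter> ball 0 1)" using b sub by (meson bij_betw_def inj_on_subset)
    show "V \<inter> ball 0 1 \<noteq> {}" using V(1) subspace_0 by fastforce
  qed (use V V' in auto)
  moreover have "B \<subseteq> B'" if "k = k'"
  proof
    fix y assume "y \<in> B"
    then obtain x where x: "x \<in> V" "norm x = 1" "y = f x" using V(4) by auto
    define x' where "x' = ?g y"
    have yT: "y \<in> T" using x V(3) by (auto simp: bij_betw_def)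
    have x': "x' \<in> V' \<inter> cball 0 1" "f' x' = y"
      unfolding x'_def using yT V'(3) by (metis bij_betw_imp_surj_on inv_into_into, metis bij_betw_inv_into_right)
    have "norm x' = 1"
    proof (rule ccontr)
      assume "norm x' \<noteq> 1"
      then have "x' \<in> V' \<inter> ball 0 1" using x' by auto
      moreover have "dim V \<le> dim V'" using that V(2) V'(2) by simp
      ultimately have "(?g' \<circ> f') x' \<in> V \<inter> ball 0 1"
        using image_subset_iff[THEN iffD1, OF is_cell_chart_ball[OF V'(1) V(1) _ b' c']] by blast
      moreover have "(?g' \<circ> f') x' = x"
        using x x'(2) V(3) by (simp add: bij_betw_inv_into_left)
      ultimately show False using x by simp
    qed
    then show "y \<in> B'" using x' V'(4) by auto
  qed
  ultimately show ?thesis using V(2) V'(2) by simp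
qed

lemma is_cell_unique:
  assumes "is_cell k T (B :: 'n::finite point set)" "is_cell k' T B'"
  shows "k = k'" "B = B'"
  using is_cell_unique_aux[OF assms] is_cell_unique_aux[OF assms(2,1)] by auto

lemma is_cell_dim_boundary:
  assumes "is_cell k T (B :: 'n::finite point set)"
  shows "cell_dim T = k" "cell_boundary T = B"
  unfolding cell_dim_def cell_boundary_def
  by (rule the_equality; use assms is_cell_unique in blast)+

lemma is_cell_translate:
  assumes "is_cell k T (B :: 'n::finite point set)"
  shows "is_cell k ((+) l ` T) ((+) l ` B)"
proof -
  obtain V :: "'n point set" and f C where V: "subspace V" "dim V = k" "bij_betw f (V \<inter> cball 0 1) T"
    "C-lipschitz_on (V \<inter> cball 0 1) f" "C-lipschitz_on T (inv_into (V \<inter> cball 0 1) f)" "B = f ` (V \<inter> sphere 0 1)"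
    by (rule is_cell_lipschitzD[OF assms])
  let ?S = "V \<inter> cball 0 1"
  let ?f = "\<lambda>x. l + f x"
  have b: "bij_betw ?f ?S ((+) l ` T)"
    using V(3) by (auto simp: bij_betw_def inj_on_def image_image)
  have inv: "inv_into ?S ?f (l + y) = inv_into ?S f y" if "y \<in> T" for y
  proof (rule inv_into_f_eq)
    show "inj_on ?f ?S" using b by (simp add: bij_betw_def)
    show "inv_into ?S f y \<in> ?S" using that V(3) by (metis bij_betw_imp_surj_on inv_into_into)
    show "l + f (inv_into ?S f y) = l + y" using that V(3) by (metis bij_betw_inv_into_right)
  qed
  have "C-lipschitz_on ?S ?f" using V(4) by (simp add: lipschitz_on_def)
  moreover have "C-lipschitz_on ((+) l ` T) (inv_into ?S ?f)"
    using V(5) by (auto simp: lipschitz_on_def inv)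
  moreover have "(+) l ` B = ?f ` (V \<inter> sphere 0 1)" using V(6) by (simp add: image_image)
  ultimately show ?thesis unfolding is_cell_def using V(1,2) b by blast
qed

lemma cell_translate:
  assumes "is_cell k T (B :: 'n::finite point set)"
  shows "cell_dim ((+) l ` T) = cell_dim T" "cell_interior ((+) l ` T) = (+) l ` cell_interior T"
  using is_cell_dim_boundary[OF assms] is_cell_dim_boundary[OF is_cell_translate[OF assms]]
  by (auto simp: cell_interior_def)

lemma negligible_lipschitz_image:
  fixes f :: "'a::euclidean_space \<Rightarrow> 'a"
  assumes "C-lipschitz_on S f" "negligible S"
  shows "negligible (f ` S)"
proof (rule negligible_locally_Lipschitz_image[OF _ assms(2)])
  fix x assume "x \<in> S"
  then show "\<exists>T B. open T \<and> x \<in> T \<and> (\<forall>y\<in>S \<inter> T. norm (f y - f x) \<le> B * norm (y - x))"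
    using lipschitz_onD[OF assms(1)] by (intro exI[of _ UNIV] exI[of _ C]) (auto simp: dist_norm)
qed simp

text \<open>Lipschitz images of null sets are null. This is where bi-Lipschitz charts matter: the
  boundary of a merely homeomorphic cell could have positive measure.\<close>

lemma is_cell_negligible:
  assumes "is_cell k T (B :: 'n::finite point set)"
  shows "k < CARD('n) \<Longrightarrow> negligible T" "negligible B" "k \<le> CARD('n)" "B \<subseteq> T" "B \<noteq> T"
proof -
  obtain V :: "'n point set" and f C where V: "subspace V" "dim V = k" "bij_betw f (V \<inter> cball 0 1) T"
    "C-lipschitz_on (V \<inter> cball 0 1) f" "B = f ` (V \<inter> sphere 0 1)"
    by (rule is_cell_lipschitzD[OF assms])
  have T: "T = f ` (V \<inter> cball 0 1)" using V(3) by (simp add: bij_betw_def)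
  have lip: "C-lipschitz_on (V \<inter> sphere 0 1) f" using V(4) by (rule lipschitz_on_subset) auto
  show neg: "negligible T" if "k < CARD('n)"
  proof -
    have "negligible V" using that V(2) by (intro negligible_lowdim) simp
    then have "negligible (V \<inter> cball 0 1)" by (rule negligible_subset) auto
    then show ?thesis unfolding T using negligible_lipschitz_image V(4) by blast
  qed
  show "negligible B"
  proof -
    have "negligible (V \<inter> sphere 0 1)" by (rule negligible_subset[OF negligible_sphere[of 0 1]]) auto
    then show ?thesis unfolding V(5) using negligible_lipschitz_image lip by blast
  qed
  show "k \<le> CARD('n)" using V(2) dim_subset_UNIV_cart[of V] by simp
  show "B \<subseteq> T" unfolding T V(5) by auto
  show "B \<noteq> T"
  proof
    assume "B = T"
    \<comment> \<open>Injectivity separates the image of the centre from the image of the sphere;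
      this includes dimension 0, where the sphere is empty and the centre is the cell.\<close>
    have 0: "0 \<in> V \<inter> cball 0 1" using V(1) by (simp add: subspace_0)
    then have "f 0 \<in> B" using \<open>B = T\<close> T by blast
    then obtain x where x: "x \<in> V" "norm x = 1" "f 0 = f x" using V(5) by auto
    then have "0 = x" using V(3) 0 unfolding bij_betw_def by (intro inj_onD[of f "V \<inter> cball 0 1" 0 x]) auto
    then show False using x by simp
  qed
qed

text \<open>In full dimension the chart lives on the whole unit ball, so invariance of domain makes
  the cell minus its boundary a genuinely open set, dense in the cell.\<close>

lemma full_cell:
  assumes "is_cell (CARD('n)) T (B :: 'n::finite point set)"
  shows "open (cell_interior T)" "T \<subseteq> closure (cell_interior T)" "cell_interior T \<subseteq> T" "cell_interior T \<noteq> {}"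
    "negligible (T - cell_interior T)" "connected T"
proof -
  obtain V :: "'n point set" and f C where V: "subspace V" "dim V = CARD('n)" "bij_betw f (V \<inter> cball 0 1) T"
    "B = f ` (V \<inter> sphere 0 1)" "continuous_on (V \<inter> cball 0 1) f"
    by (rule is_cell_lipschitzD[OF assms])
  have "V = UNIV" using V(1,2) dim_eq_full[of V] by (metis DIM_cart DIM_real mult.right_neutral span_eq_iff)
  then have bij: "bij_betw f (cball 0 1) T" and B: "B = f ` sphere 0 1" and cont: "continuous_on (cball 0 1) f"
    using V by auto
  have T: "T = f ` cball 0 1" and inj: "inj_on f (cball 0 1)" using bij by (simp_all add: bij_betw_def)
  have int: "cell_interior T = f ` ball 0 1"
  proof -
    have "f ` cball 0 1 - f ` sphere 0 1 = f ` (cball 0 1 - sphere 0 1)"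
      by (rule inj_on_image_set_diff[OF inj, symmetric]) auto
    then show ?thesis unfolding cell_interior_def is_cell_dim_boundary(2)[OF assms] B
      by (simp add: T cball_diff_sphere)
  qed
  have "open (f ` ball 0 1)"
    by (rule invariance_of_domain) (use cont inj in \<open>auto intro: continuous_on_subset inj_on_subset\<close>)
  then show "open (cell_interior T)" by (simp add: int)
  have "f ` closure (ball 0 1) \<subseteq> closure (f ` ball 0 1)"
    by (rule image_closure_subset) (simp_all add: cont closure_subset)
  then have "f ` cball 0 1 \<subseteq> closure (cell_interior T)" by (simp add: int)
  then show "T \<subseteq> closure (cell_interior T)" by (rule ord_eq_le_trans[OF T])
  show "cell_interior T \<subseteq> T" by (auto simp: cell_interior_def)
  show "cell_interior T \<noteq> {}" by (simp add: int)
  have "T - cell_interior T \<subseteq> B" using is_cell_dim_boundary(2)[OF assms] by (auto simp: cell_interior_def)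
  then show "negligible (T - cell_interior T)" using is_cell_negligible(2)[OF assms] negligible_subset by blast
  show "connected T" unfolding T by (rule connected_continuous_image[OF cont]) simp
qed

section \<open>Smooth forms and pullbacks\<close>

lemma partial_eq:
  assumes "(f has_derivative f') (at x)" shows "partial i f x = f' (axis i 1)"
  unfolding partial_def using frechet_derivative_at[OF assms] by simp

lemma differentiable_partial:
  assumes "f differentiable (at x)"
  obtains f' where "(f has_derivative f') (at x)" "\<And>i. f' (axis i 1) = partial i f x"
  using assms partial_eq unfolding differentiable_def by metis

lemma partials_Nil [simp]: "partials [] f = f"
  and partials_Cons [simp]: "partials (i # is) f = partial i (partials is f)"
  by (simp_all add: partials_def)

lemma smoothD: "smooth f \<Longrightarrow> partials is f differentiable (at x)"
  by (simp add: smooth_def)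

lemma smooth_partials: "smooth f \<Longrightarrow> smooth (partials is f)"
proof -
  have "partials js (partials is f) = partials (js @ is) f" for js by (simp add: partials_def)
  then show "smooth f \<Longrightarrow> smooth (partials is f)" by (simp add: smooth_def)
qed

lemma smooth_partial: "smooth f \<Longrightarrow> smooth (partial i f)"
  using smooth_partials[of f "[i]"] by simp

lemma smooth_continuous_on: "smooth f \<Longrightarrow> continuous_on S (partials is f)"
  by (intro continuous_at_imp_continuous_on ballI differentiable_imp_continuous_within smoothD)

lemma smooth_continuous: "smooth f \<Longrightarrow> continuous_on S f"
  using smooth_continuous_on[of f S "[]"] by simp

text \<open>Smoothness concerns all iterated partials, so a closed formula \<open>G\<close> for
  them, proved by induction on the list, reduces it to one differentiability check.\<close>

lemma smooth_scheme:
  assumes "\<And>is x. partials is f = G is" "\<And>is x. G is differentiable (at x)"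
  shows "smooth f"
  using assms by (simp add: smooth_def)

lemma partials_const: "partials is (\<lambda>x. c) = (\<lambda>x. if is = [] then c else 0)"
proof (induction "is")
  case (Cons i "is")
  have "partial i (\<lambda>x. if is = [] then c else 0) x = 0" for x
    by (rule partial_eq[OF has_derivative_const])
  then show ?case using Cons by auto
qed simp

lemma smooth_const [simp]: "smooth (\<lambda>x. c)"
  by (rule smooth_scheme[OF partials_const]) simp

lemma partials_linear:
  assumes "bounded_linear A" "smooth f"
  shows "partials is (\<lambda>x. A (f x)) = (\<lambda>x. A (partials is f x))"
proof (induction "is")
  case (Cons i "is")
  have "partial i (\<lambda>x. A (partials is f x)) x = A (partial i (partials is f) x)" for x
  proof -
    obtain f' where f': "(partials is f has_derivative f') (at x)" "\<And>i. f' (axis i 1) = partial i (partials is f) x"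
      using differentiable_partial[OF smoothD[OF assms(2)]] by metis
    show ?thesis using partial_eq[OF bounded_linear.has_derivative[OF assms(1) f'(1)]] f'(2) by simp
  qed
  then show ?case using Cons by auto
qed simp

lemma smooth_linear:
  assumes "bounded_linear A" "smooth f" shows "smooth (\<lambda>x. A (f x))"
proof (rule smooth_scheme[OF partials_linear[OF assms]])
  fix "is" x
  show "(\<lambda>x. A (partials is f x)) differentiable (at x)"
    using bounded_linear.has_derivative[OF assms(1)] smoothD[OF assms(2)] unfolding differentiable_def by metis
qed

lemma partials_add:
  assumes "smooth f" "smooth g"
  shows "partials is (\<lambda>x. f x + g x) = (\<lambda>x. partials is f x + partials is g x)"
proof (induction "is")
  case (Cons i "is")
  have "partial i (\<lambda>x. partials is f x + partials is g x) x = partial i (partials is f) x + partial i (partials is g) x" for x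
  proof -
    obtain f' where f': "(partials is f has_derivative f') (at x)" "\<And>i. f' (axis i 1) = partial i (partials is f) x"
      using differentiable_partial[OF smoothD[OF assms(1)]] by metis
    obtain g' where g': "(partials is g has_derivative g') (at x)" "\<And>i. g' (axis i 1) = partial i (partials is g) x"
      using differentiable_partial[OF smoothD[OF assms(2)]] by metis
    show ?thesis using partial_eq[OF has_derivative_add[OF f'(1) g'(1)]] f'(2) g'(2) by simp
  qed
  then show ?case using Cons by auto
qed simp

lemma smooth_add:
  assumes "smooth f" "smooth g" shows "smooth (\<lambda>x. f x + g x)"
  by (rule smooth_scheme[OF partials_add[OF assms]]) (intro differentiable_add smoothD assms)

lemma smooth_lincomb:
  assumes "smooth f" "smooth g" shows "smooth (\<lambda>x. a *\<^sub>R f x + b *\<^sub>R g x)"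
  by (rule smooth_add[OF smooth_linear[OF bounded_linear_scaleR_right assms(1)]
    smooth_linear[OF bounded_linear_scaleR_right assms(2)]])

lemma smooth_diff:
  assumes "smooth f" "smooth g" shows "smooth (\<lambda>x. f x - g x)"
  using smooth_lincomb[OF assms, of 1 "-1"] by simp

lemma smooth_sum:
  assumes "finite A" "\<And>i. i \<in> A \<Longrightarrow> smooth (f i)"
  shows "smooth (\<lambda>x. \<Sum>i\<in>A. f i x)"
  using assms by (induction A) (simp_all add: smooth_add)

lemma partials_affine:
  assumes "smooth f"
  shows "partials is (\<lambda>x. f (a + h *\<^sub>R x)) = (\<lambda>x. h ^ length is *\<^sub>R partials is f (a + h *\<^sub>R x))"
proof (induction "is")
  case (Cons i "is")
  have "partial i (\<lambda>x. h ^ length is *\<^sub>R partials is f (a + h *\<^sub>R x)) x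
      = h ^ length (i # is) *\<^sub>R partial i (partials is f) (a + h *\<^sub>R x)" for x
  proof -
    obtain f' where f': "(partials is f has_derivative f') (at (a + h *\<^sub>R x))" "\<And>i. f' (axis i 1) = partial i (partials is f) (a + h *\<^sub>R x)"
      using differentiable_partial[OF smoothD[OF assms(1)]] by metis
    have "((\<lambda>x. a + h *\<^sub>R x) has_derivative (\<lambda>k. h *\<^sub>R k)) (at x)"
      by (auto intro!: derivative_eq_intros)
    from has_derivative_compose[OF this f'(1)]
    have "((\<lambda>x. h ^ length is *\<^sub>R partials is f (a + h *\<^sub>R x)) has_derivative (\<lambda>k. h ^ length is *\<^sub>R f' (h *\<^sub>R k))) (at x)"
      by (rule has_derivative_scaleR_right)
    from partial_eq[OF this] show ?thesis
      using linear_scale[OF has_derivative_linear[OF f'(1)], of h "axis i 1"] f'(2) by (simp add: mult.commute)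
  qed
  then show ?case using Cons by auto
qed simp

lemma smooth_affine:
  assumes "smooth f" shows "smooth (\<lambda>x. f (a + h *\<^sub>R x))"
proof (rule smooth_scheme[OF partials_affine[OF assms]])
  fix "is" x
  obtain f' where f': "(partials is f has_derivative f') (at (a + h *\<^sub>R x))"
    using smoothD[OF assms] unfolding differentiable_def by metis
  have "((\<lambda>x. a + h *\<^sub>R x) has_derivative (\<lambda>k. h *\<^sub>R k)) (at x)"
    by (auto intro!: derivative_eq_intros)
  from has_derivative_scaleR_right[OF has_derivative_compose[OF this f']]
  show "(\<lambda>x. h ^ length is *\<^sub>R partials is f (a + h *\<^sub>R x)) differentiable (at x)"
    unfolding differentiable_def by metis
qed

text \<open>Induction on the list works on the open set, and continuity of the partials extends the
  equality to the closure. In this way identities in the interior of a cell hold up to its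
  boundary.\<close>

lemma partials_local:
  assumes S: "open S" and eq: "\<And>x. x \<in> S \<Longrightarrow> f x = g x" and sm: "smooth f" "smooth g" and x: "x \<in> closure S"
  shows "partials is f x = partials is g x"
proof -
  have "\<forall>x\<in>S. partials is f x = partials is g x"
  proof (induction "is")
    case (Cons i "is")
    show ?case
    proof
      fix x assume x: "x \<in> S"
      obtain f' where f': "(partials is f has_derivative f') (at x)" "\<And>i. f' (axis i 1) = partial i (partials is f) x"
        using differentiable_partial[OF smoothD[OF sm(1)]] by metis
      have "(partials is g has_derivative f') (at x)"
        by (rule has_derivative_transform_within_open[OF f'(1) S x]) (use Cons in auto)
      then show "partials (i # is) f x = partials (i # is) g x" using partial_eq f'(2) by (metis partials_Cons)
    qed
  qed (use eq in simp)
  moreover have "closed {x. partials is f x - partials is g x = 0}"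
    using continuous_closed_preimage_constant[of UNIV "\<lambda>x. partials is f x - partials is g x" 0]
      smooth_continuous_on[OF sm(1), of UNIV] smooth_continuous_on[OF sm(2), of UNIV] by (simp add: continuous_on_diff)
  ultimately have "closure S \<subseteq> {x. partials is f x - partials is g x = 0}"
    by (intro closure_minimal) auto
  then show ?thesis using x by auto
qed

section \<open>Alternating forms recovered from their values, and pullbacks to cells\<close>

lemma contract_axis:
  "contract (axis i 1) a $ I = (if i \<in> I then 0 else insert_sign i I * a $ (insert i I))"
proof -
  have "contract (axis i 1) a $ I = (\<Sum>j\<in>- I. if j = i then insert_sign i I * a $ (insert i I) else 0)"
    unfolding contract_def vec_lambda_beta by (rule sum.cong) (auto simp: axis_def)
  then show ?thesis by (auto simp: sum.delta)
qed

text \<open>Contraction with a basis vector turns the coefficient at \<open>insert i I\<close> into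
  the one at \<open>I\<close> up to sign, so induction on the index set recovers every coefficient.
  The induction quantifies over both forms because contraction changes them.\<close>

lemma eval_alt_inject:
  assumes "\<And>vs. eval_alt a vs = eval_alt b vs" shows "a = b"
proof (subst vec_eq_iff, safe)
  fix I :: "'a set"
  have "finite I" by simp
  then have "\<forall>a b. (\<forall>vs. eval_alt a vs = eval_alt b vs) \<longrightarrow> a $ I = b $ I"
  proof (induction I)
    case empty
    show ?case by (metis eval_alt.simps(1))
  next
    case (insert i I)
    show ?case
    proof safe
      fix a b :: "(real, 'a set) vec" assume *: "\<forall>vs. eval_alt a vs = eval_alt b vs"
      have "\<forall>vs. eval_alt (contract (axis i 1) a) vs = eval_alt (contract (axis i 1) b) vs"
        using * by (metis eval_alt.simps(2))
      then have "contract (axis i 1) a $ I = contract (axis i 1) b $ I" using insert.IH by blast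
      then show "a $ insert i I = b $ insert i I" using insert.hyps by (simp add: contract_axis insert_sign_def)
    qed
  qed
  then show "a $ I = b $ I" using assms by blast
qed

lemma contract_lincomb: "contract v (a *\<^sub>R x + b *\<^sub>R y) = a *\<^sub>R contract v x + b *\<^sub>R contract v y"
  by (simp add: contract_def vec_eq_iff sum.distrib sum_distrib_left distrib_left mult_ac)

lemma eval_alt_lincomb: "eval_alt (a *\<^sub>R x + b *\<^sub>R y) vs = a * eval_alt x vs + b * eval_alt y vs"
  by (induction vs arbitrary: x y) (simp_all add: contract_lincomb)

lemma same_pullback_refl [simp]: "same_pullback T U U"
  and same_pullback_sym: "same_pullback T U W \<Longrightarrow> same_pullback T W U"
  and same_pullback_trans: "same_pullback T U W \<Longrightarrow> same_pullback T W Z \<Longrightarrow> same_pullback T U Z"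
  by (simp_all add: same_pullback_def)

lemma same_pullback_lincomb:
  "same_pullback T U W \<Longrightarrow> same_pullback T U' W' \<Longrightarrow>
    same_pullback T (\<lambda>x. a *\<^sub>R U x + b *\<^sub>R U' x) (\<lambda>x. a *\<^sub>R W x + b *\<^sub>R W' x)"
  by (simp add: same_pullback_def eval_alt_lincomb)

lemma eval_alt_0 [simp]: "eval_alt 0 vs = 0"
  using eval_alt_lincomb[of 0 0 0 0 vs] by simp

lemma same_pullback_diff_zero:
  "same_pullback T (\<lambda>x. 1 *\<^sub>R U x + (- 1) *\<^sub>R W x) (\<lambda>x. 0) \<longleftrightarrow> same_pullback T U W"
  unfolding same_pullback_def eval_alt_lincomb by auto

lemma flat_at_mem: "flat_at T x V \<Longrightarrow> x \<in> T"
proof -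
  assume "flat_at T x V"
  then obtain r where "subspace V" "r > 0" "T \<inter> ball x r = (+) x ` V \<inter> ball x r" by (auto simp: flat_at_def)
  moreover then have "x \<in> (+) x ` V \<inter> ball x r" using subspace_0[of V] by force
  ultimately show "x \<in> T" by blast
qed

lemma same_pullbackI: "(\<And>x. x \<in> T \<Longrightarrow> U x = W x) \<Longrightarrow> same_pullback T U W"
  using flat_at_mem unfolding same_pullback_def by metis

lemma flat_at_open: "open S \<Longrightarrow> S \<subseteq> T \<Longrightarrow> x \<in> S \<Longrightarrow> flat_at T x UNIV"
proof -
  assume S: "open S" "S \<subseteq> T" "x \<in> S"
  then obtain r where r: "r > 0" "ball x r \<subseteq> S" using open_contains_ball by blast
  have "range ((+) x) = UNIV" by (metis add.commute surj_def diff_add_cancel)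
  then show ?thesis unfolding flat_at_def using S r by (intro conjI exI[of _ r]) auto
qed

lemma same_pullback_open:
  assumes "same_pullback T U W" "open S" "S \<subseteq> T" "x \<in> S" shows "U x = W x"
  using assms flat_at_open[OF assms(2-4)] eval_alt_inject unfolding same_pullback_def by blast

text \<open>Points of \<open>S\<close> are flat with the whole space as tangent space, so there the
  pullback sees all coefficients; continuity does the rest. On \<open>n\<close>-cells, classes
  modulo pullback are therefore genuine forms with all their derivatives.\<close>

lemma same_pullback_full:
  assumes "same_pullback T U W" "open S" "S \<subseteq> T" "T \<subseteq> closure S" "smooth U" "smooth W" "x \<in> T"
  shows "partials is U x = partials is W x"
  using assms same_pullback_open[OF assms(1-3)] by (intro partials_local[of S]) auto

lemma linear_degree_part: "bounded_linear (\<lambda>v :: (real, 'n::finite set) vec. \<chi> I. if card I = k then v $ I else 0)"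
proof -
  have "linear (\<lambda>v :: (real, 'n set) vec. \<chi> I. if card I = k then v $ I else 0)"
    by (rule linearI) (simp_all add: vec_eq_iff)
  then show ?thesis by (simp add: linear_conv_bounded_linear)
qed

lemma degree_part_eq: "degree_part k U = (\<lambda>x. (\<lambda>v. \<chi> I. if card I = k then v $ I else 0) (U x))"
  by (simp add: degree_part_def fun_eq_iff)

lemma smooth_degree_part: "smooth U \<Longrightarrow> smooth (degree_part k U)"
  unfolding degree_part_eq by (rule smooth_linear[OF linear_degree_part])

lemma k_form_degree_part [simp]: "k_form k (degree_part k U)"
  by (simp add: k_form_def degree_part_def fun_eq_iff vec_eq_iff)

lemma degree_part_lincomb:
  "degree_part k (\<lambda>x. a *\<^sub>R U x + b *\<^sub>R W x) = (\<lambda>x. a *\<^sub>R degree_part k U x + b *\<^sub>R degree_part k W x)"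
  by (simp add: degree_part_def fun_eq_iff vec_eq_iff)

lemma k_form_lincomb: "k_form k U \<Longrightarrow> k_form k W \<Longrightarrow> k_form k (\<lambda>x. a *\<^sub>R U x + b *\<^sub>R W x)"
  unfolding k_form_def degree_part_lincomb by simp

lemma sum_degree_part: "(\<Sum>k\<le>CARD('n). degree_part k U x) = U (x :: 'n::finite point)"
proof (subst vec_eq_iff, safe)
  fix I :: "'n set"
  have "card I \<le> CARD('n)" by (simp add: card_mono)
  then show "(\<Sum>k\<le>CARD('n). degree_part k U x) $ I = U x $ I"
    by (simp add: degree_part_def sum.delta)
qed

lemma norm_sq_degree_part: "(norm (U x))\<^sup>2 = (\<Sum>k\<le>CARD('n). (norm (degree_part k U (x :: 'n::finite point)))\<^sup>2)"
proof -
  have "(\<Sum>k\<le>CARD('n). (norm (degree_part k U x))\<^sup>2) = (\<Sum>k\<le>CARD('n). \<Sum>I\<in>UNIV. if k = card I then (U x $ I)\<^sup>2 else 0)"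
    by (simp add: norm_vec_def L2_set_def degree_part_def sum_nonneg) (intro sum.cong refl, auto)
  also have "\<dots> = (\<Sum>I\<in>UNIV. (U x $ I)\<^sup>2)"
    by (subst sum.swap) (simp add: sum.delta card_mono)
  finally show ?thesis by (simp add: norm_vec_def L2_set_def sum_nonneg)
qed

section \<open>Cellular complexes on the torus\<close>

lemma negligible_AE:
  assumes "negligible (- S :: 'a::euclidean_space set)" shows "AE x in lborel. x \<in> S"
proof -
  have "- S \<in> null_sets lebesgue" using assms by (simp add: negligible_iff_null_sets)
  then have "AE x in lebesgue. x \<in> S" by (rule AE_I') auto
  then show ?thesis by (simp add: AE_completion_iff)
qed

lemma negligible_countable_UN:
  assumes "countable I" "\<And>i. i \<in> I \<Longrightarrow> negligible (N i)"
  shows "negligible (\<Union>i\<in>I. N i)"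
  using assms unfolding negligible_iff_null_sets by (intro null_sets_UN') auto

context lattice_basis begin

lemma finite_mod_latticeE:
  assumes "finite_mod_lattice e \<C>"
  obtains F where "F \<subseteq> \<C>" "finite F" "\<forall>C\<in>\<C>. \<exists>C'\<in>F. \<exists>l\<in>L. C = (+) l ` C'"
proof -
  have "\<exists>F. F \<subseteq> \<C> \<and> finite F \<and> (\<forall>C\<in>\<C>. \<exists>C'\<in>F. \<exists>l\<in>L. C = (+) l ` C')"
    using assms unfolding finite_mod_lattice_def by (rule conjunct2)
  then show thesis by (elim exE conjE) (rule that)
qed

text \<open>A translate of one of the finitely many representatives meets \<open>K\<close> only if
  the lattice vector is bounded by the sizes of both.\<close>

lemma finite_mod_lattice_locally_finite:
  assumes C: "finite_mod_lattice e \<C>" and b: "\<And>C. C \<in> \<C> \<Longrightarrow> bounded C" and K: "bounded K"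
  shows "finite {C\<in>\<C>. C \<inter> K \<noteq> {}}"
proof -
  obtain F where F: "F \<subseteq> \<C>" "finite F" "\<forall>C\<in>\<C>. \<exists>C'\<in>F. \<exists>l\<in>L. C = (+) l ` C'"
    by (rule finite_mod_latticeE[OF C])
  obtain a where a: "\<And>x. x \<in> K \<Longrightarrow> norm x \<le> a" using K unfolding bounded_iff by blast
  have "bounded (\<Union>F)" using F b by (intro bounded_Union) auto
  then obtain c where c: "\<And>x. x \<in> \<Union>F \<Longrightarrow> norm x \<le> c" unfolding bounded_iff by blast
  have "finite (L \<inter> cball 0 (a + c))" by (rule finite_lattice_bounded) simp
  then have fin: "finite ((\<lambda>(l, C'). (+) l ` C') ` ((L \<inter> cball 0 (a + c)) \<times> F))" using F by simp
  have "{C\<in>\<C>. C \<inter> K \<noteq> {}} \<subseteq> (\<lambda>(l, C'). (+) l ` C') ` ((L \<inter> cball 0 (a + c)) \<times> F)"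
  proof
    fix C assume "C \<in> {C\<in>\<C>. C \<inter> K \<noteq> {}}"
    then obtain y where y: "C \<in> \<C>" "y \<in> C" "y \<in> K" by auto
    obtain C' l where l: "C' \<in> F" "l \<in> L" "C = (+) l ` C'" using bspec[OF F(3) y(1)] by (elim bexE)
    then obtain x where x: "x \<in> C'" "y = l + x" using y by auto
    have "norm x \<le> c" using c x l by blast
    moreover have "norm y \<le> a" using a y by blast
    moreover have "norm l \<le> norm y + norm x" using norm_triangle_ineq4[of y x] x by simp
    ultimately have "l \<in> cball 0 (a + c)" by simp
    then show "C \<in> (\<lambda>(l, C'). (+) l ` C') ` ((L \<inter> cball 0 (a + c)) \<times> F)"
      using l by (intro image_eqI[of _ _ "(l, C')"]) auto
  qed
  then show ?thesis using fin by (rule finite_subset)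
qed

lemma finite_mod_lattice_countable:
  assumes C: "finite_mod_lattice e \<C>" shows "countable \<C>"
proof -
  obtain F where F: "F \<subseteq> \<C>" "finite F" "\<forall>C\<in>\<C>. \<exists>C'\<in>F. \<exists>l\<in>L. C = (+) l ` C'"
    by (rule finite_mod_latticeE[OF C])
  have "countable ((\<lambda>(l, C'). (+) l ` C') ` (L \<times> F))"
    using countable_lattice F by (intro countable_image countable_SIGMA) (auto simp: countable_finite)
  moreover have "\<C> \<subseteq> (\<lambda>(l, C'). (+) l ` C') ` (L \<times> F)"
  proof
    fix C assume "C \<in> \<C>"
    from bspec[OF F(3) this] obtain C' l where "C' \<in> F" "l \<in> L" "C = (+) l ` C'" by (elim bexE)
    then show "C \<in> (\<lambda>(l, C'). (+) l ` C') ` (L \<times> F)" by (intro image_eqI[of _ _ "(l, C')"]) auto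
  qed
  ultimately show ?thesis by (rule countable_subset[rotated])
qed

text \<open>By local finiteness a point outside the union has an open neighbourhood outside it, and
  a nonempty open set is not null.\<close>

lemma locally_finite_cover:
  assumes fin: "\<And>K. bounded K \<Longrightarrow> finite {C\<in>\<C>. C \<inter> K \<noteq> {}}" and cl: "\<And>C. C \<in> \<C> \<Longrightarrow> closed C"
    and neg: "negligible (- \<Union>\<C>)"
  shows "\<Union>\<C> = (UNIV :: 'n point set)"
proof (rule ccontr)
  assume "\<Union>\<C> \<noteq> UNIV"
  then obtain x where x: "x \<notin> \<Union>\<C>" by auto
  let ?A = "{C\<in>\<C>. C \<inter> ball x 1 \<noteq> {}}"
  have "closed (\<Union>?A)" using fin[of "ball x 1"] cl by (intro closed_Union) auto
  then have "open (ball x 1 - \<Union>?A)" by (intro open_Diff) auto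
  moreover have "x \<in> ball x 1 - \<Union>?A" using x by simp
  then have "ball x 1 - \<Union>?A \<noteq> {}" by blast
  ultimately have "\<not> negligible (ball x 1 - \<Union>?A)" by (rule open_not_negligible)
  moreover have "ball x 1 - \<Union>?A \<subseteq> - \<Union>\<C>" by auto
  ultimately show False using neg negligible_subset by blast
qed

end

locale torus_mesh = lattice_basis e for e :: "'n::{finite,linorder} \<Rightarrow> 'n point" +
  fixes \<T> :: "'n point set set"
  assumes complex: "torus_complex e \<T>"
begin

definition "full = {T\<in>\<T>. cell_dim T = CARD('n)}"

lemma fullD: "T \<in> full \<Longrightarrow> T \<in> \<T>" "T \<in> full \<Longrightarrow> cell_dim T = CARD('n)" by (simp_all add: full_def)

lemma is_cell: "T \<in> \<T> \<Longrightarrow> is_cell (cell_dim T) T (cell_boundary T)"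
  using complex is_cell_dim_boundary unfolding torus_complex_def cell_family_def by metis

lemma full_is_cell: "T \<in> full \<Longrightarrow> is_cell (CARD('n)) T (cell_boundary T)"
  using is_cell[of T] by (simp add: full_def)

lemmas full_cell_props = full_cell[OF full_is_cell]

lemma cell_compact: "T \<in> \<T> \<Longrightarrow> compact T"
  using is_cell is_cell_compact by blast

lemma cell_nonempty: "T \<in> \<T> \<Longrightarrow> cell_interior T \<noteq> {}"
  using is_cell_negligible(4,5)[OF is_cell[of T]] by (auto simp: cell_interior_def)

lemma finite_mod: "finite_mod_lattice e \<T>" using complex by (simp add: torus_complex_def)

lemma cell_translate_mem:
  assumes "T \<in> \<T>" "l \<in> L"
  shows "(+) l ` T \<in> \<T>" "cell_dim ((+) l ` T) = cell_dim T" "cell_interior ((+) l ` T) = (+) l ` cell_interior T"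
  using finite_mod cell_translate[OF is_cell[OF assms(1)]] assms by (auto simp: finite_mod_lattice_def)

lemma cell_interior_disjoint: "T \<in> \<T> \<Longrightarrow> T' \<in> \<T> \<Longrightarrow> x \<in> cell_interior T \<Longrightarrow> x \<in> cell_interior T' \<Longrightarrow> T = T'"
  using complex unfolding torus_complex_def cell_family_def by blast

lemma countable_cells: "countable \<T>"
  by (rule finite_mod_lattice_countable[OF finite_mod])

lemma locally_finite: "bounded K \<Longrightarrow> finite {T\<in>\<T>. T \<inter> K \<noteq> {}}"
  by (rule finite_mod_lattice_locally_finite[OF finite_mod]) (auto intro: compact_imp_bounded cell_compact)

lemma full_interior_negligible: "negligible (- (\<Union>T\<in>full. cell_interior T))"
proof -
  have U: "\<Union>\<T> = UNIV" using complex by (simp add: torus_complex_def)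
  have "negligible (\<Union>T\<in>\<T>. if T \<in> full then T - cell_interior T else T)"
  proof (rule negligible_countable_UN[OF countable_cells])
    fix T assume T: "T \<in> \<T>"
    show "negligible (if T \<in> full then T - cell_interior T else T)"
      using full_cell_props(5)[of T] is_cell_negligible(1,3)[OF is_cell[OF T]] T by (auto simp: full_def)
  qed
  moreover have "- (\<Union>T\<in>full. cell_interior T) \<subseteq> (\<Union>T\<in>\<T>. if T \<in> full then T - cell_interior T else T)"
  proof
    fix x assume x: "x \<in> - (\<Union>T\<in>full. cell_interior T)"
    obtain T where "T \<in> \<T>" "x \<in> T" using U by blast
    then show "x \<in> (\<Union>T\<in>\<T>. if T \<in> full then T - cell_interior T else T)" using x by (intro UN_I[of T]) auto
  qed
  ultimately show ?thesis by (rule negligible_subset)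
qed

lemma AE_full_interior: "AE x in lborel. \<exists>T\<in>full. x \<in> cell_interior T"
  using negligible_AE[OF full_interior_negligible] by simp

text \<open>Lower-dimensional cells and boundaries are countably many null sets, so the
  \<open>n\<close>-cells cover almost everything, and by local finiteness then everything.\<close>

lemma full_cover: "\<exists>T\<in>full. x \<in> T"
proof -
  have "\<Union>full = UNIV"
  proof (rule locally_finite_cover)
    show "finite {C \<in> full. C \<inter> K \<noteq> {}}" if "bounded K" for K
      by (rule finite_subset[OF _ locally_finite[OF that]]) (auto simp: full_def)
    show "closed C" if "C \<in> full" for C using that cell_compact compact_imp_closed by (auto simp: full_def)
    show "negligible (- \<Union>full)"
      by (rule negligible_subset[OF full_interior_negligible]) (use full_cell_props(3) in blast)
  qed
  then show ?thesis by blast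
qed

lemma finite_subcells: "T \<in> \<T> \<Longrightarrow> finite {D\<in>\<T>. D \<subseteq> T}"
proof -
  assume T: "T \<in> \<T>"
  have "{D\<in>\<T>. D \<subseteq> T} \<subseteq> {D\<in>\<T>. D \<inter> T \<noteq> {}}" using cell_nonempty by (auto simp: cell_interior_def)
  then show ?thesis using locally_finite[OF compact_imp_bounded[OF cell_compact[OF T]]] finite_subset by blast
qed

lemma boundary_cell:
  assumes "T \<in> \<T>" "x \<in> cell_boundary T"
  shows "\<exists>D\<in>\<T>. x \<in> D \<and> D \<subseteq> cell_boundary T"
proof -
  have "\<forall>T\<in>\<T>. \<exists>\<C>\<subseteq>\<T>. cell_boundary T = \<Union>\<C>"
    using complex by (simp add: torus_complex_def cell_family_def)
  from bspec[OF this assms(1)] obtain \<C> where "\<C> \<subseteq> \<T>" "cell_boundary T = \<Union>\<C>" by (elim exE conjE)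
  then show ?thesis using assms(2) by (auto simp: subset_iff)
qed

text \<open>Descent: if \<open>x\<close> is not interior to \<open>C\<close>, it lies in a cell of
  the boundary of \<open>C\<close>, which has strictly fewer subcells. It can end only at the one
  cell with \<open>x\<close> in its interior.\<close>

lemma subcell_of_point:
  assumes "T' \<in> \<T>" "x \<in> cell_interior T'" "C \<in> \<T>" "x \<in> C"
  shows "T' \<subseteq> C"
  using assms(3,4)
proof (induction "card {D\<in>\<T>. D \<subseteq> C}" arbitrary: C rule: less_induct)
  case less
  show ?case
  proof (cases "x \<in> cell_interior C")
    case True then show ?thesis using cell_interior_disjoint[OF assms(1) less.prems(1) assms(2)] by blast
  next
    case False
    then have xb: "x \<in> cell_boundary C" using less.prems by (simp add: cell_interior_def)
    obtain D where D: "D \<in> \<T>" "x \<in> D" "D \<subseteq> cell_boundary C"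
      using boundary_cell[OF less.prems(1) xb] by (elim bexE conjE)
    have DC: "D \<subseteq> C" "D \<noteq> C" using D is_cell_negligible(4,5)[OF is_cell[OF less.prems(1)]] by blast+
    have "card {E\<in>\<T>. E \<subseteq> D} < card {E\<in>\<T>. E \<subseteq> C}"
    proof (rule psubset_card_mono[OF finite_subcells[OF less.prems(1)]])
      have "C \<in> {E\<in>\<T>. E \<subseteq> C}" "C \<notin> {E\<in>\<T>. E \<subseteq> D}" using less.prems DC by auto
      then show "{E\<in>\<T>. E \<subseteq> D} \<subset> {E\<in>\<T>. E \<subseteq> C}" using DC by blast
    qed
    then show ?thesis using less.hyps[OF _ D(1,2)] DC by blast
  qed
qed

lemma subset_full: "T' \<in> \<T> \<Longrightarrow> \<exists>T\<in>full. T' \<subseteq> T"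
proof -
  assume T': "T' \<in> \<T>"
  then obtain x where x: "x \<in> cell_interior T'" using cell_nonempty by blast
  obtain T where "T \<in> full" "x \<in> T" using full_cover by blast
  then show ?thesis using subcell_of_point[OF T' x] fullD by blast
qed

end

section \<open>Finite element spaces and the interpolator\<close>

locale fe_mesh = torus_mesh e \<T> for e :: "'n::{finite,linorder} \<Rightarrow> 'n point" and \<T> +
  fixes X :: "'n element_system" and F :: "'n dofs" and p :: nat
  assumes compat: "compatible_system \<T> X" and per_X: "periodic_system e \<T> X"
    and dofs: "unisolvent_dofs e \<T> X F" and poly: "contains_polynomials p \<T> X"
begin

lemma fes_at:
  assumes "T \<in> \<T>" "k \<le> CARD('n)"
  shows "\<forall>U\<in>X T k. smooth U \<and> k_form k U"
    "\<forall>U\<in>X T k. \<forall>W. smooth W \<longrightarrow> k_form k W \<longrightarrow> same_pullback T U W \<longrightarrow> W \<in> X T k"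
    "(\<lambda>x. 0) \<in> X T k"
    "\<forall>U\<in>X T k. \<forall>W\<in>X T k. \<forall>a b. (\<lambda>x. a *\<^sub>R U x + b *\<^sub>R W x) \<in> X T k"
    "\<forall>T'\<in>\<T>. T' \<subseteq> T \<longrightarrow> X T k \<subseteq> X T' k"
proof -
  have "finite_element_system \<T> X" using compat by (simp add: compatible_system_def)
  note * = bspec[OF this[unfolded finite_element_system_def] assms(1), THEN spec, THEN mp, OF assms(2)]
  show "\<forall>U\<in>X T k. smooth U \<and> k_form k U"
    "\<forall>U\<in>X T k. \<forall>W. smooth W \<longrightarrow> k_form k W \<longrightarrow> same_pullback T U W \<longrightarrow> W \<in> X T k"
    "(\<lambda>x. 0) \<in> X T k"
    "\<forall>U\<in>X T k. \<forall>W\<in>X T k. \<forall>a b. (\<lambda>x. a *\<^sub>R U x + b *\<^sub>R W x) \<in> X T k"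
    "\<forall>T'\<in>\<T>. T' \<subseteq> T \<longrightarrow> X T k \<subseteq> X T' k"
    by (rule *[THEN conjunct1] *[THEN conjunct2, THEN conjunct1] *[THEN conjunct2, THEN conjunct2, THEN conjunct1]
      *[THEN conjunct2, THEN conjunct2, THEN conjunct2, THEN conjunct1]
      *[THEN conjunct2, THEN conjunct2, THEN conjunct2, THEN conjunct2, THEN conjunct2, THEN conjunct2])+
qed

lemma X_smooth: "T \<in> \<T> \<Longrightarrow> k \<le> CARD('n) \<Longrightarrow> U \<in> X T k \<Longrightarrow> smooth U"
  and X_k_form: "T \<in> \<T> \<Longrightarrow> k \<le> CARD('n) \<Longrightarrow> U \<in> X T k \<Longrightarrow> k_form k U"
  using fes_at(1) by simp_all

lemma X_lincomb: "T \<in> \<T> \<Longrightarrow> k \<le> CARD('n) \<Longrightarrow> U \<in> X T k \<Longrightarrow> W \<in> X T k \<Longrightarrow> (\<lambda>x. a *\<^sub>R U x + b *\<^sub>R W x) \<in> X T k"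
  by (rule bspec[OF bspec[OF fes_at(4)], THEN spec, THEN spec])

lemma X_mono: "T \<in> \<T> \<Longrightarrow> k \<le> CARD('n) \<Longrightarrow> T' \<in> \<T> \<Longrightarrow> T' \<subseteq> T \<Longrightarrow> U \<in> X T k \<Longrightarrow> U \<in> X T' k"
  using fes_at(5) by blast

lemma X_shift: "T \<in> \<T> \<Longrightarrow> k \<le> CARD('n) \<Longrightarrow> l \<in> L \<Longrightarrow> U \<in> X T k \<Longrightarrow> (\<lambda>x. U (x - l)) \<in> X ((+) l ` T) k"
  using per_X by (simp add: periodic_system_def)

text \<open>A constant is a polynomial of degree \<open>0\<close>, whose coefficient family is
  supported at the zero multi-index. Every later step that subtracts a constant from a finite
  element form rests on this.\<close>

lemma X_const:
  assumes "T \<in> \<T>" "k \<le> CARD('n)" shows "degree_part k (\<lambda>x. c) \<in> X T k"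
proof -
  let ?\<alpha>0 = "\<lambda>i::'n. 0::nat"
  have fin: "finite {\<alpha> :: 'n \<Rightarrow> nat. (\<Sum>i\<in>UNIV. \<alpha> i) \<le> p}"
  proof (rule finite_subset)
    show "{\<alpha> :: 'n \<Rightarrow> nat. (\<Sum>i\<in>UNIV. \<alpha> i) \<le> p} \<subseteq> Pi\<^sub>E UNIV (\<lambda>_. {..p})"
      by (auto simp: PiE_def Pi_def) (metis UNIV_I finite le_trans member_le_sum zero_le)
  qed (simp add: finite_PiE)
  have "poly_map p (\<lambda>x::'n point. c' :: (real, 'n set) vec)" for c'
  proof -
    have "(\<Sum>\<alpha> | (\<Sum>i\<in>UNIV. \<alpha> i) \<le> p. (\<Prod>i\<in>UNIV. (x $ i) ^ \<alpha> i) *\<^sub>R (if \<alpha> = ?\<alpha>0 then c' else 0)) = c'" for x :: "'n point"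
    proof -
      have "(\<Sum>\<alpha> | (\<Sum>i\<in>UNIV. \<alpha> i) \<le> p. (\<Prod>i\<in>UNIV. (x $ i) ^ \<alpha> i) *\<^sub>R (if \<alpha> = ?\<alpha>0 then c' else 0))
        = (\<Sum>\<alpha> | (\<Sum>i\<in>UNIV. \<alpha> i) \<le> p. if \<alpha> = ?\<alpha>0 then c' else 0)"
        by (rule sum.cong) auto
      also have "\<dots> = c'" using fin by (simp add: sum.delta)
      finally show ?thesis .
    qed
    then show ?thesis unfolding poly_map_def by (intro exI[of _ "\<lambda>\<alpha>. if \<alpha> = ?\<alpha>0 then c' else 0"]) simp
  qed
  then have "poly_map p (degree_part k (\<lambda>x::'n point. c))" unfolding degree_part_def .
  then show ?thesis using poly assms by (simp add: contains_polynomials_def)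
qed

lemma dofs_at:
  assumes "T \<in> \<T>" "k \<le> CARD('n)"
  shows "\<forall>m\<in>F T k. \<forall>U W. smooth U \<longrightarrow> k_form k U \<longrightarrow> smooth W \<longrightarrow> k_form k W \<longrightarrow>
        (\<forall>a b. m (\<lambda>x. a *\<^sub>R U x + b *\<^sub>R W x) = a * m U + b * m W) \<and> (same_pullback T U W \<longrightarrow> m U = m W)"
    "\<forall>m\<in>F T k. \<forall>l\<in>lattice_points e. (\<lambda>U. m (\<lambda>x. U (x + l))) \<in> F ((+) l ` T) k"
    "\<forall>U. smooth U \<longrightarrow> k_form k U \<longrightarrow> (\<exists>W\<in>X T k. \<forall>T'\<in>\<T>. T' \<subseteq> T \<longrightarrow> (\<forall>m\<in>F T' k. m W = m U))"
    "\<forall>W\<in>X T k. (\<forall>T'\<in>\<T>. T' \<subseteq> T \<longrightarrow> (\<forall>m\<in>F T' k. m W = 0)) \<longrightarrow> same_pullback T W (\<lambda>x. 0)"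
proof -
  note * = bspec[OF dofs[unfolded unisolvent_dofs_def] assms(1), THEN spec, THEN mp, OF assms(2)]
  show "\<forall>m\<in>F T k. \<forall>U W. smooth U \<longrightarrow> k_form k U \<longrightarrow> smooth W \<longrightarrow> k_form k W \<longrightarrow>
        (\<forall>a b. m (\<lambda>x. a *\<^sub>R U x + b *\<^sub>R W x) = a * m U + b * m W) \<and> (same_pullback T U W \<longrightarrow> m U = m W)"
    "\<forall>m\<in>F T k. \<forall>l\<in>lattice_points e. (\<lambda>U. m (\<lambda>x. U (x + l))) \<in> F ((+) l ` T) k"
    "\<forall>U. smooth U \<longrightarrow> k_form k U \<longrightarrow> (\<exists>W\<in>X T k. \<forall>T'\<in>\<T>. T' \<subseteq> T \<longrightarrow> (\<forall>m\<in>F T' k. m W = m U))"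
    "\<forall>W\<in>X T k. (\<forall>T'\<in>\<T>. T' \<subseteq> T \<longrightarrow> (\<forall>m\<in>F T' k. m W = 0)) \<longrightarrow> same_pullback T W (\<lambda>x. 0)"
    by (rule *[THEN conjunct1] *[THEN conjunct2, THEN conjunct1] *[THEN conjunct2, THEN conjunct2, THEN conjunct1]
      *[THEN conjunct2, THEN conjunct2, THEN conjunct2])+
qed

lemma dof_lin:
  assumes "T \<in> \<T>" "k \<le> CARD('n)" "m \<in> F T k" "smooth U" "k_form k U" "smooth W" "k_form k W"
  shows "m (\<lambda>x. a *\<^sub>R U x + b *\<^sub>R W x) = a * m U + b * m W"
proof -
  note * = bspec[OF dofs_at(1)[OF assms(1,2)] assms(3), THEN spec[of _ U], THEN spec[of _ W]]
  show ?thesis using *[THEN mp, OF assms(4), THEN mp, OF assms(5), THEN mp, OF assms(6), THEN mp, OF assms(7), THEN conjunct1] by simp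
qed

lemma dof_pull:
  assumes "T \<in> \<T>" "k \<le> CARD('n)" "m \<in> F T k" "smooth U" "k_form k U" "smooth W" "k_form k W" "same_pullback T U W"
  shows "m U = m W"
  using bspec[OF dofs_at(1)[OF assms(1,2)] assms(3), THEN spec[of _ U], THEN spec[of _ W]] assms(4-8) by simp

lemma dof_unique:
  assumes T: "T \<in> \<T>" "k \<le> CARD('n)" and UW: "U \<in> X T k" "W \<in> X T k"
    and eq: "\<And>T' m. T' \<in> \<T> \<Longrightarrow> T' \<subseteq> T \<Longrightarrow> m \<in> F T' k \<Longrightarrow> m U = m W"
  shows "same_pullback T U W"
proof -
  have "(\<lambda>x. 1 *\<^sub>R U x + (-1) *\<^sub>R W x) \<in> X T k" by (rule X_lincomb[OF T UW])
  moreover have "m (\<lambda>x. 1 *\<^sub>R U x + (-1) *\<^sub>R W x) = 0" if m: "T' \<in> \<T>" "T' \<subseteq> T" "m \<in> F T' k" for T' m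
    by (subst dof_lin[OF m(1) T(2) m(3)]) (use X_smooth[OF T] X_k_form[OF T] UW eq[OF m] in auto)
  ultimately have "same_pullback T (\<lambda>x. 1 *\<^sub>R U x + (-1) *\<^sub>R W x) (\<lambda>x. 0)"
    using bspec[OF dofs_at(4)[OF T]] by blast
  then show ?thesis by (simp only: same_pullback_diff_zero)
qed

text \<open>The relation under the description operator of \<open>interpolator\<close>. Naming it
  separates existence from uniqueness, and linearity of the interpolator then follows from
  uniqueness.\<close>

definition interp_spec :: "'n form \<Rightarrow> 'n form \<Rightarrow> bool" where
  "interp_spec u v \<longleftrightarrow> v \<in> fe_space e \<T> X \<and> (\<forall>k\<le>CARD('n). \<exists>U W.
     has_traces \<T> k (degree_part k u) U \<and>
     has_traces \<T> k (degree_part k v) W \<and> (\<forall>T\<in>\<T>. W T \<in> X T k) \<and>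
     (\<forall>T\<in>\<T>. \<forall>m\<in>F T k. m (W T) = m (U T)))"

lemma interpolator_eq: "interpolator e \<T> X F u = (THE v. interp_spec u v)"
  by (simp add: interpolator_def interp_spec_def)

lemma has_tracesD:
  assumes "has_traces \<T> k u W"
  shows "T \<in> \<T> \<Longrightarrow> smooth (W T)" "T \<in> \<T> \<Longrightarrow> k_form k (W T)"
    "T \<in> \<T> \<Longrightarrow> T' \<in> \<T> \<Longrightarrow> T' \<subseteq> T \<Longrightarrow> same_pullback T' (W T) (W T')"
    "T \<in> full \<Longrightarrow> x \<in> cell_interior T \<Longrightarrow> u x = W T x"
  using assms by (simp_all add: has_traces_def full_def)

lemma has_traces_lincomb:
  assumes "has_traces \<T> k u U" "has_traces \<T> k u' U'"
  shows "has_traces \<T> k (\<lambda>x. a *\<^sub>R u x + b *\<^sub>R u' x) (\<lambda>T x. a *\<^sub>R U T x + b *\<^sub>R U' T x)"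
  using assms unfolding has_traces_def by (simp add: smooth_lincomb k_form_lincomb same_pullback_lincomb)

lemma fe_spaceD:
  assumes "v \<in> fe_space e \<T> X" "k \<le> CARD('n)"
  obtains W where "has_traces \<T> k (degree_part k v) W" "\<And>T. T \<in> \<T> \<Longrightarrow> W T \<in> X T k"
  using assms by (auto simp: fe_space_def fe_space_deg_def)

lemma fe_space_degD:
  assumes "v \<in> fe_space e \<T> X" "k \<le> CARD('n)"
  shows "periodic e (degree_part k v)" "(\<And>T. T \<in> full \<Longrightarrow> x \<notin> cell_interior T) \<Longrightarrow> degree_part k v x = 0"
  using assms by (auto simp: fe_space_def fe_space_deg_def full_def)

lemma eq_of_degree_parts:
  assumes "\<And>k. k \<le> CARD('n) \<Longrightarrow> degree_part k v x = degree_part k w (y :: 'n point)" shows "v x = w y"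
  using assms sum_degree_part[of v x] sum_degree_part[of w y] by (metis (mono_tags, lifting) atMost_iff sum.cong)

lemma fe_space_outside:
  assumes "v \<in> fe_space e \<T> X" "\<And>T. T \<in> full \<Longrightarrow> x \<notin> cell_interior T" shows "v x = 0"
proof -
  have "degree_part k v x = degree_part k (\<lambda>x. 0) x" if "k \<le> CARD('n)" for k
    using fe_space_degD(2)[OF assms(1) that assms(2)] by (simp add: degree_part_def vec_eq_iff)
  then show ?thesis using eq_of_degree_parts[of v x "\<lambda>x. 0" x] by blast
qed

lemma fe_space_lincomb:
  assumes v: "v \<in> fe_space e \<T> X" and w: "w \<in> fe_space e \<T> X"
  shows "(\<lambda>x. a *\<^sub>R v x + b *\<^sub>R w x) \<in> fe_space e \<T> X"
  unfolding fe_space_def mem_Collect_eq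
proof (intro allI impI)
  fix k assume k: "k \<le> CARD('n)"
  obtain V where V: "has_traces \<T> k (degree_part k v) V" "\<And>T. T \<in> \<T> \<Longrightarrow> V T \<in> X T k" using fe_spaceD[OF v k] by blast
  obtain W where W: "has_traces \<T> k (degree_part k w) W" "\<And>T. T \<in> \<T> \<Longrightarrow> W T \<in> X T k" using fe_spaceD[OF w k] by blast
  show "degree_part k (\<lambda>x. a *\<^sub>R v x + b *\<^sub>R w x) \<in> fe_space_deg e \<T> X k"
    unfolding fe_space_deg_def mem_Collect_eq degree_part_lincomb
  proof (intro conjI exI[of _ "\<lambda>T x. a *\<^sub>R V T x + b *\<^sub>R W T x"])
    show "periodic e (\<lambda>x. a *\<^sub>R degree_part k v x + b *\<^sub>R degree_part k w x)"
      using fe_space_degD(1)[OF v k] fe_space_degD(1)[OF w k] by (simp add: periodic_def)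
    show "\<forall>x. (\<forall>T\<in>\<T>. cell_dim T = CARD('n) \<longrightarrow> x \<notin> cell_interior T) \<longrightarrow> a *\<^sub>R degree_part k v x + b *\<^sub>R degree_part k w x = 0"
      using fe_space_degD(2)[OF v k] fe_space_degD(2)[OF w k] by (simp add: full_def)
    show "has_traces \<T> k (\<lambda>x. a *\<^sub>R degree_part k v x + b *\<^sub>R degree_part k w x) (\<lambda>T x. a *\<^sub>R V T x + b *\<^sub>R W T x)"
      by (rule has_traces_lincomb[OF V(1) W(1)])
    show "\<forall>T\<in>\<T>. (\<lambda>x. a *\<^sub>R V T x + b *\<^sub>R W T x) \<in> X T k" using X_lincomb k V(2) W(2) by blast
  qed
qed

lemma interp_spec_lincomb:
  assumes "interp_spec u v" "interp_spec u' v'"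
  shows "interp_spec (\<lambda>x. a *\<^sub>R u x + b *\<^sub>R u' x) (\<lambda>x. a *\<^sub>R v x + b *\<^sub>R v' x)"
  unfolding interp_spec_def
proof (intro conjI allI impI)
  show "(\<lambda>x. a *\<^sub>R v x + b *\<^sub>R v' x) \<in> fe_space e \<T> X"
    using assms by (intro fe_space_lincomb) (simp_all add: interp_spec_def)
  fix k assume k: "k \<le> CARD('n)"
  obtain U W where 1: "has_traces \<T> k (degree_part k u) U" "has_traces \<T> k (degree_part k v) W"
    "\<forall>T\<in>\<T>. W T \<in> X T k" "\<forall>T\<in>\<T>. \<forall>m\<in>F T k. m (W T) = m (U T)"
    using assms(1) k unfolding interp_spec_def by blast
  obtain U' W' where 2: "has_traces \<T> k (degree_part k u') U'" "has_traces \<T> k (degree_part k v') W'"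
    "\<forall>T\<in>\<T>. W' T \<in> X T k" "\<forall>T\<in>\<T>. \<forall>m\<in>F T k. m (W' T) = m (U' T)"
    using assms(2) k unfolding interp_spec_def by blast
  show "\<exists>Ua Wa. has_traces \<T> k (degree_part k (\<lambda>x. a *\<^sub>R u x + b *\<^sub>R u' x)) Ua \<and>
    has_traces \<T> k (degree_part k (\<lambda>x. a *\<^sub>R v x + b *\<^sub>R v' x)) Wa \<and> (\<forall>T\<in>\<T>. Wa T \<in> X T k) \<and>
    (\<forall>T\<in>\<T>. \<forall>m\<in>F T k. m (Wa T) = m (Ua T))"
    unfolding degree_part_lincomb
  proof (intro exI conjI ballI)
    show "has_traces \<T> k (\<lambda>x. a *\<^sub>R degree_part k u x + b *\<^sub>R degree_part k u' x) (\<lambda>T x. a *\<^sub>R U T x + b *\<^sub>R U' T x)"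
      by (rule has_traces_lincomb[OF 1(1) 2(1)])
    show "has_traces \<T> k (\<lambda>x. a *\<^sub>R degree_part k v x + b *\<^sub>R degree_part k v' x) (\<lambda>T x. a *\<^sub>R W T x + b *\<^sub>R W' T x)"
      by (rule has_traces_lincomb[OF 1(2) 2(2)])
    fix T assume T: "T \<in> \<T>"
    show "(\<lambda>x. a *\<^sub>R W T x + b *\<^sub>R W' T x) \<in> X T k" using X_lincomb[OF T k] 1(3) 2(3) T by blast
    fix m assume m: "m \<in> F T k"
    have "m (\<lambda>x. a *\<^sub>R W T x + b *\<^sub>R W' T x) = a * m (W T) + b * m (W' T)"
      by (rule dof_lin[OF T k m has_tracesD(1,2)[OF 1(2) T] has_tracesD(1,2)[OF 2(2) T]])
    moreover have "m (\<lambda>x. a *\<^sub>R U T x + b *\<^sub>R U' T x) = a * m (U T) + b * m (U' T)"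
      by (rule dof_lin[OF T k m has_tracesD(1,2)[OF 1(1) T] has_tracesD(1,2)[OF 2(1) T]])
    ultimately show "m (\<lambda>x. a *\<^sub>R W T x + b *\<^sub>R W' T x) = m (\<lambda>x. a *\<^sub>R U T x + b *\<^sub>R U' T x)"
      using bspec[OF bspec[OF 1(4) T] m] bspec[OF bspec[OF 2(4) T] m] by simp
  qed
qed

text \<open>The definition of the interpolator admits any family of traces of the form. On an
  \<open>n\<close>-cell the trace is fixed by continuity from the interior, on smaller cells by
  compatibility with an \<open>n\<close>-cell that contains them.\<close>

lemma traces_of_smooth:
  assumes u: "smooth u" and U: "has_traces \<T> k (degree_part k u) U" and T: "T \<in> \<T>"
  shows "same_pullback T (U T) (degree_part k u)"
proof -
  obtain C where C: "C \<in> full" "T \<subseteq> C" using subset_full[OF T] by blast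
  have "partials [] (U C) x = partials [] (degree_part k u) x" if "x \<in> C" for x
    by (rule partials_local[OF full_cell_props(1)[OF C(1)]])
      (use has_tracesD(4)[OF U C(1)] has_tracesD(1)[OF U fullD(1)[OF C(1)]] smooth_degree_part[OF u] that full_cell_props(2)[OF C(1)] in auto)
  then have "same_pullback T (U C) (degree_part k u)" using C(2) by (intro same_pullbackI) auto
  moreover have "same_pullback T (U C) (U T)" by (rule has_tracesD(3)[OF U fullD(1)[OF C(1)] T C(2)])
  ultimately show ?thesis using same_pullback_sym same_pullback_trans by blast
qed

lemma interp_spec_traces:
  assumes u: "smooth u" and spec: "interp_spec u v" and k: "k \<le> CARD('n)"
  obtains W where "has_traces \<T> k (degree_part k v) W" "\<And>T. T \<in> \<T> \<Longrightarrow> W T \<in> X T k"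
    "\<And>T m. T \<in> \<T> \<Longrightarrow> m \<in> F T k \<Longrightarrow> m (W T) = m (degree_part k u)"
proof -
  obtain U W where 1: "has_traces \<T> k (degree_part k u) U" "has_traces \<T> k (degree_part k v) W"
    "\<forall>T\<in>\<T>. W T \<in> X T k" "\<forall>T\<in>\<T>. \<forall>m\<in>F T k. m (W T) = m (U T)"
    using spec k unfolding interp_spec_def by blast
  show thesis
  proof (rule that[OF 1(2)])
    show "W T \<in> X T k" if "T \<in> \<T>" for T using 1(3) that by blast
    fix T m assume T: "T \<in> \<T>" and m: "m \<in> F T k"
    have "m (U T) = m (degree_part k u)"
      by (rule dof_pull[OF T k m has_tracesD(1,2)[OF 1(1) T] smooth_degree_part[OF u] k_form_degree_part traces_of_smooth[OF u 1(1) T]])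
    then show "m (W T) = m (degree_part k u)" using bspec[OF bspec[OF 1(4) T] m] by simp
  qed
qed

text \<open>Outside the interiors of the \<open>n\<close>-cells both candidates are \<open>0\<close>
  by normalisation. Inside, they share the degrees of freedom of all subcells, and unisolvence
  applies degree by degree.\<close>

lemma interp_spec_unique:
  assumes u: "smooth u" and v: "interp_spec u v" and v': "interp_spec u v'"
  shows "v = v'"
proof
  fix x
  show "v x = v' x"
  proof (cases "\<exists>T\<in>full. x \<in> cell_interior T")
    case False
    then show ?thesis using fe_space_outside[of v x] fe_space_outside[of v' x] v v' by (simp add: interp_spec_def)
  next
    case True
    then obtain T where T: "T \<in> full" "x \<in> cell_interior T" by blast
    note TT = fullD(1)[OF T(1)]
    show ?thesis
    proof (rule eq_of_degree_parts)
      fix k assume k: "k \<le> CARD('n)"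
      obtain W where W: "has_traces \<T> k (degree_part k v) W" "\<And>T. T \<in> \<T> \<Longrightarrow> W T \<in> X T k"
        "\<And>T m. T \<in> \<T> \<Longrightarrow> m \<in> F T k \<Longrightarrow> m (W T) = m (degree_part k u)" using interp_spec_traces[OF u v k] by metis
      obtain W' where W': "has_traces \<T> k (degree_part k v') W'" "\<And>T. T \<in> \<T> \<Longrightarrow> W' T \<in> X T k"
        "\<And>T m. T \<in> \<T> \<Longrightarrow> m \<in> F T k \<Longrightarrow> m (W' T) = m (degree_part k u)" using interp_spec_traces[OF u v' k] by metis
      have "same_pullback T (W T) (W' T)"
      proof (rule dof_unique[OF TT k W(2)[OF TT] W'(2)[OF TT]])
        fix T' m assume T': "T' \<in> \<T>" "T' \<subseteq> T" and m: "m \<in> F T' k"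
        have "m (W T) = m (W T')"
          by (rule dof_pull[OF T'(1) k m has_tracesD(1,2)[OF W(1) TT] has_tracesD(1,2)[OF W(1) T'(1)] has_tracesD(3)[OF W(1) TT T'(1,2)]])
        moreover have "m (W' T) = m (W' T')"
          by (rule dof_pull[OF T'(1) k m has_tracesD(1,2)[OF W'(1) TT] has_tracesD(1,2)[OF W'(1) T'(1)] has_tracesD(3)[OF W'(1) TT T'(1,2)]])
        ultimately show "m (W T) = m (W' T)" using W(3)[OF T'(1) m] W'(3)[OF T'(1) m] by simp
      qed
      then have "W T x = W' T x"
        by (rule same_pullback_open) (use full_cell_props(1,3)[OF T(1)] T(2) in auto)
      then show "degree_part k v x = degree_part k v' x"
        using has_tracesD(4)[OF W(1) T] has_tracesD(4)[OF W'(1) T] by simp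
    qed
  qed
qed

text \<open>On each cell a local interpolant is chosen, without any coordination between cells.
  Restrictions and lattice translates nevertheless agree under pullback, since they share their
  degrees of freedom.\<close>

lemma interp_spec_exists:
  assumes u: "smooth u" and per: "periodic e u"
  shows "\<exists>v. interp_spec u v"
proof -
  define P where "P k T W \<longleftrightarrow> W \<in> X T k \<and> (\<forall>T'\<in>\<T>. T' \<subseteq> T \<longrightarrow> (\<forall>m\<in>F T' k. m W = m (degree_part k u)))" for k T W
  define W where "W k T = (SOME W. P k T W)" for k T
  have W: "P k T (W k T)" if "k \<le> CARD('n)" "T \<in> \<T>" for k T
  proof -
    have "\<exists>W. P k T W"
      using dofs_at(3)[OF that(2,1), THEN spec[of _ "degree_part k u"]] smooth_degree_part[OF u] unfolding P_def by auto
    then show ?thesis unfolding W_def by (rule someI_ex)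
  qed
  have WX: "W k T \<in> X T k" if "k \<le> CARD('n)" "T \<in> \<T>" for k T using W[OF that] by (simp add: P_def)
  have Wm: "m (W k T) = m (degree_part k u)" if "k \<le> CARD('n)" "T \<in> \<T>" "T' \<in> \<T>" "T' \<subseteq> T" "m \<in> F T' k" for k T T' m
    using W[OF that(1,2)] that(3-5) by (simp add: P_def)
  have Wk: "k_form k (W k T)" and Ws: "smooth (W k T)" if "k \<le> CARD('n)" "T \<in> \<T>" for k T
    using X_k_form[OF that(2,1) WX[OF that]] X_smooth[OF that(2,1) WX[OF that]] by auto
  have Wp: "same_pullback T' (W k T) (W k T')" if k: "k \<le> CARD('n)" and T: "T \<in> \<T>" "T' \<in> \<T>" "T' \<subseteq> T" for k T T'
  proof (rule dof_unique[OF T(2) k X_mono[OF T(1) k T(2,3) WX[OF k T(1)]] WX[OF k T(2)]])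
    fix T'' m assume "T'' \<in> \<T>" "T'' \<subseteq> T'" "m \<in> F T'' k"
    then show "m (W k T) = m (W k T')" using Wm[OF k T(1)] Wm[OF k T(2)] T(3) by (metis order_trans)
  qed
  \<comment> \<open>Unisolvence on \<open>T\<close> compares the choice on \<open>?lT\<close>, moved
    back, with the choice on \<open>T\<close>. Equality is claimed in the interior only, as the
    choices are determined just up to \<open>same_pullback\<close>.\<close>
  have Wper: "W k ((+) l ` T) (x + l) = W k T x" if k: "k \<le> CARD('n)" and T: "T \<in> full" "x \<in> cell_interior T" and l: "l \<in> L" for k T x l
  proof -
    note TT = fullD(1)[OF T(1)]
    let ?lT = "(+) l ` T"
    have lT: "?lT \<in> \<T>" by (rule cell_translate_mem(1)[OF TT l])
    have bk: "(+) (- l) ` ?lT = T" by (simp add: image_image)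
    have V: "(\<lambda>x. W k ?lT (x + l)) \<in> X T k"
      using X_shift[OF lT k lattice_minus[OF l] WX[OF k lT]] unfolding bk by simp
    have "same_pullback T (\<lambda>x. W k ?lT (x + l)) (W k T)"
    proof (rule dof_unique[OF TT k V WX[OF k TT]])
      fix T' m assume T': "T' \<in> \<T>" "T' \<subseteq> T" and m: "m \<in> F T' k"
      have m': "(\<lambda>U. m (\<lambda>x. U (x + l))) \<in> F ((+) l ` T') k"
        using dofs_at(2)[OF T'(1) k] m l by blast
      have "m (\<lambda>x. W k ?lT (x + l)) = m (\<lambda>x. degree_part k u (x + l))"
        by (rule Wm[OF k lT cell_translate_mem(1)[OF T'(1) l] _ m']) (use T'(2) in auto)
      also have "(\<lambda>x. degree_part k u (x + l)) = degree_part k u"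
        using per l by (simp add: degree_part_def periodic_def fun_eq_iff)
      also have "m (degree_part k u) = m (W k T)" using Wm[OF k TT T' m] by simp
      finally show "m (\<lambda>x. W k ?lT (x + l)) = m (W k T)" .
    qed
    then show ?thesis by (rule same_pullback_open) (use full_cell_props(1,3)[OF T(1)] T(2) in auto)
  qed
  define v where "v x = (if \<exists>T\<in>full. x \<in> cell_interior T then \<Sum>k\<le>CARD('n). W k (THE T. T \<in> full \<and> x \<in> cell_interior T) x else 0)" for x
  have vT: "v x = (\<Sum>k\<le>CARD('n). W k T x)" if T: "T \<in> full" "x \<in> cell_interior T" for T x
  proof -
    have "(THE T. T \<in> full \<and> x \<in> cell_interior T) = T"
    proof (rule the_equality)
      show "T \<in> full \<and> x \<in> cell_interior T" using T by simp
      fix T' assume "T' \<in> full \<and> x \<in> cell_interior T'"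
      then show "T' = T" using cell_interior_disjoint[OF fullD(1) fullD(1)[OF T(1)] _ T(2), of T'] by simp
    qed
    moreover have "\<exists>T\<in>full. x \<in> cell_interior T" using T by blast
    ultimately show ?thesis by (simp add: v_def)
  qed
  have v0: "v x = 0" if "\<And>T. T \<in> full \<Longrightarrow> x \<notin> cell_interior T" for x
  proof -
    have "\<not> (\<exists>T\<in>full. x \<in> cell_interior T)" by (intro notI, elim bexE) (use that in simp)
    then show ?thesis unfolding v_def by (rule if_not_P)
  qed
  have dv: "degree_part k v x = W k T x" if k: "k \<le> CARD('n)" and T: "T \<in> full" "x \<in> cell_interior T" for k T x
  proof (subst vec_eq_iff, safe)
    fix I :: "'n set"
    have z: "W j T x $ I = (if card I = j then W j T x $ I else 0)" if "j \<le> CARD('n)" for j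
    proof -
      have "degree_part j (W j T) = W j T"
        using Wk[OF that fullD(1)[OF T(1)]] by (simp only: k_form_def)
      from fun_cong[OF this, of x] have "W j T x = (\<chi> I. if card I = j then W j T x $ I else 0)"
        by (simp only: degree_part_def)
      then show ?thesis by (subst (asm) vec_eq_iff) (simp only: vec_lambda_beta)
    qed
    have "(\<Sum>j\<le>CARD('n). W j T x $ I) = (\<Sum>j\<le>CARD('n). if card I = j then W j T x $ I else 0)"
      by (rule sum.cong) (use z in auto)
    also have "\<dots> = W (card I) T x $ I" by (simp add: sum.delta card_mono)
    finally show "degree_part k v x $ I = W k T x $ I"
      using z[OF k] by (auto simp: degree_part_def vT[OF T])
  qed
  have tr: "has_traces \<T> k (degree_part k v) (W k)" if k: "k \<le> CARD('n)" for k
    unfolding has_traces_def using Ws[OF k] Wk[OF k] Wp[OF k] dv[OF k] by (auto simp: full_def)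
  have perv: "periodic e v"
    unfolding periodic_def
  proof safe
    fix l x assume l: "l \<in> L"
    show "v (x + l) = v x"
    proof (cases "\<exists>T\<in>full. x \<in> cell_interior T")
      case True
      then obtain T where T: "T \<in> full" "x \<in> cell_interior T" by blast
      note tm = cell_translate_mem[OF fullD(1)[OF T(1)] l]
      have lT: "(+) l ` T \<in> full" using tm(1,2) fullD(2)[OF T(1)] by (simp add: full_def)
      have xl: "x + l \<in> cell_interior ((+) l ` T)" unfolding tm(3) using T(2) by (auto simp: add.commute)
      have "(\<Sum>k\<le>CARD('n). W k ((+) l ` T) (x + l)) = (\<Sum>k\<le>CARD('n). W k T x)"
        by (rule sum.cong) (auto intro: Wper[OF _ T l])
      then show ?thesis using vT[OF lT xl] vT[OF T] by (simp only:)
    next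
      case False
      have "x + l \<notin> cell_interior T" if T: "T \<in> full" for T
      proof
        assume "x + l \<in> cell_interior T"
        note tm = cell_translate_mem[OF fullD(1)[OF T] lattice_minus[OF l]]
        have "(+) (- l) ` T \<in> full" using tm(1,2) fullD(2)[OF T] by (simp add: full_def)
        moreover have "x \<in> cell_interior ((+) (- l) ` T)"
          unfolding tm(3) using \<open>x + l \<in> cell_interior T\<close> by (rule image_eqI[rotated]) simp
        ultimately have "\<exists>T\<in>full. x \<in> cell_interior T" by (rule bexI[rotated])
        then show False using False by (rule notE[rotated])
      qed
      then have "v (x + l) = 0" by (rule v0)
      moreover have "v x = 0" by (rule v0) (use False in blast)
      ultimately show ?thesis by simp
    qed
  qed
  have "interp_spec u v"
    unfolding interp_spec_def
  proof (intro conjI allI impI)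
    show "v \<in> fe_space e \<T> X"
      unfolding fe_space_def fe_space_deg_def mem_Collect_eq
    proof (intro allI impI conjI)
      fix k assume k: "k \<le> CARD('n)"
      show "periodic e (degree_part k v)"
        unfolding periodic_def by (intro ballI allI) (simp only: degree_part_def periodicD[OF perv])
      show "\<exists>W. has_traces \<T> k (degree_part k v) W \<and> (\<forall>T\<in>\<T>. W T \<in> X T k)" by (intro exI[of _ "W k"] conjI ballI tr[OF k] WX[OF k])
      fix x assume "\<forall>T\<in>\<T>. cell_dim T = CARD('n) \<longrightarrow> x \<notin> cell_interior T"
      then have "v x = 0" by (intro v0) (simp add: full_def)
      then show "degree_part k v x = 0" by (simp add: degree_part_def vec_eq_iff)
    qed
    fix k assume k: "k \<le> CARD('n)"
    have "has_traces \<T> k (degree_part k u) (\<lambda>T. degree_part k u)"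
      unfolding has_traces_def using smooth_degree_part[OF u] by simp
    moreover have "\<forall>T\<in>\<T>. \<forall>m\<in>F T k. m (W k T) = m (degree_part k u)" by (intro ballI, rule Wm[OF k]) auto
    ultimately show "\<exists>U W. has_traces \<T> k (degree_part k u) U \<and> has_traces \<T> k (degree_part k v) W \<and>
      (\<forall>T\<in>\<T>. W T \<in> X T k) \<and> (\<forall>T\<in>\<T>. \<forall>m\<in>F T k. m (W T) = m (U T))"
      by (intro exI[of _ "\<lambda>T. degree_part k u"] exI[of _ "W k"] conjI tr[OF k] ballI WX[OF k]) auto
  qed
  then show ?thesis by (rule exI[of "interp_spec u" v])
qed

abbreviation interp where "interp \<equiv> interpolator e \<T> X F"

lemma interp_spec_interp: "smooth u \<Longrightarrow> periodic e u \<Longrightarrow> interp_spec u (interp u)"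
  unfolding interpolator_eq by (rule theI'[where P="interp_spec u"], rule ex_ex1I) (rule interp_spec_exists, assumption+, rule interp_spec_unique)

lemma interp_eqI: "smooth u \<Longrightarrow> interp_spec u v \<Longrightarrow> interp u = v"
  unfolding interpolator_eq by (rule the_equality) (assumption, rule interp_spec_unique)

lemma interp_fe_space: "smooth u \<Longrightarrow> periodic e u \<Longrightarrow> interp u \<in> fe_space e \<T> X"
  using interp_spec_interp by (simp add: interp_spec_def)

lemma interp_lincomb:
  assumes "smooth u" "periodic e u" "smooth w" "periodic e w"
  shows "interp (\<lambda>x. a *\<^sub>R u x + b *\<^sub>R w x) = (\<lambda>x. a *\<^sub>R interp u x + b *\<^sub>R interp w x)"
  by (rule interp_eqI[OF smooth_lincomb[OF assms(1,3)] interp_spec_lincomb[OF interp_spec_interp[OF assms(1,2)] interp_spec_interp[OF assms(3,4)]]])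

text \<open>The constant lies in every local space and has the prescribed degrees of freedom. Only
  interiors of \<open>n\<close>-cells qualify, because members of \<open>fe_space\<close> vanish
  elsewhere by convention.\<close>

lemma interp_const:
  assumes T: "T \<in> full" "x \<in> cell_interior T" shows "interp (\<lambda>y. c) x = c"
proof -
  define v where "v x = (if \<exists>T\<in>full. x \<in> cell_interior T then c else 0)" for x
  define v' where "v' = interp (\<lambda>y. c)"
  have spec: "interp_spec (\<lambda>y. c) v'"
    unfolding v'_def by (rule interp_spec_interp) (simp_all add: periodic_def)
  show ?thesis unfolding v'_def[symmetric]
  proof (rule eq_of_degree_parts[where w="\<lambda>y. c"])
    fix k assume k: "k \<le> CARD('n)"
    note TT = fullD(1)[OF T(1)]
    obtain W where W: "has_traces \<T> k (degree_part k v') W" "\<And>T. T \<in> \<T> \<Longrightarrow> W T \<in> X T k"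
      "\<And>T m. T \<in> \<T> \<Longrightarrow> m \<in> F T k \<Longrightarrow> m (W T) = m (degree_part k (\<lambda>y. c))" using interp_spec_traces[OF smooth_const spec k] by metis
    have "same_pullback T (W T) (degree_part k (\<lambda>y. c))"
    proof (rule dof_unique[OF TT k W(2)[OF TT] X_const[OF TT k]])
      fix T' m assume T': "T' \<in> \<T>" "T' \<subseteq> T" and m: "m \<in> F T' k"
      have "m (W T) = m (W T')"
        by (rule dof_pull[OF T'(1) k m has_tracesD(1,2)[OF W(1) TT] has_tracesD(1,2)[OF W(1) T'(1)] has_tracesD(3)[OF W(1) TT T'(1,2)]])
      then show "m (W T) = m (degree_part k (\<lambda>y. c))" using W(3)[OF T'(1) m] by simp
    qed
    then have "W T x = degree_part k (\<lambda>y. c) x"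
      by (rule same_pullback_open) (use full_cell_props(1,3)[OF T(1)] T(2) in auto)
    then show "degree_part k v' x = degree_part k (\<lambda>y. c) x" using has_tracesD(4)[OF W(1) T] by simp
  qed
qed

end

section \<open>Mollification\<close>

lemma has_derivative_partials:
  assumes "f differentiable (at (x :: 'n::finite point))"
  shows "(f has_derivative (\<lambda>k. \<Sum>i\<in>UNIV. k $ i *\<^sub>R partial i f x)) (at x)"
proof -
  obtain f' where f': "(f has_derivative f') (at x)" "\<And>i. f' (axis i 1) = partial i f x"
    using differentiable_partial[OF assms] by metis
  have "f' k = (\<Sum>i\<in>UNIV. k $ i *\<^sub>R partial i f x)" for k
  proof -
    have "f' k = f' (\<Sum>i\<in>UNIV. k $ i *\<^sub>R axis i 1)"
      using basis_expansion[of k] by (simp add: scalar_mult_eq_scaleR)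
    also have "\<dots> = (\<Sum>i\<in>UNIV. k $ i *\<^sub>R f' (axis i 1))"
      using has_derivative_linear[OF f'(1)] by (simp add: linear_sum linear_scale)
    finally show ?thesis by (simp add: f'(2))
  qed
  then have "f' = (\<lambda>k. \<Sum>i\<in>UNIV. k $ i *\<^sub>R partial i f x)" by blast
  then show ?thesis using f'(1) by simp
qed

definition supported_in :: "real \<Rightarrow> ('n::finite point \<Rightarrow> real) \<Rightarrow> bool" where
  "supported_in \<rho> f \<longleftrightarrow> (\<forall>x. norm x > \<rho> \<longrightarrow> f x = 0)"

lemma supported_in_partials:
  fixes f :: "'n::finite point \<Rightarrow> real"
  assumes "smooth f" "supported_in \<rho> f" shows "supported_in \<rho> (partials is f)"
  unfolding supported_in_def
proof safe
  fix x :: "'n point" assume x: "norm x > \<rho>"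
  have o: "open {x :: 'n point. norm x > \<rho>}" by (rule open_Collect_less) (auto intro: continuous_intros)
  have xc: "x \<in> closure {x :: 'n point. norm x > \<rho>}"
    using x closure_subset[of "{x :: 'n point. norm x > \<rho>}"] by blast
  have "partials is f x = partials is (\<lambda>x. 0) x"
    by (rule partials_local[OF o _ assms(1) smooth_const xc]) (use assms(2) in \<open>auto simp: supported_in_def\<close>)
  then show "partials is f x = 0" by (simp add: partials_const)
qed

lemma supported_in_bounded:
  fixes f :: "'n::finite point \<Rightarrow> real"
  assumes "continuous_on UNIV f" "supported_in \<rho> f"
  obtains B where "B \<ge> 0" "\<And>x. \<bar>f x\<bar> \<le> B"
proof -
  have "bounded (f ` cball 0 \<rho>)"
    by (intro compact_imp_bounded compact_continuous_image continuous_on_subset[OF assms(1)]) auto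
  then obtain B where "\<forall>y\<in>f ` cball 0 \<rho>. norm y \<le> B" unfolding bounded_iff by (elim exE)
  then have B: "\<bar>f x\<bar> \<le> B" if "norm x \<le> \<rho>" for x using that by simp
  show thesis
  proof (rule that[of "max B 0"])
    fix x show "\<bar>f x\<bar> \<le> max B 0"
      using B[of x] assms(2) by (cases "norm x \<le> \<rho>") (auto simp: supported_in_def)
  qed simp
qed

lemma supported_in_lipschitz:
  fixes f :: "'n::finite point \<Rightarrow> real"
  assumes "smooth f" "supported_in \<rho> f"
  obtains B where "B \<ge> 0" "\<And>x y. \<bar>f x - f y\<bar> \<le> B * norm (x - y)"
proof -
  have "\<exists>B\<ge>0. \<forall>x. \<bar>partial i f x\<bar> \<le> B" for i
  proof -
    have c: "continuous_on UNIV (partial i f)" and su: "supported_in \<rho> (partial i f)"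
      using smooth_continuous_on[OF assms(1), of UNIV "[i]"] supported_in_partials[OF assms, of "[i]"] by simp_all
    show ?thesis by (rule supported_in_bounded[OF c su]) blast
  qed
  then obtain b where b: "\<And>i. b i \<ge> 0" "\<And>i x. \<bar>partial i f x\<bar> \<le> b i" by metis
  show thesis
  proof (rule that[of "\<Sum>i\<in>UNIV. b i"])
    show "0 \<le> (\<Sum>i\<in>UNIV. b i)" by (simp add: b sum_nonneg)
    fix x y
    have "norm (f x - f y) \<le> (\<Sum>i\<in>UNIV. b i) * norm (x - y)"
    proof (rule differentiable_bound[of UNIV f "\<lambda>x k. \<Sum>i\<in>UNIV. k $ i *\<^sub>R partial i f x"])
      fix x
      show "(f has_derivative (\<lambda>k. \<Sum>i\<in>UNIV. k $ i *\<^sub>R partial i f x)) (at x within UNIV)"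
        by (rule has_derivative_partials[OF smoothD[OF assms(1), of "[]", unfolded partials_Nil]])
      show "onorm (\<lambda>k. \<Sum>i\<in>UNIV. k $ i *\<^sub>R partial i f x) \<le> (\<Sum>i\<in>UNIV. b i)"
      proof (rule onorm_bound)
        fix k :: "'n point"
        have "norm (\<Sum>i\<in>UNIV. k $ i *\<^sub>R partial i f x) \<le> (\<Sum>i\<in>UNIV. norm k * b i)"
          by (rule sum_norm_le) (auto simp: abs_mult b intro!: mult_mono component_le_norm_cart)
        then show "norm (\<Sum>i\<in>UNIV. k $ i *\<^sub>R partial i f x) \<le> (\<Sum>i\<in>UNIV. b i) * norm k"
          by (simp add: sum_distrib_left mult.commute)
      qed (simp add: b sum_nonneg)
    qed auto
    then show "\<bar>f x - f y\<bar> \<le> (\<Sum>i\<in>UNIV. b i) * norm (x - y)" by simp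
  qed
qed

text \<open>The mean value theorem on the segment from \<open>x\<close> to \<open>x + k\<close>,
  combined with the Lipschitz bound for the first partials, gives a quadratic remainder that is
  uniform in \<open>x\<close>.\<close>

lemma supported_in_taylor:
  fixes f :: "'n::finite point \<Rightarrow> real"
  assumes "smooth f" "supported_in \<rho> f"
  obtains B where "B \<ge> 0" "\<And>x k. \<bar>f (x + k) - f x - (\<Sum>i\<in>UNIV. k $ i * partial i f x)\<bar> \<le> B * (norm k)\<^sup>2"
proof -
  have "\<exists>B\<ge>0. \<forall>x y. \<bar>partial i f x - partial i f y\<bar> \<le> B * norm (x - y)" for i
  proof -
    have su: "supported_in \<rho> (partial i f)" using supported_in_partials[OF assms, of "[i]"] by simp
    show ?thesis by (rule supported_in_lipschitz[OF smooth_partial[OF assms(1)] su]) blast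
  qed
  then obtain b where b: "\<And>i. b i \<ge> 0" "\<And>i x y. \<bar>partial i f x - partial i f y\<bar> \<le> b i * norm (x - y)" by metis
  show thesis
  proof (rule that[of "\<Sum>i\<in>UNIV. b i"])
    show "0 \<le> (\<Sum>i\<in>UNIV. b i)" by (simp add: b sum_nonneg)
    fix x k :: "'n point"
    have d: "((\<lambda>t. f (x + t *\<^sub>R k)) has_real_derivative (\<Sum>i\<in>UNIV. k $ i * partial i f (x + t *\<^sub>R k))) (at t)" for t :: real
    proof -
      have "((\<lambda>t. x + t *\<^sub>R k) has_derivative (\<lambda>h. h *\<^sub>R k)) (at t)"
        by (auto intro!: derivative_eq_intros)
      moreover have "(f has_derivative (\<lambda>j. \<Sum>i\<in>UNIV. j $ i *\<^sub>R partial i f (x + t *\<^sub>R k))) (at (x + t *\<^sub>R k))"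
        by (rule has_derivative_partials[OF smoothD[OF assms(1), of "[]", unfolded partials_Nil]])
      ultimately have "((\<lambda>t. f (x + t *\<^sub>R k)) has_derivative (\<lambda>h. \<Sum>i\<in>UNIV. (h *\<^sub>R k) $ i *\<^sub>R partial i f (x + t *\<^sub>R k))) (at t)"
        by (rule has_derivative_compose)
      then show ?thesis unfolding has_field_derivative_def
        by (rule has_derivative_eq_rhs) (simp add: fun_eq_iff sum_distrib_left sum_distrib_right mult_ac)
    qed
    obtain t :: real where t: "0 < t" "t < 1"
      "f (x + 1 *\<^sub>R k) - f (x + 0 *\<^sub>R k) = (1 - 0) * (\<Sum>i\<in>UNIV. k $ i * partial i f (x + t *\<^sub>R k))"
      using MVT2[of 0 1 "\<lambda>t. f (x + t *\<^sub>R k)" "\<lambda>t. \<Sum>i\<in>UNIV. k $ i * partial i f (x + t *\<^sub>R k)"] d by auto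
    then have "f (x + k) - f x - (\<Sum>i\<in>UNIV. k $ i * partial i f x)
      = (\<Sum>i\<in>UNIV. k $ i * (partial i f (x + t *\<^sub>R k) - partial i f x))"
      by (simp add: right_diff_distrib sum_subtractf)
    also have "\<bar>\<dots>\<bar> \<le> (\<Sum>i\<in>UNIV. norm k * (b i * norm k))"
    proof (rule order_trans[OF sum_abs sum_mono])
      fix i
      have "\<bar>partial i f (x + t *\<^sub>R k) - partial i f x\<bar> \<le> b i * (\<bar>t\<bar> * norm k)" using b(2)[of i "x + t *\<^sub>R k" x] by simp
      also have "\<dots> \<le> b i * norm k" using t b(1) by (intro mult_left_mono) (auto simp: mult_left_le_one_le)
      finally show "\<bar>k $ i * (partial i f (x + t *\<^sub>R k) - partial i f x)\<bar> \<le> norm k * (b i * norm k)"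
        unfolding abs_mult by (intro mult_mono component_le_norm_cart) auto
    qed
    also have "\<dots> = (\<Sum>i\<in>UNIV. b i) * (norm k)\<^sup>2"
      by (simp add: sum_distrib_left sum_distrib_right power2_eq_square mult_ac)
    finally show "\<bar>f (x + k) - f x - (\<Sum>i\<in>UNIV. k $ i * partial i f x)\<bar> \<le> (\<Sum>i\<in>UNIV. b i) * (norm k)\<^sup>2" .
  qed
qed

lemma lborel_integral_affine:
  fixes f :: "'a::euclidean_space \<Rightarrow> 'b::{banach, second_countable_topology}"
  assumes [measurable]: "f \<in> borel_measurable borel" and c: "c \<noteq> 0"
  shows "(LINT x|lborel. f x) = \<bar>c\<bar> ^ DIM('a) *\<^sub>R (LINT x|lborel. f (t + c *\<^sub>R x))"
proof -
  have "(LINT x|lborel. f x) = (LINT x|density (distr lborel borel (\<lambda>x. t + c *\<^sub>R x)) (\<lambda>_. ennreal (\<bar>c\<bar> ^ DIM('a))). f x)"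
    by (subst lborel_affine[OF c, of t]) (rule refl)
  also have "\<dots> = (LINT x|distr lborel borel (\<lambda>x. t + c *\<^sub>R x). (\<bar>c\<bar> ^ DIM('a)) *\<^sub>R f x)"
    by (subst integral_density) auto
  also have "\<dots> = (LINT x|lborel. (\<bar>c\<bar> ^ DIM('a)) *\<^sub>R f (t + c *\<^sub>R x))"
    by (rule integral_distr) auto
  finally show ?thesis by simp
qed

lemma smooth_measurable: "smooth f \<Longrightarrow> f \<in> borel_measurable borel"
  using smooth_continuous[of f UNIV] by (rule borel_measurable_continuous_onI)

section \<open>Convolution with smooth kernels of bounded support\<close>

definition locally_integrable :: "'n::finite form \<Rightarrow> bool" where
  "locally_integrable u \<longleftrightarrow> u \<in> borel_measurable borel \<and> (\<forall>x r. set_integrable lborel (cball x r) (\<lambda>y. norm (u y)))"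

lemma convolve_integrable:
  assumes f: "continuous_on UNIV f" "supported_in \<rho> f" and u: "locally_integrable u"
  shows "integrable lborel (\<lambda>y. f (x - y) *\<^sub>R u y)"
proof -
  obtain B where B: "B \<ge> 0" "\<And>x. \<bar>f x\<bar> \<le> B" using supported_in_bounded[OF f] by blast
  have [measurable]: "f \<in> borel_measurable borel" using f(1) by (rule borel_measurable_continuous_onI)
  have [measurable]: "u \<in> borel_measurable borel" using u by (simp add: locally_integrable_def)
  have "integrable lborel (\<lambda>y. B * (indicator (cball x \<rho>) y *\<^sub>R norm (u y)))"
    using u by (intro integrable_mult_right) (simp add: locally_integrable_def set_integrable_def)
  then show ?thesis
  proof (rule Bochner_Integration.integrable_bound)
    show "AE y in lborel. norm (f (x - y) *\<^sub>R u y) \<le> norm (B * (indicator (cball x \<rho>) y *\<^sub>R norm (u y)))"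
    proof (rule AE_I2)
      fix y
      show "norm (f (x - y) *\<^sub>R u y) \<le> norm (B * (indicator (cball x \<rho>) y *\<^sub>R norm (u y)))"
      proof (cases "norm (x - y) \<le> \<rho>")
        case True then show ?thesis using B by (simp add: dist_norm mult_right_mono abs_mult)
      next
        case False then show ?thesis using f(2) by (simp add: supported_in_def)
      qed
    qed
  qed measurable
qed

lemma convolve_norm_le:
  assumes f: "continuous_on UNIV f" "supported_in \<rho> f" and u: "locally_integrable u" and B: "\<And>x. \<bar>f x\<bar> \<le> B"
  shows "ennreal (norm (convolve f u x)) \<le> ennreal B * (\<integral>\<^sup>+y\<in>cball x \<rho>. ennreal (norm (u y)) \<partial>lborel)"
proof -
  have [measurable]: "u \<in> borel_measurable borel" using u by (simp add: locally_integrable_def)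
  have [measurable]: "cball x \<rho> \<in> sets borel" by simp
  have "ennreal (norm (convolve f u x)) \<le> (\<integral>\<^sup>+y. ennreal (norm (f (x - y) *\<^sub>R u y)) \<partial>lborel)"
    unfolding convolve_def by (rule integral_norm_bound_ennreal[OF convolve_integrable[OF f u]])
  also have "\<dots> \<le> (\<integral>\<^sup>+y. ennreal B * (ennreal (norm (u y)) * indicator (cball x \<rho>) y) \<partial>lborel)"
  proof (rule nn_integral_mono)
    fix y
    show "ennreal (norm (f (x - y) *\<^sub>R u y)) \<le> ennreal B * (ennreal (norm (u y)) * indicator (cball x \<rho>) y)"
    proof (cases "norm (x - y) \<le> \<rho>")
      case True
      have "norm (f (x - y) *\<^sub>R u y) \<le> B * norm (u y)" using B by (simp add: mult_right_mono)
      then have "ennreal (norm (f (x - y) *\<^sub>R u y)) \<le> ennreal (B * norm (u y))" by (rule ennreal_leI)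
      also have "\<dots> = ennreal B * ennreal (norm (u y))" using B[of 0] by (intro ennreal_mult) auto
      finally show ?thesis using True by (simp add: dist_norm)
    next
      case False then show ?thesis using f(2) by (simp add: supported_in_def)
    qed
  qed
  also have "\<dots> = ennreal B * (\<integral>\<^sup>+y\<in>cball x \<rho>. ennreal (norm (u y)) \<partial>lborel)"
    by (rule nn_integral_cmult) measurable
  finally show ?thesis .
qed

text \<open>Differentiation under the integral in quantitative form: the Taylor remainder of
  \<open>f\<close>, quadratic uniformly in the base point, is integrated against \<open>u\<close>
  and leaves an error of at most \<open>B * (norm k)\<^sup>2 * I\<close>.\<close>

lemma convolve_has_derivative:
  fixes f :: "'n::finite point \<Rightarrow> real"
  assumes f: "smooth f" "supported_in \<rho> f" and u: "locally_integrable u"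
  shows "(convolve f u has_derivative (\<lambda>k. \<Sum>i\<in>UNIV. k $ i *\<^sub>R convolve (partial i f) u x)) (at x)"
proof -
  obtain B where B: "B \<ge> 0" "\<And>x k. \<bar>f (x + k) - f x - (\<Sum>i\<in>UNIV. k $ i * partial i f x)\<bar> \<le> B * (norm k)\<^sup>2"
    using supported_in_taylor[OF f] by blast
  have fi: "continuous_on UNIV (partial i f)" "supported_in \<rho> (partial i f)" for i
    using smooth_continuous_on[OF f(1), of UNIV "[i]"] supported_in_partials[OF f, of "[i]"] by auto
  have fc: "continuous_on UNIV f" using smooth_continuous[OF f(1)] .
  \<comment> \<open>For \<open>norm k \<le> 1\<close> all kernels involved vanish outside this ball;
    the absolute value spares an assumption on the sign of \<open>\<rho>\<close>.\<close>
  define I where "I = (LINT y:cball x (\<bar>\<rho>\<bar> + 1)|lborel. norm (u y))"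
  have I: "0 \<le> I" unfolding I_def set_lebesgue_integral_def by (rule Bochner_Integration.integral_nonneg) simp
  have bound: "norm (convolve f u (x + k) - convolve f u x - (\<Sum>i\<in>UNIV. k $ i *\<^sub>R convolve (partial i f) u x)) \<le> B * (norm k)\<^sup>2 * I"
    if k: "norm k \<le> 1" for k
  proof -
    let ?g = "\<lambda>y. (f (x - y + k) - f (x - y) - (\<Sum>i\<in>UNIV. k $ i * partial i f (x - y))) *\<^sub>R u y"
    have i1: "integrable lborel (\<lambda>y. f (x + k - y) *\<^sub>R u y)" "integrable lborel (\<lambda>y. f (x - y) *\<^sub>R u y)"
      by (rule convolve_integrable[OF fc f(2) u])+
    have i2: "integrable lborel (\<lambda>y. \<Sum>i\<in>UNIV. k $ i *\<^sub>R (partial i f (x - y) *\<^sub>R u y))"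
      by (intro Bochner_Integration.integrable_sum integrable_scaleR_right convolve_integrable[OF fi u])
    have ga: "?g = (\<lambda>y. f (x + k - y) *\<^sub>R u y - f (x - y) *\<^sub>R u y - (\<Sum>i\<in>UNIV. k $ i *\<^sub>R (partial i f (x - y) *\<^sub>R u y)))"
      by (rule ext) (simp add: scaleR_left_diff_distrib scaleR_sum_left algebra_simps)
    have "convolve f u (x + k) - convolve f u x - (\<Sum>i\<in>UNIV. k $ i *\<^sub>R convolve (partial i f) u x) = (LINT y|lborel. ?g y)"
    proof -
      have "(LINT y|lborel. (\<Sum>i\<in>UNIV. k $ i *\<^sub>R (partial i f (x - y) *\<^sub>R u y))) = (\<Sum>i\<in>UNIV. LINT y|lborel. k $ i *\<^sub>R (partial i f (x - y) *\<^sub>R u y))"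
        by (rule Bochner_Integration.integral_sum) (intro integrable_scaleR_right convolve_integrable[OF fi u])
      then show ?thesis
        unfolding ga by (simp only: Bochner_Integration.integral_diff[OF Bochner_Integration.integrable_diff[OF i1] i2]
          Bochner_Integration.integral_diff[OF i1] convolve_def integral_scaleR_right)
    qed
    also have "norm \<dots> \<le> (LINT y|lborel. B * (norm k)\<^sup>2 * (indicator (cball x (\<bar>\<rho>\<bar> + 1)) y *\<^sub>R norm (u y)))"
    proof (rule Bochner_Integration.integral_norm_bound_integral)
      show "integrable lborel ?g" unfolding ga by (intro Bochner_Integration.integrable_diff i1 i2)
      show "integrable lborel (\<lambda>y. B * (norm k)\<^sup>2 * (indicator (cball x (\<bar>\<rho>\<bar> + 1)) y *\<^sub>R norm (u y)))"
        using u by (intro integrable_mult_right) (simp add: locally_integrable_def set_integrable_def)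
      fix y
      show "norm (?g y) \<le> B * (norm k)\<^sup>2 * (indicator (cball x (\<bar>\<rho>\<bar> + 1)) y *\<^sub>R norm (u y))"
      proof (cases "norm (x - y) \<le> \<bar>\<rho>\<bar> + 1")
        case True
        then show ?thesis using mult_right_mono[OF B(2)[of "x - y" k], of "norm (u y)"] by (simp add: dist_norm)
      next
        case False
        have "norm (x - y) \<le> norm (x - y + k) + norm k" using norm_triangle_ineq4[of "x - y + k" k] by simp
        then have "norm (x - y + k) > \<rho>" "norm (x - y) > \<rho>" using False k by linarith+
        then have "f (x - y + k) = 0" "f (x - y) = 0" "\<And>i. partial i f (x - y) = 0"
          using f(2) fi(2) by (auto simp: supported_in_def)
        then show ?thesis using B(1) by simp
      qed
    qed
    also have "\<dots> = B * (norm k)\<^sup>2 * I" by (simp add: I_def set_lebesgue_integral_def)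
    finally show ?thesis .
  qed
  have lin: "bounded_linear (\<lambda>k. \<Sum>i\<in>UNIV. k $ i *\<^sub>R convolve (partial i f) u x)"
    by (intro bounded_linear_sum bounded_linear_scaleR_const bounded_linear_vec_nth)
  show ?thesis
    unfolding has_derivative_at
  proof (intro conjI lin)
    let ?q = "\<lambda>k. norm (convolve f u (x + k) - convolve f u x - (\<Sum>i\<in>UNIV. k $ i *\<^sub>R convolve (partial i f) u x)) / norm k"
    show "?q \<midarrow>0\<rightarrow> 0"
    proof (rule tendsto_sandwich[of "\<lambda>_. 0" _ _ "\<lambda>k. B * I * norm k"])
      show "\<forall>\<^sub>F k in at 0. 0 \<le> ?q k" by (simp add: divide_nonneg_nonneg)
      have "\<forall>\<^sub>F k in at 0. norm (k :: 'n point) \<le> 1"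
        unfolding eventually_at by (intro exI[of _ 1]) (auto simp: dist_norm)
      then show "\<forall>\<^sub>F k in at 0. ?q k \<le> B * I * norm k"
      proof eventually_elim
        case (elim k)
        show ?case
        proof (cases "k = 0")
          case False
          then show ?thesis using bound[OF elim] by (simp add: divide_le_eq power2_eq_square mult_ac)
        qed simp
      qed
      have "((\<lambda>k :: 'n point. B * I * norm k) \<longlongrightarrow> B * I * norm (0 :: 'n point)) (at 0)" by (intro tendsto_intros)
      then show "((\<lambda>k :: 'n point. B * I * norm k) \<longlongrightarrow> 0) (at 0)" by simp
    qed simp
  qed
qed

lemma partials_convolve:
  fixes f :: "'n::finite point \<Rightarrow> real"
  assumes f: "smooth f" "supported_in \<rho> f" and u: "locally_integrable u"
  shows "partials is (convolve f u) = convolve (partials is f) u"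
proof (induction "is")
  case (Cons i "is")
  have "partial i (convolve (partials is f) u) x = convolve (partial i (partials is f)) u x" for x
  proof -
    have "(convolve (partials is f) u has_derivative (\<lambda>k. \<Sum>j\<in>UNIV. k $ j *\<^sub>R convolve (partial j (partials is f)) u x)) (at x)"
      by (rule convolve_has_derivative[OF smooth_partials[OF f(1)] supported_in_partials[OF f] u])
    from partial_eq[OF this, of i]
    have "partial i (convolve (partials is f) u) x = (\<Sum>j\<in>UNIV. axis i 1 $ j *\<^sub>R convolve (partial j (partials is f)) u x)" .
    also have "\<dots> = (\<Sum>j\<in>UNIV. if j = i then convolve (partial i (partials is f)) u x else 0)"
      by (rule sum.cong) (auto simp: axis_def)
    finally show ?thesis by simp
  qed
  then show ?case using Cons by auto
qed simp

lemma smooth_convolve: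
  fixes f :: "'n::finite point \<Rightarrow> real"
  assumes f: "smooth f" "supported_in \<rho> f" and u: "locally_integrable u"
  shows "smooth (convolve f u)"
  by (rule smooth_scheme[OF partials_convolve[OF assms]])
    (use convolve_has_derivative[OF smooth_partials[OF f(1)] supported_in_partials[OF f] u] in \<open>unfold differentiable_def, blast\<close>)

lemma convolve_lincomb:
  assumes f: "continuous_on UNIV f" "supported_in \<rho> f" and u: "locally_integrable u" and w: "locally_integrable w"
  shows "convolve f (\<lambda>x. a *\<^sub>R u x + b *\<^sub>R w x) = (\<lambda>x. a *\<^sub>R convolve f u x + b *\<^sub>R convolve f w x)"
proof
  fix x
  have eq: "(\<lambda>y. f (x - y) *\<^sub>R (a *\<^sub>R u y + b *\<^sub>R w y)) = (\<lambda>y. a *\<^sub>R (f (x - y) *\<^sub>R u y) + b *\<^sub>R (f (x - y) *\<^sub>R w y))"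
    by (simp add: scaleR_right_distrib mult_ac)
  have i: "integrable lborel (\<lambda>y. a *\<^sub>R (f (x - y) *\<^sub>R u y))" "integrable lborel (\<lambda>y. b *\<^sub>R (f (x - y) *\<^sub>R w y))"
    by (intro integrable_scaleR_right convolve_integrable[OF f] u w)+
  show "convolve f (\<lambda>x. a *\<^sub>R u x + b *\<^sub>R w x) x = a *\<^sub>R convolve f u x + b *\<^sub>R convolve f w x"
    unfolding convolve_def eq Bochner_Integration.integral_add[OF i] by (simp only: integral_scaleR_right)
qed

text \<open>Every derivative costs one factor \<open>1 / \<delta>\<close> and the normalisation
  costs \<open>1 / \<delta> ^ CARD('n)\<close>; constants survive because the integral is
  one.\<close>

lemma mollifier_rescaled:
  fixes \<phi> :: "'n::finite point \<Rightarrow> real"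
  assumes \<phi>: "mollifier p \<phi>" and \<delta>: "\<delta> > 0"
  shows "smooth (rescaled \<delta> \<phi>)" "supported_in \<delta> (rescaled \<delta> \<phi>)"
    "partials is (rescaled \<delta> \<phi>) x = partials is \<phi> (x /\<^sub>R \<delta>) / \<delta> ^ (length is + CARD('n))"
    "convolve (rescaled \<delta> \<phi>) (\<lambda>x. c) x = c"
proof -
  have sm: "smooth \<phi>" using \<phi> by (simp add: mollifier_def)
  have eq: "rescaled \<delta> \<phi> = (\<lambda>x. (1 / \<delta> ^ CARD('n)) *\<^sub>R \<phi> (0 + (1 / \<delta>) *\<^sub>R x))"
    by (simp add: rescaled_def fun_eq_iff divide_inverse)
  note sa = smooth_affine[OF sm, of 0 "1 / \<delta>"]
  show sr: "smooth (rescaled \<delta> \<phi>)" unfolding eq by (rule smooth_linear[OF bounded_linear_scaleR_right sa])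
  have norm_less: "norm (x /\<^sub>R \<delta>) > 1" if "norm x > \<delta>" for x :: "'n point"
    using that \<delta> by (simp add: field_simps)
  show "supported_in \<delta> (rescaled \<delta> \<phi>)"
    unfolding supported_in_def rescaled_def using \<phi> norm_less by (auto simp: mollifier_def)
  show "partials is (rescaled \<delta> \<phi>) x = partials is \<phi> (x /\<^sub>R \<delta>) / \<delta> ^ (length is + CARD('n))"
    unfolding eq partials_linear[OF bounded_linear_scaleR_right sa] partials_affine[OF sm]
    by (simp add: power_add power_divide divide_inverse power_inverse mult_ac)
  have [measurable]: "\<phi> \<in> borel_measurable borel" by (rule smooth_measurable[OF sm])
  have [measurable]: "rescaled \<delta> \<phi> \<in> borel_measurable borel" by (rule smooth_measurable[OF sr])
  have "(LINT y|lborel. rescaled \<delta> \<phi> (x - y)) = 1"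
  proof -
    have "(LINT y|lborel. rescaled \<delta> \<phi> (x - y)) = \<bar>- \<delta>\<bar> ^ DIM('n point) *\<^sub>R (LINT y|lborel. rescaled \<delta> \<phi> (x - (x + (- \<delta>) *\<^sub>R y)))"
      by (rule lborel_integral_affine) (use \<delta> in auto)
    also have "\<dots> = (LINT y|lborel. \<phi> y)" using \<delta> by (simp add: rescaled_def)
    finally show ?thesis using \<phi> by (simp add: mollifier_def)
  qed
  \<comment> \<open>The Bochner integral of a non-integrable function is \<open>0\<close>, so the
    value \<open>1\<close> already certifies integrability.\<close>
  moreover from this have "integrable lborel (\<lambda>y. rescaled \<delta> \<phi> (x - y))"
    using not_integrable_integral_eq by fastforce
  ultimately show "convolve (rescaled \<delta> \<phi>) (\<lambda>x. c) x = c"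
    unfolding convolve_def by (subst integral_scaleR_left) auto
qed

context lattice_basis begin

text \<open>A ball folds into the fundamental domain with multiplicity bounded by
  \<open>card_lattice_ball\<close>; then \<open>norm (u y) \<le> 1 + (norm (u y))\<^sup>2\<close>
  passes from squares to first powers.\<close>

lemma L2_locally_integrable:
  assumes u: "u \<in> L2_forms e" shows "locally_integrable u"
proof -
  have [measurable]: "u \<in> borel_measurable borel" by (rule L2_formsD(2)[OF u])
  have "set_integrable lborel (cball x r) (\<lambda>y. norm (u y))" for x r
  proof -
    have [measurable]: "cball x r \<in> sets borel" by simp
    let ?K = "of_nat (card (L \<inter> cball 0 (2 * r))) :: ennreal"
    have "(\<integral>\<^sup>+y. ennreal ((norm (u y))\<^sup>2) * indicator (cball x r) y \<partial>lborel)
      = (\<integral>\<^sup>+y\<in>FD. (\<integral>\<^sup>+l. ennreal ((norm (u (y + l)))\<^sup>2) * indicator (cball x r) (y + l) \<partial>count_space L) \<partial>lborel)"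
      by (rule nn_integral_unfold) measurable
    also have "\<dots> \<le> (\<integral>\<^sup>+y\<in>FD. ?K * ennreal ((norm (u y))\<^sup>2) \<partial>lborel)"
    proof (intro nn_integral_mono mult_right_mono)
      fix y
      define A where "A = {l\<in>L. norm ((y - x) + l) \<le> r}"
      have A: "finite A" "card A \<le> card (L \<inter> cball 0 (2 * r))" using card_lattice_ball[of "y - x" r] by (simp_all add: A_def)
      have "(\<integral>\<^sup>+l. ennreal ((norm (u (y + l)))\<^sup>2) * indicator (cball x r) (y + l) \<partial>count_space L)
        = (\<integral>\<^sup>+l. ennreal ((norm (u y))\<^sup>2) * indicator A l \<partial>count_space L)"
      proof (rule nn_integral_cong)
        fix l assume "l \<in> space (count_space L)"
        then have l: "l \<in> L" by simp
        have "y + l \<in> cball x r \<longleftrightarrow> l \<in> A" using l by (simp add: A_def dist_norm norm_minus_commute[of x] algebra_simps)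
        then show "ennreal ((norm (u (y + l)))\<^sup>2) * indicator (cball x r) (y + l) = ennreal ((norm (u y))\<^sup>2) * indicator A l"
          using periodicD[OF L2_formsD(1)[OF u] l, of y] by (simp add: indicator_def)
      qed
      also have "\<dots> = ennreal ((norm (u y))\<^sup>2) * of_nat (card A)"
        using A(1) by (subst nn_integral_cmult_indicator) (auto simp: A_def)
      also have "\<dots> \<le> ?K * ennreal ((norm (u y))\<^sup>2)"
        using A(2) by (subst mult.commute) (intro mult_right_mono, simp_all)
      finally show "(\<integral>\<^sup>+l. ennreal ((norm (u (y + l)))\<^sup>2) * indicator (cball x r) (y + l) \<partial>count_space L) \<le> ?K * ennreal ((norm (u y))\<^sup>2)" .
    qed simp
    also have "\<dots> = ?K * ennreal ((L2_form_norm e u)\<^sup>2)"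
      by (simp add: mult.assoc nn_integral_cmult L2_formsD(3)[OF u])
    also have "\<dots> < \<infinity>" by (simp add: ennreal_mult_less_top of_nat_less_top)
    finally have sq: "(\<integral>\<^sup>+y. ennreal ((norm (u y))\<^sup>2) * indicator (cball x r) y \<partial>lborel) < \<infinity>" .
    have "(\<integral>\<^sup>+y. ennreal (norm (indicator (cball x r) y *\<^sub>R norm (u y))) \<partial>lborel)
      \<le> (\<integral>\<^sup>+y. indicator (cball x r) y + ennreal ((norm (u y))\<^sup>2) * indicator (cball x r) y \<partial>lborel)"
    proof (rule nn_integral_mono)
      fix y
      have "norm (u y) \<le> 1 + (norm (u y))\<^sup>2"
        using zero_le_power2[of "norm (u y) - 1"] by (simp add: power2_eq_square algebra_simps) (smt (verit) norm_ge_zero mult_nonneg_nonneg)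
      then have "ennreal (norm (u y)) \<le> ennreal (1 + (norm (u y))\<^sup>2)" by (rule ennreal_leI)
      also have "\<dots> = 1 + ennreal ((norm (u y))\<^sup>2)" by (subst ennreal_plus) simp_all
      finally show "ennreal (norm (indicator (cball x r) y *\<^sub>R norm (u y))) \<le> indicator (cball x r) y + ennreal ((norm (u y))\<^sup>2) * indicator (cball x r) y"
        by (auto simp: indicator_def)
    qed
    also have "\<dots> = emeasure lborel (cball x r) + (\<integral>\<^sup>+y. ennreal ((norm (u y))\<^sup>2) * indicator (cball x r) y \<partial>lborel)"
      by (subst nn_integral_add) auto
    also have "\<dots> < \<infinity>" using sq emeasure_lborel_cball_finite[of x r] by (simp add: less_top)
    finally show ?thesis unfolding set_integrable_def by (intro integrableI_bounded) auto
  qed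
  then show ?thesis by (simp add: locally_integrable_def)
qed

lemma periodic_convolve:
  assumes u: "periodic e u" and [measurable]: "u \<in> borel_measurable borel" "f \<in> borel_measurable borel"
  shows "periodic e (convolve f u)"
  unfolding periodic_def
proof safe
  fix l x assume l: "l \<in> L"
  have "convolve f u (x + l) = \<bar>1\<bar> ^ DIM('n point) *\<^sub>R (LINT y|lborel. f (x + l - (l + 1 *\<^sub>R y)) *\<^sub>R u (l + 1 *\<^sub>R y))"
    unfolding convolve_def by (rule lborel_integral_affine) auto
  also have "\<dots> = convolve f u x"
    using periodicD[OF u l] by (simp add: convolve_def add.commute[of l])
  finally show "convolve f u (x + l) = convolve f u x" .
qed

end

section \<open>Simplicial refinements\<close>

lemma negligible_low_aff_dim:
  fixes S :: "'a::euclidean_space set"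
  assumes "convex S" "aff_dim S \<noteq> int DIM('a)" shows "negligible S"
  using assms by (simp add: negligible_convex_interior interior_rel_interior_gen)

text \<open>On the connected set the distance from \<open>x\<close> takes all values in
  \<open>{0..dist x y}\<close>, while each piece contributes an interval of length
  \<open>2 * D\<close>; the lengths are compared by Lebesgue measure. No chain of neighbouring
  pieces has to be built.\<close>

lemma connected_diameter_le:
  fixes T :: "'a::euclidean_space set"
  assumes T: "connected T" "T \<subseteq> \<Union>A" "finite A" "card A \<le> N" and D: "D \<ge> 0" "\<And>\<sigma> a b. \<sigma> \<in> A \<Longrightarrow> a \<in> \<sigma> \<Longrightarrow> b \<in> \<sigma> \<Longrightarrow> dist a b \<le> D"
    and xy: "x \<in> T" "y \<in> T"
  shows "dist x y \<le> 2 * real N * D"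
proof -
  let ?f = "\<lambda>t. dist x t"
  let ?c = "\<lambda>\<sigma>. ?f (SOME q. q \<in> \<sigma>)"
  have "connected (?f ` T)" by (intro connected_continuous_image T continuous_intros)
  moreover have "0 \<in> ?f ` T" "dist x y \<in> ?f ` T" using xy by (auto intro!: image_eqI[of _ _ x])
  ultimately have "{0..dist x y} \<subseteq> ?f ` T" by (rule connected_contains_Icc)
  also have "\<dots> \<subseteq> (\<Union>\<sigma>\<in>A. {?c \<sigma> - D..?c \<sigma> + D})"
  proof
    fix r assume "r \<in> ?f ` T"
    then obtain t \<sigma> where t: "t \<in> \<sigma>" "\<sigma> \<in> A" "r = dist x t" using T(2) by blast
    have q: "(SOME q. q \<in> \<sigma>) \<in> \<sigma>" using t(1) by (rule someI)
    have "\<bar>dist x t - ?c \<sigma>\<bar> \<le> dist t (SOME q. q \<in> \<sigma>)" using abs_dist_diff_le[of t x] by (metis dist_commute abs_dist_diff_le)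
    also have "\<dots> \<le> D" by (rule D(2)[OF t(2) t(1) q])
    finally show "r \<in> (\<Union>\<sigma>\<in>A. {?c \<sigma> - D..?c \<sigma> + D})" using t by (intro UN_I[of \<sigma>]) (auto simp: abs_le_iff)
  qed
  finally have sub: "{0..dist x y} \<subseteq> (\<Union>\<sigma>\<in>A. {?c \<sigma> - D..?c \<sigma> + D})" .
  have "ennreal (dist x y) = emeasure lborel {0..dist x y}" by simp
  also have "\<dots> \<le> emeasure lborel (\<Union>\<sigma>\<in>A. {?c \<sigma> - D..?c \<sigma> + D})" using sub by (rule emeasure_mono) (use T(3) in auto)
  also have "\<dots> \<le> (\<Sum>\<sigma>\<in>A. emeasure lborel {?c \<sigma> - D..?c \<sigma> + D})"
    by (rule emeasure_subadditive_finite) (use T(3) in auto)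
  also have "\<dots> = ennreal (\<Sum>\<sigma>\<in>A. 2 * D)"
    using D(1) by (subst sum_ennreal[symmetric]) auto
  also have "\<dots> \<le> ennreal (2 * real N * D)"
    using T(4) D(1) by (intro ennreal_leI) (simp add: mult_right_mono)
  finally show ?thesis using D(1) by (simp add: ennreal_le_iff)
qed

text \<open>Shrinking \<open>\<sigma>\<close> towards \<open>a\<close> by the factor
  \<open>1 - t\<close>, \<open>t = norm z / r\<close>, leaves room for the shift: by convexity the
  smaller copy plus \<open>z\<close> stays inside \<open>\<sigma>\<close>. The points pushed out lie
  in the remaining layer, of relative measure \<open>1 - (1 - t) ^ DIM('a)\<close>, which Bernoulli
  bounds by \<open>DIM('a) * t\<close>.\<close>

lemma convex_shift_measure:
  fixes \<sigma> :: "'a::euclidean_space set"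
  assumes \<sigma>: "convex \<sigma>" "compact \<sigma>" and r: "r > 0" "cball a r \<subseteq> \<sigma>"
  shows "measure lebesgue {x\<in>\<sigma>. x + z \<notin> \<sigma>} \<le> real DIM('a) * (norm z / r) * measure lebesgue \<sigma>"
proof -
  let ?n = "DIM('a)"
  define t where "t = norm z / r"
  have t0: "t \<ge> 0" using r by (simp add: t_def)
  have m\<sigma>: "\<sigma> \<in> lmeasurable" using \<sigma>(2) by (rule lmeasurable_compact)
  have "closed \<sigma>" using \<sigma>(2) by (rule compact_imp_closed)
  then have "closed ((\<lambda>x. x + z) -` \<sigma>)" by (intro continuous_closed_vimage) (auto intro: continuous_intros)
  moreover have "{x\<in>\<sigma>. x + z \<notin> \<sigma>} = \<sigma> - (\<lambda>x. x + z) -` \<sigma>" by auto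
  ultimately have mb: "{x\<in>\<sigma>. x + z \<notin> \<sigma>} \<in> lmeasurable"
    using m\<sigma> \<sigma>(2) by (auto intro!: bounded_set_imp_lmeasurable sets.Diff intro: bounded_subset[OF compact_imp_bounded] simp: fmeasurableD)
  show ?thesis
  proof (cases "t \<le> 1")
    case False
    have "measure lebesgue {x\<in>\<sigma>. x + z \<notin> \<sigma>} \<le> 1 * measure lebesgue \<sigma>"
      using mb m\<sigma> by (simp, intro measure_mono_fmeasurable) (auto simp: fmeasurableD)
    also have "\<dots> \<le> (real ?n * t) * measure lebesgue \<sigma>"
    proof (rule mult_right_mono)
      have "1 * 1 \<le> real ?n * t" using False DIM_positive[where 'a='a] by (intro mult_mono) (simp_all add: Suc_le_eq)
      then show "1 \<le> real ?n * t" by simp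
    qed simp
    finally show ?thesis by (simp add: t_def)
  next
    case True
    define f where "f = (\<lambda>q. t *\<^sub>R a + (1 - t) *\<^sub>R q)"
    have f: "f = (\<lambda>q. (1 - t) *\<^sub>R q + t *\<^sub>R a)" by (simp add: f_def add.commute)
    have fm: "f ` \<sigma> \<in> lmeasurable" "measure lebesgue (f ` \<sigma>) = (1 - t) ^ ?n * measure lebesgue \<sigma>"
    proof -
      have "compact (f ` \<sigma>)" unfolding f_def by (intro compact_continuous_image \<sigma> continuous_intros)
      then show "f ` \<sigma> \<in> lmeasurable" by (rule lmeasurable_compact)
      show "measure lebesgue (f ` \<sigma>) = (1 - t) ^ ?n * measure lebesgue \<sigma>"
        using measure_lebesgue_affine[of "1 - t" "t *\<^sub>R a" \<sigma>] True by (simp add: f add.commute)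
    qed
    have sub: "f ` \<sigma> \<subseteq> \<sigma>"
    proof
      fix x assume "x \<in> f ` \<sigma>"
      then obtain q where q: "q \<in> \<sigma>" "x = t *\<^sub>R a + (1 - t) *\<^sub>R q" by (auto simp: f_def)
      have "a \<in> \<sigma>" using r by auto
      then show "x \<in> \<sigma>" using q convexD[OF \<sigma>(1), of a q t "1 - t"] True t0 by simp
    qed
    have "{x\<in>\<sigma>. x + z \<notin> \<sigma>} \<subseteq> \<sigma> - f ` \<sigma>"
    proof safe
      fix q assume q: "q \<in> \<sigma>" and nz: "f q + z \<notin> \<sigma>"
      show False
      proof (cases "t = 0")
        case True
        then have "z = 0" using r by (simp add: t_def)
        then show False using nz True q by (simp add: f_def)
      next
        case False
        \<comment> \<open>The shift is absorbed by the centre: \<open>f q + z\<close> is a convex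
          combination of \<open>q\<close> and \<open>a + z /\<^sub>R t\<close>, a point of the
          inscribed ball.\<close>
        have "norm (z /\<^sub>R t) \<le> r" using False t0 r by (simp add: t_def field_simps)
        then have "a + z /\<^sub>R t \<in> \<sigma>" using r(2) by (auto simp: dist_norm)
        then have "t *\<^sub>R (a + z /\<^sub>R t) + (1 - t) *\<^sub>R q \<in> \<sigma>" using convexD[OF \<sigma>(1) _ q, of "a + z /\<^sub>R t" t "1 - t"] \<open>t \<le> 1\<close> t0 by simp
        moreover have "t *\<^sub>R (a + z /\<^sub>R t) + (1 - t) *\<^sub>R q = f q + z" using False by (simp add: f_def algebra_simps)
        ultimately show False using nz by simp
      qed
    qed
    then have "measure lebesgue {x\<in>\<sigma>. x + z \<notin> \<sigma>} \<le> measure lebesgue (\<sigma> - f ` \<sigma>)"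
      using mb m\<sigma> fm(1) by (intro measure_mono_fmeasurable) (auto simp: fmeasurableD intro: fmeasurable.Diff)
    also have "\<dots> = measure lebesgue \<sigma> - measure lebesgue (f ` \<sigma>)"
      using m\<sigma> fm(1) sub by (intro measurable_measure_Diff) (auto simp: fmeasurableD)
    also have "\<dots> = (1 - (1 - t) ^ ?n) * measure lebesgue \<sigma>" by (simp add: fm(2) algebra_simps)
    also have "\<dots> \<le> (real ?n * t) * measure lebesgue \<sigma>"
    proof (rule mult_right_mono)
      have "1 + real ?n * (- t) \<le> (1 + (- t)) ^ ?n" by (rule Bernoulli_inequality) (use True in simp)
      then show "1 - (1 - t) ^ ?n \<le> real ?n * t" by simp
    qed simp
    finally show ?thesis by (simp add: t_def)
  qed
qed

lemma simplex_translate: "d simplex \<sigma> \<Longrightarrow> d simplex ((+) l ` \<sigma>)"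
proof -
  assume "d simplex \<sigma>"
  then obtain C where C: "\<not> affine_dependent C" "int (card C) = d + 1" "\<sigma> = convex hull C"
    by (auto simp: simplex_def)
  have "\<not> affine_dependent ((+) l ` C)" using C(1) by (simp add: affine_dependent_translation_eq[symmetric])
  moreover have "card ((+) l ` C) = card C" by (simp add: card_image)
  moreover have "(+) l ` \<sigma> = convex hull ((+) l ` C)" unfolding C(3) by (simp add: convex_hull_translation)
  ultimately show ?thesis using C(2) unfolding simplex_def by metis
qed

locale refined_mesh = torus_mesh e \<T> for e :: "'n::{finite,linorder} \<Rightarrow> 'n point" and \<T> +
  fixes \<S> :: "'n point set set" and h \<kappa> :: real and N :: nat
  assumes refinement: "simplicial_refinement e \<T> \<S>" and h: "h > 0" and \<kappa>: "\<kappa> > 0"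
    and quasi: "\<forall>\<sigma>\<in>\<S>. int CARD('n) simplex \<sigma> \<longrightarrow>
        h / \<kappa> \<le> diameter \<sigma> \<and> diameter \<sigma> \<le> \<kappa> * h \<and> (\<exists>x. cball x (diameter \<sigma> / \<kappa>) \<subseteq> \<sigma>)"
    and number: "\<forall>T\<in>\<T>. finite {\<sigma>\<in>\<S>. \<sigma> \<subseteq> T} \<and> card {\<sigma>\<in>\<S>. \<sigma> \<subseteq> T} \<le> N"
begin

definition "FS = {\<sigma>\<in>\<S>. int CARD('n) simplex \<sigma>}"

lemma FS_D: "\<sigma> \<in> FS \<Longrightarrow> \<sigma> \<in> \<S>" "\<sigma> \<in> FS \<Longrightarrow> int CARD('n) simplex \<sigma>" by (simp_all add: FS_def)

lemma S_props:
  "finite_mod_lattice e \<S>" "\<Union>\<S> = UNIV" "\<forall>\<sigma>\<in>\<S>. \<exists>d. d simplex \<sigma>"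
  "\<forall>\<sigma>\<in>\<S>. \<forall>\<tau>\<in>\<S>. (\<sigma> \<inter> \<tau>) face_of \<sigma>" "\<forall>T\<in>\<T>. T = \<Union>{\<sigma>\<in>\<S>. \<sigma> \<subseteq> T}"
  using refinement by (simp_all add: simplicial_refinement_def)

lemma S_compact_convex: "\<sigma> \<in> \<S> \<Longrightarrow> compact \<sigma>" "\<sigma> \<in> \<S> \<Longrightarrow> convex \<sigma>"
  using S_props(3) compact_simplex convex_simplex by blast+

lemma S_negligible: "\<sigma> \<in> \<S> \<Longrightarrow> \<sigma> \<notin> FS \<Longrightarrow> negligible \<sigma>"
proof -
  assume \<sigma>: "\<sigma> \<in> \<S>" "\<sigma> \<notin> FS"
  obtain d where d: "d simplex \<sigma>" using S_props(3) \<sigma>(1) by blast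
  then have "d \<noteq> int CARD('n)" using \<sigma> by (auto simp: FS_def)
  then show ?thesis using aff_dim_simplex[OF d] S_compact_convex(2)[OF \<sigma>(1)] by (intro negligible_low_aff_dim) auto
qed

lemma S_countable: "countable \<S>" by (rule finite_mod_lattice_countable[OF S_props(1)])

lemma S_locally_finite: "bounded K \<Longrightarrow> finite {\<sigma>\<in>\<S>. \<sigma> \<inter> K \<noteq> {}}"
  by (rule finite_mod_lattice_locally_finite[OF S_props(1)]) (auto intro: compact_imp_bounded S_compact_convex)

lemma FS_cover: "\<Union>FS = UNIV"
proof (rule locally_finite_cover)
  show "finite {\<sigma> \<in> FS. \<sigma> \<inter> K \<noteq> {}}" if "bounded K" for K
    by (rule finite_subset[OF _ S_locally_finite[OF that]]) (auto simp: FS_def)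
  show "closed \<sigma>" if "\<sigma> \<in> FS" for \<sigma> using S_compact_convex(1)[OF FS_D(1)[OF that]] by (rule compact_imp_closed)
  have "negligible (\<Union>\<sigma>\<in>\<S>. if \<sigma> \<in> FS then {} else \<sigma>)"
    by (rule negligible_countable_UN[OF S_countable]) (simp add: S_negligible)
  moreover have "- \<Union>FS \<subseteq> (\<Union>\<sigma>\<in>\<S>. if \<sigma> \<in> FS then {} else \<sigma>)"
  proof
    fix x assume x: "x \<in> - \<Union>FS"
    obtain \<sigma> where "\<sigma> \<in> \<S>" "x \<in> \<sigma>" using S_props(2) by (metis UNIV_I UnionE)
    then show "x \<in> (\<Union>\<sigma>\<in>\<S>. if \<sigma> \<in> FS then {} else \<sigma>)" using x by (intro UN_I[of \<sigma>]) auto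
  qed
  ultimately show "negligible (- \<Union>FS)" by (rule negligible_subset)
qed

lemma FS_quasi:
  assumes "\<sigma> \<in> FS"
  shows "h / \<kappa> \<le> diameter \<sigma>" "diameter \<sigma> \<le> \<kappa> * h" "\<exists>x. cball x (h / \<kappa>\<^sup>2) \<subseteq> \<sigma>"
proof -
  have q: "h / \<kappa> \<le> diameter \<sigma> \<and> diameter \<sigma> \<le> \<kappa> * h \<and> (\<exists>x. cball x (diameter \<sigma> / \<kappa>) \<subseteq> \<sigma>)"
    using quasi FS_D[OF assms] by blast
  then show "h / \<kappa> \<le> diameter \<sigma>" "diameter \<sigma> \<le> \<kappa> * h" by auto
  have "h / \<kappa>\<^sup>2 = h / \<kappa> / \<kappa>" by (simp add: power2_eq_square)
  also have "\<dots> \<le> diameter \<sigma> / \<kappa>" using q \<kappa> by (intro divide_right_mono) auto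
  finally show "\<exists>x. cball x (h / \<kappa>\<^sup>2) \<subseteq> \<sigma>" using q by (meson dual_order.trans subset_cball)
qed

lemma FS_dist: "\<sigma> \<in> FS \<Longrightarrow> a \<in> \<sigma> \<Longrightarrow> b \<in> \<sigma> \<Longrightarrow> dist a b \<le> \<kappa> * h"
  using FS_quasi(2) diameter_bounded_bound[OF compact_imp_bounded[OF S_compact_convex(1)[OF FS_D(1)]]]
  by (meson order_trans)

text \<open>The intersection is a face of both simplices; as they differ, it is a proper face of at
  least one and so has lower dimension.\<close>

lemma FS_almost_disjoint:
  assumes "\<sigma> \<in> FS" "\<tau> \<in> FS" "\<sigma> \<noteq> \<tau>" shows "negligible (\<sigma> \<inter> \<tau>)"
proof -
  have ad: "aff_dim \<sigma> = int CARD('n)" "aff_dim \<tau> = int CARD('n)"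
    using aff_dim_simplex FS_D(2) assms by auto
  have f: "(\<sigma> \<inter> \<tau>) face_of \<sigma>" "(\<tau> \<inter> \<sigma>) face_of \<tau>"
    using S_props(4) FS_D(1) assms by blast+
  have cv: "convex \<sigma>" "convex \<tau>" using S_compact_convex(2) FS_D(1) assms by auto
  have "aff_dim (\<sigma> \<inter> \<tau>) < int CARD('n)"
  proof (cases "\<sigma> \<inter> \<tau> = \<sigma>")
    case False
    then show ?thesis using face_of_aff_dim_lt[OF cv(1) f(1)] ad by simp
  next
    case True
    then have "\<tau> \<inter> \<sigma> \<noteq> \<tau>" using assms(3) by blast
    then show ?thesis using face_of_aff_dim_lt[OF cv(2) f(2)] ad by (simp add: Int_commute)
  qed
  then show ?thesis using cv by (intro negligible_low_aff_dim convex_Int) auto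
qed

lemma FS_translate: "\<sigma> \<in> FS \<Longrightarrow> l \<in> L \<Longrightarrow> (+) l ` \<sigma> \<in> FS"
  using S_props(1) simplex_translate[of "int CARD('n)" \<sigma> l] by (simp add: FS_def finite_mod_lattice_def)

text \<open>A relative interior point lies in some \<open>n\<close>-cell, hence in a simplex
  \<open>\<tau>\<close> of that cell; the face \<open>\<sigma> \<inter> \<tau>\<close> of
  \<open>\<sigma>\<close> meets the relative interior and so is all of
  \<open>\<sigma>\<close>.\<close>

lemma FS_subset_full:
  assumes "\<sigma> \<in> FS" shows "\<exists>T\<in>full. \<sigma> \<subseteq> T"
proof -
  have ad: "aff_dim \<sigma> = int CARD('n)" using aff_dim_simplex FS_D(2) assms by auto
  have cv: "convex \<sigma>" using S_compact_convex(2) FS_D(1) assms by auto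
  have "interior \<sigma> = rel_interior \<sigma>" using ad by (simp add: interior_rel_interior_gen)
  moreover have "\<sigma> \<noteq> {}" using ad by auto
  ultimately obtain x where x: "x \<in> rel_interior \<sigma>" using rel_interior_eq_empty[OF cv] by auto
  obtain T where T: "T \<in> full" "x \<in> T" using full_cover by blast
  have "T = \<Union>{\<sigma>\<in>\<S>. \<sigma> \<subseteq> T}" using S_props(5) fullD(1)[OF T(1)] by blast
  then obtain \<tau> where \<tau>: "\<tau> \<in> \<S>" "\<tau> \<subseteq> T" "x \<in> \<tau>" using T(2) by blast
  have "(\<sigma> \<inter> \<tau>) face_of \<sigma>" using S_props(4) FS_D(1)[OF assms] \<tau>(1) by blast
  moreover have "x \<in> \<sigma>" using x rel_interior_subset by blast
  ultimately have "\<sigma> \<inter> \<tau> = \<sigma>" using x \<tau>(3) face_of_disjoint_rel_interior by blast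
  then show ?thesis using T(1) \<tau>(2) by blast
qed

text \<open>Cells need not be convex, so the diameter is bounded through connectedness and the
  number of simplices. Lower-dimensional simplices can be left out because the interior of the cell
  is open and dense in it.\<close>

lemma full_dist:
  assumes "T \<in> full" "x \<in> T" "y \<in> T" shows "dist x y \<le> 2 * real N * (\<kappa> * h)"
proof -
  note TT = fullD(1)[OF assms(1)]
  let ?A = "{\<sigma>\<in>FS. \<sigma> \<subseteq> T}"
  have fin: "finite {\<sigma>\<in>\<S>. \<sigma> \<subseteq> T}" "card {\<sigma>\<in>\<S>. \<sigma> \<subseteq> T} \<le> N" using number TT by auto
  have sub: "?A \<subseteq> {\<sigma>\<in>\<S>. \<sigma> \<subseteq> T}" by (auto simp: FS_def)
  have A: "finite ?A" "card ?A \<le> N" using finite_subset[OF sub fin(1)] card_mono[OF fin(1) sub] fin(2) by auto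
  have cl: "closed (\<Union>?A)" using A(1) S_compact_convex(1) FS_D(1) compact_imp_closed by (intro closed_Union) blast+
  have "cell_interior T - \<Union>?A = {}"
  proof (rule ccontr)
    assume ne: "cell_interior T - \<Union>?A \<noteq> {}"
    have "open (cell_interior T - \<Union>?A)" using full_cell_props(1)[OF assms(1)] cl by (rule open_Diff)
    then have nn: "\<not> negligible (cell_interior T - \<Union>?A)" using ne by (rule open_not_negligible)
    have "negligible (\<Union>{\<sigma>\<in>\<S>. \<sigma> \<subseteq> T \<and> \<sigma> \<notin> FS})"
      using fin(1) by (intro negligible_Union) (auto intro: S_negligible finite_subset[rotated])
    moreover have "T = \<Union>{\<sigma>\<in>\<S>. \<sigma> \<subseteq> T}" using S_props(5) TT by blast
    then have "cell_interior T - \<Union>?A \<subseteq> \<Union>{\<sigma>\<in>\<S>. \<sigma> \<subseteq> T \<and> \<sigma> \<notin> FS}"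
      using full_cell_props(3)[OF assms(1)] by blast
    ultimately show False using nn negligible_subset by blast
  qed
  then have "T \<subseteq> \<Union>?A" using full_cell_props(2)[OF assms(1)] closure_minimal[OF _ cl] by blast
  then show ?thesis
    by (rule connected_diameter_le[OF full_cell_props(6)[OF assms(1)] _ A _ _ assms(2,3)]) (use FS_dist h \<kappa> in auto)
qed

text \<open>A common simplex is asked for rather than a common cell: convexity serves both the mean
  value inequality along the segment and the measure of this set.\<close>

definition bad :: "'n point \<Rightarrow> 'n point set" where
  "bad z = {x. \<not> (\<exists>\<sigma>\<in>FS. x \<in> \<sigma> \<and> x + z \<in> \<sigma>)}"

lemma bad_measurable: "bad z \<in> sets borel"
proof -
  have eq: "bad z = - (\<Union>\<sigma>\<in>FS. \<sigma> \<inter> (\<lambda>x. x + z) -` \<sigma>)" by (auto simp: bad_def)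
  have "(\<Union>\<sigma>\<in>FS. \<sigma> \<inter> (\<lambda>x. x + z) -` \<sigma>) \<in> sets borel"
  proof (rule sets.countable_UN'')
    show "countable FS" using S_countable by (rule countable_subset[rotated]) (auto simp: FS_def)
    fix \<sigma> assume "\<sigma> \<in> FS"
    then have "closed \<sigma>" using S_compact_convex(1) FS_D(1) compact_imp_closed by blast
    then have "closed (\<sigma> \<inter> (\<lambda>x. x + z) -` \<sigma>)" by (intro closed_Int continuous_closed_vimage) (auto intro: continuous_intros)
    then show "\<sigma> \<inter> (\<lambda>x. x + z) -` \<sigma> \<in> sets borel" by (rule borel_closed)
  qed
  then show ?thesis unfolding eq by (rule borel_comp)
qed

lemma bad_periodic: "periodic e (\<lambda>x. x \<in> bad z)"
proof -
  have *: "x + l \<notin> bad z" if l: "l \<in> L" and x: "x \<notin> bad z" for x l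
  proof -
    obtain \<sigma> where \<sigma>: "\<sigma> \<in> FS" "x \<in> \<sigma>" "x + z \<in> \<sigma>" using x by (auto simp: bad_def)
    have "x + l \<in> (+) l ` \<sigma>" by (rule image_eqI[OF _ \<sigma>(2)]) (simp add: add.commute)
    moreover have "x + l + z \<in> (+) l ` \<sigma>" by (rule image_eqI[OF _ \<sigma>(3)]) (simp add: add_ac)
    ultimately have "\<exists>\<tau>\<in>FS. x + l \<in> \<tau> \<and> x + l + z \<in> \<tau>" by (intro bexI[OF _ FS_translate[OF \<sigma>(1) l]] conjI)
    then show ?thesis by (simp add: bad_def)
  qed
  show ?thesis unfolding periodic_def
  proof (intro ballI allI)
    fix l x assume "l \<in> L"
    then show "(x + l \<in> bad z) = (x \<in> bad z)" using *[of l x] *[of "- l" "x + l"] by auto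
  qed
qed

text \<open>A bad point is pushed out of every simplex that contains it, so
  \<open>convex_shift_measure\<close> applies with inradius \<open>h / \<kappa>\<^sup>2\<close>. The
  simplices involved are almost disjoint and lie within radius
  \<open>(\<rho> + \<kappa>) * h\<close>, so their volumes add up to at most that of one
  ball.\<close>

lemma bad_emeasure:
  assumes \<rho>: "\<rho> \<ge> 0"
  shows "emeasure lborel (bad z \<inter> cball y (\<rho> * h))
    \<le> ennreal (real CARD('n) * \<kappa>\<^sup>2 * unit_ball_vol CARD('n) * (\<rho> + \<kappa>) ^ CARD('n) * (norm z / h) * h ^ CARD('n))"
proof -
  define A where "A = {\<sigma>\<in>FS. \<sigma> \<inter> cball y (\<rho> * h) \<noteq> {}}"
  have A: "finite A" unfolding A_def by (rule finite_subset[OF _ S_locally_finite[of "cball y (\<rho> * h)"]]) (auto simp: FS_def)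
  have AF: "\<sigma> \<in> FS" if "\<sigma> \<in> A" for \<sigma> using that by (simp add: A_def)
  have lm: "\<sigma> \<in> lmeasurable" if "\<sigma> \<in> A" for \<sigma> using S_compact_convex(1)[OF FS_D(1)[OF AF[OF that]]] by (rule lmeasurable_compact)
  let ?b = "\<lambda>\<sigma>. {x\<in>\<sigma>. x + z \<notin> \<sigma>}"
  let ?c = "real CARD('n) * (norm z / (h / \<kappa>\<^sup>2))"
  have c0: "?c \<ge> 0" using h \<kappa> by simp
  have lb: "?b \<sigma> \<in> lmeasurable" if "\<sigma> \<in> A" for \<sigma>
  proof -
    have "closed \<sigma>" using S_compact_convex(1)[OF FS_D(1)[OF AF[OF that]]] by (rule compact_imp_closed)
    then have "closed ((\<lambda>x. x + z) -` \<sigma>)" by (intro continuous_closed_vimage) (auto intro: continuous_intros)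
    moreover have "?b \<sigma> = \<sigma> - (\<lambda>x. x + z) -` \<sigma>" by auto
    ultimately show ?thesis using lm[OF that] S_compact_convex(1)[OF FS_D(1)[OF AF[OF that]]]
      by (auto intro!: bounded_set_imp_lmeasurable sets.Diff intro: bounded_subset[OF compact_imp_bounded] simp: fmeasurableD)
  qed
  have sub: "bad z \<inter> cball y (\<rho> * h) \<subseteq> (\<Union>\<sigma>\<in>A. ?b \<sigma>)"
  proof
    fix x assume x: "x \<in> bad z \<inter> cball y (\<rho> * h)"
    have "x \<in> \<Union>FS" by (simp add: FS_cover)
    then obtain \<sigma> where \<sigma>: "\<sigma> \<in> FS" "x \<in> \<sigma>" by (elim UnionE)
    have "\<not> (\<exists>\<tau>\<in>FS. x \<in> \<tau> \<and> x + z \<in> \<tau>)" using x by (simp add: bad_def)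
    then have "x + z \<notin> \<sigma>" using \<sigma> by blast
    moreover have "\<sigma> \<in> A" unfolding A_def using \<sigma> x by (simp only: mem_Collect_eq, blast)
    ultimately show "x \<in> (\<Union>\<sigma>\<in>A. ?b \<sigma>)" using \<sigma>(2) by (intro UN_I[of \<sigma>]) simp_all
  qed
  have lU: "(\<Union>\<sigma>\<in>A. ?b \<sigma>) \<in> lmeasurable" using A lb by (intro fmeasurable.finite_UN) auto
  have "emeasure lborel (bad z \<inter> cball y (\<rho> * h)) = emeasure lebesgue (bad z \<inter> cball y (\<rho> * h))"
  proof -
    have "bad z \<inter> cball y (\<rho> * h) \<in> sets lborel" using bad_measurable[of z] by auto
    then show ?thesis by simp
  qed
  also have "\<dots> \<le> emeasure lebesgue (\<Union>\<sigma>\<in>A. ?b \<sigma>)" using sub lU by (intro emeasure_mono) (auto simp: fmeasurableD)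
  also have "\<dots> = ennreal (measure lebesgue (\<Union>\<sigma>\<in>A. ?b \<sigma>))" using lU by (rule emeasure_eq_measure2)
  also have "\<dots> \<le> ennreal (?c * measure lebesgue (cball y ((\<rho> + \<kappa>) * h)))"
  proof (rule ennreal_leI)
    have "measure lebesgue (\<Union>\<sigma>\<in>A. ?b \<sigma>) \<le> (\<Sum>\<sigma>\<in>A. measure lebesgue (?b \<sigma>))"
      using A lb by (intro measure_UNION_le) (auto simp: fmeasurableD)
    also have "\<dots> \<le> (\<Sum>\<sigma>\<in>A. ?c * measure lebesgue \<sigma>)"
    proof (rule sum_mono)
      fix \<sigma> assume \<sigma>: "\<sigma> \<in> A"
      obtain a where a: "cball a (h / \<kappa>\<^sup>2) \<subseteq> \<sigma>" using FS_quasi(3)[OF AF[OF \<sigma>]] by blast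
      show "measure lebesgue (?b \<sigma>) \<le> ?c * measure lebesgue \<sigma>"
        using convex_shift_measure[OF S_compact_convex(2,1)[OF FS_D(1)[OF AF[OF \<sigma>]]] _ a, of z] h \<kappa> by simp
    qed
    also have "\<dots> = ?c * (\<Sum>\<sigma>\<in>A. measure lebesgue \<sigma>)" by (simp only: sum_distrib_left)
    also have "(\<Sum>\<sigma>\<in>A. measure lebesgue \<sigma>) = measure lebesgue (\<Union>A)"
      by (rule measure_negligible_finite_Union[symmetric, OF A lm]) (auto simp: pairwise_def intro: FS_almost_disjoint AF)
    also have "?c * measure lebesgue (\<Union>A) \<le> ?c * measure lebesgue (cball y ((\<rho> + \<kappa>) * h))"
    proof (intro mult_left_mono c0 measure_mono_fmeasurable)
      show "\<Union>A \<subseteq> cball y ((\<rho> + \<kappa>) * h)"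
      proof
        fix x assume "x \<in> \<Union>A"
        then obtain \<sigma> where \<sigma>0: "\<sigma> \<in> A" "x \<in> \<sigma>" by (elim UnionE)
        then have "\<sigma> \<inter> cball y (\<rho> * h) \<noteq> {}" by (simp add: A_def)
        then obtain q where "q \<in> \<sigma>" "dist y q \<le> \<rho> * h" by auto
        note \<sigma> = \<sigma>0 this
        have "dist y x \<le> dist y q + dist q x" by (rule dist_triangle)
        then show "x \<in> cball y ((\<rho> + \<kappa>) * h)" using FS_dist[OF AF[OF \<sigma>(1)] \<sigma>(3,2)] \<sigma>(4) by (simp add: algebra_simps)
      qed
      show "\<Union>A \<in> sets lebesgue" using A lm by (intro sets.finite_Union) (auto simp: fmeasurableD)
    qed simp
    finally show "measure lebesgue (\<Union>\<sigma>\<in>A. ?b \<sigma>) \<le> ?c * measure lebesgue (cball y ((\<rho> + \<kappa>) * h))" .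
  qed
  also have "measure lebesgue (cball y ((\<rho> + \<kappa>) * h)) = unit_ball_vol CARD('n) * ((\<rho> + \<kappa>) * h) ^ CARD('n)"
    using \<rho> \<kappa> h content_cball[of "(\<rho> + \<kappa>) * h" y] by simp
  also have "?c * (unit_ball_vol CARD('n) * ((\<rho> + \<kappa>) * h) ^ CARD('n))
    = real CARD('n) * \<kappa>\<^sup>2 * unit_ball_vol CARD('n) * (\<rho> + \<kappa>) ^ CARD('n) * (norm z / h) * h ^ CARD('n)"
    unfolding power_mult_distrib by simp
  finally show ?thesis .
qed

end

section \<open>The inverse estimate\<close>

lemma nn_integral_lborel_affine:
  fixes f :: "'a::euclidean_space \<Rightarrow> ennreal"
  assumes [measurable]: "f \<in> borel_measurable borel" and c: "c > 0"
  shows "(\<integral>\<^sup>+x. f x \<partial>lborel) = ennreal (c ^ DIM('a)) * (\<integral>\<^sup>+x. f (t + c *\<^sub>R x) \<partial>lborel)"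
proof -
  have "(\<integral>\<^sup>+x. f x \<partial>lborel) = (\<integral>\<^sup>+x. f x \<partial>density (distr lborel borel (\<lambda>x. t + c *\<^sub>R x)) (\<lambda>_. ennreal (\<bar>c\<bar> ^ DIM('a))))"
    by (subst lborel_affine[of c t]) (use c in simp_all)
  also have "\<dots> = ennreal (c ^ DIM('a)) * (\<integral>\<^sup>+x. f (t + c *\<^sub>R x) \<partial>lborel)"
    using c by (simp add: nn_integral_density nn_integral_distr nn_integral_cmult)
  finally show ?thesis .
qed

text \<open>Suppose a hyperplane with normal \<open>n\<close> separates \<open>y\<close> from the
  perturbed hull. The ball of radius \<open>2 * \<rho>\<close> forces a vertex \<open>v\<close> with
  \<open>n \<bullet> v \<le> n \<bullet> a - 2 * \<rho> * norm n\<close>; its perturbation loses at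
  most half of this gap and remains on the side of \<open>y\<close>.\<close>

lemma convex_hull_perturb:
  fixes S :: "'a::euclidean_space set"
  assumes S: "finite S" and ball: "cball a (2 * \<rho>) \<subseteq> convex hull S" and \<rho>: "\<rho> > 0"
    and f: "\<And>v. v \<in> S \<Longrightarrow> norm (f v - v) < \<rho>"
  shows "cball a \<rho> \<subseteq> convex hull (f ` S)"
proof
  fix y assume y: "y \<in> cball a \<rho>"
  show "y \<in> convex hull (f ` S)"
  proof (rule ccontr)
    assume "y \<notin> convex hull (f ` S)"
    moreover have "closed (convex hull (f ` S))" using S by (simp add: compact_imp_closed finite_imp_compact_convex_hull)
    ultimately obtain n b where n: "n \<bullet> y < b" "\<And>x. x \<in> convex hull (f ` S) \<Longrightarrow> b < n \<bullet> x"
      using separating_hyperplane_closed_point[OF convex_convex_hull, of "f ` S" y] by auto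
    have n0: "n \<noteq> 0"
    proof
      assume "n = 0"
      have "a \<in> convex hull S" using ball \<rho> by auto
      then have "S \<noteq> {}" by auto
      then obtain v where "v \<in> S" by blast
      then have "f v \<in> convex hull (f ` S)" by (simp add: hull_inc)
      then have "b < 0" using n(2)[of "f v"] \<open>n = 0\<close> by simp
      then show False using n(1) \<open>n = 0\<close> by simp
    qed
    let ?w = "n /\<^sub>R norm n"
    have w: "n \<bullet> ?w = norm n" using n0 by (simp add: dot_square_norm power2_eq_square)
    have "a - (2 * \<rho>) *\<^sub>R ?w \<in> convex hull S" using ball \<rho> n0 by (auto simp: dist_norm)
    moreover have "convex {x. n \<bullet> x > n \<bullet> a - 2 * \<rho> * norm n}" by (rule convex_halfspace_gt)
    moreover have "n \<bullet> (a - (2 * \<rho>) *\<^sub>R ?w) = n \<bullet> a - 2 * \<rho> * norm n"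
      by (simp only: inner_diff_right inner_scaleR_right[of n "2 * \<rho>"] w)
    ultimately have "\<not> S \<subseteq> {x. n \<bullet> x > n \<bullet> a - 2 * \<rho> * norm n}"
      using hull_minimal[of S "{x. n \<bullet> x > n \<bullet> a - 2 * \<rho> * norm n}" convex] by (metis less_irrefl mem_Collect_eq subsetD)
    then obtain v where v: "v \<in> S" "n \<bullet> v \<le> n \<bullet> a - 2 * \<rho> * norm n" by force
    have "n \<bullet> (f v - v) \<le> norm n * norm (f v - v)" by (rule norm_cauchy_schwarz)
    also have "\<dots> \<le> norm n * \<rho>" using f[OF v(1)] by (intro mult_left_mono) auto
    finally have "n \<bullet> f v \<le> n \<bullet> v + norm n * \<rho>" by (simp add: inner_diff_right)
    moreover have "2 * \<rho> * norm n = 2 * (norm n * \<rho>)" by simp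
    ultimately have "n \<bullet> f v \<le> n \<bullet> a - norm n * \<rho>" using v(2) by linarith
    moreover have "n \<bullet> (a - y) \<le> norm n * \<rho>"
      using norm_cauchy_schwarz[of n "a - y"] y mult_left_mono[of "norm (a - y)" \<rho> "norm n"] by (simp add: dist_norm)
    then have "n \<bullet> a - norm n * \<rho> \<le> n \<bullet> y" by (simp add: inner_diff_right)
    moreover have "b < n \<bullet> f v" using n(2)[of "f v"] v(1) by (simp add: hull_inc)
    ultimately show False using n(1) by linarith
  qed
qed

lemma bounded_coeffs_subseq:
  fixes \<gamma> :: "nat \<Rightarrow> nat \<Rightarrow> real"
  assumes "\<And>i l. \<bar>\<gamma> i l\<bar> \<le> 1"
  shows "\<exists>s g. strict_mono s \<and> (\<forall>l<r. (\<lambda>i. \<gamma> (s i) l) \<longlonglongrightarrow> g l)"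
proof (induction r)
  case 0
  show ?case by (intro exI[of _ id]) (simp add: strict_mono_def)
next
  case (Suc r)
  then obtain s g where s: "strict_mono s" "\<And>l. l < r \<Longrightarrow> (\<lambda>i. \<gamma> (s i) l) \<longlonglongrightarrow> g l" by blast
  have "\<forall>i. \<gamma> (s i) r \<in> {-1..1}" using assms[of "s _" r] by (simp add: abs_le_iff)
  then obtain a t where t: "strict_mono t" "((\<lambda>i. \<gamma> (s i) r) \<circ> t) \<longlonglongrightarrow> a"
    using compact_Icc[of "-1::real" 1] unfolding compact_eq_seq_compact_metric seq_compact_def by metis
  show ?case
  proof (intro exI[of _ "s \<circ> t"] exI[of _ "g(r := a)"] conjI allI impI)
    show "strict_mono (s \<circ> t)" using s(1) t(1) by (rule strict_mono_o)
    fix l assume "l < Suc r"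
    then consider "l < r" | "l = r" by linarith
    then show "(\<lambda>i. \<gamma> ((s \<circ> t) i) l) \<longlonglongrightarrow> (g(r := a)) l"
    proof cases
      case 1
      then show ?thesis using LIMSEQ_subseq_LIMSEQ[OF s(2) t(1)] by (simp add: o_def)
    next
      case 2
      then show ?thesis using t(2) by (simp add: o_def)
    qed
  qed
qed

lemma simplex_interior_dense:
  assumes "int DIM('a) simplex (\<sigma> :: 'a::euclidean_space set)"
  shows "\<sigma> \<subseteq> closure (interior \<sigma>)"
proof -
  have "interior \<sigma> = rel_interior \<sigma>" using aff_dim_simplex[OF assms] by (simp add: interior_rel_interior_gen)
  then show ?thesis using convex_closure_rel_interior[OF convex_simplex[OF assms]] closure_subset[of \<sigma>] by simp
qed

lemma negligible_affine_image:
  fixes A :: "'a::euclidean_space \<Rightarrow> 'a"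
  assumes "linear A" "negligible S" "\<And>x. x \<in> S \<Longrightarrow> f x = A x + c"
  shows "negligible (f ` S)"
proof -
  obtain K where K: "\<And>x. norm (A x) \<le> norm x * K"
    using bounded_linear.bounded[of A] assms(1) by (auto simp: linear_conv_bounded_linear)
  have "\<bar>K\<bar>-lipschitz_on S f"
  proof (rule lipschitz_onI)
    fix x y assume "x \<in> S" "y \<in> S"
    then have "dist (f x) (f y) = norm (A (x - y))" using assms(1,3) by (simp add: dist_norm linear_diff)
    also have "\<dots> \<le> norm (x - y) * K" by (rule K)
    also have "\<dots> \<le> norm (x - y) * \<bar>K\<bar>" by (intro mult_left_mono) auto
    finally show "dist (f x) (f y) \<le> \<bar>K\<bar> * dist x y" by (simp add: dist_norm mult.commute)
  qed simp
  then show ?thesis using assms(2) by (rule negligible_lipschitz_image)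
qed

text \<open>The first-order jet at the origin, to which the point of evaluation is moved by
  scaling.\<close>

definition jet_sq :: "'n::finite form \<Rightarrow> real" where
  "jet_sq V = (norm (V 0))\<^sup>2 + (\<Sum>q\<in>UNIV. (norm (partial q V 0))\<^sup>2)"

text \<open>
  Once their largest coefficient is scaled to \<open>1\<close>, forms violating the inverse estimate on converging
  macro-elements have a limit in the span of the limit basis.  It is nonzero by independence, hence
  bounded below on a ball in the limit cell, whereas the scaled jets stay bounded.
\<close>

lemma macro_inverse_contradiction:
  fixes D :: "nat \<Rightarrow> 'n::{finite,linorder} macro_element"
  assumes conv: "macro_converges D E" and fin: "finite (fst E)" and k: "k \<le> CARD('n)"
    and T: "\<And>i. T i \<in> fst (D i)" and V: "\<And>i. V i \<in> snd (D i) (T i) k"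
    and sm: "\<And>i W. W \<in> snd (D i) (T i) k \<Longrightarrow> smooth W"
    and smE: "\<And>T0 W. T0 \<in> fst E \<Longrightarrow> W \<in> snd E T0 k \<Longrightarrow> smooth W"
    and Op: "\<And>i. open (Op i)" "\<And>i. Op i \<subseteq> T i" "\<And>i. T i \<subseteq> closure (Op i)"
    and T0: "\<And>i. 0 \<in> T i"
    and viol: "\<And>i. ennreal (real i) * (\<integral>\<^sup>+y\<in>T i. ennreal ((norm (V i y))\<^sup>2) \<partial>lborel) < ennreal (jet_sq (V i))"
  shows False
proof -
  obtain \<S> \<Psi> N where macro: "simplicial_complex \<S>" "\<Union>\<S> = \<Union>(fst E)" "\<forall>T\<in>fst E. T = \<Union>{\<sigma>\<in>\<S>. \<sigma> \<subseteq> T}"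
    "\<forall>i\<ge>N. inj_on (\<Psi> i) (\<Union>(fst E)) \<and> (\<forall>\<sigma>\<in>\<S>. \<exists>A c. linear A \<and> (\<forall>x\<in>\<sigma>. \<Psi> i x = A x + c)) \<and>
        bij_betw ((`) (\<Psi> i)) (fst E) (fst (D i))"
    "\<forall>x\<in>\<Union>(fst E). (\<lambda>i. \<Psi> i x) \<longlonglongrightarrow> x"
    "\<forall>T\<in>fst E. \<forall>k\<le>CARD('n). \<exists>r b b'.
        basis_on_cell T (snd E T k) r b \<and>
        (\<forall>i\<ge>N. basis_on_cell (\<Psi> i ` T) (snd (D i) (\<Psi> i ` T) k) r (b' i)) \<and>
        (\<forall>l<r. \<forall>is R. uniform_limit (cball 0 R) (\<lambda>i. partials is (b' i l)) (partials is (b l)) sequentially)"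
    using conv unfolding macro_converges_def by (elim exE conjE) (rule that)
  have "\<forall>i\<in>{N..}. \<exists>C. C \<in> fst E \<and> T i = \<Psi> i ` C"
  proof
    fix i assume "i \<in> {N..}"
    then have "bij_betw ((`) (\<Psi> i)) (fst E) (fst (D i))" using macro(4) by simp
    then have "T i \<in> (`) (\<Psi> i) ` fst E" using T[of i] by (simp add: bij_betw_imp_surj_on)
    then show "\<exists>C. C \<in> fst E \<and> T i = \<Psi> i ` C" by auto
  qed
  from bchoice[OF this] obtain Cf where Cf: "\<And>i. i \<ge> N \<Longrightarrow> Cf i \<in> fst E \<and> T i = \<Psi> i ` Cf i" by auto
  have "finite (Cf ` {N..})" using fin by (rule finite_subset[rotated]) (use Cf in auto)
  \<comment> \<open>There are finitely many limit cells, so one of them corresponds to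
    \<open>T i\<close> for infinitely many \<open>i\<close>; from here on it is fixed.\<close>
  then obtain i0 where i0: "i0 \<ge> N" "infinite {i\<in>{N..}. Cf i = Cf i0}"
    using pigeonhole_infinite[of "{N..}" Cf] by (auto simp: infinite_Ici)
  define C where "C = Cf i0"
  define I where "I = {i\<in>{N..}. Cf i = C}"
  have infI: "infinite I" using i0 by (simp add: I_def C_def)
  have C: "C \<in> fst E" using Cf i0 by (simp add: C_def)
  have TI: "T i = \<Psi> i ` C" "i \<ge> N" if "i \<in> I" for i using that Cf[of i] by (auto simp: I_def)
  obtain r b b' where bas: "basis_on_cell C (snd E C k) r b"
    "\<forall>i\<ge>N. basis_on_cell (\<Psi> i ` C) (snd (D i) (\<Psi> i ` C) k) r (b' i)"
    "\<forall>l<r. \<forall>is R. uniform_limit (cball 0 R) (\<lambda>i. partials is (b' i l)) (partials is (b l)) sequentially"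
    by (rule bspec[OF macro(6) C, THEN spec, THEN mp, OF k, THEN exE], elim exE conjE) (rule that)
  have sb: "smooth (b l)" if "l < r" for l
  proof -
    have "b l \<in> snd E C k" using bas(1) that by (simp add: basis_on_cell_def)
    then show ?thesis by (rule smE[OF C])
  qed
  have sb': "smooth (b' i l)" if "l < r" "i \<in> I" for i l
  proof -
    have "basis_on_cell (T i) (snd (D i) (T i) k) r (b' i)" using bas(2) TI[OF that(2)] by simp
    then have "b' i l \<in> snd (D i) (T i) k" using that(1) by (simp add: basis_on_cell_def)
    then show ?thesis by (rule sm)
  qed
  have partials_sum: "partials is (\<lambda>x. \<Sum>l<m. a l *\<^sub>R f l x) = (\<lambda>x. \<Sum>l<m. a l *\<^sub>R partials is (f l) x)"
    if "\<And>l. l < m \<Longrightarrow> smooth (f l)" for "is" and m :: nat and a :: "nat \<Rightarrow> real" and f :: "nat \<Rightarrow> 'n form"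
    using that
  proof (induction m)
    case 0 show ?case by (simp add: partials_const)
  next
    case (Suc m)
    have s1: "smooth (\<lambda>x. \<Sum>l<m. a l *\<^sub>R f l x)"
      using Suc.prems by (intro smooth_sum smooth_linear[OF bounded_linear_scaleR_right]) auto
    have s2: "smooth (f m)" using Suc.prems by simp
    show ?case using partials_add[OF s1 smooth_linear[OF bounded_linear_scaleR_right s2, of "a m"], of "is"]
        partials_linear[OF bounded_linear_scaleR_right s2, of "is" "a m"] Suc by simp
  qed
  have ex_c: "\<exists>c. \<forall>y\<in>T i. \<forall>is. partials is (V i) y = (\<Sum>l<r. c l *\<^sub>R partials is (b' i l) y)" if i: "i \<in> I" for i
  proof -
    have "basis_on_cell (T i) (snd (D i) (T i) k) r (b' i)" using bas(2) TI[OF i] by simp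
    then obtain c where c: "same_pullback (T i) (V i) (\<lambda>x. \<Sum>l<r. c l *\<^sub>R b' i l x)"
      using V[of i] unfolding basis_on_cell_def by blast
    have s1: "smooth (\<lambda>x. \<Sum>l<r. c l *\<^sub>R b' i l x)"
      using sb' i by (intro smooth_sum smooth_linear[OF bounded_linear_scaleR_right]) auto
    show ?thesis
    proof (intro exI[of _ c] ballI allI)
      fix y "is" assume y: "y \<in> T i"
      have "partials is (V i) y = partials is (\<lambda>x. \<Sum>l<r. c l *\<^sub>R b' i l x) y"
        by (rule same_pullback_full[OF c Op(1)[of i] Op(2,3) sm[OF V] s1 y])
      then show "partials is (V i) y = (\<Sum>l<r. c l *\<^sub>R partials is (b' i l) y)" using partials_sum sb' i by simp
    qed
  qed
  have "\<forall>i\<in>I. \<exists>c. \<forall>y\<in>T i. \<forall>is. partials is (V i) y = (\<Sum>l<r. c l *\<^sub>R partials is (b' i l) y)"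
    by (intro ballI ex_c)
  from bchoice[OF this] obtain c where c':
    "\<forall>i\<in>I. \<forall>y\<in>T i. \<forall>is. partials is (V i) y = (\<Sum>l<r. c i l *\<^sub>R partials is (b' i l) y)" by (elim exE)
  have c: "partials is (V i) y = (\<Sum>l<r. c i l *\<^sub>R partials is (b' i l) y)" if "i \<in> I" "y \<in> T i" for i y "is"
    using bspec[OF bspec[OF c' that(1)] that(2)] by (rule spec)
  \<comment> \<open>The normalising factor is the sum of the moduli: it keeps the coefficients
    bounded, and the normalised sum, constantly \<open>1\<close>, passes to the limit, which is
    therefore nonzero.\<close>
  define \<mu> where "\<mu> i = (\<Sum>l<r. \<bar>c i l\<bar>)" for i
  have \<mu>0: "\<mu> i \<ge> 0" for i by (simp add: \<mu>_def sum_nonneg)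
  have \<mu>: "\<mu> i > 0" if i: "i \<in> I" for i
  proof (rule ccontr)
    assume "\<not> \<mu> i > 0"
    then have "\<mu> i = 0" using \<mu>0[of i] by simp
    then have "c i l = 0" if "l < r" for l using that by (simp add: \<mu>_def sum_nonneg_eq_0_iff)
    then have "partials is (V i) 0 = 0" for "is" using c[OF i T0] by simp
    from this[of "[]"] this[of "[q]" for q] have "jet_sq (V i) = 0" by (simp add: jet_sq_def)
    then show False using viol[of i] by simp
  qed
  \<comment> \<open>Set to \<open>0\<close> beyond \<open>r\<close>, since
    \<open>bounded_coeffs_subseq\<close> asks for a bound at every index.\<close>
  define \<gamma> where "\<gamma> i l = (if l < r then c i l / \<mu> i else 0)" for i l
  have "\<bar>\<gamma> i l\<bar> \<le> 1" for i l
  proof (cases "l < r \<and> \<mu> i \<noteq> 0")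
    case True
    then have "\<bar>c i l\<bar> \<le> \<mu> i" unfolding \<mu>_def by (intro member_le_sum) auto
    then show ?thesis using True \<mu>0[of i] by (simp add: \<gamma>_def)
  qed (auto simp: \<gamma>_def)
  then obtain s1 g where s1: "strict_mono s1" "\<And>l. l < r \<Longrightarrow> (\<lambda>i. \<gamma> (enumerate I (s1 i)) l) \<longlonglongrightarrow> g l"
    using bounded_coeffs_subseq[of "\<lambda>i. \<gamma> (enumerate I i)" r] by metis
  define s where "s = (\<lambda>i. enumerate I (s1 i))"
  have s: "strict_mono s" using strict_mono_o[OF strict_mono_enumerate[OF infI] s1(1)] by (simp add: s_def o_def)
  have sI: "s i \<in> I" for i unfolding s_def by (rule enumerate_in_set[OF infI])
  have sg: "(\<lambda>i. \<gamma> (s i) l) \<longlonglongrightarrow> g l" if "l < r" for l using s1(2)[OF that] by (simp add: s_def)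
  have "(\<Sum>l<r. \<bar>g l\<bar>) = 1"
  proof (rule LIMSEQ_unique)
    show "(\<lambda>i. \<Sum>l<r. \<bar>\<gamma> (s i) l\<bar>) \<longlonglongrightarrow> (\<Sum>l<r. \<bar>g l\<bar>)" by (intro tendsto_intros sg) auto
    have "(\<Sum>l<r. \<bar>\<gamma> (s i) l\<bar>) = 1" for i
      using \<mu>[OF sI[of i]] by (simp add: \<gamma>_def sum_divide_distrib[symmetric] \<mu>_def)
    then show "(\<lambda>i. \<Sum>l<r. \<bar>\<gamma> (s i) l\<bar>) \<longlonglongrightarrow> 1" by simp
  qed
  then obtain l0 where l0: "l0 < r" "g l0 \<noteq> 0" by (metis abs_zero lessThan_iff sum.neutral zero_neq_one)
  define U where "U x = (\<Sum>l<r. g l *\<^sub>R b l x)" for x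
  have "\<not> same_pullback C U (\<lambda>x. 0)" using bas(1) l0 unfolding basis_on_cell_def U_def[abs_def] by blast
  then obtain x0 where x0: "x0 \<in> C" "U x0 \<noteq> 0" using same_pullbackI[of C U "\<lambda>x. 0"] by blast
  have sU: "smooth U" unfolding U_def by (intro smooth_sum smooth_linear[OF bounded_linear_scaleR_right] sb) auto
  have cU: "continuous_on UNIV U" by (rule smooth_continuous[OF sU])
  define A where "A = {\<sigma>\<in>\<S>. \<sigma> \<subseteq> C}"
  define A' where "A' = {\<sigma>\<in>A. int CARD('n) simplex \<sigma>}"
  have finS: "finite \<S>" and simp: "\<And>\<sigma>. \<sigma> \<in> \<S> \<Longrightarrow> \<exists>d. d simplex \<sigma>" using macro(1) by (auto simp: simplicial_complex_def)
  have finA: "finite A" "finite A'" using finS by (simp_all add: A_def A'_def)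
  have CA: "C = \<Union>A" using macro(3) C by (simp add: A_def)
  have aff: "\<exists>B d. linear B \<and> (\<forall>x\<in>\<sigma>. \<Psi> i x = B x + d)" if "\<sigma> \<in> A" "i \<ge> N" for \<sigma> i
    using macro(4) that by (auto simp: A_def)
  \<comment> \<open>That the limit cell has full dimension everywhere is seen through one
    \<open>\<Psi> i\<close>, which maps it onto the \<open>n\<close>-cell \<open>T i\<close>:
    lower-dimensional simplices have null images, so the images of the others, a closed set, contain
    the dense part \<open>Op i\<close>. Injectivity pulls the covering back.\<close>
  have "C \<subseteq> \<Union>A'"
  proof -
    let ?i = "s 0"
    note iN = TI[OF sI[of 0]]
    have cpt: "compact (\<Psi> ?i ` \<sigma>)" if \<sigma>: "\<sigma> \<in> A" for \<sigma>
    proof -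
      obtain B d where B: "linear B" "\<forall>x\<in>\<sigma>. \<Psi> ?i x = B x + d" using aff[OF \<sigma> iN(2)] by blast
      have "continuous_on \<sigma> (\<lambda>x. B x + d)"
        using B(1) by (intro continuous_intros linear_continuous_on) (simp add: linear_conv_bounded_linear)
      moreover have "compact \<sigma>" using simp \<sigma> compact_simplex by (auto simp: A_def)
      ultimately have "compact ((\<lambda>x. B x + d) ` \<sigma>)" by (rule compact_continuous_image)
      moreover have "\<Psi> ?i ` \<sigma> = (\<lambda>x. B x + d) ` \<sigma>" using B(2) by (intro image_cong) auto
      ultimately show ?thesis by simp
    qed
    have neg: "negligible (\<Psi> ?i ` \<sigma>)" if \<sigma>: "\<sigma> \<in> A" "\<sigma> \<notin> A'" for \<sigma>
    proof -
      obtain B d where B: "linear B" "\<forall>x\<in>\<sigma>. \<Psi> ?i x = B x + d" using aff[OF \<sigma>(1) iN(2)] by blast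
      obtain m where m: "m simplex \<sigma>" using simp \<sigma> by (auto simp: A_def)
      then have "m \<noteq> int CARD('n)" using \<sigma> by (auto simp: A'_def)
      then have "negligible \<sigma>"
        using aff_dim_simplex[OF m] convex_simplex[OF m] by (simp add: negligible_convex_interior interior_rel_interior_gen)
      then show ?thesis using B by (intro negligible_affine_image[of B _ _ d]) auto
    qed
    have cl: "closed (\<Union>\<sigma>\<in>A'. \<Psi> ?i ` \<sigma>)" using finA(2) cpt by (intro closed_UN) (auto simp: A'_def compact_imp_closed)
    have "Op ?i - (\<Union>\<sigma>\<in>A'. \<Psi> ?i ` \<sigma>) = {}"
    proof (rule ccontr)
      assume "Op ?i - (\<Union>\<sigma>\<in>A'. \<Psi> ?i ` \<sigma>) \<noteq> {}"
      moreover have "open (Op ?i - (\<Union>\<sigma>\<in>A'. \<Psi> ?i ` \<sigma>))" using Op(1) cl by (rule open_Diff)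
      ultimately have "\<not> negligible (Op ?i - (\<Union>\<sigma>\<in>A'. \<Psi> ?i ` \<sigma>))" using open_not_negligible by blast
      moreover have "negligible (\<Union>\<sigma>\<in>A - A'. \<Psi> ?i ` \<sigma>)"
        using finA(1) neg by (intro negligible_countable_UN) (auto simp: countable_finite)
      moreover have "Op ?i - (\<Union>\<sigma>\<in>A'. \<Psi> ?i ` \<sigma>) \<subseteq> (\<Union>\<sigma>\<in>A - A'. \<Psi> ?i ` \<sigma>)"
      proof
        fix x assume x: "x \<in> Op ?i - (\<Union>\<sigma>\<in>A'. \<Psi> ?i ` \<sigma>)"
        then have "x \<in> \<Psi> ?i ` C" using Op(2)[of ?i] iN(1) by blast
        then obtain y where y: "y \<in> C" "x = \<Psi> ?i y" by (elim imageE)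
        then have "y \<in> \<Union>A" using CA by simp
        then obtain \<sigma> where \<sigma>: "\<sigma> \<in> A" "y \<in> \<sigma>" by (elim UnionE)
        have "\<sigma> \<notin> A'" using x y(2) \<sigma>(2) by blast
        then show "x \<in> (\<Union>\<sigma>\<in>A - A'. \<Psi> ?i ` \<sigma>)" using \<sigma> y(2) by blast
      qed
      ultimately show False using negligible_subset by blast
    qed
    then have "closure (Op ?i) \<subseteq> (\<Union>\<sigma>\<in>A'. \<Psi> ?i ` \<sigma>)" by (intro closure_minimal cl) auto
    then have "T ?i \<subseteq> (\<Union>\<sigma>\<in>A'. \<Psi> ?i ` \<sigma>)" using Op(3)[of ?i] by (rule order_trans[rotated])
    then have "\<Psi> ?i ` C \<subseteq> \<Psi> ?i ` \<Union>A'" unfolding iN(1) by (simp only: image_Union)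
    moreover have "inj_on (\<Psi> ?i) (\<Union>(fst E))" using macro(4) iN(2) by auto
    moreover have "C \<subseteq> \<Union>(fst E)" "\<Union>A' \<subseteq> \<Union>(fst E)" using C CA by (auto simp: A'_def)
    ultimately show ?thesis by (metis inj_on_image_subset_iff)
  qed
  then obtain \<sigma> where \<sigma>: "\<sigma> \<in> A" "int CARD('n) simplex \<sigma>" "x0 \<in> \<sigma>" using x0(1) by (auto simp: A'_def)
  have opU: "open {x. U x \<noteq> 0}"
  proof -
    have "open (U -` (- {0}))" using cU by (intro open_vimage) auto
    moreover have "U -` (- {0}) = {x. U x \<noteq> 0}" by auto
    ultimately show ?thesis by simp
  qed
  have "x0 \<in> closure (interior \<sigma>)" using simplex_interior_dense[of \<sigma>] \<sigma>(2,3) by auto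
  then have "{x. U x \<noteq> 0} \<inter> interior \<sigma> \<noteq> {}"
    using x0(2) open_Int_closure_eq_empty[OF opU, of "interior \<sigma>"] by blast
  then obtain x1 where x1: "U x1 \<noteq> 0" "x1 \<in> interior \<sigma>" by blast
  \<comment> \<open>A third of the value: near \<open>x1\<close> the limit form exceeds
    \<open>2 * \<eta>\<close> in norm, and its approximants lose at most
    \<open>\<eta>\<close>.\<close>
  define \<eta> where "\<eta> = norm (U x1) / 3"
  have \<eta>: "\<eta> > 0" using x1(1) by (simp add: \<eta>_def)
  have "open {x. norm (U x) > 2 * \<eta>}" by (intro open_Collect_less continuous_intros cU)
  then have "open (interior \<sigma> \<inter> {x. norm (U x) > 2 * \<eta>})" by (intro open_Int) auto
  moreover have "x1 \<in> interior \<sigma> \<inter> {x. norm (U x) > 2 * \<eta>}" using x1 by (simp add: \<eta>_def)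
  ultimately obtain \<rho>0 where \<rho>0: "\<rho>0 > 0" "cball x1 \<rho>0 \<subseteq> interior \<sigma> \<inter> {x. norm (U x) > 2 * \<eta>}"
    using open_contains_cball by blast
  define \<rho> where "\<rho> = \<rho>0 / 2"
  have \<rho>: "\<rho> > 0" "cball x1 (2 * \<rho>) \<subseteq> \<sigma>" "\<And>y. y \<in> cball x1 (2 * \<rho>) \<Longrightarrow> norm (U y) > 2 * \<eta>"
    using \<rho>0 interior_subset by (auto simp: \<rho>_def)
  obtain S0 where S0: "finite S0" "\<sigma> = convex hull S0"
  proof -
    have "\<exists>C. \<not> affine_dependent C \<and> int (card C) = int CARD('n) + 1 \<and> \<sigma> = convex hull C"
      using \<sigma>(2) by (simp add: simplex_def)
    then obtain C where "\<not> affine_dependent C" "\<sigma> = convex hull C" by (elim exE conjE)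
    then show thesis using that aff_independent_finite by metis
  qed
  \<comment> \<open>An affine map moves a simplex as the hull of its vertices, so convergence at the
    finitely many vertices suffices for the image to contain a fixed ball.\<close>
  have evball: "\<forall>\<^sub>F i in sequentially. i \<ge> N \<longrightarrow> cball x1 \<rho> \<subseteq> \<Psi> i ` \<sigma>"
  proof -
    have "\<forall>\<^sub>F i in sequentially. \<forall>v\<in>S0. norm (\<Psi> i v - v) < \<rho>"
    proof (intro eventually_ball_finite S0(1) ballI)
      fix v assume "v \<in> S0"
      then have "v \<in> \<sigma>" unfolding S0(2) by (rule hull_inc)
      then have "v \<in> C" using \<sigma>(1) CA by (simp, blast)
      then have "v \<in> \<Union>(fst E)" using C by (rule UnionI[rotated])
      then have "(\<lambda>i. \<Psi> i v) \<longlonglongrightarrow> v" by (rule bspec[OF macro(5)])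
      from tendstoD[OF this \<rho>(1)] show "\<forall>\<^sub>F i in sequentially. norm (\<Psi> i v - v) < \<rho>" by (simp add: dist_norm)
    qed
    then show ?thesis
    proof eventually_elim
      case (elim i)
      show ?case
      proof
        assume "i \<ge> N"
        then obtain B d where B: "linear B" "\<forall>x\<in>\<sigma>. \<Psi> i x = B x + d" using aff[OF \<sigma>(1)] by blast
        have "\<Psi> i ` \<sigma> = (\<lambda>x. d + B x) ` \<sigma>"
          by (rule image_cong) (use B(2) in \<open>simp_all add: add.commute\<close>)
        also have "\<dots> = (+) d ` B ` (convex hull S0)" by (simp only: image_image S0(2))
        also have "\<dots> = convex hull ((+) d ` B ` S0)" by (simp add: convex_hull_linear_image[OF B(1)] convex_hull_translation)
        also have "(+) d ` B ` S0 = \<Psi> i ` S0"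
        proof -
          have "\<Psi> i v = d + B v" if "v \<in> S0" for v
          proof -
            have "v \<in> \<sigma>" unfolding S0(2) using that by (rule hull_inc)
            then show ?thesis using B(2) by (simp add: add.commute)
          qed
          then show ?thesis by (simp add: image_image)
        qed
        finally have "\<Psi> i ` \<sigma> = convex hull (\<Psi> i ` S0)" .
        then show "cball x1 \<rho> \<subseteq> \<Psi> i ` \<sigma>"
          using convex_hull_perturb[OF S0(1) _ \<rho>(1), of x1 "\<Psi> i"] \<rho>(2) S0(2) elim by auto
      qed
    qed
  qed
  define W where "W i y = (\<Sum>l<r. \<gamma> (s i) l *\<^sub>R b' (s i) l y)" for i y
  have VW: "partials is (V (s i)) y = \<mu> (s i) *\<^sub>R (\<Sum>l<r. \<gamma> (s i) l *\<^sub>R partials is (b' (s i) l) y)" if "y \<in> T (s i)" for i y "is"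
  proof -
    have "\<mu> (s i) *\<^sub>R (\<Sum>l<r. \<gamma> (s i) l *\<^sub>R partials is (b' (s i) l) y) = (\<Sum>l<r. c (s i) l *\<^sub>R partials is (b' (s i) l) y)"
      unfolding scaleR_sum_right by (rule sum.cong) (use \<mu>[OF sI[of i]] in \<open>auto simp: \<gamma>_def\<close>)
    then show ?thesis using c[OF sI that] by simp
  qed
  have lim_b: "(\<lambda>i. partials is (b' (s i) l) y) \<longlonglongrightarrow> partials is (b l) y" if "l < r" for l "is" y
  proof -
    have "uniform_limit (cball 0 (norm y)) (\<lambda>i. partials is (b' i l)) (partials is (b l)) sequentially" using bas(3) that by blast
    then have "(\<lambda>i. partials is (b' i l) y) \<longlonglongrightarrow> partials is (b l) y" by (rule tendsto_uniform_limitI) simp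
    from LIMSEQ_subseq_LIMSEQ[OF this s] show ?thesis by (simp add: o_def)
  qed
  define J where "J i = (norm (\<Sum>l<r. \<gamma> (s i) l *\<^sub>R partials [] (b' (s i) l) 0))\<^sup>2
    + (\<Sum>q\<in>UNIV. (norm (\<Sum>l<r. \<gamma> (s i) l *\<^sub>R partials [q] (b' (s i) l) 0))\<^sup>2)" for i
  define J0 where "J0 = (norm (\<Sum>l<r. g l *\<^sub>R partials [] (b l) 0))\<^sup>2 + (\<Sum>q\<in>UNIV. (norm (\<Sum>l<r. g l *\<^sub>R partials [q] (b l) 0))\<^sup>2)"
  have "J \<longlonglongrightarrow> J0" unfolding J_def[abs_def] J0_def by (intro tendsto_intros sg lim_b) auto
  then have evJ: "\<forall>\<^sub>F i in sequentially. J i < J0 + 1" by (rule order_tendstoD) simp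
  have jet: "jet_sq (V (s i)) = (\<mu> (s i))\<^sup>2 * J i" for i
    using VW[OF T0, of "[]" i] VW[OF T0, of "[q]" i for q] \<mu>0[of "s i"]
    by (simp add: jet_sq_def J_def power_mult_distrib distrib_left sum_distrib_left)
  have "\<exists>Bd. \<forall>l<r. \<forall>y\<in>cball x1 \<rho>. norm (b l y) \<le> Bd"
  proof -
    have "\<exists>Bd. \<forall>y\<in>cball x1 \<rho>. norm (b l y) \<le> Bd" if "l < r" for l
    proof -
      have "bounded (b l ` cball x1 \<rho>)" using smooth_continuous[OF sb[OF that]] by (intro compact_imp_bounded compact_continuous_image) auto
      then show ?thesis by (auto simp: bounded_iff)
    qed
    then obtain Bf where Bf: "\<And>l y. l < r \<Longrightarrow> y \<in> cball x1 \<rho> \<Longrightarrow> norm (b l y) \<le> Bf l" by metis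
    have "norm (b l y) \<le> (\<Sum>l<r. \<bar>Bf l\<bar>)" if "l < r" "y \<in> cball x1 \<rho>" for l y
      using Bf[OF that] member_le_sum[of l "{..<r}" "\<lambda>l. \<bar>Bf l\<bar>"] that(1) by fastforce
    then show ?thesis by blast
  qed
  then obtain Bd where Bd: "\<And>l y. l < r \<Longrightarrow> y \<in> cball x1 \<rho> \<Longrightarrow> norm (b l y) \<le> Bd" by blast
  have Bd0: "0 \<le> Bd" using Bd[OF l0(1), of x1] \<rho>(1) norm_ge_zero[of "b l0 x1"] by (simp del: norm_ge_zero)
  \<comment> \<open>Chosen so that \<open>r\<close> terms, each with error at most
    \<open>\<delta> * (1 + Bd)\<close>, add up to \<open>\<eta>\<close>.\<close>
  define \<delta> where "\<delta> = \<eta> / (real r * (1 + Bd))"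
  have r0: "real r > 0" using l0(1) by simp
  have \<delta>: "\<delta> > 0" using \<eta> r0 Bd0 by (simp add: \<delta>_def)
  have evW: "\<forall>\<^sub>F i in sequentially. \<forall>y\<in>cball x1 \<rho>. norm (W i y) \<ge> \<eta>"
  proof -
    have e1: "\<forall>\<^sub>F i in sequentially. \<forall>l\<in>{..<r}. \<forall>y\<in>cball 0 (norm x1 + \<rho>). dist (b' (s i) l y) (b l y) < \<delta>"
    proof (rule eventually_ball_finite[OF finite_lessThan], rule ballI)
      fix l assume "l \<in> {..<r}"
      then have "uniform_limit (cball 0 (norm x1 + \<rho>)) (\<lambda>i. partials [] (b' i l)) (partials [] (b l)) sequentially" using bas(3) by blast
      from uniform_limitD[OF this \<delta>]
      have "\<forall>\<^sub>F i in sequentially. \<forall>y\<in>cball 0 (norm x1 + \<rho>). dist (b' i l y) (b l y) < \<delta>" by simp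
      then show "\<forall>\<^sub>F i in sequentially. \<forall>y\<in>cball 0 (norm x1 + \<rho>). dist (b' (s i) l y) (b l y) < \<delta>"
        by (rule eventually_subseq[OF s])
    qed
    have e2: "\<forall>\<^sub>F i in sequentially. \<forall>l\<in>{..<r}. dist (\<gamma> (s i) l) (g l) < \<delta>"
      by (rule eventually_ball_finite[OF finite_lessThan], rule ballI) (intro tendstoD[OF sg] \<delta>, simp)
    from e1 e2 show ?thesis
    proof eventually_elim
      case (elim i)
      show ?case
      proof
        fix y assume y: "y \<in> cball x1 \<rho>"
        have "norm y \<le> norm x1 + \<rho>" using y norm_triangle_ineq[of x1 "y - x1"] by (simp add: dist_norm norm_minus_commute)
        then have d: "norm (b' (s i) l y - b l y) \<le> \<delta>" if "l < r" for l using elim(1) that by (simp add: dist_norm less_imp_le)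
        have "W i y - U y = (\<Sum>l<r. \<gamma> (s i) l *\<^sub>R (b' (s i) l y - b l y) + (\<gamma> (s i) l - g l) *\<^sub>R b l y)"
          unfolding W_def U_def sum_subtractf[symmetric] by (rule sum.cong) (auto simp: algebra_simps)
        also have "norm \<dots> \<le> (\<Sum>l<r. \<delta> * (1 + Bd))"
        proof (rule sum_norm_le)
          fix l assume "l \<in> {..<r}"
          then have l: "l < r" by simp
          have "norm (\<gamma> (s i) l *\<^sub>R (b' (s i) l y - b l y)) \<le> 1 * \<delta>"
            unfolding norm_scaleR using \<open>\<bar>\<gamma> (s i) l\<bar> \<le> 1\<close> d[OF l] by (intro mult_mono) auto
          moreover have "norm ((\<gamma> (s i) l - g l) *\<^sub>R b l y) \<le> \<delta> * Bd"
            unfolding norm_scaleR using elim(2) l Bd[OF l y] \<delta> by (intro mult_mono) (auto simp: dist_real_def less_imp_le)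
          ultimately show "norm (\<gamma> (s i) l *\<^sub>R (b' (s i) l y - b l y) + (\<gamma> (s i) l - g l) *\<^sub>R b l y) \<le> \<delta> * (1 + Bd)"
            by (intro norm_triangle_le) (simp add: distrib_left)
        qed
        also have "\<dots> = \<eta>" using r0 Bd0 by (simp add: \<delta>_def)
        finally have "norm (W i y - U y) \<le> \<eta>" .
        moreover have "norm (U y) > 2 * \<eta>" using \<rho>(1,3) y by (simp add: order_trans)
        moreover have "norm (U y) \<le> norm (W i y) + norm (W i y - U y)"
          using norm_triangle_ineq4[of "W i y" "W i y - U y"] by simp
        ultimately show "norm (W i y) \<ge> \<eta>" by linarith
      qed
    qed
  qed
  \<comment> \<open>Lower bound for the squared L2 norm of the normalised forms on the fixed ball;
    since their jets stay below \<open>J0 + 1\<close>, the violation with factor \<open>i\<close>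
    fails once \<open>i * m0\<close> exceeds that.\<close>
  define m0 where "m0 = \<eta>\<^sup>2 * (unit_ball_vol CARD('n) * \<rho> ^ CARD('n))"
  have m0: "m0 > 0" using \<eta> \<rho>(1) by (simp add: m0_def)
  obtain M :: nat where M: "real M > (J0 + 1) / m0" using reals_Archimedean2 by blast
  have "\<forall>\<^sub>F i in sequentially. i \<ge> M" by (rule eventually_ge_at_top)
  with evJ evW eventually_subseq[OF s evball] have "\<forall>\<^sub>F i in sequentially. False"
  proof eventually_elim
    case (elim i)
    have sub: "cball x1 \<rho> \<subseteq> T (s i)"
    proof -
      have "\<Psi> (s i) ` \<sigma> \<subseteq> \<Psi> (s i) ` C" by (rule image_mono) (use \<sigma>(1) in \<open>simp add: A_def\<close>)
      then show ?thesis unfolding TI(1)[OF sI[of i]] using mp[OF elim(3) TI(2)[OF sI]] by (rule order_trans[rotated])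
    qed
    let ?m = "(\<mu> (s i))\<^sup>2"
    have "ennreal (?m * m0) = (\<integral>\<^sup>+y\<in>cball x1 \<rho>. ennreal (?m * \<eta>\<^sup>2) \<partial>lborel)"
      using \<rho>(1) by (subst nn_integral_cmult_indicator) (auto simp: emeasure_cball m0_def mult.assoc simp flip: ennreal_mult)
    also have "\<dots> \<le> (\<integral>\<^sup>+y\<in>T (s i). ennreal ((norm (V (s i) y))\<^sup>2) \<partial>lborel)"
    proof (rule nn_integral_mono)
      fix y
      show "ennreal (?m * \<eta>\<^sup>2) * indicator (cball x1 \<rho>) y \<le> ennreal ((norm (V (s i) y))\<^sup>2) * indicator (T (s i)) y"
      proof (cases "y \<in> cball x1 \<rho>")
        case True
        then have yT: "y \<in> T (s i)" using sub by blast
        have "V (s i) y = \<mu> (s i) *\<^sub>R W i y" using VW[OF yT, of "[]"] by (simp add: W_def)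
        then have "(norm (V (s i) y))\<^sup>2 = ?m * (norm (W i y))\<^sup>2" by (simp add: power_mult_distrib)
        moreover have "\<eta>\<^sup>2 \<le> (norm (W i y))\<^sup>2" using elim(2) True \<eta> by (intro power_mono) auto
        ultimately show ?thesis using True yT by (simp add: ennreal_leI mult_left_mono)
      qed simp
    qed
    finally have le: "ennreal (?m * m0) \<le> (\<integral>\<^sup>+y\<in>T (s i). ennreal ((norm (V (s i) y))\<^sup>2) \<partial>lborel)" .
    have "real i \<le> real (s i)" using strict_mono_imp_increasing[OF s] by simp
    then have "ennreal (real i * (?m * m0)) \<le> ennreal (real (s i)) * ennreal (?m * m0)"
      using m0 by (simp add: ennreal_mult[symmetric] mult_right_mono ennreal_leI)
    also have "\<dots> \<le> ennreal (real (s i)) * (\<integral>\<^sup>+y\<in>T (s i). ennreal ((norm (V (s i) y))\<^sup>2) \<partial>lborel)"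
      by (intro mult_left_mono le) simp
    also have "\<dots> < ennreal (jet_sq (V (s i)))" by (rule viol)
    finally have "real i * (?m * m0) < ?m * J i" using m0 by (simp add: jet ennreal_less_iff)
    also have "\<dots> \<le> ?m * (J0 + 1)" using elim(1) by (intro mult_left_mono) auto
    finally have "?m * (real i * m0) < ?m * (J0 + 1)" by (simp add: mult_ac)
    then have "real i * m0 < J0 + 1" using \<mu>[OF sI[of i]] by (simp add: mult_less_cancel_left)
    moreover have "J0 + 1 < real i * m0"
      using M elim(4) m0 by (smt (verit) mult_right_mono of_nat_le_iff pos_divide_less_eq)
    ultimately show False by linarith
  qed
  then show False by simp
qed

text \<open>Each violation is transported to the macro-element about \<open>T m\<close>, scaled by
  \<open>h\<close> with \<open>x m\<close> as origin. The scaling absorbs the powers of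
  \<open>h\<close> in the estimate, so a single compact family receives the violations of all
  meshes.\<close>

lemma macro_seq_contradiction:
  fixes h :: "nat \<Rightarrow> real" and X :: "nat \<Rightarrow> 'n::{finite,linorder} element_system"
  assumes hs: "h_setting h \<T> X" and h: "\<And>j. h j > 0"
    and compat: "\<And>j. compatible_system (\<T> j) (X j)" and k: "k \<le> CARD('n)"
    and full: "\<And>m. T m \<in> \<T> (j m)" "\<And>m. is_cell (CARD('n)) (T m) (cell_boundary (T m))"
    and U: "\<And>m. U m \<in> X (j m) (T m) k" and x: "\<And>m. x m \<in> T m"
    and viol: "\<And>m::nat. ennreal (real m / h (j m) ^ CARD('n)) * (\<integral>\<^sup>+y\<in>T m. ennreal ((norm (U m y))\<^sup>2) \<partial>lborel)
      < ennreal ((norm (U m (x m)))\<^sup>2 + (h (j m))\<^sup>2 * (\<Sum>q\<in>UNIV. (norm (partial q (U m) (x m)))\<^sup>2))"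
  shows False
proof -
  obtain \<F> where \<F>: "macro_compact \<F>"
    "\<forall>E\<in>\<F>. finite (fst E) \<and> cell_family (fst E) \<and> compatible_system (fst E) (snd E)"
    "\<forall>j. \<forall>T\<in>\<T> j. \<forall>a\<in>T. scaled_macro a (h j) (macro_cells (\<T> j) T, X j) \<in> \<F>"
    using hs unfolding h_setting_def by (elim exE conjE) (rule that)
  have smX: "smooth W" if "W \<in> X j T k" "T \<in> \<T> j" for W j T
  proof -
    have "finite_element_system (\<T> j) (X j)" using compat[of j] by (simp add: compatible_system_def)
    from bspec[OF this[unfolded finite_element_system_def] that(2), THEN spec, THEN mp, OF k, THEN conjunct1] that(1)
    show ?thesis by simp
  qed
  define H where "H m = h (j m)" for m
  have H: "H m > 0" for m by (simp add: H_def h)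
  define D where "D m = scaled_macro (x m) (H m) (macro_cells (\<T> (j m)) (T m), X (j m))" for m
  have "\<forall>m. D m \<in> \<F>" using \<F>(3) full(1) x by (simp add: D_def H_def)
  then have "\<exists>E\<in>\<F>. \<exists>r. strict_mono r \<and> macro_converges (D \<circ> r) E" using \<F>(1) unfolding macro_compact_def by simp
  then obtain E r where E: "E \<in> \<F>" and r: "strict_mono r" and conv: "macro_converges (D \<circ> r) E" by (elim bexE exE conjE)
  define g where "g m = (\<lambda>y. (y - x m) /\<^sub>R H m)" for m
  define g' where "g' m = (\<lambda>y. x m + H m *\<^sub>R y)" for m
  have gg: "g' m (g m y) = y" "g m (g' m y) = y" for m y using H[of m] by (simp_all add: g_def g'_def)
  have im: "g m ` S = g' m -` S" for m S using gg by (auto simp: image_iff) (metis gg(2))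
  have cg: "continuous_on S (g m)" "continuous_on S (g' m)" for S m unfolding g_def g'_def by (intro continuous_intros)+
  define V where "V m = (\<lambda>y. U m (x m + H m *\<^sub>R y))" for m
  define T' where "T' m = g m ` T m" for m
  have bk: "(\<lambda>y. x m + H m *\<^sub>R y) ` T' m = T m" for m
  proof -
    have "(\<lambda>y. x m + H m *\<^sub>R y) ` T' m = (\<lambda>y. g' m (g m y)) ` T m" by (simp add: T'_def image_image g'_def)
    then show ?thesis by (simp add: gg)
  qed
  have TD: "T' m \<in> fst (D m)" for m
  proof -
    have "T m \<in> macro_cells (\<T> (j m)) (T m)" using full(1)[of m] x[of m] by (auto simp: macro_cells_def)
    then show ?thesis by (simp add: D_def scaled_macro_def T'_def g_def)
  qed
  have sndD: "snd (D m) (T' m) k = (\<lambda>U y. U (x m + H m *\<^sub>R y)) ` X (j m) (T m) k" for m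
    by (simp add: D_def scaled_macro_def bk)
  have smU: "smooth (U m)" for m using smX[OF U full(1)] .
  note is_full = full_cell[OF full(2)]
  show False
  proof (rule macro_inverse_contradiction[OF conv _ k, of "\<lambda>i. T' (r i)" "\<lambda>i. V (r i)" "\<lambda>i. g (r i) ` cell_interior (T (r i))"])
    show "finite (fst E)" using \<F>(2) E by blast
    show "T' (r i) \<in> fst ((D \<circ> r) i)" for i using TD by simp
    show "V (r i) \<in> snd ((D \<circ> r) i) (T' (r i)) k" for i using U by (auto simp: sndD V_def)
    show "smooth W" if W: "W \<in> snd ((D \<circ> r) i) (T' (r i)) k" for W i
    proof -
      obtain W' where "W' \<in> X (j (r i)) (T (r i)) k" "W = (\<lambda>y. W' (x (r i) + H (r i) *\<^sub>R y))"
        using W by (auto simp: sndD)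
      then show ?thesis using smooth_affine[OF smX[OF _ full(1)]] by simp
    qed
    show "smooth W" if "T0 \<in> fst E" "W \<in> snd E T0 k" for T0 W
    proof -
      have "finite_element_system (fst E) (snd E)" using \<F>(2) E by (simp add: compatible_system_def)
      from bspec[OF this[unfolded finite_element_system_def] that(1), THEN spec, THEN mp, OF k, THEN conjunct1] that(2)
      show ?thesis by simp
    qed
    show "open (g (r i) ` cell_interior (T (r i)))" for i
      unfolding im by (rule open_vimage[OF is_full(1) cg(2)])
    show "g (r i) ` cell_interior (T (r i)) \<subseteq> T' (r i)" for i
      unfolding T'_def by (rule image_mono[OF is_full(3)])
    show "T' (r i) \<subseteq> closure (g (r i) ` cell_interior (T (r i)))" for i
    proof -
      have "g (r i) ` closure (cell_interior (T (r i))) \<subseteq> closure (g (r i) ` cell_interior (T (r i)))"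
        by (rule image_closure_subset[OF cg(1)]) (simp_all add: closure_subset)
      then show ?thesis unfolding T'_def using image_mono[OF is_full(2)] by (rule order_trans[rotated])
    qed
    show "0 \<in> T' (r i)" for i unfolding T'_def by (rule image_eqI[OF _ x]) (simp add: g_def)
    show "ennreal (real i) * (\<integral>\<^sup>+y\<in>T' (r i). ennreal ((norm (V (r i) y))\<^sup>2) \<partial>lborel) < ennreal (jet_sq (V (r i)))" for i
    proof -
      let ?m = "r i"
      let ?I = "\<integral>\<^sup>+y\<in>T' ?m. ennreal ((norm (V ?m y))\<^sup>2) \<partial>lborel"
      have [measurable]: "T ?m \<in> sets borel" using is_cell_compact[OF full(2)[of ?m]] by (simp add: compact_imp_closed)
      have [measurable]: "U ?m \<in> borel_measurable borel" using smooth_continuous[OF smU] by (rule borel_measurable_continuous_onI)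
      have "(\<integral>\<^sup>+y\<in>T ?m. ennreal ((norm (U ?m y))\<^sup>2) \<partial>lborel)
        = ennreal (H ?m ^ DIM('n point)) * (\<integral>\<^sup>+y. ennreal ((norm (U ?m (x ?m + H ?m *\<^sub>R y)))\<^sup>2) * indicator (T ?m) (x ?m + H ?m *\<^sub>R y) \<partial>lborel)"
        by (rule nn_integral_lborel_affine) (use H in auto)
      also have "(\<integral>\<^sup>+y. ennreal ((norm (U ?m (x ?m + H ?m *\<^sub>R y)))\<^sup>2) * indicator (T ?m) (x ?m + H ?m *\<^sub>R y) \<partial>lborel) = ?I"
        by (intro nn_integral_cong) (simp add: V_def T'_def im g'_def indicator_def)
      finally have I: "(\<integral>\<^sup>+y\<in>T ?m. ennreal ((norm (U ?m y))\<^sup>2) \<partial>lborel) = ennreal (H ?m ^ CARD('n)) * ?I" by simp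
      have "partial q (V ?m) 0 = H ?m *\<^sub>R partial q (U ?m) (x ?m)" for q
      proof -
        have "partials [q] (\<lambda>y. U ?m (x ?m + H ?m *\<^sub>R y)) = (\<lambda>y. H ?m ^ length [q] *\<^sub>R partials [q] (U ?m) (x ?m + H ?m *\<^sub>R y))"
          by (rule partials_affine[OF smU])
        from fun_cong[OF this, of 0] show ?thesis by (simp add: V_def)
      qed
      then have jet: "jet_sq (V ?m) = (norm (U ?m (x ?m)))\<^sup>2 + (h (j ?m))\<^sup>2 * (\<Sum>q\<in>UNIV. (norm (partial q (U ?m) (x ?m)))\<^sup>2)"
        by (simp add: jet_sq_def V_def H_def power_mult_distrib sum_distrib_left)
      \<comment> \<open>Along the subsequence the violated constant \<open>r i\<close> is at least
        \<open>i\<close>.\<close>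
      have "ennreal (real i) * ?I \<le> ennreal (real ?m) * ?I"
        using strict_mono_imp_increasing[OF r] by (intro mult_right_mono ennreal_leI) auto
      also have "ennreal (real ?m) = ennreal (real ?m / H ?m ^ CARD('n)) * ennreal (H ?m ^ CARD('n))"
        using H[of ?m] by (subst ennreal_mult[symmetric]) auto
      also have "\<dots> * ?I = ennreal (real ?m / H ?m ^ CARD('n)) * (\<integral>\<^sup>+y\<in>T ?m. ennreal ((norm (U ?m y))\<^sup>2) \<partial>lborel)"
        by (simp only: I mult.assoc)
      also have "\<dots> < ennreal (jet_sq (V ?m))" using viol[of ?m] unfolding jet H_def .
      finally show ?thesis .
    qed
  qed
qed

text \<open>The constant is not constructed: failure of every integer constant \<open>m\<close>
  supplies the sequence that compactness excludes. The index \<open>j\<close> may repeat along it,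
  so no limit \<open>h \<rightarrow> 0\<close> is involved.\<close>

lemma inverse_estimate_degree:
  fixes h :: "nat \<Rightarrow> real" and X :: "nat \<Rightarrow> 'n::{finite,linorder} element_system"
  assumes hs: "h_setting h \<T> X" and h: "\<And>j. h j > 0"
    and compat: "\<And>j. compatible_system (\<T> j) (X j)" and k: "k \<le> CARD('n)"
    and cells: "\<And>j T. T \<in> \<T> j \<Longrightarrow> is_cell (cell_dim T) T (cell_boundary T)"
  shows "\<exists>C\<ge>0. \<forall>j. \<forall>T\<in>\<T> j. cell_dim T = CARD('n) \<longrightarrow> (\<forall>U\<in>X j T k. \<forall>x\<in>T.
    ennreal ((norm (U x))\<^sup>2 + (h j)\<^sup>2 * (\<Sum>q\<in>UNIV. (norm (partial q U x))\<^sup>2))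
      \<le> ennreal (C / h j ^ CARD('n)) * (\<integral>\<^sup>+y\<in>T. ennreal ((norm (U y))\<^sup>2) \<partial>lborel))"
proof (rule ccontr)
  define P where "P m j T U x \<longleftrightarrow> T \<in> \<T> j \<and> cell_dim T = CARD('n) \<and> U \<in> X j T k \<and> x \<in> T \<and>
    ennreal (real m / h j ^ CARD('n)) * (\<integral>\<^sup>+y\<in>T. ennreal ((norm (U y))\<^sup>2) \<partial>lborel)
      < ennreal ((norm (U x))\<^sup>2 + (h j)\<^sup>2 * (\<Sum>q\<in>UNIV. (norm (partial q U x))\<^sup>2))" for m :: nat and j T U x
  assume neg: "\<not> ?thesis"
  have "\<exists>j T U x. P m j T U x" for m
  proof -
    have "\<not> (\<forall>j. \<forall>T\<in>\<T> j. cell_dim T = CARD('n) \<longrightarrow> (\<forall>U\<in>X j T k. \<forall>x\<in>T.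
    ennreal ((norm (U x))\<^sup>2 + (h j)\<^sup>2 * (\<Sum>q\<in>UNIV. (norm (partial q U x))\<^sup>2))
      \<le> ennreal (real m / h j ^ CARD('n)) * (\<integral>\<^sup>+y\<in>T. ennreal ((norm (U y))\<^sup>2) \<partial>lborel)))"
    proof
      assume "\<forall>j. \<forall>T\<in>\<T> j. cell_dim T = CARD('n) \<longrightarrow> (\<forall>U\<in>X j T k. \<forall>x\<in>T.
    ennreal ((norm (U x))\<^sup>2 + (h j)\<^sup>2 * (\<Sum>q\<in>UNIV. (norm (partial q U x))\<^sup>2))
      \<le> ennreal (real m / h j ^ CARD('n)) * (\<integral>\<^sup>+y\<in>T. ennreal ((norm (U y))\<^sup>2) \<partial>lborel))"
      with neg show False by (elim notE) (intro exI[of _ "real m"] conjI, simp_all)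
    qed
    then show ?thesis unfolding P_def by (simp only: not_all ball_simps not_imp not_le bex_simps Bex_def) blast
  qed
  then have "\<forall>m. \<exists>p. P m (fst p) (fst (snd p)) (fst (snd (snd p))) (snd (snd (snd p)))" by auto
  from choice[OF this] obtain p where p: "\<forall>m. P m (fst (p m)) (fst (snd (p m))) (fst (snd (snd (p m)))) (snd (snd (snd (p m))))"
    by (elim exE)
  show False
  proof (rule macro_seq_contradiction[OF hs h compat k, of "\<lambda>m. fst (snd (p m))" "\<lambda>m. fst (p m)"
        "\<lambda>m. fst (snd (snd (p m)))" "\<lambda>m. snd (snd (snd (p m)))"])
    fix m
    note pm = spec[OF p, of m, unfolded P_def]
    show T: "fst (snd (p m)) \<in> \<T> (fst (p m))" using pm by (elim conjE)
    show "is_cell (CARD('n)) (fst (snd (p m))) (cell_boundary (fst (snd (p m))))"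
      using cells[OF T] pm by (elim conjE) simp
  qed (use p in \<open>simp_all add: P_def\<close>)
qed

lemma inverse_estimate:
  fixes h :: "nat \<Rightarrow> real" and X :: "nat \<Rightarrow> 'n::{finite,linorder} element_system"
  assumes hs: "h_setting h \<T> X" and h: "\<And>j. h j > 0"
    and compat: "\<And>j. compatible_system (\<T> j) (X j)"
    and cells: "\<And>j T. T \<in> \<T> j \<Longrightarrow> is_cell (cell_dim T) T (cell_boundary T)"
  obtains C where "C \<ge> 0" "\<And>j T k U x. T \<in> \<T> j \<Longrightarrow> cell_dim T = CARD('n) \<Longrightarrow> k \<le> CARD('n) \<Longrightarrow> U \<in> X j T k \<Longrightarrow> x \<in> T \<Longrightarrow>
    ennreal ((norm (U x))\<^sup>2 + (h j)\<^sup>2 * (\<Sum>q\<in>UNIV. (norm (partial q U x))\<^sup>2))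
      \<le> ennreal (C / h j ^ CARD('n)) * (\<integral>\<^sup>+y\<in>T. ennreal ((norm (U y))\<^sup>2) \<partial>lborel)"
proof -
  let ?Q = "\<lambda>k C. C \<ge> 0 \<and> (\<forall>j. \<forall>T\<in>\<T> j. cell_dim T = CARD('n) \<longrightarrow> (\<forall>U\<in>X j T k. \<forall>x\<in>T.
    ennreal ((norm (U x))\<^sup>2 + (h j)\<^sup>2 * (\<Sum>q\<in>UNIV. (norm (partial q U x))\<^sup>2))
      \<le> ennreal (C / h j ^ CARD('n)) * (\<integral>\<^sup>+y\<in>T. ennreal ((norm (U y))\<^sup>2) \<partial>lborel)))"
  have "\<forall>k\<in>{..CARD('n)}. \<exists>C. ?Q k C"
    using inverse_estimate_degree[OF hs h compat _ cells] by (intro ballI) auto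
  from bchoice[OF this] obtain Cf where Cf: "\<forall>k\<in>{..CARD('n)}. ?Q k (Cf k)" by (elim exE)
  show thesis
  proof (rule that[of "\<Sum>k\<le>CARD('n). Cf k"])
    show "0 \<le> (\<Sum>k\<le>CARD('n). Cf k)" using Cf by (intro sum_nonneg) blast
    fix j T k U x
    assume a: "T \<in> \<T> j" "cell_dim T = CARD('n)" "k \<le> CARD('n)" "U \<in> X j T k" "x \<in> T"
    have "Cf k \<le> (\<Sum>k\<le>CARD('n). Cf k)" using Cf a(3) by (intro member_le_sum) auto
    then have "Cf k / h j ^ CARD('n) \<le> (\<Sum>k\<le>CARD('n). Cf k) / h j ^ CARD('n)" using h[of j] by (simp add: divide_right_mono)
    moreover have "ennreal ((norm (U x))\<^sup>2 + (h j)\<^sup>2 * (\<Sum>q\<in>UNIV. (norm (partial q U x))\<^sup>2))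
      \<le> ennreal (Cf k / h j ^ CARD('n)) * (\<integral>\<^sup>+y\<in>T. ennreal ((norm (U y))\<^sup>2) \<partial>lborel)"
      using bspec[OF Cf, of k, THEN conjunct2, THEN spec, THEN bspec, OF _ a(1), THEN mp, OF _ a(2), THEN bspec, OF _ a(4), THEN bspec, OF _ a(5)] a(3) by simp
    ultimately show "ennreal ((norm (U x))\<^sup>2 + (h j)\<^sup>2 * (\<Sum>q\<in>UNIV. (norm (partial q U x))\<^sup>2))
      \<le> ennreal ((\<Sum>k\<le>CARD('n). Cf k) / h j ^ CARD('n)) * (\<integral>\<^sup>+y\<in>T. ennreal ((norm (U y))\<^sup>2) \<partial>lborel)"
      by (meson ennreal_leI mult_right_mono order_trans zero_le)
  qed
qed

section \<open>The smoothed projector\<close>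

context lattice_basis begin

lemma L2_forms_diff:
  assumes u: "u \<in> L2_forms e" and w: "w \<in> L2_forms e"
  shows "(\<lambda>x. u x - w x) \<in> L2_forms e"
proof (rule L2_formsI)
  note [measurable] = L2_formsD(2)[OF u] L2_formsD(2)[OF w]
  show "periodic e (\<lambda>x. u x - w x)" using L2_formsD(1)[OF u] L2_formsD(1)[OF w] by (simp add: periodic_def)
  show "(\<lambda>x. u x - w x) \<in> borel_measurable borel" by measurable
  have "(\<integral>\<^sup>+x\<in>FD. ennreal ((norm (u x - w x))\<^sup>2) \<partial>lborel)
    \<le> (\<integral>\<^sup>+x\<in>FD. 2 * ennreal ((norm (u x))\<^sup>2) + 2 * ennreal ((norm (w x))\<^sup>2) \<partial>lborel)"
  proof (rule nn_integral_mono, rule mult_right_mono)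
    fix x
    show "ennreal ((norm (u x - w x))\<^sup>2) \<le> 2 * ennreal ((norm (u x))\<^sup>2) + 2 * ennreal ((norm (w x))\<^sup>2)"
      using ennreal_sq_diff_le[of "u x" "w x" 0] by simp
  qed simp
  also have "\<dots> = 2 * ennreal ((L2_form_norm e u)\<^sup>2) + 2 * ennreal ((L2_form_norm e w)\<^sup>2)"
    by (simp add: distrib_right nn_integral_add mult.assoc nn_integral_cmult L2_formsD(3)[OF u] L2_formsD(3)[OF w])
  also have "\<dots> < \<infinity>" by (simp add: ennreal_mult_less_top)
  finally show "(\<integral>\<^sup>+x\<in>FD. ennreal ((norm (u x - w x))\<^sup>2) \<partial>lborel) < \<infinity>" .
qed

end

lemma locally_integrable_const: "locally_integrable (\<lambda>x :: 'n::finite point. c)"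
proof -
  have "integrable lborel (\<lambda>y. indicator (cball x r) y * norm c)" for x :: "'n point" and r
    using emeasure_lborel_cball_finite[of x r] by (intro integrable_mult_left integrable_real_indicator) (simp_all add: less_top)
  then show ?thesis by (simp add: locally_integrable_def set_integrable_def)
qed

lemma locally_integrable_lincomb:
  fixes u :: "'n::finite form"
  assumes u: "locally_integrable u" and w: "locally_integrable w"
  shows "locally_integrable (\<lambda>x. a *\<^sub>R u x + b *\<^sub>R w x)"
proof -
  have [measurable]: "u \<in> borel_measurable borel" "w \<in> borel_measurable borel"
    using u w by (simp_all add: locally_integrable_def)
  have [measurable]: "cball (x :: 'n point) r \<in> sets borel" for x r by simp
  have "set_integrable lborel (cball x r) (\<lambda>y. norm (a *\<^sub>R u y + b *\<^sub>R w y))" for x r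
    unfolding set_integrable_def
  proof (rule Bochner_Integration.integrable_bound)
    show "integrable lborel (\<lambda>y. \<bar>a\<bar> * (indicator (cball x r) y *\<^sub>R norm (u y)) + \<bar>b\<bar> * (indicator (cball x r) y *\<^sub>R norm (w y)))"
      using u w by (intro Bochner_Integration.integrable_add integrable_mult_right)
        (simp_all add: locally_integrable_def set_integrable_def)
    show "AE y in lborel. norm (indicator (cball x r) y *\<^sub>R norm (a *\<^sub>R u y + b *\<^sub>R w y))
      \<le> norm (\<bar>a\<bar> * (indicator (cball x r) y *\<^sub>R norm (u y)) + \<bar>b\<bar> * (indicator (cball x r) y *\<^sub>R norm (w y)))"
    proof (rule AE_I2)
      fix y
      have "norm (a *\<^sub>R u y + b *\<^sub>R w y) \<le> \<bar>a\<bar> * norm (u y) + \<bar>b\<bar> * norm (w y)"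
        using norm_triangle_ineq[of "a *\<^sub>R u y" "b *\<^sub>R w y"] by simp
      then show "norm (indicator (cball x r) y *\<^sub>R norm (a *\<^sub>R u y + b *\<^sub>R w y))
        \<le> norm (\<bar>a\<bar> * (indicator (cball x r) y *\<^sub>R norm (u y)) + \<bar>b\<bar> * (indicator (cball x r) y *\<^sub>R norm (w y)))"
        by (auto simp: indicator_def)
    qed
  qed measurable
  then show ?thesis by (simp add: locally_integrable_def)
qed

text \<open>A choice depending on \<open>\<phi>\<close> alone and made outside any mesh, so that the
  constants built from it are the same for all \<open>j\<close>.\<close>

definition deriv_bound :: "('n::finite point \<Rightarrow> real) \<Rightarrow> 'n list \<Rightarrow> real" where
  "deriv_bound \<phi> is = (SOME b. b \<ge> 0 \<and> (\<forall>x. \<bar>partials is \<phi> x\<bar> \<le> b))"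

text \<open>In units of \<open>h\<close>, \<open>2 * real N * \<kappa>\<close> bounds the diameter
  of an \<open>n\<close>-cell and \<open>\<epsilon>\<close> is the reach of the mollifier. The
  maximum with \<open>1\<close> meets the requirement \<open>R \<ge> 1\<close> of
  \<open>gagliardo_stability\<close>.\<close>

definition mesh_radius :: "real \<Rightarrow> nat \<Rightarrow> real \<Rightarrow> real" where
  "mesh_radius \<kappa> N \<epsilon> = max 1 (2 * real N * \<kappa> + \<epsilon>)"

definition local_const :: "('n::finite point \<Rightarrow> real) \<Rightarrow> real \<Rightarrow> real \<Rightarrow> nat \<Rightarrow> real" where
  "local_const \<phi> \<epsilon> CI m = CI * (\<Sum>is | length is \<le> m. deriv_bound \<phi> is / \<epsilon> ^ (length is + CARD('n)))"

text \<open>The second factor is the pointwise constant for \<open>Q u - u\<close>, with the ball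
  volume from Cauchy-Schwarz; \<open>2 + 2 * CP\<^sup>2\<close> comes from splitting off the
  interpolation error and applying the stable projector to it.\<close>

definition approx_const :: "real \<Rightarrow> nat \<Rightarrow> ('n::finite point \<Rightarrow> real) \<Rightarrow> real \<Rightarrow> real \<Rightarrow> real \<Rightarrow> nat \<Rightarrow> real" where
  "approx_const \<kappa> N \<phi> \<epsilon> CI CP m =
    (2 + 2 * CP\<^sup>2) * ((local_const \<phi> \<epsilon> CI m)\<^sup>2 * (unit_ball_vol CARD('n) * mesh_radius \<kappa> N \<epsilon> ^ CARD('n)))"

text \<open>One mesh of the sequence. The constants are parameters and not existentials within the
  locale, so that the instances for all \<open>j\<close> can receive the same ones.\<close>

locale projector_mesh = refined_mesh e \<T> \<S> h \<kappa> N + fe_mesh e \<T> X F p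
  for e :: "'n::{finite,linorder} \<Rightarrow> 'n point" and \<T> \<S> h \<kappa> N X F p +
  fixes \<phi> :: "'n point \<Rightarrow> real" and \<epsilon> CI CV CP :: real and m :: nat
  assumes phi: "mollifier p \<phi>" and eps: "\<epsilon> > 0" and const_nonneg: "CI \<ge> 0" "CV \<ge> 0" "CP \<ge> 0"
    and Cm: "\<And>T u x. T \<in> full \<Longrightarrow> smooth u \<Longrightarrow> periodic e u \<Longrightarrow> x \<in> cell_interior T \<Longrightarrow>
      norm (interp u x) \<le> CI * (\<Sum>is | length is \<le> m. h ^ length is * (SUP y\<in>T. norm (partials is u y)))"
    and inv: "\<And>T k U x. T \<in> full \<Longrightarrow> k \<le> CARD('n) \<Longrightarrow> U \<in> X T k \<Longrightarrow> x \<in> T \<Longrightarrow>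
      ennreal ((norm (U x))\<^sup>2 + h\<^sup>2 * (\<Sum>q\<in>UNIV. (norm (partial q U x))\<^sup>2))
        \<le> ennreal (CV / h ^ CARD('n)) * (\<integral>\<^sup>+y\<in>T. ennreal ((norm (U y))\<^sup>2) \<partial>lborel)"
    and bij: "bij_betw (mollified_interpolation e \<T> X F \<phi> (\<epsilon> * h)) (fe_space e \<T> X) (fe_space e \<T> X)"
    and stable: "\<And>u. u \<in> L2_forms e \<Longrightarrow> L2_form_norm e (smoothed_projector e \<T> X F \<phi> (\<epsilon> * h) u) \<le> CP * L2_form_norm e u"
    and fe_L2: "fe_space e \<T> X \<subseteq> L2_forms e"
begin

abbreviation "mol \<equiv> rescaled (\<epsilon> * h) \<phi>"
abbreviation "Q \<equiv> mollified_interpolation e \<T> X F \<phi> (\<epsilon> * h)"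
abbreviation "proj \<equiv> smoothed_projector e \<T> X F \<phi> (\<epsilon> * h)"

lemma eh: "\<epsilon> * h > 0" using eps h by simp

lemmas mol = mollifier_rescaled[OF phi eh]

lemma mol_cont: "continuous_on UNIV mol" by (rule smooth_continuous[OF mol(1)])

lemma smooth_mol: "locally_integrable u \<Longrightarrow> smooth (convolve mol u)"
  by (rule smooth_convolve[OF mol(1,2)])

lemma periodic_mol: "u \<in> L2_forms e \<Longrightarrow> periodic e (convolve mol u)"
  by (rule periodic_convolve[OF L2_formsD(1,2) smooth_measurable[OF mol(1)]])

lemma Q_eq: "Q u = interp (convolve mol u)" by (simp add: mollified_interpolation_def)

lemma Q_fe: "u \<in> L2_forms e \<Longrightarrow> Q u \<in> fe_space e \<T> X"
  unfolding Q_eq by (intro interp_fe_space smooth_mol periodic_mol L2_locally_integrable)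

lemma Q_lincomb:
  assumes "u \<in> L2_forms e" "w \<in> L2_forms e"
  shows "Q (\<lambda>x. a *\<^sub>R u x + b *\<^sub>R w x) = (\<lambda>x. a *\<^sub>R Q u x + b *\<^sub>R Q w x)"
  unfolding Q_eq convolve_lincomb[OF mol_cont mol(2) L2_locally_integrable[OF assms(1)] L2_locally_integrable[OF assms(2)]]
  by (intro interp_lincomb smooth_mol periodic_mol L2_locally_integrable assms)

lemma Q_diff:
  assumes "u \<in> L2_forms e" "w \<in> L2_forms e"
  shows "Q (\<lambda>x. u x - w x) = (\<lambda>x. Q u x - Q w x)"
  using Q_lincomb[OF assms, of 1 "-1"] by simp

lemma fe_diff: "v \<in> fe_space e \<T> X \<Longrightarrow> w \<in> fe_space e \<T> X \<Longrightarrow> (\<lambda>x. v x - w x) \<in> fe_space e \<T> X"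
  using fe_space_lincomb[of v w 1 "-1"] by simp

lemma proj_eq: "proj u = inv_into (fe_space e \<T> X) Q (Q u)" by (simp add: smoothed_projector_def)

lemma proj_fe: "u \<in> L2_forms e \<Longrightarrow> proj u \<in> fe_space e \<T> X"
  and Q_proj: "u \<in> L2_forms e \<Longrightarrow> Q (proj u) = Q u"
  unfolding proj_eq using Q_fe[of u] bij_betw_imp_surj_on[OF bij] inv_into_into[of "Q u" Q "fe_space e \<T> X"] f_inv_into_f[of "Q u" Q "fe_space e \<T> X"] by simp_all

text \<open>\<open>Q\<close> is linear, and injective on the finite element space; both sides have
  the same image under it.\<close>

lemma proj_diff_fe:
  assumes u: "u \<in> L2_forms e" and w: "w \<in> fe_space e \<T> X"
  shows "proj (\<lambda>x. u x - w x) = (\<lambda>x. proj u x - w x)"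
proof -
  have wL: "w \<in> L2_forms e" using w fe_L2 by blast
  have vL: "proj u \<in> L2_forms e" using proj_fe[OF u] fe_L2 by blast
  have "Q (\<lambda>x. u x - w x) = Q (\<lambda>x. proj u x - w x)"
    unfolding Q_diff[OF u wL] Q_diff[OF vL wL] Q_proj[OF u] ..
  then show ?thesis
    unfolding proj_eq[of "\<lambda>x. u x - w x"] using bij_betw_inv_into_left[OF bij fe_diff[OF proj_fe[OF u] w]] by simp
qed

abbreviation "B \<equiv> deriv_bound \<phi>"
abbreviation "R \<equiv> mesh_radius \<kappa> N \<epsilon>"
abbreviation "KQ \<equiv> local_const \<phi> \<epsilon> CI m"
abbreviation "CA \<equiv> approx_const \<kappa> N \<phi> \<epsilon> CI CP m"

lemma deriv_bound: "B is \<ge> 0" "\<bar>partials is \<phi> x\<bar> \<le> B is"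
proof -
  have sm: "smooth \<phi>" and su: "supported_in 1 \<phi>" using phi by (auto simp: mollifier_def supported_in_def)
  obtain b where "b \<ge> 0" "\<And>x. \<bar>partials is \<phi> x\<bar> \<le> b"
    by (rule supported_in_bounded[OF smooth_continuous_on[OF sm] supported_in_partials[OF sm su]]) blast
  then have "\<exists>b. b \<ge> 0 \<and> (\<forall>x. \<bar>partials is \<phi> x\<bar> \<le> b)" by blast
  from someI_ex[OF this] show "B is \<ge> 0" "\<bar>partials is \<phi> x\<bar> \<le> B is" unfolding deriv_bound_def by auto
qed

lemma mesh_radius: "R \<ge> 1" "2 * real N * (\<kappa> * h) + \<epsilon> * h \<le> R * h" "2 * real N * (\<kappa> * h) \<le> R * h"
proof -
  show "R \<ge> 1" by (simp add: mesh_radius_def)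
  have "(2 * real N * \<kappa> + \<epsilon>) * h \<le> R * h" using h by (intro mult_right_mono) (auto simp: mesh_radius_def)
  then show 1: "2 * real N * (\<kappa> * h) + \<epsilon> * h \<le> R * h" by (simp add: algebra_simps)
  then show "2 * real N * (\<kappa> * h) \<le> R * h" using eh by linarith
qed

text \<open>With \<open>c = u x\<close> frozen and constants reproduced, \<open>Q u x - u x\<close>
  is the interpolant at \<open>x\<close> of the mollified \<open>u - c\<close>. Derivatives fall on
  the mollifier; their powers of \<open>1 / h\<close> cancel the weights of the scaled norm except
  for \<open>1 / h ^ CARD('n)\<close>, and Cauchy-Schwarz turns the mean of \<open>u - c\<close>
  into a mean square.\<close>

lemma Q_pointwise:
  assumes T: "T \<in> full" and x: "x \<in> cell_interior T" and u: "u \<in> L2_forms e"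
  shows "ennreal ((norm (Q u x - u x))\<^sup>2)
    \<le> ennreal (KQ\<^sup>2 * (unit_ball_vol CARD('n) * R ^ CARD('n)) / h ^ CARD('n)) * ball_osc (R * h) u x"
proof -
  let ?n = "CARD('n)"
  define c where "c = u x"
  note ul = L2_locally_integrable[OF u]
  define w where "w = (\<lambda>y. 1 *\<^sub>R u y + (-1) *\<^sub>R c)"
  have wl: "locally_integrable w" unfolding w_def by (rule locally_integrable_lincomb[OF ul locally_integrable_const])
  have [measurable]: "u \<in> borel_measurable borel" by (rule L2_formsD(2)[OF u])
  have [measurable]: "w \<in> borel_measurable borel" unfolding w_def by measurable
  have cw: "convolve mol w = (\<lambda>x. 1 *\<^sub>R convolve mol u x + (-1) *\<^sub>R c)"
    unfolding w_def convolve_lincomb[OF mol_cont mol(2) ul locally_integrable_const] mol(4) ..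
  have ppc: "periodic e (\<lambda>x. c)" by (simp add: periodic_def)
  have "interp (convolve mol w) = (\<lambda>x. 1 *\<^sub>R Q u x + (-1) *\<^sub>R interp (\<lambda>x. c) x)"
    unfolding cw Q_eq by (rule interp_lincomb[OF smooth_mol[OF ul] periodic_mol[OF u] smooth_const ppc])
  then have Iw: "interp (convolve mol w) x = Q u x - u x"
    using interp_const[OF T x, of c] by (simp add: c_def)
  have per_w: "periodic e (convolve mol w)" using periodic_mol[OF u] unfolding cw periodic_def by simp
  have xT: "x \<in> T" using x full_cell_props(3)[OF T] by blast
  have [measurable]: "cball y r \<in> sets borel" for y :: "'n point" and r by simp
  define I where "I = (\<integral>\<^sup>+y\<in>cball x (R * h). ennreal (norm (w y)) \<partial>lborel)"
  have I_fin: "I < \<infinity>"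
  proof -
    have "integrable lborel (\<lambda>y. indicator (cball x (R * h)) y *\<^sub>R norm (w y))"
      using wl by (simp add: locally_integrable_def set_integrable_def)
    then have "(\<integral>\<^sup>+y. ennreal (norm (indicator (cball x (R * h)) y *\<^sub>R norm (w y))) \<partial>lborel) < \<infinity>"
      unfolding integrable_iff_bounded by blast
    moreover have "(\<integral>\<^sup>+y. ennreal (norm (indicator (cball x (R * h)) y *\<^sub>R norm (w y))) \<partial>lborel) = I"
      unfolding I_def by (intro nn_integral_cong) (auto simp: indicator_def)
    ultimately show ?thesis by simp
  qed
  define I' where "I' = enn2real I"
  have I': "I = ennreal I'" "I' \<ge> 0" using I_fin by (simp_all add: I'_def)
  have bound: "norm (partials is (convolve mol w) y) \<le> B is / (\<epsilon> * h) ^ (length is + ?n) * I'" if y: "y \<in> T" for "is" y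
  proof -
    let ?b = "B is / (\<epsilon> * h) ^ (length is + ?n)"
    have b0: "?b \<ge> 0" using deriv_bound(1) eh by (intro divide_nonneg_nonneg) auto
    have "ennreal (norm (convolve (partials is mol) w y)) \<le> ennreal ?b * (\<integral>\<^sup>+z\<in>cball y (\<epsilon> * h). ennreal (norm (w z)) \<partial>lborel)"
    proof (rule convolve_norm_le[OF smooth_continuous_on[OF mol(1)] supported_in_partials[OF mol(1,2)] wl])
      fix x show "\<bar>partials is mol x\<bar> \<le> ?b"
        unfolding mol(3) using deriv_bound(2)[of "is" "x /\<^sub>R (\<epsilon> * h)"] eh by (simp add: divide_right_mono)
    qed
    also have "\<dots> \<le> ennreal ?b * I"
      unfolding I_def
    proof (rule mult_left_mono, rule nn_integral_mono)
      fix z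
      have "z \<in> cball x (R * h)" if "z \<in> cball y (\<epsilon> * h)"
        using that full_dist[OF T xT y] mesh_radius(2) dist_triangle[of x z y] by (simp add: dist_commute)
      then show "ennreal (norm (w z)) * indicator (cball y (\<epsilon> * h)) z \<le> ennreal (norm (w z)) * indicator (cball x (R * h)) z"
        by (auto simp: indicator_def)
    qed simp
    also have "\<dots> = ennreal (?b * I')" unfolding I'(1) by (rule ennreal_mult[symmetric, OF b0 I'(2)])
    finally show ?thesis
      unfolding partials_convolve[OF mol(1,2) wl] by (rule ennreal_le_iff[OF mult_nonneg_nonneg[OF b0 I'(2)], THEN iffD1])
  qed
  have "norm (Q u x - u x) \<le> CI * (\<Sum>is | length is \<le> m. h ^ length is * (SUP y\<in>T. norm (partials is (convolve mol w) y)))"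
    using Cm[OF T smooth_mol[OF wl] per_w x] by (simp only: Iw)
  also have "\<dots> \<le> CI * (\<Sum>is | length is \<le> m. B is / \<epsilon> ^ (length is + ?n) * (I' / h ^ ?n))"
  proof (intro mult_left_mono sum_mono const_nonneg(1))
    fix "is" :: "'n list"
    have "(SUP y\<in>T. norm (partials is (convolve mol w) y)) \<le> B is / (\<epsilon> * h) ^ (length is + ?n) * I'"
      using xT bound by (intro cSUP_least) auto
    then have "h ^ length is * (SUP y\<in>T. norm (partials is (convolve mol w) y)) \<le> h ^ length is * (B is / (\<epsilon> * h) ^ (length is + ?n) * I')"
      using h by (intro mult_left_mono) auto
    also have "\<dots> = B is / \<epsilon> ^ (length is + ?n) * (I' / h ^ ?n)"
      using h eps unfolding power_mult_distrib power_add[of h] by (simp add: field_simps)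
    finally show "h ^ length is * (SUP y\<in>T. norm (partials is (convolve mol w) y)) \<le> B is / \<epsilon> ^ (length is + ?n) * (I' / h ^ ?n)" .
  qed
  also have "\<dots> = KQ / h ^ ?n * I'"
    unfolding local_const_def sum_distrib_right[symmetric] by (simp only: times_divide_eq_right times_divide_eq_left mult.assoc)
  finally have "(norm (Q u x - u x))\<^sup>2 \<le> (KQ / h ^ ?n * I')\<^sup>2" by (intro power_mono) auto
  then have "ennreal ((norm (Q u x - u x))\<^sup>2) \<le> ennreal ((KQ / h ^ ?n)\<^sup>2 * I'\<^sup>2)" by (intro ennreal_leI) (simp only: power_mult_distrib)
  also have "\<dots> = ennreal ((KQ / h ^ ?n)\<^sup>2) * I\<^sup>2" unfolding I'(1) using I'(2) by (simp add: ennreal_mult ennreal_power)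
  also have "I\<^sup>2 \<le> ennreal (unit_ball_vol ?n * (R * h) ^ ?n) * ball_osc (R * h) u x"
  proof -
    \<comment> \<open>The indicator is written twice, so that one copy can play the role of the
      factor \<open>1\<close> in Cauchy-Schwarz.\<close>
    have I_eq: "I = (\<integral>\<^sup>+y. indicator (cball 0 (R * h)) y * (ennreal (norm (u (x + y) - u x)) * indicator (cball 0 (R * h)) y) \<partial>lborel)"
    proof -
      have "I = (\<integral>\<^sup>+y. ennreal (norm (w (y + x))) * indicator (cball x (R * h)) (y + x) \<partial>lborel)"
        unfolding I_def by (rule nn_integral_lborel_shift[symmetric]) measurable
      also have "\<dots> = (\<integral>\<^sup>+y. indicator (cball 0 (R * h)) y * (ennreal (norm (u (x + y) - u x)) * indicator (cball 0 (R * h)) y) \<partial>lborel)"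
        by (intro nn_integral_cong) (auto simp: w_def c_def indicator_def dist_norm add.commute)
      finally show ?thesis .
    qed
    have "I\<^sup>2 \<le> (\<integral>\<^sup>+y. (indicator (cball 0 (R * h)) y)\<^sup>2 \<partial>(lborel :: 'n point measure)) * (\<integral>\<^sup>+y. (ennreal (norm (u (x + y) - u x)) * indicator (cball 0 (R * h)) y)\<^sup>2 \<partial>lborel)"
      unfolding I_eq by (rule Cauchy_Schwarz_nn_integral) measurable
    also have "(\<integral>\<^sup>+y. (indicator (cball 0 (R * h)) y)\<^sup>2 \<partial>(lborel :: 'n point measure)) = (\<integral>\<^sup>+y. indicator (cball 0 (R * h)) y \<partial>(lborel :: 'n point measure))"
      by (intro nn_integral_cong) (simp add: indicator_def)
    also have "\<dots> = ennreal (unit_ball_vol ?n * (R * h) ^ ?n)"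
      using mesh_radius(1) h by (simp add: emeasure_cball)
    also have "(\<integral>\<^sup>+y. (ennreal (norm (u (x + y) - u x)) * indicator (cball 0 (R * h)) y)\<^sup>2 \<partial>lborel) = ball_osc (R * h) u x"
      unfolding ball_osc_def by (intro nn_integral_cong) (simp add: indicator_def ennreal_power)
    finally show ?thesis .
  qed
  also have "ennreal ((KQ / h ^ ?n)\<^sup>2) * (ennreal (unit_ball_vol ?n * (R * h) ^ ?n) * ball_osc (R * h) u x)
    = ennreal (KQ\<^sup>2 * (unit_ball_vol ?n * R ^ ?n) / h ^ ?n) * ball_osc (R * h) u x"
  proof -
    have "ennreal ((KQ / h ^ ?n)\<^sup>2) * ennreal (unit_ball_vol ?n * (R * h) ^ ?n) = ennreal ((KQ / h ^ ?n)\<^sup>2 * (unit_ball_vol ?n * (R * h) ^ ?n))"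
      by (rule ennreal_mult[symmetric]) (use mesh_radius(1) h in auto)
    also have "(KQ / h ^ ?n)\<^sup>2 * (unit_ball_vol ?n * (R * h) ^ ?n) = KQ\<^sup>2 * (unit_ball_vol ?n * R ^ ?n) / h ^ ?n"
      using h unfolding power_mult_distrib power_divide by (simp add: power2_eq_square)
    finally show ?thesis by (simp only: mult.assoc[symmetric])
  qed
  finally show ?thesis by (simp add: mult_left_mono)
qed

text \<open>As \<open>Q u\<close> belongs to the space, the error is
  \<open>proj (u - Q u) - (u - Q u)\<close>, and L2 stability leaves only \<open>u - Q u\<close>.
  Its pointwise bound, integrated over a period, becomes an integral of translation
  differences.\<close>

lemma approximation:
  assumes u: "u \<in> L2_forms e"
  shows "(\<integral>\<^sup>+x\<in>FD. ennreal ((norm (proj u x - u x))\<^sup>2) \<partial>lborel)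
    \<le> ennreal (CA / h ^ CARD('n)) * (\<integral>\<^sup>+q\<in>cball 0 (R * h). transl_diff u q \<partial>lborel)"
proof -
  let ?n = "CARD('n)"
  let ?K = "KQ\<^sup>2 * (unit_ball_vol ?n * R ^ ?n)"
  have K0: "?K / h ^ ?n \<ge> 0" using mesh_radius(1) h by simp
  have QL: "Q u \<in> L2_forms e" using Q_fe[OF u] fe_L2 by blast
  have dL: "(\<lambda>x. u x - Q u x) \<in> L2_forms e" by (rule L2_forms_diff[OF u QL])
  have PL: "proj u \<in> L2_forms e" using proj_fe[OF u] fe_L2 by blast
  have PdL: "proj (\<lambda>x. u x - Q u x) \<in> L2_forms e" using proj_fe[OF dL] fe_L2 by blast
  note [measurable] = L2_formsD(2)[OF u] L2_formsD(2)[OF QL] L2_formsD(2)[OF PL] L2_formsD(2)[OF dL] L2_formsD(2)[OF PdL]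
  let ?S = "\<integral>\<^sup>+x\<in>FD. ennreal ((norm (u x - Q u x))\<^sup>2) \<partial>lborel"
  have "?S \<le> (\<integral>\<^sup>+x. ennreal (?K / h ^ ?n) * (ball_osc (R * h) u x * indicator FD x) \<partial>lborel)"
  proof (rule nn_integral_mono_AE)
    show "AE x in lborel. ennreal ((norm (u x - Q u x))\<^sup>2) * indicator FD x \<le> ennreal (?K / h ^ ?n) * (ball_osc (R * h) u x * indicator FD x)"
      using AE_full_interior
    proof eventually_elim
      case (elim x)
      then obtain T where T: "T \<in> full" "x \<in> cell_interior T" by blast
      show ?case using mult_right_mono[OF Q_pointwise[OF T u], of "indicator FD x"]
        by (simp add: norm_minus_commute mult.assoc)
    qed
  qed
  also have "\<dots> = ennreal (?K / h ^ ?n) * (\<integral>\<^sup>+x\<in>FD. ball_osc (R * h) u x \<partial>lborel)"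
    by (rule nn_integral_cmult) measurable
  also have "\<dots> = ennreal (?K / h ^ ?n) * (\<integral>\<^sup>+q\<in>cball 0 (R * h). transl_diff u q \<partial>lborel)"
    by (subst nn_integral_FD_ball_osc) simp_all
  finally have S: "?S \<le> ennreal (?K / h ^ ?n) * (\<integral>\<^sup>+q\<in>cball 0 (R * h). transl_diff u q \<partial>lborel)" .
  have "(\<integral>\<^sup>+x\<in>FD. ennreal ((norm (proj (\<lambda>x. u x - Q u x) x))\<^sup>2) \<partial>lborel) = ennreal ((L2_form_norm e (proj (\<lambda>x. u x - Q u x)))\<^sup>2)"
    by (rule L2_formsD(3)[OF PdL])
  also have "\<dots> \<le> ennreal ((CP * L2_form_norm e (\<lambda>x. u x - Q u x))\<^sup>2)"
    by (intro ennreal_leI power_mono stable dL) (simp add: L2_form_norm_def set_lebesgue_integral_def)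
  also have "\<dots> = ennreal (CP\<^sup>2) * ?S"
    unfolding L2_formsD(3)[OF dL] by (simp add: power_mult_distrib ennreal_mult)
  finally have P: "(\<integral>\<^sup>+x\<in>FD. ennreal ((norm (proj (\<lambda>x. u x - Q u x) x))\<^sup>2) \<partial>lborel) \<le> ennreal (CP\<^sup>2) * ?S" .
  have "(\<integral>\<^sup>+x\<in>FD. ennreal ((norm (proj u x - u x))\<^sup>2) \<partial>lborel)
    \<le> (\<integral>\<^sup>+x\<in>FD. 2 * ennreal ((norm (proj (\<lambda>x. u x - Q u x) x))\<^sup>2) + 2 * ennreal ((norm (u x - Q u x))\<^sup>2) \<partial>lborel)"
  proof (rule nn_integral_mono, rule mult_right_mono)
    fix x
    show "ennreal ((norm (proj u x - u x))\<^sup>2) \<le> 2 * ennreal ((norm (proj (\<lambda>x. u x - Q u x) x))\<^sup>2) + 2 * ennreal ((norm (u x - Q u x))\<^sup>2)"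
      unfolding proj_diff_fe[OF u Q_fe[OF u]] by (rule ennreal_sq_diff_le)
  qed simp
  also have "\<dots> = 2 * (\<integral>\<^sup>+x\<in>FD. ennreal ((norm (proj (\<lambda>x. u x - Q u x) x))\<^sup>2) \<partial>lborel) + 2 * ?S"
    by (simp add: distrib_right nn_integral_add mult.assoc nn_integral_cmult)
  also have "\<dots> \<le> 2 * (ennreal (CP\<^sup>2) * ?S) + 2 * ?S" by (intro add_mono mult_left_mono P) auto
  also have "\<dots> = ennreal (2 + 2 * CP\<^sup>2) * ?S"
    by (simp add: ennreal_plus ennreal_mult distrib_right mult.assoc add.commute)
  also have "\<dots> \<le> ennreal (2 + 2 * CP\<^sup>2) * (ennreal (?K / h ^ ?n) * (\<integral>\<^sup>+q\<in>cball 0 (R * h). transl_diff u q \<partial>lborel))"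
    by (intro mult_left_mono S) simp
  also have "\<dots> = ennreal (2 + 2 * CP\<^sup>2) * ennreal (?K / h ^ ?n) * (\<integral>\<^sup>+q\<in>cball 0 (R * h). transl_diff u q \<partial>lborel)"
    by (simp only: mult.assoc)
  also have "ennreal (2 + 2 * CP\<^sup>2) * ennreal (?K / h ^ ?n) = ennreal (CA / h ^ ?n)"
    by (subst ennreal_mult[symmetric]) (use K0 in \<open>auto simp: approx_const_def\<close>)
  finally show ?thesis .
qed

end

section \<open>Local bounds for finite element forms, up to constants\<close>

context projector_mesh begin

text \<open>The inverse estimate is available for members of the local spaces, one degree at a time.
  Subtracting \<open>c\<close> stays in these spaces and the degree parts are orthogonal, so the
  squared bounds add up. \<open>V\<close> continues \<open>v\<close> smoothly from the interior to
  the whole space.\<close>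

lemma fe_local:
  assumes v: "v \<in> fe_space e \<T> X" and T: "T \<in> full"
  obtains V where "smooth V" "\<And>x. x \<in> cell_interior T \<Longrightarrow> v x = V x"
    "\<And>x c. x \<in> T \<Longrightarrow> ennreal ((norm (V x - c))\<^sup>2 + h\<^sup>2 * (\<Sum>q\<in>UNIV. (norm (partial q V x))\<^sup>2))
      \<le> ennreal (CV / h ^ CARD('n)) * (\<integral>\<^sup>+y\<in>T. ennreal ((norm (v y - c))\<^sup>2) \<partial>lborel)"
proof -
  let ?n = "CARD('n)"
  note TT = fullD(1)[OF T]
  have "\<forall>k\<in>{..?n}. \<exists>W. W \<in> X T k \<and> (\<forall>x\<in>cell_interior T. degree_part k v x = W x)"
  proof
    fix k assume "k \<in> {..?n}"
    then have k: "k \<le> ?n" by simp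
    obtain W where W: "has_traces \<T> k (degree_part k v) W" "\<And>T. T \<in> \<T> \<Longrightarrow> W T \<in> X T k" using fe_spaceD[OF v k] by blast
    show "\<exists>W. W \<in> X T k \<and> (\<forall>x\<in>cell_interior T. degree_part k v x = W x)"
      using W(2)[OF TT] has_tracesD(4)[OF W(1) T] by (intro exI[of _ "W T"]) simp
  qed
  from bchoice[OF this] obtain W where W: "\<forall>k\<in>{..?n}. W k \<in> X T k \<and> (\<forall>x\<in>cell_interior T. degree_part k v x = W k x)"
    by (elim exE)
  have WX: "W k \<in> X T k" and Wv: "x \<in> cell_interior T \<Longrightarrow> degree_part k v x = W k x" if "k \<le> ?n" for k x
    using W that by simp_all
  have Ws: "smooth (W k)" if "k \<le> ?n" for k using X_smooth[OF TT that WX[OF that]] .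
  define V where "V = (\<lambda>x. \<Sum>k\<le>?n. W k x)"
  have V: "smooth V" unfolding V_def by (rule smooth_sum) (auto intro: Ws)
  have dV: "degree_part k V x = W k x" if k: "k \<le> ?n" for k x
  proof -
    have z: "W j x $ I = 0" if "j \<le> ?n" "card I \<noteq> j" for j I
    proof -
      have "degree_part j (W j) x = W j x" using X_k_form[OF TT that(1) WX[OF that(1)]] by (simp add: k_form_def)
      then have "W j x $ I = degree_part j (W j) x $ I" by simp
      then show ?thesis using that(2) by (simp add: degree_part_def)
    qed
    show ?thesis unfolding vec_eq_iff
    proof
      fix I
      show "degree_part k V x $ I = W k x $ I"
      proof (cases "card I = k")
        case True
        have "(\<Sum>j\<le>?n. W j x $ I) = (\<Sum>j\<le>?n. if j = k then W k x $ I else 0)"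
          by (rule sum.cong) (use z True in auto)
        then show ?thesis using k True by (simp add: degree_part_def V_def)
      next
        case False
        then show ?thesis using z[OF k False] by (simp add: degree_part_def)
      qed
    qed
  qed
  have vV: "v x = V x" if "x \<in> cell_interior T" for x
    by (rule eq_of_degree_parts) (simp add: Wv[OF _ that] dV)
  have [measurable]: "T \<in> sets borel" using cell_compact[OF TT] by (simp add: borel_compact)
  show thesis
  proof (rule that[OF V vV])
    fix x c assume x: "x \<in> T"
    define G where "G = (\<lambda>x. V x - c)"
    have G: "smooth G" unfolding G_def by (rule smooth_diff[OF V smooth_const])
    have [measurable]: "degree_part k G \<in> borel_measurable borel" for k by (rule smooth_measurable[OF smooth_degree_part[OF G]])
    have pG: "partial q G x = partial q V x" for q
    proof -
      have D: "(V has_derivative (\<lambda>k. \<Sum>i\<in>UNIV. k $ i *\<^sub>R partial i V x)) (at x)"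
        by (rule has_derivative_partials[OF smoothD[OF V, of "[]", unfolded partials_Nil]])
      have "(G has_derivative (\<lambda>k. (\<Sum>i\<in>UNIV. k $ i *\<^sub>R partial i V x) - 0)) (at x)"
        unfolding G_def by (rule has_derivative_diff[OF D has_derivative_const])
      from partial_eq[OF this, of q] partial_eq[OF D, of q] show ?thesis by simp
    qed
    have dpe: "degree_part k U = (\<lambda>x. \<chi> I. if card I = k then U x $ I else 0)" for k and U :: "'n form"
      by (simp add: degree_part_def fun_eq_iff)
    have pq: "partials [q] f = partial q f" for q and f :: "'n form" by (simp add: partials_def)
    have pd: "partial q (degree_part k G) = degree_part k (partial q G)" for q k
      using partials_linear[OF linear_degree_part[of k] G, of "[q]"] unfolding dpe pq .
    have UX: "degree_part k G \<in> X T k" if k: "k \<le> ?n" for k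
    proof -
      have "degree_part k G = (\<lambda>x. 1 *\<^sub>R W k x + (-1) *\<^sub>R degree_part k (\<lambda>x. c) x)"
      proof
        fix x
        have "degree_part k G x = degree_part k V x - degree_part k (\<lambda>x. c) x"
          by (simp add: degree_part_def G_def vec_eq_iff)
        then show "degree_part k G x = 1 *\<^sub>R W k x + (-1) *\<^sub>R degree_part k (\<lambda>x. c) x" by (simp add: dV[OF k])
      qed
      then show ?thesis using X_lincomb[OF TT k WX[OF k] X_const[OF TT k, of c]] by (simp only:)
    qed
    have "(\<Sum>q\<in>UNIV. (norm (partial q G x))\<^sup>2) = (\<Sum>q\<in>UNIV. \<Sum>k\<le>?n. (norm (partial q (degree_part k G) x))\<^sup>2)"
      unfolding pd by (rule sum.cong[OF refl]) (rule norm_sq_degree_part)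
    also have "\<dots> = (\<Sum>k\<le>?n. \<Sum>q\<in>UNIV. (norm (partial q (degree_part k G) x))\<^sup>2)" by (rule sum.swap)
    finally have sq: "(\<Sum>q\<in>UNIV. (norm (partial q G x))\<^sup>2) = (\<Sum>k\<le>?n. \<Sum>q\<in>UNIV. (norm (partial q (degree_part k G) x))\<^sup>2)" .
    have "(norm (V x - c))\<^sup>2 + h\<^sup>2 * (\<Sum>q\<in>UNIV. (norm (partial q V x))\<^sup>2)
      = (norm (G x))\<^sup>2 + h\<^sup>2 * (\<Sum>q\<in>UNIV. (norm (partial q G x))\<^sup>2)" by (simp add: pG) (simp add: G_def)
    also have "\<dots> = (\<Sum>k\<le>?n. (norm (degree_part k G x))\<^sup>2 + h\<^sup>2 * (\<Sum>q\<in>UNIV. (norm (partial q (degree_part k G) x))\<^sup>2))"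
      unfolding sq norm_sq_degree_part[of G x] sum.distrib sum_distrib_left ..
    finally have "ennreal ((norm (V x - c))\<^sup>2 + h\<^sup>2 * (\<Sum>q\<in>UNIV. (norm (partial q V x))\<^sup>2))
      = (\<Sum>k\<le>?n. ennreal ((norm (degree_part k G x))\<^sup>2 + h\<^sup>2 * (\<Sum>q\<in>UNIV. (norm (partial q (degree_part k G) x))\<^sup>2)))"
      by (subst sum_ennreal) (auto intro!: add_nonneg_nonneg mult_nonneg_nonneg sum_nonneg)
    also have "\<dots> \<le> (\<Sum>k\<le>?n. ennreal (CV / h ^ ?n) * (\<integral>\<^sup>+y\<in>T. ennreal ((norm (degree_part k G y))\<^sup>2) \<partial>lborel))"
      by (rule sum_mono) (rule inv[OF T _ UX x], simp_all)
    also have "\<dots> = ennreal (CV / h ^ ?n) * (\<integral>\<^sup>+y. (\<Sum>k\<le>?n. ennreal ((norm (degree_part k G y))\<^sup>2) * indicator T y) \<partial>lborel)"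
      unfolding sum_distrib_left[symmetric] by (subst nn_integral_sum) auto
    also have "(\<integral>\<^sup>+y. (\<Sum>k\<le>?n. ennreal ((norm (degree_part k G y))\<^sup>2) * indicator T y) \<partial>lborel)
      = (\<integral>\<^sup>+y\<in>T. ennreal ((norm (G y))\<^sup>2) \<partial>lborel)"
    proof (rule nn_integral_cong)
      fix y
      show "(\<Sum>k\<le>?n. ennreal ((norm (degree_part k G y))\<^sup>2) * indicator T y) = ennreal ((norm (G y))\<^sup>2) * indicator T y"
        unfolding sum_distrib_right[symmetric] norm_sq_degree_part[of G y] by (subst sum_ennreal) auto
    qed
    also have "\<dots> = (\<integral>\<^sup>+y\<in>T. ennreal ((norm (v y - c))\<^sup>2) \<partial>lborel)"
    proof (rule nn_integral_cong_AE)
      have "AE y in lborel. y \<in> - (T - cell_interior T)" by (rule negligible_AE) (simp only: double_compl full_cell_props(5)[OF T])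
      then show "AE y in lborel. ennreal ((norm (G y))\<^sup>2) * indicator T y = ennreal ((norm (v y - c))\<^sup>2) * indicator T y"
      proof eventually_elim
        case (elim y)
        then show ?case using vV[of y] by (auto simp: indicator_def G_def)
      qed
    qed
    finally show "ennreal ((norm (V x - c))\<^sup>2 + h\<^sup>2 * (\<Sum>q\<in>UNIV. (norm (partial q V x))\<^sup>2))
      \<le> ennreal (CV / h ^ ?n) * (\<integral>\<^sup>+y\<in>T. ennreal ((norm (v y - c))\<^sup>2) \<partial>lborel)" .
  qed
qed

lemma nn_integral_cell_le_ball:
  fixes v :: "'n form"
  assumes T: "T \<in> full" "x \<in> T" and [measurable]: "v \<in> borel_measurable borel"
  shows "(\<integral>\<^sup>+y\<in>T. ennreal ((norm (v y - c))\<^sup>2) \<partial>lborel) \<le> (\<integral>\<^sup>+w\<in>cball 0 (R * h). ennreal ((norm (v (x + w) - c))\<^sup>2) \<partial>lborel)"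
proof -
  have [measurable]: "cball x (R * h) \<in> sets borel" by simp
  have "(\<integral>\<^sup>+y\<in>T. ennreal ((norm (v y - c))\<^sup>2) \<partial>lborel) \<le> (\<integral>\<^sup>+y\<in>cball x (R * h). ennreal ((norm (v y - c))\<^sup>2) \<partial>lborel)"
  proof (rule nn_integral_mono)
    fix y
    have "y \<in> T \<Longrightarrow> y \<in> cball x (R * h)" using full_dist[OF T, of y] mesh_radius(3) by simp
    then show "ennreal ((norm (v y - c))\<^sup>2) * indicator T y \<le> ennreal ((norm (v y - c))\<^sup>2) * indicator (cball x (R * h)) y"
      by (auto simp: indicator_def)
  qed
  also have "\<dots> = (\<integral>\<^sup>+w. ennreal ((norm (v (w + x) - c))\<^sup>2) * indicator (cball x (R * h)) (w + x) \<partial>lborel)"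
    by (rule nn_integral_lborel_shift[symmetric]) measurable
  also have "\<dots> = (\<integral>\<^sup>+w\<in>cball 0 (R * h). ennreal ((norm (v (x + w) - c))\<^sup>2) \<partial>lborel)"
    by (intro nn_integral_cong) (auto simp: indicator_def dist_norm add.commute)
  finally show ?thesis .
qed

lemma pointwise_value:
  assumes v: "v \<in> fe_space e \<T> X"
  shows "AE x in lborel. \<forall>c. ennreal ((norm (v x - c))\<^sup>2)
    \<le> ennreal (CV / h ^ CARD('n)) * (\<integral>\<^sup>+w\<in>cball 0 (R * h). ennreal ((norm (v (x + w) - c))\<^sup>2) \<partial>lborel)"
  using AE_full_interior
proof eventually_elim
  case (elim x)
  then obtain T where T: "T \<in> full" "x \<in> cell_interior T" by blast
  have vm: "v \<in> borel_measurable borel" using v fe_L2 L2_formsD(2) by blast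
  have xT: "x \<in> T" using T full_cell_props(3) by blast
  obtain V where V: "smooth V" "\<And>x. x \<in> cell_interior T \<Longrightarrow> v x = V x"
    "\<And>x c. x \<in> T \<Longrightarrow> ennreal ((norm (V x - c))\<^sup>2 + h\<^sup>2 * (\<Sum>q\<in>UNIV. (norm (partial q V x))\<^sup>2))
      \<le> ennreal (CV / h ^ CARD('n)) * (\<integral>\<^sup>+y\<in>T. ennreal ((norm (v y - c))\<^sup>2) \<partial>lborel)"
    by (rule fe_local[OF v T(1)]) blast
  show ?case
  proof
    fix c
    have "ennreal ((norm (v x - c))\<^sup>2) \<le> ennreal ((norm (V x - c))\<^sup>2 + h\<^sup>2 * (\<Sum>q\<in>UNIV. (norm (partial q V x))\<^sup>2))"
      unfolding V(2)[OF T(2)] by (intro ennreal_leI) (simp add: sum_nonneg)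
    also note V(3)[OF xT]
    also note mult_left_mono[OF nn_integral_cell_le_ball[OF T(1) xT vm, of c] zero_le]
    finally show "ennreal ((norm (v x - c))\<^sup>2)
      \<le> ennreal (CV / h ^ CARD('n)) * (\<integral>\<^sup>+w\<in>cball 0 (R * h). ennreal ((norm (v (x + w) - c))\<^sup>2) \<partial>lborel)" .
  qed
qed

text \<open>The cell with \<open>x\<close> in its interior is contained in \<open>T\<close>, so its
  open interior lies in the closure of that of \<open>T\<close> and meets it; disjointness of
  interiors then identifies the two cells.\<close>

lemma full_subset_eq:
  assumes "T \<in> full" "T' \<in> full" "x \<in> cell_interior T'" "x \<in> T" shows "x \<in> cell_interior T"
proof -
  have "T' \<subseteq> T" by (rule subcell_of_point[OF fullD(1)[OF assms(2)] assms(3) fullD(1)[OF assms(1)] assms(4)])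
  then have "cell_interior T' \<subseteq> closure (cell_interior T)" using full_cell_props(2,3) assms(1,2) by blast
  then have "cell_interior T' \<inter> cell_interior T \<noteq> {}"
    using open_Int_closure_eq_empty[OF full_cell_props(1)[OF assms(2)]] full_cell_props(4)[OF assms(2)] by blast
  then have "T' = T" using cell_interior_disjoint[OF fullD(1)[OF assms(2)] fullD(1)[OF assms(1)]] by blast
  then show ?thesis using assms(3) by simp
qed

text \<open>When \<open>x\<close> and \<open>x + z\<close> share a simplex, the segment between them
  stays in one cell, where \<open>v\<close> agrees almost everywhere with a smooth form; the inverse
  estimate bounds its gradient by the local oscillation divided by \<open>h\<close>, and the mean
  value inequality applies.\<close>

lemma pointwise_difference:
  assumes v: "v \<in> fe_space e \<T> X"
  shows "AE x in lborel. x \<notin> bad z \<longrightarrow> (\<forall>c. ennreal ((norm (v (x + z) - v x))\<^sup>2)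
    \<le> ennreal ((real CARD('n))\<^sup>2 * (CV + 1) * (norm z / h)\<^sup>2 / h ^ CARD('n)) * (\<integral>\<^sup>+w\<in>cball 0 (R * h). ennreal ((norm (v (x + w) - c))\<^sup>2) \<partial>lborel))"
  using AE_full_interior AE_lborel_shift[OF AE_full_interior, of z]
proof eventually_elim
  case (elim x)
  let ?n = "real CARD('n)"
  have vm: "v \<in> borel_measurable borel" using v fe_L2 L2_formsD(2) by blast
  show ?case
  proof (intro impI allI)
    fix c assume "x \<notin> bad z"
    then obtain \<sigma> where \<sigma>: "\<sigma> \<in> FS" "x \<in> \<sigma>" "x + z \<in> \<sigma>" by (auto simp: bad_def)
    obtain T where T: "T \<in> full" "\<sigma> \<subseteq> T" using FS_subset_full[OF \<sigma>(1)] by blast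
    have xT: "x \<in> T" "x + z \<in> T" using \<sigma> T by auto
    have xi: "x \<in> cell_interior T" "x + z \<in> cell_interior T"
      using elim full_subset_eq[OF T(1)] xT by blast+
    obtain V where V: "smooth V" "\<And>x. x \<in> cell_interior T \<Longrightarrow> v x = V x"
      "\<And>x c. x \<in> T \<Longrightarrow> ennreal ((norm (V x - c))\<^sup>2 + h\<^sup>2 * (\<Sum>q\<in>UNIV. (norm (partial q V x))\<^sup>2))
        \<le> ennreal (CV / h ^ CARD('n)) * (\<integral>\<^sup>+y\<in>T. ennreal ((norm (v y - c))\<^sup>2) \<partial>lborel)"
      by (rule fe_local[OF v T(1)]) blast
    define A where "A = (\<integral>\<^sup>+w\<in>cball 0 (R * h). ennreal ((norm (v (x + w) - c))\<^sup>2) \<partial>lborel)"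
    \<comment> \<open>\<open>CV + 1\<close> instead of \<open>CV\<close> makes the factor positive
      for \<open>z \<noteq> 0\<close>, so that an infinite integral makes the bound trivial.\<close>
    let ?c = "?n\<^sup>2 * (CV + 1) * (norm z / h)\<^sup>2 / h ^ CARD('n)"
    have "ennreal ((norm (v (x + z) - v x))\<^sup>2) \<le> ennreal ?c * A"
    proof (cases "z = 0 \<or> A = \<infinity>")
      case True
      have "?c > 0" if "z \<noteq> 0" using that h const_nonneg(2) by (simp add: add_nonneg_pos)
      then show ?thesis using True by (cases "z = 0") (auto simp: ennreal_mult_eq_top_iff ennreal_mult_top)
    next
      case False
      then obtain A' where A': "A = ennreal A'" "A' \<ge> 0" by (cases A) auto
      define K where "K = CV / h ^ CARD('n) * A'"
      have K: "K \<ge> 0" using A'(2) const_nonneg(2) h by (simp add: K_def)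
      have pb: "norm (partial q V y) \<le> sqrt K / h" if y: "y \<in> \<sigma>" for q y
      proof -
        have "ennreal ((norm (V y - c))\<^sup>2 + h\<^sup>2 * (\<Sum>q\<in>UNIV. (norm (partial q V y))\<^sup>2)) \<le> ennreal (CV / h ^ CARD('n)) * A"
          unfolding A_def using V(3)[of y c] mult_left_mono[OF nn_integral_cell_le_ball[OF T(1) xT(1) vm, of c] zero_le] y T(2)
          by (meson order_trans subsetD)
        also have "\<dots> = ennreal K" unfolding A'(1) K_def
          by (rule ennreal_mult[symmetric, OF _ A'(2)]) (use const_nonneg(2) h in simp)
        finally have "(norm (V y - c))\<^sup>2 + h\<^sup>2 * (\<Sum>q\<in>UNIV. (norm (partial q V y))\<^sup>2) \<le> K"
          by (rule ennreal_le_iff[OF K, THEN iffD1])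
        moreover have "h\<^sup>2 * (norm (partial q V y))\<^sup>2 \<le> h\<^sup>2 * (\<Sum>q\<in>UNIV. (norm (partial q V y))\<^sup>2)"
          by (intro mult_left_mono member_le_sum) auto
        ultimately have "(h * norm (partial q V y))\<^sup>2 \<le> K"
          using zero_le_power2[of "norm (V y - c)"] unfolding power_mult_distrib by linarith
        then have "h * norm (partial q V y) \<le> sqrt K" by (rule real_le_rsqrt)
        then show ?thesis using h by (simp add: pos_le_divide_eq mult.commute)
      qed
      \<comment> \<open>The operator norm is bounded crudely by summing the partials; this costs the
        factor \<open>?n\<close>, which appears squared in \<open>?c\<close>.\<close>
      have "norm (V (x + z) - V x) \<le> ?n * (sqrt K / h) * norm (x + z - x)"
      proof (rule differentiable_bound[OF S_compact_convex(2)[OF FS_D(1)[OF \<sigma>(1)]] _ _ \<sigma>(3,2)])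
        fix y assume y: "y \<in> \<sigma>"
        show "(V has_derivative (\<lambda>k. \<Sum>i\<in>UNIV. k $ i *\<^sub>R partial i V y)) (at y within \<sigma>)"
          by (rule has_derivative_at_withinI) (rule has_derivative_partials[OF smoothD[OF V(1), of "[]", unfolded partials_Nil]])
        show "onorm (\<lambda>k. \<Sum>i\<in>UNIV. k $ i *\<^sub>R partial i V y) \<le> ?n * (sqrt K / h)"
        proof (rule onorm_le)
          fix k :: "'n point"
          have "norm (\<Sum>i\<in>UNIV. k $ i *\<^sub>R partial i V y) \<le> (\<Sum>i\<in>(UNIV :: 'n set). norm k * (sqrt K / h))"
          proof (rule order_trans[OF norm_sum sum_mono])
            fix i
            show "norm (k $ i *\<^sub>R partial i V y) \<le> norm k * (sqrt K / h)"
              unfolding norm_scaleR using component_le_norm_cart[of k i] pb[OF y] by (intro mult_mono) auto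
          qed
          then show "norm (\<Sum>i\<in>UNIV. k $ i *\<^sub>R partial i V y) \<le> ?n * (sqrt K / h) * norm k" by (simp add: mult_ac)
        qed
      qed
      then have "(norm (v (x + z) - v x))\<^sup>2 \<le> (?n * (sqrt K / h) * norm z)\<^sup>2"
        unfolding V(2)[OF xi(1)] V(2)[OF xi(2)] by (intro power_mono) auto
      also have "\<dots> = ?n\<^sup>2 * CV * (norm z / h)\<^sup>2 / h ^ CARD('n) * A'"
        using K[unfolded K_def] by (simp add: power_mult_distrib power_divide K_def mult_ac)
      also have "\<dots> \<le> ?c * A'"
        using A'(2) h by (intro mult_right_mono divide_right_mono mult_left_mono) auto
      finally have "ennreal ((norm (v (x + z) - v x))\<^sup>2) \<le> ennreal (?c * A')" by (rule ennreal_leI)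
      also have "\<dots> = ennreal ?c * A" unfolding A'(1)
        by (rule ennreal_mult[OF _ A'(2)]) (use const_nonneg(2) h in simp)
      finally show ?thesis .
    qed
    then show "ennreal ((norm (v (x + z) - v x))\<^sup>2)
      \<le> ennreal ?c * (\<integral>\<^sup>+w\<in>cball 0 (R * h). ennreal ((norm (v (x + w) - c))\<^sup>2) \<partial>lborel)" by (simp only: A_def)
  qed
qed

end
lemma ennreal_coef_mono:
  assumes "0 < h" "a \<le> b" "c \<le> ennreal (a / h ^ k) * I" shows "c \<le> ennreal (b / h ^ k) * I"
proof (rule order_trans[OF assms(3)])
  have "a / h ^ k \<le> b / h ^ k" using assms(1,2) by (intro divide_right_mono) auto
  then show "ennreal (a / h ^ k) * I \<le> ennreal (b / h ^ k) * I" by (intro mult_right_mono ennreal_leI) auto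
qed

theorem proposition5p8:
  fixes e :: "'n::{finite,linorder} \<Rightarrow> 'n point"
    and h :: "nat \<Rightarrow> real"
    and \<T> :: "nat \<Rightarrow> 'n point set set"
    and X :: "nat \<Rightarrow> 'n element_system"
    and F :: "nat \<Rightarrow> 'n dofs"
    and \<phi> :: "'n point \<Rightarrow> real"
    and p :: nat
    and \<epsilon> s s' :: real
  assumes basis: "inj e" "independent (range e)"
    and h: "\<And>j. h j > 0" "h \<longlonglongrightarrow> 0"
    and mesh: "\<And>j. torus_complex e (\<T> j)" "\<And>j. h j = mesh_size e (\<T> j)"
      "quasi_uniform e h \<T>"
    and spaces: "\<And>j. compatible_system (\<T> j) (X j)" "\<And>j. periodic_system e (\<T> j) (X j)"
      "\<And>j. contains_polynomials p (\<T> j) (X j)"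
      "\<And>j. fe_space e (\<T> j) (X j) \<subseteq> X_space e"
      "h_setting h \<T> X"
    and interpolator: "\<And>j. unisolvent_dofs e (\<T> j) (X j) (F j)"
      "\<And>j. commutes_with_d e (interpolator e (\<T> j) (X j) (F j))"
      "scaled_Cm_bounded e h \<T> (\<lambda>j. interpolator e (\<T> j) (X j) (F j))"
    and phi: "mollifier p \<phi>"
    and eps: "admissible_eps e h \<T> X F \<phi> \<epsilon>"
    and s: "0 < s" "s < s'" "s' < 1/2"
  shows "\<exists>M. \<forall>j. \<forall>u\<in>Hs_forms e s'.
    smoothed_projector e (\<T> j) (X j) (F j) \<phi> (\<epsilon> * h j) u \<in> Hs_forms e s \<and>
    Hs_norm e s (smoothed_projector e (\<T> j) (X j) (F j) \<phi> (\<epsilon> * h j) u) \<le> M * Hs_norm e s' u"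
proof -
  interpret lattice_basis e using basis by unfold_locales
  let ?n = "CARD('n)"
  have tm: "torus_mesh e (\<T> j)" for j using mesh(1) by unfold_locales
  obtain \<S> \<kappa> N where \<kappa>: "\<kappa> > 0" and q: "\<forall>j. simplicial_refinement e (\<T> j) (\<S> j) \<and>
     (\<forall>\<sigma>\<in>\<S> j. int ?n simplex \<sigma> \<longrightarrow> h j / \<kappa> \<le> diameter \<sigma> \<and> diameter \<sigma> \<le> \<kappa> * h j \<and> (\<exists>x. cball x (diameter \<sigma> / \<kappa>) \<subseteq> \<sigma>)) \<and>
     (\<forall>T\<in>\<T> j. finite {\<sigma>\<in>\<S> j. \<sigma> \<subseteq> T} \<and> card {\<sigma>\<in>\<S> j. \<sigma> \<subseteq> T} \<le> N)"
    using mesh(3) unfolding quasi_uniform_def by (elim exE conjE)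
  obtain m CI0 where Cm: "\<forall>j. \<forall>T\<in>\<T> j. cell_dim T = ?n \<longrightarrow>
     (\<forall>u. smooth u \<longrightarrow> periodic e u \<longrightarrow> (\<forall>x\<in>cell_interior T. norm (interpolator e (\<T> j) (X j) (F j) u x) \<le>
          CI0 * (\<Sum>is | length is \<le> m. h j ^ length is * (SUP y\<in>T. norm (partials is u y)))))"
    using interpolator(3) unfolding scaled_Cm_bounded_def by (elim exE)
  obtain CV where CV: "CV \<ge> 0" "\<And>j T k U x. T \<in> \<T> j \<Longrightarrow> cell_dim T = ?n \<Longrightarrow> k \<le> ?n \<Longrightarrow> U \<in> X j T k \<Longrightarrow> x \<in> T \<Longrightarrow>
    ennreal ((norm (U x))\<^sup>2 + (h j)\<^sup>2 * (\<Sum>q\<in>UNIV. (norm (partial q U x))\<^sup>2))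
      \<le> ennreal (CV / h j ^ ?n) * (\<integral>\<^sup>+y\<in>T. ennreal ((norm (U y))\<^sup>2) \<partial>lborel)"
  proof (rule inverse_estimate[OF spaces(5) h(1) spaces(1) torus_mesh.is_cell[OF tm]])
    fix C assume C: "C \<ge> 0" "\<And>j T k U x. T \<in> \<T> j \<Longrightarrow> cell_dim T = ?n \<Longrightarrow> k \<le> ?n \<Longrightarrow> U \<in> X j T k \<Longrightarrow> x \<in> T \<Longrightarrow>
      ennreal ((norm (U x))\<^sup>2 + (h j)\<^sup>2 * (\<Sum>q\<in>UNIV. (norm (partial q U x))\<^sup>2))
        \<le> ennreal (C / h j ^ ?n) * (\<integral>\<^sup>+y\<in>T. ennreal ((norm (U y))\<^sup>2) \<partial>lborel)"
    show thesis by (rule that[OF C])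
  qed
  have \<epsilon>: "\<epsilon> > 0" and bij: "\<And>j. bij_betw (mollified_interpolation e (\<T> j) (X j) (F j) \<phi> (\<epsilon> * h j)) (fe_space e (\<T> j) (X j)) (fe_space e (\<T> j) (X j))"
    using eps by (simp_all add: admissible_eps_def)
  obtain CP0 where CP0: "\<forall>j. \<forall>u\<in>L2_forms e.
        L2_form_norm e (smoothed_projector e (\<T> j) (X j) (F j) \<phi> (\<epsilon> * h j) u) \<le> CP0 * L2_form_norm e u"
    using eps unfolding admissible_eps_def by (elim exE conjE)
  \<comment> \<open>Convergence of \<open>h\<close> provides the upper bound that controls the
    positive power of \<open>h\<close> left over in \<open>gagliardo_stability\<close>.\<close>
  obtain H where H: "H > 0" "\<And>j. h j \<le> H"
  proof (rule BseqE[OF convergent_imp_Bseq[OF convergentI[OF h(2)]]])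
    fix K assume "0 < K" "\<forall>j. norm (h j) \<le> K"
    then show thesis using that[of K] by (auto simp: abs_le_iff)
  qed
  \<comment> \<open>The hypotheses do not fix the signs of the two constants; absolute values keep
    the bounds valid because the quantities they multiply are nonnegative.\<close>
  define CI CP where "CI = \<bar>CI0\<bar>" and "CP = \<bar>CP0\<bar>"
  have L2_nonneg: "L2_form_norm e u \<ge> 0" for u :: "'n form"
    unfolding L2_form_norm_def set_lebesgue_integral_def by (intro real_sqrt_ge_zero Bochner_Integration.integral_nonneg) simp
  have PM: "projector_mesh e (\<T> j) (\<S> j) (h j) \<kappa> N (X j) (F j) p \<phi> \<epsilon> CI CV CP m" for j
  proof -
    interpret torus_mesh e "\<T> j" by (rule tm)
    show ?thesis
    proof unfold_locales
      show "simplicial_refinement e (\<T> j) (\<S> j)"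
        "\<forall>\<sigma>\<in>\<S> j. int ?n simplex \<sigma> \<longrightarrow> h j / \<kappa> \<le> diameter \<sigma> \<and> diameter \<sigma> \<le> \<kappa> * h j \<and> (\<exists>x. cball x (diameter \<sigma> / \<kappa>) \<subseteq> \<sigma>)"
        "\<forall>T\<in>\<T> j. finite {\<sigma>\<in>\<S> j. \<sigma> \<subseteq> T} \<and> card {\<sigma>\<in>\<S> j. \<sigma> \<subseteq> T} \<le> N"
        by (rule q[THEN spec, THEN conjunct1] q[THEN spec, THEN conjunct2, THEN conjunct1] q[THEN spec, THEN conjunct2, THEN conjunct2])+
      show "h j > 0" "\<kappa> > 0" "\<epsilon> > 0" "CI \<ge> 0" "CV \<ge> 0" "CP \<ge> 0" using h(1) \<kappa> \<epsilon> CV(1) by (simp_all add: CI_def CP_def)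
      show "compatible_system (\<T> j) (X j)" "periodic_system e (\<T> j) (X j)" "unisolvent_dofs e (\<T> j) (X j) (F j)"
        "contains_polynomials p (\<T> j) (X j)" "mollifier p \<phi>" by (rule spaces interpolator phi)+
      show "bij_betw (mollified_interpolation e (\<T> j) (X j) (F j) \<phi> (\<epsilon> * h j)) (fe_space e (\<T> j) (X j)) (fe_space e (\<T> j) (X j))" by (rule bij)
      show "fe_space e (\<T> j) (X j) \<subseteq> L2_forms e" using spaces(4)[of j] by (auto simp: X_space_def weak_d_def)
    next
      fix u :: "'n form" assume "u \<in> L2_forms e"
      then have "L2_form_norm e (smoothed_projector e (\<T> j) (X j) (F j) \<phi> (\<epsilon> * h j) u) \<le> CP0 * L2_form_norm e u" using CP0 by blast
      also have "\<dots> \<le> CP * L2_form_norm e u" unfolding CP_def by (intro mult_right_mono L2_nonneg) simp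
      finally show "L2_form_norm e (smoothed_projector e (\<T> j) (X j) (F j) \<phi> (\<epsilon> * h j) u) \<le> CP * L2_form_norm e u" .
    next
      fix T k U x assume "T \<in> full" "k \<le> ?n" "U \<in> X j T k" "x \<in> T"
      then show "ennreal ((norm (U x))\<^sup>2 + (h j)\<^sup>2 * (\<Sum>q\<in>UNIV. (norm (partial q U x))\<^sup>2))
        \<le> ennreal (CV / h j ^ ?n) * (\<integral>\<^sup>+y\<in>T. ennreal ((norm (U y))\<^sup>2) \<partial>lborel)" by (intro CV(2)[of T j k U x]) (simp_all add: full_def)
    next
      fix T x and u :: "'n form" assume T: "T \<in> full" and u: "smooth u" "periodic e u" and x: "x \<in> cell_interior T"
      let ?s = "\<Sum>is | length is \<le> m. h j ^ length is * (SUP y\<in>T. norm (partials is u y))"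
      have xT: "x \<in> T" using x full_cell_props(3)[OF T] by blast
      \<comment> \<open>A supremum of nonnegative numbers is known to be nonnegative only when it is
        bounded above; compactness of the cell provides this.\<close>
      have "0 \<le> (SUP y\<in>T. norm (partials is u y))" for "is"
      proof -
        have "compact ((\<lambda>y. norm (partials is u y)) ` T)"
          by (intro compact_continuous_image continuous_on_norm smooth_continuous_on u cell_compact fullD T)
        then have "bdd_above ((\<lambda>y. norm (partials is u y)) ` T)" by (intro bounded_imp_bdd_above compact_imp_bounded)
        from order_trans[OF norm_ge_zero cSUP_upper[OF xT this]] show ?thesis .
      qed
      then have s0: "?s \<ge> 0" using h(1)[of j] by (intro sum_nonneg mult_nonneg_nonneg) auto
      have "norm (interpolator e (\<T> j) (X j) (F j) u x) \<le> CI0 * ?s"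
        using Cm[THEN spec, THEN bspec, OF fullD(1)[OF T], THEN mp, OF fullD(2)[OF T]] u x by blast
      also have "\<dots> \<le> CI * ?s" unfolding CI_def by (intro mult_right_mono s0) simp
      finally show "norm (interpolator e (\<T> j) (X j) (F j) u x) \<le> CI * ?s" .
    qed
  qed
  define R where "R = mesh_radius \<kappa> N \<epsilon>"
  define CA where "CA = approx_const \<kappa> N \<phi> \<epsilon> CI CP m"
  define CB where "CB = real ?n * \<kappa>\<^sup>2 * unit_ball_vol ?n * (R + 1 + \<kappa>) ^ ?n"
  \<comment> \<open>A single constant above those of the approximation, the value bound, the
    difference bound and the bad set, because \<open>gagliardo_stability\<close> takes only
    one.\<close>
  define C where "C = CA + CV + (real ?n)\<^sup>2 * (CV + 1) + CB"
  have R1: "R \<ge> 1" by (simp add: R_def mesh_radius_def)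
  have CA: "CA \<ge> 0" unfolding CA_def approx_const_def by (simp add: mesh_radius_def)
  have CB: "CB \<ge> 0" using R1 \<kappa> by (simp add: CB_def)
  have CD: "(real ?n)\<^sup>2 * (CV + 1) \<ge> 0" using CV(1) by simp
  have C: "C \<ge> 0" "CA \<le> C" "CV \<le> C" "(real ?n)\<^sup>2 * (CV + 1) \<le> C" "CB \<le> C"
    using CA CB CD CV(1) unfolding C_def by linarith+
  show ?thesis
  proof (rule gagliardo_stability[OF s C(1) R1 H(1)])
  fix M assume M: "M \<ge> 0" "\<And>u v h bad. \<lbrakk>u \<in> L2_forms e; v \<in> L2_forms e; 0 < h; h \<le> H;
    (\<integral>\<^sup>+x\<in>FD. ennreal ((norm (v x - u x))\<^sup>2) \<partial>lborel)
      \<le> ennreal (C / h ^ CARD('n)) * (\<integral>\<^sup>+q\<in>cball 0 (R * h). transl_diff u q \<partial>lborel);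
    AE x in lborel. \<forall>c. ennreal ((norm (v x - c))\<^sup>2)
      \<le> ennreal (C / h ^ CARD('n)) * (\<integral>\<^sup>+w\<in>cball 0 (R * h). ennreal ((norm (v (x + w) - c))\<^sup>2) \<partial>lborel);
    \<And>z. norm z \<le> h \<Longrightarrow> AE x in lborel. x \<notin> bad z \<longrightarrow> (\<forall>c. ennreal ((norm (v (x + z) - v x))\<^sup>2)
      \<le> ennreal (C * (norm z / h)\<^sup>2 / h ^ CARD('n)) * (\<integral>\<^sup>+w\<in>cball 0 (R * h). ennreal ((norm (v (x + w) - c))\<^sup>2) \<partial>lborel));
    \<And>z. bad z \<in> sets borel; \<And>z. periodic e (\<lambda>x. x \<in> bad z);
    \<And>z y. norm z \<le> h \<Longrightarrow> emeasure lborel (bad z \<inter> cball y ((R + 1) * h)) \<le> ennreal (C * (norm z / h) * h ^ CARD('n))\<rbrakk>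
    \<Longrightarrow> gagliardo s v \<le> ennreal M * (gagliardo s' u + ennreal ((L2_form_norm e u)\<^sup>2))"
  have s': "0 < s'" using s by simp
  obtain K where K: "K \<ge> 0" "\<And>u. u \<in> Hs_forms e s' \<Longrightarrow> gagliardo s' u \<le> ennreal (K * (Hs_norm e s' u)\<^sup>2)"
    by (rule gagliardo_le[OF s']) blast
  show ?thesis
  proof (intro exI allI ballI)
    fix j u assume u: "u \<in> Hs_forms e s'"
    interpret P: projector_mesh e "\<T> j" "\<S> j" "h j" \<kappa> N "X j" "F j" p \<phi> \<epsilon> CI CV CP m by (rule PM)
    let ?v = "smoothed_projector e (\<T> j) (X j) (F j) \<phi> (\<epsilon> * h j) u"
    let ?N = "Hs_norm e s' u"
    have uL: "u \<in> L2_forms e" using u by (simp add: Hs_forms_def)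
    have vf: "?v \<in> fe_space e (\<T> j) (X j)" by (rule P.proj_fe[OF uL])
    have vL: "?v \<in> L2_forms e" using vf P.fe_L2 by blast
    have gag: "gagliardo s ?v \<le> ennreal M * (gagliardo s' u + ennreal ((L2_form_norm e u)\<^sup>2))"
    proof (rule M(2)[OF uL vL h(1) H(2), where bad = P.bad])
      show "(\<integral>\<^sup>+x\<in>FD. ennreal ((norm (?v x - u x))\<^sup>2) \<partial>lborel)
        \<le> ennreal (C / h j ^ ?n) * (\<integral>\<^sup>+q\<in>cball 0 (R * h j). transl_diff u q \<partial>lborel)"
        unfolding R_def by (rule ennreal_coef_mono[OF h(1) C(2)[unfolded CA_def] P.approximation[OF uL]])
      show "AE x in lborel. \<forall>c. ennreal ((norm (?v x - c))\<^sup>2)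
        \<le> ennreal (C / h j ^ ?n) * (\<integral>\<^sup>+w\<in>cball 0 (R * h j). ennreal ((norm (?v (x + w) - c))\<^sup>2) \<partial>lborel)"
        using P.pointwise_value[OF vf]
      proof eventually_elim
        case (elim x)
        show ?case unfolding R_def by (rule allI) (rule ennreal_coef_mono[OF h(1) C(3) elim[THEN spec]])
      qed
      fix z :: "'n point"
      show "AE x in lborel. x \<notin> P.bad z \<longrightarrow> (\<forall>c. ennreal ((norm (?v (x + z) - ?v x))\<^sup>2)
        \<le> ennreal (C * (norm z / h j)\<^sup>2 / h j ^ ?n) * (\<integral>\<^sup>+w\<in>cball 0 (R * h j). ennreal ((norm (?v (x + w) - c))\<^sup>2) \<partial>lborel))"
        using P.pointwise_difference[OF vf, of z]
      proof eventually_elim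
        case (elim x)
        have c: "(real ?n)\<^sup>2 * (CV + 1) * (norm z / h j)\<^sup>2 \<le> C * (norm z / h j)\<^sup>2" by (intro mult_right_mono C(4)) simp
        show ?case unfolding R_def by (intro impI allI) (rule ennreal_coef_mono[OF h(1) c elim[THEN mp, THEN spec]])
      qed
      show "P.bad z \<in> sets borel" by (rule P.bad_measurable)
      show "periodic e (\<lambda>x. x \<in> P.bad z)" by (rule P.bad_periodic)
      fix y
      have "CB * (norm z / h j) * h j ^ ?n \<le> C * (norm z / h j) * h j ^ ?n"
        using h(1)[of j] by (intro mult_right_mono C(5)) auto
      from order_trans[OF P.bad_emeasure[of "R + 1" z y] ennreal_leI[OF this[unfolded CB_def]]]
      show "emeasure lborel (P.bad z \<inter> cball y ((R + 1) * h j)) \<le> ennreal (C * (norm z / h j) * h j ^ ?n)" using R1 by simp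
    qed
    have L2N: "(L2_form_norm e u)\<^sup>2 \<le> ?N\<^sup>2" by (simp add: Hs_norm_def)
    have N0: "?N \<ge> 0" by (simp add: Hs_norm_def)
    have "Hs_seminorm_sq e s ?v \<le> gagliardo s ?v"
      by (rule Hs_seminorm_le_gagliardo[OF L2_formsD(2,1)[OF vL]]) (use s in simp)
    also note gag
    also have "ennreal M * (gagliardo s' u + ennreal ((L2_form_norm e u)\<^sup>2)) \<le> ennreal M * (ennreal (K * ?N\<^sup>2) + ennreal (?N\<^sup>2))"
      by (rule mult_left_mono[OF add_mono[OF K(2)[OF u] ennreal_leI[OF L2N]] zero_le])
    also have "\<dots> = ennreal (M * (K + 1) * ?N\<^sup>2)"
      using M(1) K(1) by (simp add: ennreal_plus[symmetric] ennreal_mult[symmetric] distrib_right mult.assoc del: ennreal_plus)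
    finally have sem: "Hs_seminorm_sq e s ?v \<le> ennreal (M * (K + 1) * ?N\<^sup>2)" .
    have "Hs_seminorm_sq e s ?v < \<infinity>" using le_less_trans[OF sem ennreal_less_top] by simp
    then have "?v \<in> Hs_forms e s" using vL by (simp add: Hs_forms_def)
    \<comment> \<open>\<open>CP\<close> accounts for the L2 part and \<open>M * (K + 1)\<close> for
      the seminorm, with \<open>K\<close> from comparing \<open>gagliardo\<close> with the norm and
      \<open>1\<close> from the L2 term.\<close>
    moreover have "Hs_norm e s ?v \<le> sqrt (CP\<^sup>2 + M * (K + 1)) * ?N"
    proof -
      have "(L2_form_norm e ?v)\<^sup>2 \<le> (CP * L2_form_norm e u)\<^sup>2" by (intro power_mono P.stable uL L2_nonneg)
      also have "\<dots> \<le> CP\<^sup>2 * ?N\<^sup>2" unfolding power_mult_distrib by (intro mult_left_mono L2N) simp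
      finally have 1: "(L2_form_norm e ?v)\<^sup>2 \<le> CP\<^sup>2 * ?N\<^sup>2" .
      have "enn2real (Hs_seminorm_sq e s ?v) \<le> M * (K + 1) * ?N\<^sup>2"
        by (rule enn2real_leI) (use sem M(1) K(1) in auto)
      then have "Hs_norm e s ?v \<le> sqrt ((CP\<^sup>2 + M * (K + 1)) * ?N\<^sup>2)"
        using 1 unfolding Hs_norm_def[of e s] by (intro real_sqrt_le_mono) (simp add: distrib_right)
      also have "\<dots> = sqrt (CP\<^sup>2 + M * (K + 1)) * ?N" using N0 by (simp add: real_sqrt_mult)
      finally show ?thesis .
    qed
    ultimately show "?v \<in> Hs_forms e s \<and> Hs_norm e s ?v \<le> sqrt (CP\<^sup>2 + M * (K + 1)) * ?N" by blast
  qed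
  qed
qed

end
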